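(* Let $(T_n,n\ge1)$ be a sequence of trees resulting from the alpha-gamma growth rules for some $0<\alpha<1$ and $0<\gamma\le\alpha$, and let $k\ge1$. Denote by $R(T_n,[k])$, $n\ge k$, the subtree of $T_n$ spanned by the root and the leaves $1,\ldots,k$, reduced by removing degree-2 vertices, represented as a discrete $\mathbb{R}$-tree with graph distances in $T_n$ as edge lengths. Then, as $n\to\infty$, $$\frac{R(T_n,[k])}{n^\gamma}\longrightarrow\mathcal{R}_k\qquad\text{a.s., in the sense that all edge lengths converge},$$ for some discrete tree $\mathcal{R}_k$ with shape $T_k$ and edge lengths specified in terms of three random variables $W_k,L_k,D_k$, conditionally independent given that $T_k$ has $k+\ell$ edges, as $L_kW_k^\gamma D_k$ with - $W_k\sim{\rm beta}(k(1-\alpha)+\ell\gamma,\ (k-1)\alpha-\ell\gamma)$; - $L_k$ with density $\displaystyle\frac{\Gamma(1+k(1-\alpha)+\ell\gamma)}{\Gamma(1+\ell+k(1-\alpha)/\gamma)}\,s^{\ell+k(1-\alpha)/\gamma}g_\gamma(s)$, where $g_\gamma$ is the Mittag-Leffler density, the density of $\sigma_1^{-\gamma}$ for a subordinator $\sigma$ with Laplace exponent $\lambda^\gamma$ (that is, $\mathbb{E}(e^{-\lambda\sigma_1})=e^{-\lambda^\gamma}$); - $D_k\sim{\rm Dirichlet}((1-\alpha)/\gamma,\ldots,(1-\alpha)/\gamma,1,\ldots,1)$, where $D_k$ contains edge length proportions, first with parameter $(1-\alpha)/\gamma$ for edges adjacent to leaves and then with parameter $1$ for the other edges, each enumerated e.g.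 by depth first search.
   Context: Alpha-gamma trees. Let $\mathbb{T}_n$ be the set of combinatorial trees without degree-2 vertices that have one degree-1 vertex called the root and exactly $n$ further degree-1 vertices (leaves) labelled by $[n]=\{1,\ldots,n\}$; the other vertices are branch points; edges are directed away from the root. $T_1,T_2$ are the unique elements of $\mathbb{T}_1,\mathbb{T}_2$. Given $T_n$, $n\ge 2$: (i) assign weight $1-\alpha$ to each of the $n$ edges adjacent to a leaf, weight $\gamma$ to each other edge (including the edge adjacent to the root), and weight $(m-1)\alpha-\gamma$ to each vertex of degree $m+1\ge 3$; (ii) select an edge $a\to c$ or a branch point $v$ at random with probability proportional to weight; (iii) if an edge $a\to c$ was selected, replace it by three edges $a\to b$, $b\to c$, $b\to n+1$, where $b$ is a new branch point and $n+1$ a new leaf; if a vertex $v$ was selected, add an edge $v\to n+1$ to a new leaf $n+1$. The result is $T_{n+1}$. (For $n\ge k$ the combinatorial shape of $R(T_n,[k])$ is $T_k$.) Distributions. ${\rm beta}(a,b)$ has density $B(a,b)^{-1}x^{a-1}(1-x)^{b-1}$ on $(0,1)$, where $B$ is the Beta function; when its second parameter is $0$ it is understood as the point mass at $1$. ${\rm Dirichlet}(a_1,\ldots,a_m)$ is the distribution on $\{x\in[0,1]^m:x_1+\ldots+x_m=1\}$ whose first $m-1$ marginals have density proportional to $x_1^{a_1-1}\cdots x_{m-1}^{a_{m-1}-1}(1-x_1-\ldots-x_{m-1})^{a_m-1}$ (point mass at $1$ if $m=1$). *)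

theory Defs
  imports "HOL-Probability.Probability"
begin

section \<open>Leaf-labelled rooted trees\<close>

text \<open>
  A tree is recorded by its set of edges, directed away from the root. So that equality of trees is
  equality of leaf-labelled shapes, branch points carry a canonical name, fixed in \<open>trees\<close> below:
  a branch point is called \<open>Branch j\<close> if the leaf \<open>j\<close> is the one that makes it a branch point, that
  is, if it is a branch point of the subtree spanned by the root and the leaves \<open>1, \<dots>, j\<close> but not of
  the one spanned by the root and \<open>1, \<dots>, j - 1\<close>. In the growth rules this is the name of the branch
  point created together with the leaf \<open>j\<close>.
\<close>

datatype vertex = Root | Leaf nat | Branch nat

type_synonym edge = "vertex \<times> vertex"
type_synonym tree = "edge set"

definition degree :: "tree \<Rightarrow> vertex \<Rightarrow> nat" where
  "degree E v = card {e \<in> E. fst e = v \<or> snd e = v}"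

definition leaf_edge :: "edge \<Rightarrow> bool" where
  "leaf_edge e \<longleftrightarrow> snd e \<in> range Leaf"

text \<open>The union of the paths from the root to the leaves \<open>1, \<dots>, k\<close>:\<close>

definition spanned :: "nat \<Rightarrow> tree \<Rightarrow> tree" where
  "spanned k E = {(u, v) \<in> E. \<exists>i\<in>{1..k}. (v, Leaf i) \<in> E\<^sup>*}"

definition rooted_tree :: "tree \<Rightarrow> bool" where
  "rooted_tree E \<longleftrightarrow>
     finite E \<and> Root \<in> Field E \<and>
     (\<forall>v\<in>Field E. (Root, v) \<in> E\<^sup>*) \<and>
     Root \<notin> Range E \<and> single_valued (E\<inverse>)"

definition trees :: "nat \<Rightarrow> tree set" where
  "trees n = {E. rooted_tree E \<and>
     range Leaf \<inter> Field E = Leaf ` {1..n} \<and>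
     degree E Root = 1 \<and>
     (\<forall>i\<in>{1..n}. degree E (Leaf i) = 1) \<and>
     (\<forall>j. Branch j \<in> Field E \<longrightarrow>
        3 \<le> degree E (Branch j) \<and>
        j = (LEAST i. 3 \<le> degree (spanned i E) (Branch j)))}"


section \<open>The alpha-gamma growth rules\<close>

datatype site = Edge_Site edge | Vertex_Site vertex

definition sites :: "tree \<Rightarrow> site set" where
  "sites E = Edge_Site ` E \<union> Vertex_Site ` {v \<in> Field E. 3 \<le> degree E v}"

fun site_weight :: "real \<Rightarrow> real \<Rightarrow> tree \<Rightarrow> site \<Rightarrow> real" where
  "site_weight \<alpha> \<gamma> E (Edge_Site e) = (if leaf_edge e then 1 - \<alpha> else \<gamma>)"
| "site_weight \<alpha> \<gamma> E (Vertex_Site v) =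
     (let m = real (degree E v) - 1 in (m - 1) * \<alpha> - \<gamma>)"

fun insert_leaf :: "nat \<Rightarrow> tree \<Rightarrow> site \<Rightarrow> tree" where
  "insert_leaf j E (Edge_Site (a, c)) =
     (E - {(a, c)}) \<union> {(a, Branch j), (Branch j, c), (Branch j, Leaf j)}"
| "insert_leaf j E (Vertex_Site v) = E \<union> {(v, Leaf j)}"

definition growth_prob :: "real \<Rightarrow> real \<Rightarrow> nat \<Rightarrow> tree \<Rightarrow> tree \<Rightarrow> real" where
  "growth_prob \<alpha> \<gamma> n E E' =
     (\<Sum>s \<in> {s \<in> sites E. insert_leaf (n + 1) E s = E'}. site_weight \<alpha> \<gamma> E s) /
     (\<Sum>s \<in> sites E. site_weight \<alpha> \<gamma> E s)"

definition alpha_gamma_trees ::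
    "real \<Rightarrow> real \<Rightarrow> 'a measure \<Rightarrow> (nat \<Rightarrow> 'a \<Rightarrow> tree) \<Rightarrow> bool" where
  "alpha_gamma_trees \<alpha> \<gamma> M T \<longleftrightarrow>
     prob_space M \<and>
     (\<forall>n\<ge>1. T n \<in> M \<rightarrow>\<^sub>M count_space (trees n)) \<and>
     (\<forall>\<omega>\<in>space M. T 1 \<omega> = {(Root, Leaf 1)}) \<and>
     (\<forall>\<omega>\<in>space M. T 2 \<omega> = {(Root, Branch 2), (Branch 2, Leaf 1), (Branch 2, Leaf 2)}) \<and>
     (\<forall>n\<ge>2. \<forall>t.
        measure M {\<omega> \<in> space M. \<forall>i\<in>{1..n + 1}. T i \<omega> = t i} =
        measure M {\<omega> \<in> space M. \<forall>i\<in>{1..n}. T i \<omega> = t i} *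
          growth_prob \<alpha> \<gamma> n (t n) (t (n + 1)))"


section \<open>Reduced trees with edge lengths\<close>

definition graph_dist :: "tree \<Rightarrow> vertex \<Rightarrow> vertex \<Rightarrow> nat" where
  "graph_dist E u v = (LEAST d. (u, v) \<in> (E \<union> E\<inverse>) ^^ d)"

definition remove_degree_2 :: "tree \<Rightarrow> tree" where
  "remove_degree_2 S =
     (let V = {v \<in> Field S. degree S v \<noteq> 2} in
      {(u, v). u \<in> V \<and> v \<in> V \<and> (u, v) \<in> S\<^sup>+ \<and>
         \<not> (\<exists>w\<in>V. (u, w) \<in> S\<^sup>+ \<and> (w, v) \<in> S\<^sup>+)})"

text \<open>A discrete real tree is a shape together with a length for each edge of the shape; the values
  of the length function off the shape are irrelevant.\<close>

type_synonym real_tree = "tree \<times> (edge \<Rightarrow> real)"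

abbreviation shape :: "real_tree \<Rightarrow> tree" where "shape \<equiv> fst"
abbreviation edge_length :: "real_tree \<Rightarrow> edge \<Rightarrow> real" where "edge_length \<equiv> snd"

definition reduced_tree :: "nat \<Rightarrow> tree \<Rightarrow> real_tree" where
  "reduced_tree k E =
     (remove_degree_2 (spanned k E), \<lambda>(u, v). real (graph_dist E u v))"

definition divide_lengths :: "real_tree \<Rightarrow> real \<Rightarrow> real_tree" where
  "divide_lengths R c = (shape R, \<lambda>e. edge_length R e / c)"

definition edge_lengths_converge :: "(nat \<Rightarrow> real_tree) \<Rightarrow> real_tree \<Rightarrow> bool" where
  "edge_lengths_converge R R' \<longleftrightarrow>
     (\<forall>\<^sub>F n in sequentially. shape (R n) = shape R') \<and>
     (\<forall>e\<in>shape R'. (\<lambda>n. edge_length (R n) e) \<longlonglongrightarrow> edge_length R' e)"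

text \<open>An enumeration of the edges of every tree with \<open>k\<close> leaves that lists the \<open>k\<close> edges adjacent
  to leaves before all others; depth first search within the two groups is an instance.\<close>

definition edge_enumeration :: "nat \<Rightarrow> (tree \<Rightarrow> nat \<Rightarrow> edge) \<Rightarrow> bool" where
  "edge_enumeration k enum \<longleftrightarrow>
     (\<forall>E\<in>trees k. bij_betw (enum E) {..<card E} E \<and>
        (\<forall>i<card E. leaf_edge (enum E i) \<longleftrightarrow> i < k))"


section \<open>Distributions\<close>

definition beta_distribution :: "real \<Rightarrow> real \<Rightarrow> real measure" where
  "beta_distribution a b =
     (if b = 0 then return borel 1
      else density lborel (\<lambda>x. ennreal
        (if 0 < x \<and> x < 1 then x powr (a - 1) * (1 - x) powr (b - 1) / Beta a b else 0)))"

text \<open>The law of a vector indexed by \<open>{..<m}\<close>: its first \<open>m - 1\<close> coordinates have the normalised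
  density, the last one is determined by them. For \<open>m = 1\<close> the product space \<open>N\<close> is a single point of
  mass one, so the result is the point mass at \<open>1\<close>.\<close>

definition dirichlet :: "real list \<Rightarrow> (nat \<Rightarrow> real) measure" where
  "dirichlet a =
     (let m = length a;
          N = Pi\<^sub>M {..<m - 1} (\<lambda>_. lborel);
          rest = (\<lambda>x. 1 - (\<Sum>i<m - 1. x i));
          f = (\<lambda>x. ennreal (if (\<forall>i<m - 1. 0 < x i) \<and> 0 < rest x
                 then (\<Prod>i<m - 1. x i powr (a ! i - 1)) * rest x powr (a ! (m - 1) - 1)
                 else 0))
      in distr (density N (\<lambda>x. f x / (\<integral>\<^sup>+ y. f y \<partial>N)))
           (Pi\<^sub>M {..<m} (\<lambda>_. borel)) (\<lambda>x. x(m - 1 := rest x)))"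

text \<open>\<open>S\<close> is the law of the value at time one of a subordinator with Laplace exponent
  \<open>\<lambda> powr \<gamma>\<close>; it is determined by its Laplace transform, so \<open>g\<close> is unique up to null sets.\<close>

definition mittag_leffler_density :: "real \<Rightarrow> (real \<Rightarrow> real) \<Rightarrow> bool" where
  "mittag_leffler_density \<gamma> g \<longleftrightarrow>
     (\<forall>s. 0 \<le> g s) \<and>
     (\<exists>S. real_distribution S \<and> (AE x in S. 0 < x) \<and>
        (\<forall>u\<ge>0. (\<integral>x. exp (- (u * x)) \<partial>S) = exp (- (u powr \<gamma>))) \<and>
        distributed S lborel (\<lambda>x. x powr (- \<gamma>)) (\<lambda>s. ennreal (g s)))"

definition indep_triple ::
    "'a measure \<Rightarrow> 'b measure \<Rightarrow> ('a \<Rightarrow> 'b) \<Rightarrow> 'c measure \<Rightarrow> ('a \<Rightarrow> 'c) \<Rightarrow>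
     'd measure \<Rightarrow> ('a \<Rightarrow> 'd) \<Rightarrow> bool" where
  "indep_triple P A X B Y C Z \<longleftrightarrow>
     X \<in> P \<rightarrow>\<^sub>M A \<and> Y \<in> P \<rightarrow>\<^sub>M B \<and> Z \<in> P \<rightarrow>\<^sub>M C \<and>
     prob_space.indep_sets P
       (\<lambda>i. [{X -` a \<inter> space P |a. a \<in> sets A},
             {Y -` b \<inter> space P |b. b \<in> sets B},
             {Z -` c \<inter> space P |c. c \<in> sets C}] ! i)
       {..<3::nat}"

end

theory Submission
  imports Defs "HOL-Real_Asymp.Real_Asymp"
begin

text \<open>
  Fix the shape \<open>T\<^sub>k\<close>, with \<open>k + \<ell>\<close> edges. The growth rules give a Markov chain for the lengths of
  its edges in \<open>T\<^sub>n\<close> and the total weight \<open>U\<^sub>n\<close> of all sites on these edges or in the subtrees attached to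
  them. If \<open>Y\<^sub>i\<close> is the length of the edge \<open>i\<close>, shifted by a constant so that \<open>\<gamma> Y\<^sub>i\<close> is its weight, then
  \<open>Y\<^sub>i\<close> and \<open>U\<close> both grow by one with probability \<open>\<gamma> Y\<^sub>i / (n - \<alpha>)\<close>, and \<open>U\<close> alone grows by one with
  probability \<open>(U - \<gamma> \<Sum>\<^sub>i Y\<^sub>i) / (n - \<alpha>)\<close>.

  Each of \<open>Y\<^sub>i\<close> and \<open>U\<close> is therefore a multiple of a martingale; a second moment bound gives convergence
  along the subsequence \<open>j\<^sup>c\<close>, and monotonicity fills the gaps. Moreover
  \<open>\<Prod>\<^sub>i pochhammer Y\<^sub>i p\<^sub>i * pochhammer (U + \<gamma> \<Sum>\<^sub>i p\<^sub>i) q\<close> is a multiple of a martingale as well, which yields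
  all joint moments of the limits \<open>\<xi>\<^sub>i\<close> of \<open>Y\<^sub>i / n\<^sup>\<gamma>\<close> and \<open>W\<close> of \<open>U / n\<close>. They equal those of
  \<open>(L W\<^sup>\<gamma> D\<^sub>i, W)\<close> for independent \<open>W, L, D\<close> with the required laws. These moments determine
  the joint law, and \<open>(W, L, D)\<close> is recovered from it as \<open>L = \<Sum>\<^sub>i \<xi>\<^sub>i / W\<^sup>\<gamma>\<close> and \<open>D\<^sub>i = \<xi>\<^sub>i / \<Sum>\<^sub>j \<xi>\<^sub>j\<close>.
\<close>


section \<open>Insertion of a leaf\<close>

text \<open>The hypothesis prescribes only probabilities of finite histories of trees, so
  expectations are computed as finite sums over histories, and conditioning on the past is an
  explicit sum over sites. Any set of sites that absorbs an insertion gains weight exactly one;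
  therefore lengths and weights behave like a Polya urn. Rising factorials are the test functions
  adapted to it, since \<open>pochhammer (y + 1) r * y = pochhammer y r * (y + r)\<close>; the shift
  inside the factor of \<open>U\<close> absorbs the extra terms that the edges produce. The
  parameters of the limit are weights at time \<open>k\<close>: the edges weigh
  \<open>k (1 - \<alpha>) + l \<gamma>\<close> in total, the branch points carry the rest
  \<open>(k - 1) \<alpha> - l \<gamma>\<close> of the total weight \<open>k - \<alpha>\<close>, and
  single edge weights divided by \<gamma> are the Dirichlet parameters. The variable
  \<open>L\<close> is unbounded, but its \<open>p\<close>-th moment divided by \<open>p!\<close>
  decays faster than any geometric sequence, while \<open>W\<close> is at most one and
  \<open>D\<close> lies in the simplex; this is why moments suffice to identify the joint
  law.\<close>

definition anc :: "tree \<Rightarrow> vertex \<Rightarrow> edge set" where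
  "anc E v = {e \<in> E. (snd e, v) \<in> E\<^sup>*}"

text \<open>The potential \<open>\<rho>\<close> excludes cycles. It is real-valued so that it can be interpolated at a branch
  point inserted on an edge.\<close>

definition proper :: "nat \<Rightarrow> tree \<Rightarrow> bool" where
  "proper n E \<longleftrightarrow> finite E \<and> (\<forall>u v w. (u, w) \<in> E \<longrightarrow> (v, w) \<in> E \<longrightarrow> u = v) \<and>
     (\<exists>\<rho> :: vertex \<Rightarrow> real. \<forall>(u, v) \<in> E. \<rho> u < \<rho> v) \<and>
     (\<forall>i x. (Leaf i, x) \<notin> E) \<and> (\<forall>u. (u, Root) \<notin> E) \<and>
     (\<forall>i. Leaf i \<in> Field E \<longleftrightarrow> i \<in> {1..n}) \<and>
     (\<forall>j. Branch j \<in> Field E \<longrightarrow> j \<le> n) \<and>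
     (\<forall>e \<in> E. \<exists>i \<in> {1..n}. (snd e, Leaf i) \<in> E\<^sup>*)"

inductive grown :: "nat \<Rightarrow> tree \<Rightarrow> bool" where
  base: "grown (Suc 0) {(Root, Leaf 1)}"
| step: "grown n E \<Longrightarrow> s \<in> sites E \<Longrightarrow> grown (Suc n) (insert_leaf (Suc n) E s)"

lemma grown_pos: "grown n E \<Longrightarrow> n \<ge> 1"
  by (induction rule: grown.induct) auto

lemma insert_leaf_Edge: "insert_leaf j E (Edge_Site e) =
    (E - {e}) \<union> {(fst e, Branch j), (Branch j, snd e), (Branch j, Leaf j)}"
  by (cases e) simp

text \<open>The vertices \<open>b\<close> and \<open>l\<close> can be entered from old vertices only
  through \<open>a\<close> and left only through the edge from \<open>b\<close> to \<open>c\<close>.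
  A passage through them thus amounts to the old edge from \<open>a\<close> to \<open>c\<close>, and
  \<open>l\<close> is a dead end.\<close>

lemma subdivide_rtrancl:
  assumes ac: "(a, c) \<in> E" and b: "b \<notin> Field E" and l: "l \<notin> Field E" and bl: "b \<noteq> l"
    and E': "E' = (E - {(a, c)}) \<union> {(a, b), (b, c)} \<union> X" and X: "X \<subseteq> {(b, l)}"
    and x: "x \<noteq> b" "x \<noteq> l"
  shows "y \<noteq> b \<Longrightarrow> y \<noteq> l \<Longrightarrow> (x, y) \<in> E'\<^sup>* \<longleftrightarrow> (x, y) \<in> E\<^sup>*"
    and "y \<noteq> b \<Longrightarrow> y \<noteq> l \<Longrightarrow> (b, y) \<in> E'\<^sup>* \<longleftrightarrow> (c, y) \<in> E\<^sup>*"
proof -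
  have fwd: "(x, y) \<in> E\<^sup>*" if "(x, y) \<in> E'\<^sup>*" "y \<noteq> b" "y \<noteq> l" "x \<noteq> b" "x \<noteq> l" for x y
  proof -
    \<comment> \<open>The induction has to pass through the fresh vertices; there it remembers that
      \<open>a\<close> has been reached.\<close>
    have "(y \<noteq> b \<and> y \<noteq> l \<longrightarrow> (x, y) \<in> E\<^sup>*) \<and> (y = b \<or> y = l \<longrightarrow> (x, a) \<in> E\<^sup>*)"
      using that(1)
    proof (induction rule: rtrancl_induct)
      case base
      show ?case using that by auto
    next
      case (step y z)
      have old: "u \<noteq> b \<and> u \<noteq> l \<and> v \<noteq> b \<and> v \<noteq> l" if "(u, v) \<in> E" for u v
        using b l that by (auto simp: Field_def)
      have "(y, z) \<in> E \<or> (y, z) \<in> {(a, b), (b, c), (b, l)}"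
        using step(2) X unfolding E' by blast
      then have cases: "(y, z) \<in> E \<and> y \<noteq> b \<and> y \<noteq> l \<and> z \<noteq> b \<and> z \<noteq> l \<or> y = a \<and> z = b \<or>
          y = b \<and> z = c \<or> y = b \<and> z = l"
        using old[of y z] by auto
      have "a \<noteq> b" "a \<noteq> l" "c \<noteq> b" "c \<noteq> l"
        using ac b l by (auto simp: Field_def)
      then show ?case using cases step.IH ac bl
        by (auto intro: rtrancl_into_rtrancl)
    qed
    then show ?thesis using that by auto
  qed
  have old: "a \<noteq> b" "a \<noteq> l" "c \<noteq> b" "c \<noteq> l"
    using ac b l by (auto simp: Field_def)
  have bwd: "(x, y) \<in> E'\<^sup>*" if "(x, y) \<in> E\<^sup>*" for x y
    using that
  proof (induction rule: rtrancl_induct)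
    case (step y z)
    have "(y, z) \<in> E'\<^sup>*"
    proof (cases "(y, z) = (a, c)")
      case True
      have "(a, b) \<in> E'" "(b, c) \<in> E'" using E' by auto
      then show ?thesis using True by (auto intro: rtrancl_trans)
    next
      case False
      then show ?thesis using step(2) E' by auto
    qed
    with step.IH show ?case by simp
  qed simp
  show "(x, y) \<in> E'\<^sup>* \<longleftrightarrow> (x, y) \<in> E\<^sup>*" if "y \<noteq> b" "y \<noteq> l"
    using fwd bwd that x by blast
  show "(b, y) \<in> E'\<^sup>* \<longleftrightarrow> (c, y) \<in> E\<^sup>*" if y: "y \<noteq> b" "y \<noteq> l"
  proof
    assume "(b, y) \<in> E'\<^sup>*"
    then obtain z where z: "(b, z) \<in> E'" "(z, y) \<in> E'\<^sup>*"
      using y by (metis converse_rtranclE)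
    have "z = c \<or> z = l"
      using z(1) E' X b old by (auto simp: Field_def)
    moreover have "z \<noteq> l"
    proof
      assume "z = l"
      then obtain w where "(l, w) \<in> E'" using z(2) y by (metis converse_rtranclE)
      then show False using E' X l bl old by (auto simp: Field_def)
    qed
    ultimately show "(c, y) \<in> E\<^sup>*" using fwd z(2) y old by auto
  next
    assume "(c, y) \<in> E\<^sup>*"
    moreover have "(b, c) \<in> E'" using E' by auto
    ultimately show "(b, y) \<in> E'\<^sup>*" using bwd by (meson converse_rtrancl_into_rtrancl)
  qed
qed

lemma add_edge_rtrancl:
  assumes l: "l \<notin> Field E" "v \<noteq> l" and y: "y \<noteq> l"
  shows "(x, y) \<in> (E \<union> {(v, l)})\<^sup>* \<longleftrightarrow> (x, y) \<in> E\<^sup>*"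
proof
  assume "(x, y) \<in> (E \<union> {(v, l)})\<^sup>*"
  then show "(x, y) \<in> E\<^sup>*" using y
  proof (induction rule: rtrancl_induct)
    case (step y z)
    then have "(y, z) \<in> E" "y \<noteq> l" using l by (auto simp: Field_def)
    with step show ?case by (auto intro: rtrancl_into_rtrancl)
  qed simp
next
  assume "(x, y) \<in> E\<^sup>*"
  then show "(x, y) \<in> (E \<union> {(v, l)})\<^sup>*"
    by (meson Un_upper1 in_mono rtrancl_mono)
qed

text \<open>The effect of inserting the leaf \<open>j\<close> at \<open>s\<close> on a set \<open>S\<close> of edges that contains all edges
  between two given vertices.\<close>

fun subdivide :: "nat \<Rightarrow> site \<Rightarrow> edge set \<Rightarrow> edge set" where
  "subdivide j (Edge_Site e) S =
     (if e \<in> S then S - {e} \<union> {(fst e, Branch j), (Branch j, snd e)} else S)"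
| "subdivide j (Vertex_Site v) S = S"

lemma spanned_anc: "spanned k E = (\<Union>i\<in>{1..k}. anc E (Leaf i))"
  by (auto simp: spanned_def anc_def)

section \<open>Ancestor edges, distances and insertion in proper trees\<close>

context
  fixes n E
  assumes pr: "proper n E"
begin

lemma fresh: "Leaf (Suc n) \<notin> Field E" "Branch (Suc n) \<notin> Field E"
  using pr by (auto simp: proper_def dest: Suc_le_lessD)

lemma proper_leaf_below: "e \<in> E \<Longrightarrow> \<exists>i\<in>{1..n}. (snd e, Leaf i) \<in> E\<^sup>*"
  using pr unfolding proper_def by (elim conjE) (erule bspec)

lemma proper_finite: "finite E" "finite (anc E v)" "finite (Field E)"
  using pr by (auto simp: proper_def anc_def finite_Field)

lemma proper_trancl_irrefl: "(x, y) \<in> E\<^sup>* \<Longrightarrow> (y, x) \<in> E\<^sup>+ \<Longrightarrow> False"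
proof -
  assume "(x, y) \<in> E\<^sup>*" "(y, x) \<in> E\<^sup>+"
  then have xx: "(x, x) \<in> E\<^sup>+" by auto
  obtain \<rho> :: "vertex \<Rightarrow> real" where \<rho>: "\<forall>(u, v) \<in> E. \<rho> u < \<rho> v"
    using pr by (auto simp: proper_def)
  have "\<rho> u < \<rho> v" if "(u, v) \<in> E\<^sup>+" for u v
    using that by (induction rule: trancl_induct) (use \<rho> in \<open>force+\<close>)
  with xx show False by fastforce
qed

lemma proper_edge_neq: "(x, y) \<in> E \<Longrightarrow> x \<noteq> y"
  using proper_trancl_irrefl[of x y] by auto

lemma proper_parent: "(u, w) \<in> E \<Longrightarrow> (v, w) \<in> E \<Longrightarrow> u = v"
  using pr by (auto simp: proper_def)

text \<open>Uniqueness of the parent forces every other edge above \<open>y\<close> to lie above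
  \<open>x\<close> already. Hence \<open>card (anc E y)\<close> is a depth that grows by one along
  each edge.\<close>

lemma anc_edge:
  assumes "(x, y) \<in> E"
  shows "anc E y = insert (x, y) (anc E x)" "(x, y) \<notin> anc E x"
proof -
  show "(x, y) \<notin> anc E x"
    using proper_trancl_irrefl[of y x] assms by (auto simp: anc_def)
  show "anc E y = insert (x, y) (anc E x)"
  proof (intro set_eqI iffI)
    fix e assume e: "e \<in> anc E y"
    show "e \<in> insert (x, y) (anc E x)"
    proof (cases "snd e = y")
      case True
      then show ?thesis using e assms proper_parent[of "fst e" y x]
        by (cases e) (auto simp: anc_def)
    next
      case False
      with e obtain z where "(snd e, z) \<in> E\<^sup>*" "(z, y) \<in> E"
        by (auto simp: anc_def elim: rtranclE)
      then show ?thesis using e assms proper_parent[of z y x] by (auto simp: anc_def)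
    qed
  next
    fix e assume "e \<in> insert (x, y) (anc E x)"
    then show "e \<in> anc E y" using assms by (auto simp: anc_def)
  qed
qed

lemma anc_mono: "(u, v) \<in> E\<^sup>* \<Longrightarrow> anc E u \<subseteq> anc E v"
  by (auto simp: anc_def)

lemma card_anc_edge: "(x, y) \<in> E \<Longrightarrow> card (anc E y) = Suc (card (anc E x))"
  using anc_edge[of x y] proper_finite by simp

text \<open>An undirected step changes the depth \<open>card (anc E _)\<close> by exactly one, so no
  walk from \<open>u\<close> to \<open>v\<close> is shorter than the difference of depths, and the
  directed path attains it. This turns graph distances into cardinalities of edge sets, whose change
  under insertion is easy to follow.\<close>

lemma graph_dist_anc:
  assumes "(u, v) \<in> E\<^sup>*"
  shows "graph_dist E u v = card (anc E v - anc E u)"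
proof -
  have c: "card (anc E v - anc E u) = card (anc E v) - card (anc E u)"
    using anc_mono[OF assms] proper_finite by (simp add: card_Diff_subset)
  have le: "card (anc E u) \<le> card (anc E v)"
    using anc_mono[OF assms] proper_finite by (simp add: card_mono)
  have "(u, v) \<in> E ^^ (card (anc E v) - card (anc E u))"
    using assms
  proof (induction rule: rtrancl_induct)
    case (step y z)
    have "card (anc E u) \<le> card (anc E y)"
      using anc_mono[OF step(1)] proper_finite by (simp add: card_mono)
    then have "card (anc E z) - card (anc E u) = Suc (card (anc E y) - card (anc E u))"
      using card_anc_edge[OF step(2)] by simp
    then show ?case using step by auto
  qed simp
  moreover have "E ^^ d \<subseteq> (E \<union> E\<inverse>) ^^ d" for d
    by (induction d) auto
  ultimately have 1: "(u, v) \<in> (E \<union> E\<inverse>) ^^ (card (anc E v) - card (anc E u))" by blast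
  \<comment> \<open>The lower bound needs only that a step gains at most one level.\<close>
  have 2: "card (anc E y) \<le> card (anc E x) + d" if "(x, y) \<in> (E \<union> E\<inverse>) ^^ d" for x y d
    using that
  proof (induction d arbitrary: y)
    case (Suc d)
    then obtain z where z: "(x, z) \<in> (E \<union> E\<inverse>) ^^ d" "(z, y) \<in> E \<or> (y, z) \<in> E" by auto
    then show ?case using card_anc_edge[of z y] card_anc_edge[of y z] Suc.IH[OF z(1)] by auto
  qed simp
  show ?thesis unfolding graph_dist_def c
  proof (rule Least_equality, rule 1)
    fix d assume "(u, v) \<in> (E \<union> E\<inverse>) ^^ d"
    then show "card (anc E v) - card (anc E u) \<le> d" using 2 by fastforce
  qed
qed

text \<open>No old vertex lies below the new leaf, and the fresh branch point has the same old
  descendants as the lower end of the split edge. An ancestor set therefore changes only if it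
  contains that edge.\<close>

lemma anc_insert_leaf:
  assumes s: "s \<in> sites E" and x: "x \<noteq> Leaf (Suc n)" "x \<noteq> Branch (Suc n)"
  shows "anc (insert_leaf (Suc n) E s) x = subdivide (Suc n) s (anc E x)"
proof (cases s)
  case (Edge_Site e)
  obtain a c where e: "e = (a, c)" by force
  have ac: "(a, c) \<in> E" using s Edge_Site e by (auto simp: sites_def)
  have old: "a \<noteq> Branch (Suc n)" "a \<noteq> Leaf (Suc n)" "c \<noteq> Branch (Suc n)" "c \<noteq> Leaf (Suc n)"
    using ac fresh by (auto simp: Field_def)
  let ?E = "insert_leaf (Suc n) E s"
  have E': "?E = (E - {(a, c)}) \<union> {(a, Branch (Suc n)), (Branch (Suc n), c)} \<union> {(Branch (Suc n), Leaf (Suc n))}"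
    using Edge_Site e by auto
  note R = subdivide_rtrancl[OF ac fresh(2,1) _ E' order_refl, simplified]
  have ne: "snd f \<noteq> Branch (Suc n) \<and> snd f \<noteq> Leaf (Suc n)" if "f \<in> E" for f
    using that fresh by (cases f) (auto simp: Field_def)
  have r1: "(snd f, x) \<in> ?E\<^sup>* \<longleftrightarrow> (snd f, x) \<in> E\<^sup>*" if "f \<in> E" for f
    using R(1)[of "snd f" x] ne[OF that] x by auto
  have r2: "(Branch (Suc n), x) \<in> ?E\<^sup>* \<longleftrightarrow> (c, x) \<in> E\<^sup>*"
    using R(2)[of Root x] x by auto
  have r3: "(c, x) \<in> ?E\<^sup>* \<longleftrightarrow> (c, x) \<in> E\<^sup>*"
    using R(1)[of c x] old x by auto
  have r4: "(Leaf (Suc n), x) \<notin> ?E\<^sup>*"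
  proof
    assume "(Leaf (Suc n), x) \<in> ?E\<^sup>*"
    then obtain w where "(Leaf (Suc n), w) \<in> ?E" using x by (metis converse_rtranclE)
    then show False using E' fresh old by (auto simp: Field_def)
  qed
  have "anc ?E x = {f \<in> E. f \<noteq> (a, c) \<and> (snd f, x) \<in> ?E\<^sup>*} \<union>
      {f \<in> {(a, Branch (Suc n)), (Branch (Suc n), c), (Branch (Suc n), Leaf (Suc n))}. (snd f, x) \<in> ?E\<^sup>*}"
    unfolding anc_def using E' by blast
  also have "{f \<in> E. f \<noteq> (a, c) \<and> (snd f, x) \<in> ?E\<^sup>*} = {f \<in> E. f \<noteq> (a, c) \<and> (snd f, x) \<in> E\<^sup>*}"
    using r1 by auto
  also have "\<dots> = anc E x - {(a, c)}" by (auto simp: anc_def)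
  also have "{f \<in> {(a, Branch (Suc n)), (Branch (Suc n), c), (Branch (Suc n), Leaf (Suc n))}. (snd f, x) \<in> ?E\<^sup>*}
     = (if (c, x) \<in> E\<^sup>* then {(a, Branch (Suc n)), (Branch (Suc n), c)} else {})"
    using r2 r3 r4 by auto
  finally show ?thesis
    using Edge_Site e ac by (auto simp: anc_def)
next
  case (Vertex_Site v)
  have v: "v \<in> Field E" using s Vertex_Site by (auto simp: sites_def)
  let ?E = "insert_leaf (Suc n) E s"
  have E': "?E = E \<union> {(v, Leaf (Suc n))}" using Vertex_Site by auto
  have vl: "v \<noteq> Leaf (Suc n)" using v fresh by auto
  have "(y, x) \<in> ?E\<^sup>* \<longleftrightarrow> (y, x) \<in> E\<^sup>*" for y
    unfolding E' using add_edge_rtrancl[OF fresh(1) vl x(1)] .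
  then have "anc ?E x = {e \<in> E \<union> {(v, Leaf (Suc n))}. (snd e, x) \<in> E\<^sup>*}"
    unfolding anc_def using E' by blast
  moreover have "(Leaf (Suc n), x) \<notin> E\<^sup>*"
    using fresh(1) x by (metis FieldI1 converse_rtranclE)
  ultimately have "anc ?E x = anc E x"
    unfolding anc_def by fastforce
  then show ?thesis
    using Vertex_Site by simp
qed

lemma rtrancl_insert_leaf:
  assumes s: "s \<in> sites E" and x: "x \<noteq> Leaf (Suc n)" "x \<noteq> Branch (Suc n)"
    and y: "y \<noteq> Leaf (Suc n)" "y \<noteq> Branch (Suc n)"
  shows "(x, y) \<in> (insert_leaf (Suc n) E s)\<^sup>* \<longleftrightarrow> (x, y) \<in> E\<^sup>*"
proof (cases s)
  case (Edge_Site e)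
  obtain a c where e: "e = (a, c)" by force
  have ac: "(a, c) \<in> E" using s Edge_Site e by (auto simp: sites_def)
  let ?E = "insert_leaf (Suc n) E s"
  have E': "?E = (E - {(a, c)}) \<union> {(a, Branch (Suc n)), (Branch (Suc n), c)} \<union> {(Branch (Suc n), Leaf (Suc n))}"
    using Edge_Site e by auto
  show ?thesis
    using subdivide_rtrancl(1)[OF ac fresh(2,1) _ E' order_refl, of x y] x y by simp
next
  case (Vertex_Site v)
  then show ?thesis
    using add_edge_rtrancl[OF fresh(1), of v y x] fresh s y by (auto simp: sites_def)
qed

lemma Field_insert_leaf:
  assumes s: "s \<in> sites E"
  shows "Field E \<subseteq> Field (insert_leaf (Suc n) E s)"
    "Field (insert_leaf (Suc n) E s) \<subseteq> Field E \<union> {Leaf (Suc n), Branch (Suc n)}"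
    "Leaf (Suc n) \<in> Field (insert_leaf (Suc n) E s)"
proof -
  have F: "Field X = fst ` X \<union> snd ` X" for X :: tree
    by (simp add: Field_def Domain_fst Range_snd)
  have "Field (insert_leaf (Suc n) E s) =
      (case s of Edge_Site e \<Rightarrow> Field E \<union> {Leaf (Suc n), Branch (Suc n)} | Vertex_Site v \<Rightarrow> Field E \<union> {Leaf (Suc n)})"
  proof (cases s)
    case (Edge_Site e)
    then have e: "e \<in> E" using s by (auto simp: sites_def)
    have "Field E \<subseteq> Field (E - {e}) \<union> {fst e, snd e}" by (auto simp: F)
    then show ?thesis using Edge_Site e by (auto simp: insert_leaf_Edge F)
  next
    case (Vertex_Site v)
    then have "v \<in> Field E" using s by (auto simp: sites_def)
    then show ?thesis using Vertex_Site by (auto simp: F)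
  qed
  then show "Field E \<subseteq> Field (insert_leaf (Suc n) E s)"
    "Field (insert_leaf (Suc n) E s) \<subseteq> Field E \<union> {Leaf (Suc n), Branch (Suc n)}"
    "Leaf (Suc n) \<in> Field (insert_leaf (Suc n) E s)"
    by (auto split: site.splits)
qed

text \<open>The site can be read off from the new tree. The parent of the new leaf is either the
  selected old branch point or the fresh one, and in the latter case the parent and the other child
  of the fresh branch point are the ends of the selected edge. This is what allows the region hit by
  an insertion to be a function of the tree sequence.\<close>

lemma insert_leaf_inj:
  assumes "s \<in> sites E" "s' \<in> sites E"
    "insert_leaf (Suc n) E s = insert_leaf (Suc n) E s'"
  shows "s = s'"
proof -
  have old: "fst e \<noteq> Branch (Suc n)" "fst e \<noteq> Leaf (Suc n)" "snd e \<noteq> Branch (Suc n)" "snd e \<noteq> Leaf (Suc n)"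
    if "e \<in> E" for e
    using that fresh by (cases e; auto simp: Field_def)+
  let ?b = "Branch (Suc n)" and ?l = "Leaf (Suc n)"
  have ed: "e = (THE f. (fst f, ?b) \<in> X \<and> (?b, snd f) \<in> X \<and> snd f \<noteq> ?l) \<and> (\<forall>v. (v, ?l) \<in> X \<longleftrightarrow> v = ?b)"
    if "Edge_Site e \<in> sites E" "X = insert_leaf (Suc n) E (Edge_Site e)" for e X
  proof -
    have e: "e \<in> E" using that by (auto simp: sites_def)
    have X: "X = (E - {e}) \<union> {(fst e, ?b), (?b, snd e), (?b, ?l)}"
      using that insert_leaf_Edge by simp
    have A: "(u, ?b) \<in> X \<longleftrightarrow> u = fst e" for u
      using X old[OF e] old[of "(u, ?b)"] by auto
    have B: "(?b, u) \<in> X \<and> u \<noteq> ?l \<longleftrightarrow> u = snd e" for u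
      using X old[OF e] old[of "(?b, u)"] by auto
    have C: "(u, ?l) \<in> X \<longleftrightarrow> u = ?b" for u
      using X old[OF e] old[of "(u, ?l)"] by auto
    have "(THE f. (fst f, ?b) \<in> X \<and> (?b, snd f) \<in> X \<and> snd f \<noteq> ?l) = e"
      using A B by (intro the_equality) (auto simp: prod_eq_iff)
    with C show ?thesis by auto
  qed
  have ve: "(u, ?l) \<in> X \<longleftrightarrow> u = v"
    if "Vertex_Site v \<in> sites E" "X = insert_leaf (Suc n) E (Vertex_Site v)" for u v X
    using that old[of "(u, ?l)"] by auto
  have vb: "v \<noteq> ?b" if "Vertex_Site v \<in> sites E" for v
    using that fresh by (auto simp: sites_def)
  show ?thesis
  proof (cases s; cases s')
    fix e f assume "s = Edge_Site e" "s' = Edge_Site f"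
    then show ?thesis using ed[of e] ed[of f] assms by metis
  next
    fix e f assume "s = Edge_Site e" "s' = Vertex_Site f"
    then show ?thesis using ed[of e] ve[of f] vb[of f] assms by metis
  next
    fix e f assume "s = Vertex_Site f" "s' = Edge_Site e"
    then show ?thesis using ed[of e] ve[of f] vb[of f] assms by metis
  next
    fix e f assume "s = Vertex_Site f" "s' = Vertex_Site e"
    then show ?thesis using ve[of e] ve[of f] assms by metis
  qed
qed

lemma proper_insert_leaf:
  assumes s: "s \<in> sites E" and n: "n \<ge> 1"
  shows "proper (Suc n) (insert_leaf (Suc n) E s)"
proof -
  let ?b = "Branch (Suc n)" and ?l = "Leaf (Suc n)" and ?E = "insert_leaf (Suc n) E s"
  have old: "fst e \<noteq> ?b" "fst e \<noteq> ?l" "snd e \<noteq> ?b" "snd e \<noteq> ?l"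
    if "e \<in> E" for e
    using that fresh by (cases e; auto simp: Field_def)+
  have old': "a \<noteq> ?b" "a \<noteq> ?l" "c \<noteq> ?b" "c \<noteq> ?l" if "(a, c) \<in> E" for a c
    using old[OF that] by auto
  have nb: "(x, ?b) \<notin> E" "(x, ?l) \<notin> E" "(?b, x) \<notin> E" "(?l, x) \<notin> E" for x
    using old' by blast+
  have sE: "e \<in> E" if "s = Edge_Site e" for e using s that by (auto simp: sites_def)
  have sV: "v \<in> Field E \<and> v \<noteq> ?l \<and> v \<noteq> ?b \<and> 3 \<le> degree E v" if "s = Vertex_Site v" for v
    using s that fresh by (auto simp: sites_def)
  \<comment> \<open>A leaf has at most one incoming edge and none outgoing, so its degree is below
    three and no edge is ever attached to it.\<close>
  have notleaf: "v \<notin> range Leaf" if "s = Vertex_Site v" for v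
  proof
    assume "v \<in> range Leaf"
    then obtain i where i: "v = Leaf i" by auto
    have "e = f" if "e \<in> E" "f \<in> E" "fst e = v \<or> snd e = v" "fst f = v \<or> snd f = v" for e f
      using that pr i by (cases e; cases f) (auto simp: proper_def)
    then have "degree E v \<le> Suc 0"
      unfolding degree_def using proper_finite(1) by (subst card_le_Suc0_iff_eq) auto
    with sV[OF that] show False by simp
  qed
  have rt: "\<exists>\<rho> :: vertex \<Rightarrow> real. \<forall>(u, v) \<in> ?E. \<rho> u < \<rho> v"
  proof -
    obtain \<rho> :: "vertex \<Rightarrow> real" where \<rho>: "\<forall>(u, v) \<in> E. \<rho> u < \<rho> v"
      using pr by (auto simp: proper_def)
    show ?thesis
    proof (cases s)
      case (Edge_Site e)
      obtain a c where ac: "e = (a, c)" "(a, c) \<in> E" using sE[OF Edge_Site] by (cases e) auto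
      then have "\<rho> a < \<rho> c" using \<rho> by auto
      then have "\<forall>(u, v) \<in> ?E. (\<rho>(?b := (\<rho> a + \<rho> c) / 2, ?l := \<rho> c)) u < (\<rho>(?b := (\<rho> a + \<rho> c) / 2, ?l := \<rho> c)) v"
        using \<rho> nb ac old'[OF ac(2)] Edge_Site by (auto simp: field_simps)
      then show ?thesis by blast
    next
      case (Vertex_Site v)
      then have "\<forall>(u, w) \<in> ?E. (\<rho>(?l := \<rho> v + 1)) u < (\<rho>(?l := \<rho> v + 1)) w"
        using \<rho> nb sV[OF Vertex_Site] by auto
      then show ?thesis by blast
    qed
  qed
  have 1: "finite ?E" using proper_finite(1) by (cases s) (auto simp: insert_leaf_Edge)
  have 2: "u = v" if "(u, w) \<in> ?E" "(v, w) \<in> ?E" for u v w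
  proof (cases s)
    case (Edge_Site e)
    then show ?thesis
      using that nb old[OF sE[OF Edge_Site]] sE[OF Edge_Site]
      by (cases e) (auto dest: proper_parent)
  next
    case (Vertex_Site x)
    then show ?thesis using that nb by (auto dest: proper_parent)
  qed
  have 3: "(Leaf i, x) \<notin> ?E" for i x
    using pr sE notleaf by (cases s) (auto simp: insert_leaf_Edge proper_def)
  have noroot: "(x, Root) \<notin> ?E" for x
  proof (cases s)
    case (Edge_Site e)
    then show ?thesis
      using pr sE[OF Edge_Site] by (cases e) (auto simp: proper_def)
  next
    case (Vertex_Site v)
    then show ?thesis
      using pr by (auto simp: proper_def)
  qed
  have 4: "Leaf i \<in> Field ?E \<longleftrightarrow> i \<in> {1..Suc n}" for i
  proof -
    have "Leaf i \<in> Field E \<longleftrightarrow> i \<in> {1..n}" using pr by (simp add: proper_def)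
    moreover have "Leaf i \<in> Field ?E \<longleftrightarrow> Leaf i \<in> Field E \<or> i = Suc n"
      using Field_insert_leaf[OF s] by auto
    ultimately show ?thesis by auto
  qed
  have 5: "j \<le> Suc n" if "Branch j \<in> Field ?E" for j
  proof -
    have "Branch j \<in> Field E \<or> j = Suc n" using that Field_insert_leaf(2)[OF s] by auto
    then show ?thesis using pr by (auto simp: proper_def intro: le_SucI)
  qed
  have 6: "\<exists>i\<in>{1..Suc n}. (snd e, Leaf i) \<in> ?E\<^sup>*" if e: "e \<in> ?E" for e
  proof -
    have A: "\<exists>i\<in>{1..Suc n}. (snd e, Leaf i) \<in> ?E\<^sup>*" if eE: "e \<in> E" for e
    proof -
      obtain i where i: "i \<in> {1..n}" "(snd e, Leaf i) \<in> E\<^sup>*"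
        using proper_leaf_below[OF eE] by blast
      then have "(snd e, Leaf i) \<in> ?E\<^sup>*"
        by (subst rtrancl_insert_leaf[OF s]) (use old[OF eE] i in simp_all)
      then show ?thesis using i by (intro bexI[of _ i]) auto
    qed
    show ?thesis
    proof (cases "e \<in> E \<or> snd e = ?l")
      case True
      then show ?thesis
      proof
        assume "snd e = ?l"
        then show ?thesis by (intro bexI[of _ "Suc n"]) auto
      qed (rule A)
    next
      case False
      then obtain f where f: "s = Edge_Site f" "snd e = ?b \<or> snd e = snd f"
        using e by (cases s) (auto simp: insert_leaf_Edge)
      show ?thesis
      proof (cases "snd e = ?b")
        case True
        have "(?b, ?l) \<in> ?E" using f by (auto simp: insert_leaf_Edge)
        then show ?thesis using True by (intro bexI[of _ "Suc n"]) auto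
      next
        case False
        then show ?thesis using f A[of f] sE by metis
      qed
    qed
  qed
  show ?thesis unfolding proper_def
    by (intro conjI allI impI ballI; (rule 1 rt 3 noroot 4)?; (erule (1) 2)?; (erule 5)?; (erule 6)?)
qed

end

lemma proper_grown: "grown n E \<Longrightarrow> proper n E"
proof (induction rule: grown.induct)
  case base
  have "\<exists>\<rho> :: vertex \<Rightarrow> real. \<forall>(u, v) \<in> {(Root, Leaf 1)}. \<rho> u < \<rho> v"
    by (intro exI[of _ "\<lambda>v. if v = Root then 0 else 1"]) auto
  then show ?case unfolding proper_def by (auto simp: Field_def)
next
  case (step n E s)
  then show ?case using proper_insert_leaf grown_pos by blast
qed

section \<open>Weights\<close>

abbreviation (input) edge_weight :: "real \<Rightarrow> real \<Rightarrow> edge \<Rightarrow> real" where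
  "edge_weight \<alpha> \<gamma> e \<equiv> (if leaf_edge e then 1 - \<alpha> else \<gamma>)"

abbreviation (input) vertex_weight :: "real \<Rightarrow> real \<Rightarrow> tree \<Rightarrow> vertex \<Rightarrow> real" where
  "vertex_weight \<alpha> \<gamma> E v \<equiv> (real (degree E v) - 2) * \<alpha> - \<gamma>"

text \<open>Edges are addressed by their lower endpoint, so that two vertex sets describe a set of
  sites in every later tree. The sets for vertices and for edges differ because an edge into a
  branch point may have to be counted without that branch point.\<close>

definition region :: "vertex set \<Rightarrow> vertex set \<Rightarrow> tree \<Rightarrow> site set" where
  "region P Q E = Edge_Site ` {e \<in> E. snd e \<in> Q} \<union> Vertex_Site ` {v \<in> Field E. 3 \<le> degree E v \<and> v \<in> P}"

definition region_weight :: "real \<Rightarrow> real \<Rightarrow> vertex set \<Rightarrow> vertex set \<Rightarrow> tree \<Rightarrow> real" where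
  "region_weight \<alpha> \<gamma> P Q E = (\<Sum>e\<in>{e \<in> E. snd e \<in> Q}. edge_weight \<alpha> \<gamma> e) +
     (\<Sum>v\<in>{v \<in> Field E. 3 \<le> degree E v \<and> v \<in> P}. vertex_weight \<alpha> \<gamma> E v)"

lemma sum_region:
  assumes "finite E"
  shows "(\<Sum>s\<in>region P Q E. site_weight \<alpha> \<gamma> E s) = region_weight \<alpha> \<gamma> P Q E"
proof -
  have "(\<Sum>s\<in>region P Q E. site_weight \<alpha> \<gamma> E s) =
      (\<Sum>s\<in>Edge_Site ` {e \<in> E. snd e \<in> Q}. site_weight \<alpha> \<gamma> E s) +
      (\<Sum>s\<in>Vertex_Site ` {v \<in> Field E. 3 \<le> degree E v \<and> v \<in> P}. site_weight \<alpha> \<gamma> E s)"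
    unfolding region_def using assms by (intro sum.union_disjoint) (auto simp: finite_Field)
  then show ?thesis
    by (simp add: sum.reindex inj_on_def region_weight_def Let_def algebra_simps)
qed

lemma region_UNIV: "region UNIV UNIV E = sites E"
  by (simp add: region_def sites_def)

lemma degree_eq_sum: "finite E \<Longrightarrow> degree E v = (\<Sum>e\<in>E. if fst e = v \<or> snd e = v then 1 else 0)"
  unfolding degree_def by (simp add: sum.If_cases Int_def)

lemma degree_disjoint_insert:
  assumes "finite E" "e \<notin> E"
  shows "degree (insert e E) v = degree E v + (if fst e = v \<or> snd e = v then 1 else 0)"
  using assms by (simp add: degree_eq_sum)

lemma degree_notin_Field: "v \<notin> Field E \<Longrightarrow> degree E v = 0"
proof -
  assume "v \<notin> Field E"
  then have "{e \<in> E. fst e = v \<or> snd e = v} = {}" by (force simp: Field_def Domain_iff Range_iff)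
  then show "degree E v = 0" unfolding degree_def by (metis card.empty)
qed

context
  fixes n E
  assumes pr: "proper n E"
begin

lemma degree_insert_leaf:
  assumes s: "s \<in> sites E"
  shows "v \<noteq> Leaf (Suc n) \<Longrightarrow> v \<noteq> Branch (Suc n) \<Longrightarrow>
      degree (insert_leaf (Suc n) E s) v = degree E v + (if s = Vertex_Site v then 1 else 0)"
    and "degree (insert_leaf (Suc n) E s) (Leaf (Suc n)) = 1"
    and "s = Edge_Site e \<Longrightarrow> degree (insert_leaf (Suc n) E s) (Branch (Suc n)) = 3"
proof -
  let ?b = "Branch (Suc n)" and ?l = "Leaf (Suc n)" and ?E = "insert_leaf (Suc n) E s"
  have nb: "(x, ?b) \<notin> E" "(x, ?l) \<notin> E" "(?b, x) \<notin> E" "(?l, x) \<notin> E" for x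
    using fresh[OF pr] by (auto simp: Field_def)
  note fin = proper_finite(1)[OF pr]
  have d0: "degree F ?b = 0" "degree F ?l = 0" if "F \<subseteq> E" for F
  proof -
    have "?b \<notin> Field F" "?l \<notin> Field F" using fresh[OF pr] mono_Field[OF that] by auto
    then show "degree F ?b = 0" "degree F ?l = 0" by (auto simp: degree_notin_Field)
  qed
  have edge: "degree ?E v = degree (E - {(a, c)}) v + (if v = a \<or> v = ?b then 1 else 0)
       + (if v = ?b \<or> v = c then 1 else 0) + (if v = ?b \<or> v = ?l then 1 else 0)"
    "(a, c) \<in> E" "a \<noteq> c" "a \<noteq> ?b" "a \<noteq> ?l" "c \<noteq> ?b" "c \<noteq> ?l"
    if "s = Edge_Site (a, c)" for a c v
  proof -
    show ac: "(a, c) \<in> E" using s that by (auto simp: sites_def)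
    then show ne: "a \<noteq> c" "a \<noteq> ?b" "a \<noteq> ?l" "c \<noteq> ?b" "c \<noteq> ?l"
      using nb proper_edge_neq[OF pr ac] by auto
    have "?E = insert (a, ?b) (insert (?b, c) (insert (?b, ?l) (E - {(a, c)})))"
      using that by auto
    then show "degree ?E v = degree (E - {(a, c)}) v + (if v = a \<or> v = ?b then 1 else 0)
       + (if v = ?b \<or> v = c then 1 else 0) + (if v = ?b \<or> v = ?l then 1 else 0)"
      using fin ne nb by (simp add: degree_disjoint_insert)
  qed
  have vert: "degree ?E v = degree E v + (if v = x \<or> v = ?l then 1 else 0)" "x \<noteq> ?l"
    if "s = Vertex_Site x" for x v
  proof -
    show "x \<noteq> ?l" using s that fresh[OF pr] by (auto simp: sites_def)
    have "?E = insert (x, ?l) E" using that by auto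
    then show "degree ?E v = degree E v + (if v = x \<or> v = ?l then 1 else 0)"
      using fin nb by (auto simp: degree_disjoint_insert)
  qed
  show "degree ?E v = degree E v + (if s = Vertex_Site v then 1 else 0)"
    if v: "v \<noteq> ?l" "v \<noteq> ?b"
  proof (cases s)
    case (Edge_Site e)
    obtain a c where e: "e = (a, c)" by force
    note D = edge[OF Edge_Site[unfolded e]]
    have "E = insert (a, c) (E - {(a, c)})" using D(2) by auto
    then have "degree E v = degree (insert (a, c) (E - {(a, c)})) v" by simp
    also have "\<dots> = degree (E - {(a, c)}) v + (if v = a \<or> v = c then 1 else 0)"
      using fin by (subst degree_disjoint_insert) auto
    finally show ?thesis using D v Edge_Site by auto
  next
    case (Vertex_Site x)
    then show ?thesis using vert[OF Vertex_Site] v by auto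
  qed
  show "degree ?E ?l = 1"
  proof (cases s)
    case (Edge_Site e)
    obtain a c where e: "e = (a, c)" by force
    show ?thesis using edge[OF Edge_Site[unfolded e]] d0[of "E - {(a, c)}"] by auto
  next
    case (Vertex_Site x)
    then show ?thesis using vert[OF Vertex_Site] d0[of E] by auto
  qed
  show "degree ?E ?b = 3" if "s = Edge_Site e"
  proof -
    obtain a c where e: "e = (a, c)" by force
    show ?thesis using edge[OF that[unfolded e]] d0[of "E - {(a, c)}"] by auto
  qed
qed

text \<open>Splitting an edge leaves its weight on the lower half and adds \<gamma> for the upper
  half, \<open>1 - \<alpha>\<close> for the new leaf edge and \<open>\<alpha> - \<gamma>\<close> for
  a branch point of degree three. A leaf attached to a branch point raises the weight of the latter
  by \<alpha> and adds an edge of weight \<open>1 - \<alpha>\<close>. Both totals are one. The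
  primed sets agree with the old ones on old vertices and take in the fresh vertices exactly when
  the site lies in the region.\<close>

lemma region_weight_insert_leaf:
  assumes s: "s \<in> sites E"
    and P: "\<And>v. v \<in> Field E \<Longrightarrow> v \<in> P' \<longleftrightarrow> v \<in> P"
    and Q: "\<And>v. v \<in> Field E \<Longrightarrow> v \<in> Q' \<longleftrightarrow> v \<in> Q"
    and new: "s \<in> region P Q E \<Longrightarrow> {Leaf (Suc n), Branch (Suc n)} \<subseteq> P' \<inter> Q'"
      "s \<notin> region P Q E \<Longrightarrow> {Leaf (Suc n), Branch (Suc n)} \<inter> (P' \<union> Q') = {}"
  shows "region_weight \<alpha> \<gamma> P' Q' (insert_leaf (Suc n) E s) =
    region_weight \<alpha> \<gamma> P Q E + (if s \<in> region P Q E then 1 else 0)"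
proof -
  let ?b = "Branch (Suc n)" and ?l = "Leaf (Suc n)" and ?E = "insert_leaf (Suc n) E s"
  let ?w = "edge_weight \<alpha> \<gamma>"
  have nb: "(x, ?b) \<notin> E" "(x, ?l) \<notin> E" "(?b, x) \<notin> E" "(?l, x) \<notin> E" for x
    using fresh[OF pr] by (auto simp: Field_def)
  note fin = proper_finite[OF pr]
  let ?A = "{e \<in> E. snd e \<in> Q}" and ?A' = "{e \<in> ?E. snd e \<in> Q'}"
  let ?B = "{v \<in> Field E. 3 \<le> degree E v \<and> v \<in> P}" and ?B' = "{v \<in> Field ?E. 3 \<le> degree ?E v \<and> v \<in> P'}"
  have sndE: "snd e \<in> Field E" if "e \<in> E" for e
    using that by (cases e) (auto simp: Field_def)
  have AE: "{e \<in> E. snd e \<in> Q'} = ?A" using Q sndE by auto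
  note F = Field_insert_leaf[OF pr s]
  note D = degree_insert_leaf[OF s]
  have FE: "v \<noteq> ?l" "v \<noteq> ?b" if "v \<in> Field E" for v using that fresh[OF pr] by auto
  show ?thesis
  proof (cases s)
    case (Edge_Site e)
    obtain a c where e: "e = (a, c)" by force
    have ac: "(a, c) \<in> E" using s Edge_Site e by (auto simp: sites_def)
    have ne: "a \<noteq> c" "a \<noteq> ?b" "a \<noteq> ?l" "c \<noteq> ?b" "c \<noteq> ?l"
      using nb proper_edge_neq[OF pr ac] ac by auto
    have c: "c \<in> Field E" using ac by (auto simp: Field_def)
    have mem: "s \<in> region P Q E \<longleftrightarrow> c \<in> Q" using Edge_Site e ac by (auto simp: region_def)
    have deg: "degree ?E v = degree E v" if "v \<in> Field E" for v
      using D(1)[of v] FE[OF that] Edge_Site by simp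
    have B: "(\<Sum>v\<in>?B. vertex_weight \<alpha> \<gamma> ?E v) = (\<Sum>v\<in>?B. vertex_weight \<alpha> \<gamma> E v)"
      using deg by (intro sum.cong) auto
    have bF: "?b \<in> Field ?E" using Edge_Site e by (auto simp: Field_def)
    show ?thesis
    proof (cases "c \<in> Q")
      case True
      then have new': "?l \<in> P'" "?l \<in> Q'" "?b \<in> P'" "?b \<in> Q'" "c \<in> Q'" using new(1) mem Q[OF c] by auto
      have "?A' = insert (a, ?b) (insert (?b, c) (insert (?b, ?l) ({e \<in> E. snd e \<in> Q'} - {(a, c)})))"
        using Edge_Site e new' by auto
      note this[unfolded AE]
      then have "sum ?w ?A' = ?w (a, ?b) + (?w (?b, c) + (?w (?b, ?l) + sum ?w (?A - {(a, c)})))"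
        using fin ne nb by (simp add: sum.insert)
      also have "sum ?w (?A - {(a, c)}) = sum ?w ?A - ?w (a, c)"
        using ac True fin by (subst sum_diff1) auto
      finally have 1: "sum ?w ?A' = sum ?w ?A + \<gamma> + (1 - \<alpha>)"
        by (auto simp: leaf_edge_def)
      have "?B' = insert ?b ?B"
        using F bF D(2) D(3)[OF Edge_Site] deg P new' FE by auto
      moreover have "?b \<notin> ?B" using fresh[OF pr] by auto
      ultimately have "(\<Sum>v\<in>?B'. vertex_weight \<alpha> \<gamma> ?E v) = (\<alpha> - \<gamma>) + (\<Sum>v\<in>?B. vertex_weight \<alpha> \<gamma> E v)"
        using fin D(3)[OF Edge_Site] B by simp
      then show ?thesis using 1 True mem unfolding region_weight_def by simp
    next
      case False
      then have new': "?l \<notin> P'" "?l \<notin> Q'" "?b \<notin> P'" "?b \<notin> Q'" "c \<notin> Q'" using new(2) mem Q[OF c] by auto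
      have "?A' = {e \<in> E. snd e \<in> Q'}" using Edge_Site e new' by auto
      note this[unfolded AE]
      moreover have "?B' = ?B" using F deg P new' FE by auto
      ultimately show ?thesis using False mem B unfolding region_weight_def by simp
    qed
  next
    case (Vertex_Site x)
    have x: "x \<in> Field E" "3 \<le> degree E x" using s Vertex_Site by (auto simp: sites_def)
    have mem: "s \<in> region P Q E \<longleftrightarrow> x \<in> P" using Vertex_Site x by (auto simp: region_def)
    have deg: "degree ?E v = degree E v + (if v = x then 1 else 0)" if "v \<in> Field E" for v
      using D(1)[of v] FE[OF that] Vertex_Site by auto
    have Fl: "Field ?E = insert ?l (Field E)"
      using Vertex_Site x(1) by (auto simp: Field_insert)
    have "v \<in> ?B' \<longleftrightarrow> v \<in> ?B" for v
    proof (cases "v \<in> Field E")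
      case True
      then show ?thesis unfolding Fl using deg[OF True] P[OF True] x by auto
    next
      case False
      then show ?thesis unfolding Fl using D(2) by auto
    qed
    then have B': "?B' = ?B" by blast
    have B: "(\<Sum>v\<in>?B. vertex_weight \<alpha> \<gamma> ?E v) = (\<Sum>v\<in>?B. vertex_weight \<alpha> \<gamma> E v + (if v = x then \<alpha> else 0))"
      using deg by (intro sum.cong) (auto simp: algebra_simps)
    have B2: "\<dots> = (\<Sum>v\<in>?B. vertex_weight \<alpha> \<gamma> E v) + (if x \<in> P then \<alpha> else 0)"
      using fin x by (simp add: sum.distrib)
    have A: "?A' = (if x \<in> P then insert (x, ?l) {e \<in> E. snd e \<in> Q'} else {e \<in> E. snd e \<in> Q'})"
      using Vertex_Site new mem by auto
    note A = A[unfolded AE]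
    have "sum ?w ?A' = sum ?w ?A + (if x \<in> P then 1 - \<alpha> else 0)"
      unfolding A using fin nb by (auto simp: leaf_edge_def)
    then show ?thesis unfolding region_weight_def B' using B B2 mem by simp
  qed
qed

end

text \<open>The single edge of the first tree weighs \<open>1 - \<alpha>\<close>, and the region of
  all sites absorbs every insertion.\<close>

lemma total_weight:
  assumes "grown n E"
  shows "(\<Sum>s\<in>sites E. site_weight \<alpha> \<gamma> E s) = real n - \<alpha>"
proof -
  have "region_weight \<alpha> \<gamma> UNIV UNIV E = real n - \<alpha>"
    using assms
  proof (induction rule: grown.induct)
    case base
    have "degree {(Root, Leaf 1)} v \<le> card {(Root, Leaf 1)}" for v
      unfolding degree_def by (intro card_mono) auto
    then have "degree {(Root, Leaf 1)} v \<le> 1" for v by simp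
    then have "\<not> 3 \<le> degree {(Root, Leaf 1)} v" for v by (meson le_trans numeral_le_one_iff semiring_norm(70))
    then show ?case by (simp add: region_weight_def leaf_edge_def)
  next
    case (step n E s)
    then show ?case
      using region_weight_insert_leaf[OF proper_grown[OF step(1)] step(2), of UNIV UNIV UNIV UNIV \<alpha> \<gamma>]
      by (simp add: region_UNIV)
  qed
  then show ?thesis
    using sum_region[OF proper_finite(1)[OF proper_grown[OF assms]], of \<alpha> \<gamma> UNIV UNIV]
    by (simp add: region_UNIV)
qed

section \<open>Reduced trees under growth\<close>

text \<open>The inserted vertex has degree two and is removed again; all other degrees and the
  reachability between old vertices are unchanged.\<close>

lemma remove_degree_2_subdivide:
  assumes fin: "finite S" and ac: "(a, c) \<in> S" and b: "b \<notin> Field S" and ne: "a \<noteq> c"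
  shows "remove_degree_2 (S - {(a, c)} \<union> {(a, b), (b, c)}) = remove_degree_2 S"
proof -
  let ?S = "S - {(a, c)} \<union> {(a, b), (b, c)}"
  have nb: "(x, b) \<notin> S" "(b, x) \<notin> S" for x using b by (auto simp: Field_def)
  have bac: "a \<noteq> b" "c \<noteq> b" using ac nb by auto
  have S': "?S = insert (a, b) (insert (b, c) (S - {(a, c)}))" by auto
  have "S = insert (a, c) (S - {(a, c)})" using ac by auto
  then have dS: "degree S v = degree (S - {(a, c)}) v + (if a = v \<or> c = v then 1 else 0)" for v
    using fin degree_disjoint_insert[of "S - {(a, c)}" "(a, c)" v] by simp
  have dS': "degree ?S v = degree (S - {(a, c)}) v + (if a = v \<or> b = v then 1 else 0) + (if b = v \<or> c = v then 1 else 0)" for v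
    unfolding S' using fin nb bac by (simp add: degree_disjoint_insert)
  have d1: "degree ?S v = degree S v" if "v \<noteq> b" for v
    using dS[of v] dS'[of v] that ne by auto
  have "b \<notin> Field (S - {(a, c)})" using b mono_Field[of "S - {(a, c)}" S] by auto
  then have d2: "degree ?S b = 2" using dS'[of b] degree_notin_Field by simp
  have FS: "Field ?S = insert b (Field S)"
  proof -
    have F: "Field X = fst ` X \<union> snd ` X" for X :: tree
      by (simp add: Field_def Domain_fst Range_snd)
    have "Field S \<subseteq> Field (S - {(a, c)}) \<union> {a, c}" by (auto simp: F)
    moreover have "a \<in> Field S" "c \<in> Field S" using ac by (auto simp: Field_def)
    ultimately show ?thesis by (auto simp: F)
  qed
  have V: "{v \<in> Field ?S. degree ?S v \<noteq> 2} = {v \<in> Field S. degree S v \<noteq> 2}"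
  proof -
    have "{v \<in> F. d v \<noteq> 2} = {v \<in> Field S. degree S v \<noteq> 2}"
      if "F = insert b (Field S)" "\<And>v. v \<noteq> b \<Longrightarrow> d v = degree S v" "d b = 2"
      for F and d :: "vertex \<Rightarrow> nat"
    proof (intro set_eqI)
      fix v
      show "v \<in> {v \<in> F. d v \<noteq> 2} \<longleftrightarrow> v \<in> {v \<in> Field S. degree S v \<noteq> 2}"
        using that(1,3) that(2)[of v] b by (cases "v = b") auto
    qed
    from this[OF FS d1 d2] show ?thesis .
  qed
  have fwd: "(y \<noteq> b \<longrightarrow> (x, y) \<in> S\<^sup>+) \<and> (y = b \<longrightarrow> (x, a) \<in> S\<^sup>*)" if "(x, y) \<in> ?S\<^sup>+" "x \<noteq> b" for x y
    using that(1)
  proof (induction rule: trancl_induct)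
    case (base y)
    then show ?case using that(2) nb by auto
  next
    case (step y z)
    from step(2) have "(y, z) \<in> S \<or> y = a \<and> z = b \<or> y = b \<and> z = c" by auto
    then show ?case
    proof (elim disjE)
      assume "(y, z) \<in> S"
      then show ?thesis using step.IH nb by (auto intro: trancl_into_trancl)
    next
      assume "y = a \<and> z = b"
      then show ?thesis using step.IH bac by (auto intro: trancl_into_rtrancl)
    next
      assume "y = b \<and> z = c"
      then show ?thesis using step.IH bac ac by (auto intro: rtrancl_into_trancl1)
    qed
  qed
  have bwd: "(x, y) \<in> ?S\<^sup>+" if "(x, y) \<in> S\<^sup>+" for x y
    using that
  proof (induction rule: trancl_induct)
    case (base y)
    show ?case
    proof (cases "(x, y) = (a, c)")
      case True
      have "(a, b) \<in> ?S" "(b, c) \<in> ?S" by auto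
      then show ?thesis using True by (auto intro: trancl_into_trancl)
    next
      case False
      then show ?thesis using base by auto
    qed
  next
    case (step y z)
    have "(y, z) \<in> ?S\<^sup>+"
    proof (cases "(y, z) = (a, c)")
      case True
      have "(a, b) \<in> ?S" "(b, c) \<in> ?S" by auto
      then show ?thesis using True by (auto intro: trancl_into_trancl)
    next
      case False
      then show ?thesis using step by auto
    qed
    with step.IH show ?case by (rule trancl_trans)
  qed
  have tr: "(x, y) \<in> ?S\<^sup>+ \<longleftrightarrow> (x, y) \<in> S\<^sup>+" if "x \<noteq> b" "y \<noteq> b" for x y
    using fwd[of x y] bwd[of x y] that by auto
  have nV: "v \<noteq> b" if "v \<in> {v \<in> Field S. degree S v \<noteq> 2}" for v using that b by auto
  show ?thesis
    unfolding remove_degree_2_def Let_def V using tr nV by blast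
qed

text \<open>No vertex has degree two, so nothing is removed. The edges are then recovered as the
  reachable pairs without a vertex strictly between them, because parents are unique and there are
  no cycles.\<close>

lemma remove_degree_2_trees:
  assumes "t \<in> trees k" "proper k t"
  shows "remove_degree_2 t = t"
proof -
  have deg: "degree t v \<noteq> 2" if "v \<in> Field t" for v
  proof (cases v)
    case Root
    then show ?thesis using assms(1) by (simp add: trees_def)
  next
    case (Leaf i)
    then have "i \<in> {1..k}" using assms(2) that by (simp add: proper_def)
    then have "degree t v = 1" using assms(1) Leaf by (simp add: trees_def)
    then show ?thesis by simp
  next
    case (Branch j)
    then have "3 \<le> degree t v" using assms(1) that by (simp add: trees_def)
    then show ?thesis by simp
  qed
  then have V: "{v \<in> Field t. degree t v \<noteq> 2} = Field t" by auto
  have "(u, v) \<in> t \<longleftrightarrow> u \<in> Field t \<and> v \<in> Field t \<and> (u, v) \<in> t\<^sup>+ \<and>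
      \<not> (\<exists>w\<in>Field t. (u, w) \<in> t\<^sup>+ \<and> (w, v) \<in> t\<^sup>+)" for u v
  proof
    assume uv: "(u, v) \<in> t"
    have "False" if w: "(u, w) \<in> t\<^sup>+" "(w, v) \<in> t\<^sup>+" for w
    proof -
      obtain z where z: "(w, z) \<in> t\<^sup>*" "(z, v) \<in> t" using w(2) by (meson tranclD2)
      then have "z = u" using proper_parent[OF assms(2)] uv by blast
      then show False using proper_trancl_irrefl[OF assms(2), of w u] w z by blast
    qed
    then show "u \<in> Field t \<and> v \<in> Field t \<and> (u, v) \<in> t\<^sup>+ \<and>
      \<not> (\<exists>w\<in>Field t. (u, w) \<in> t\<^sup>+ \<and> (w, v) \<in> t\<^sup>+)"
      using uv by (auto simp: Field_def)
  next
    assume a: "u \<in> Field t \<and> v \<in> Field t \<and> (u, v) \<in> t\<^sup>+ \<and>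
      \<not> (\<exists>w\<in>Field t. (u, w) \<in> t\<^sup>+ \<and> (w, v) \<in> t\<^sup>+)"
    then obtain z where z: "(u, z) \<in> t\<^sup>*" "(z, v) \<in> t" by (meson tranclD2)
    show "(u, v) \<in> t"
    proof (cases "u = z")
      case False
      then have "(u, z) \<in> t\<^sup>+" using z by (meson rtranclD)
      moreover have "z \<in> Field t" using z by (auto simp: Field_def)
      ultimately show ?thesis using a z by blast
    qed (use z in simp)
  qed
  then show ?thesis unfolding remove_degree_2_def Let_def V by auto
qed

section \<open>Paths and attached subtrees of the edges of the reduced tree\<close>

definition tree_path :: "tree \<Rightarrow> edge \<Rightarrow> edge set" where
  "tree_path E e = anc E (snd e) - anc E (fst e)"

text \<open>All vertices that the insertion of a leaf in \<open>J\<close> may create;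
  \<open>Branch j\<close> is listed whether or not it occurs in the tree.\<close>

definition labelled :: "nat set \<Rightarrow> vertex set" where
  "labelled J = Leaf ` J \<union> Branch ` J"

text \<open>The sites in the subtrees of \<open>E\<close> that are attached to the edges of the reduced tree \<open>t\<close>, where
  \<open>J\<close> contains the labels of the leaves of these subtrees.\<close>

definition edge_region :: "tree \<Rightarrow> nat set \<Rightarrow> tree \<Rightarrow> site set" where
  "edge_region t J E = region (labelled J) (Field t \<union> labelled J) E"

text \<open>The invariant of the growth after time \<open>k\<close>, with \<open>t\<close> the tree
  at time \<open>k\<close>. Its last two clauses carry the chain: a path weighs \<gamma> per edge up
  to a constant depending on the kind of the edge it replaces, and the region weighs its initial
  weight plus the number of leaves it has received. Quantifying over the parameters inside keeps the
  invariant purely combinatorial.\<close>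

definition reduces_to :: "nat \<Rightarrow> tree \<Rightarrow> nat \<Rightarrow> tree \<Rightarrow> nat set \<Rightarrow> bool" where
  "reduces_to k t n E J \<longleftrightarrow> k \<le> n \<and> grown n E \<and> J \<subseteq> {k<..n} \<and> Field t \<subseteq> Field E \<and>
     t \<subseteq> E\<^sup>* \<and> remove_degree_2 (spanned k E) = t \<and>
     (\<forall>e\<in>t. snd ` tree_path E e \<subseteq> Field t \<union> labelled J) \<and>
     (\<forall>e\<in>t. 1 \<le> card (tree_path E e)) \<and>
     (\<forall>e\<in>t. \<forall>f\<in>t. e \<noteq> f \<longrightarrow> tree_path E e \<inter> tree_path E f = {}) \<and>
     (\<forall>e\<in>t. \<forall>\<alpha> \<gamma>. (\<Sum>f\<in>tree_path E e. edge_weight \<alpha> \<gamma> f) =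
        \<gamma> * (real (card (tree_path E e)) - 1) + edge_weight \<alpha> \<gamma> e) \<and>
     (\<forall>\<alpha> \<gamma>. (\<Sum>s\<in>edge_region t J E. site_weight \<alpha> \<gamma> E s) = (\<Sum>e\<in>t. edge_weight \<alpha> \<gamma> e) + real (card J))"

lemma edge_in_Field: "e \<in> t \<Longrightarrow> fst e \<in> Field t" "e \<in> t \<Longrightarrow> snd e \<in> Field t"
  by (cases e; auto simp: Field_def)+

lemma finite_tree_path: "proper n E \<Longrightarrow> finite (tree_path E e)"
  unfolding tree_path_def using proper_finite by auto

lemma tree_path_subset: "tree_path E e \<subseteq> E"
  by (auto simp: tree_path_def anc_def)

lemma subdivide_Diff:
  assumes "Branch j \<notin> Field S" "T \<subseteq> S"
  shows "subdivide j s S - subdivide j s T = subdivide j s (S - T)"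
proof (cases s)
  case (Edge_Site e)
  have "(x, Branch j) \<notin> S" "(Branch j, x) \<notin> S" for x using assms(1) by (auto simp: Field_def)
  then show ?thesis using Edge_Site assms(2) by auto
qed simp

lemma subdivide_disjoint:
  assumes "Branch j \<notin> Field S" "Branch j \<notin> Field T" "S \<inter> T = {}"
  shows "subdivide j s S \<inter> subdivide j s T = {}"
proof (cases s)
  case (Edge_Site e)
  have "(x, Branch j) \<notin> S \<union> T" "(Branch j, x) \<notin> S \<union> T" for x using assms by (auto simp: Field_def)
  then show ?thesis using Edge_Site assms(3) by auto
qed (use assms in simp)

text \<open>The upper half of a split edge ends in a branch point and weighs \<gamma>; the lower
  half keeps the lower endpoint, hence the kind and the weight of the original.\<close>

lemma subdivide_weight:
  assumes fin: "finite S" and nb: "Branch j \<notin> Field S"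
  shows "sum (edge_weight \<alpha> \<gamma>) (subdivide j s S) =
      sum (edge_weight \<alpha> \<gamma>) S + (if s \<in> Edge_Site ` S then \<gamma> else 0)"
    and "card (subdivide j s S) = card S + (if s \<in> Edge_Site ` S then 1 else 0)"
proof -
  have nb: "(x, Branch j) \<notin> S" "(Branch j, x) \<notin> S" for x using nb by (auto simp: Field_def)
  show "card (subdivide j s S) = card S + (if s \<in> Edge_Site ` S then 1 else 0)"
  proof (cases "s \<in> Edge_Site ` S")
    case True
    then obtain e where e: "e \<in> S" "s = Edge_Site e" by auto
    have "subdivide j s S = insert (fst e, Branch j) (insert (Branch j, snd e) (S - {e}))" using e by auto
    moreover have "fst e \<noteq> Branch j" using nb(2)[of "snd e"] e by (metis prod.collapse)
    ultimately have "card (subdivide j s S) = Suc (Suc (card (S - {e})))"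
      using fin nb by simp
    then show ?thesis using card_Suc_Diff1[OF fin e(1)] by (simp only: True if_True)
  next
    case False
    then show ?thesis by (cases s) auto
  qed
  show "sum (edge_weight \<alpha> \<gamma>) (subdivide j s S) =
      sum (edge_weight \<alpha> \<gamma>) S + (if s \<in> Edge_Site ` S then \<gamma> else 0)"
  proof (cases "s \<in> Edge_Site ` S")
    case True
    then obtain e where e: "e \<in> S" "s = Edge_Site e" by auto
    have "subdivide j s S = insert (fst e, Branch j) (insert (Branch j, snd e) (S - {e}))" using e by auto
    moreover have "fst e \<noteq> Branch j" using nb(2)[of "snd e"] e by (metis prod.collapse)
    ultimately have "sum (edge_weight \<alpha> \<gamma>) (subdivide j s S) = edge_weight \<alpha> \<gamma> (fst e, Branch j) +
        (edge_weight \<alpha> \<gamma> (Branch j, snd e) + sum (edge_weight \<alpha> \<gamma>) (S - {e}))"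
      using fin nb by simp
    also have "edge_weight \<alpha> \<gamma> (fst e, Branch j) = \<gamma>"
      by (auto simp: leaf_edge_def)
    also have "edge_weight \<alpha> \<gamma> (Branch j, snd e) = edge_weight \<alpha> \<gamma> e"
      by (simp add: leaf_edge_def)
    also have "edge_weight \<alpha> \<gamma> e + sum (edge_weight \<alpha> \<gamma>) (S - {e}) = sum (edge_weight \<alpha> \<gamma>) S"
      using sum.remove[OF fin e(1), of "edge_weight \<alpha> \<gamma>"] by simp
    finally show ?thesis using True by simp
  next
    case False
    then show ?thesis by (cases s) auto
  qed
qed

text \<open>At time \<open>k\<close> every path is a single edge and nothing has been attached yet.
  The region consists of edges alone, as the branch points of \<open>t\<close> do not belong to
  it.\<close>

lemma reduces_to_self:
  assumes "grown k t" "t \<in> trees k"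
  shows "reduces_to k t k t {}"
proof -
  note pr = proper_grown[OF assms(1)]
  have path: "tree_path t e = {e}" if "e \<in> t" for e
    using anc_edge[OF pr, of "fst e" "snd e"] that unfolding tree_path_def by auto
  have sp: "spanned k t = t"
    using proper_leaf_below[OF pr] unfolding spanned_def by force
  have "(\<Sum>s\<in>edge_region t {} t. site_weight \<alpha> \<gamma> t s) = (\<Sum>e\<in>t. edge_weight \<alpha> \<gamma> e)" for \<alpha> \<gamma>
  proof -
    have "{e \<in> t. snd e \<in> Field t} = t" by (force simp: Field_def)
    then show ?thesis
      unfolding edge_region_def sum_region[OF proper_finite(1)[OF pr]] region_weight_def
      by (simp add: labelled_def)
  qed
  moreover have "snd e \<in> Field t" if "e \<in> t" for e using that by (cases e) (auto simp: Field_def)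
  ultimately show ?thesis
    unfolding reduces_to_def
    using assms(1) sp remove_degree_2_trees[OF assms(2) pr] by (auto simp: path)
qed

context
  fixes k t n E J
  assumes red: "reduces_to k t n E J"
begin

lemma reduces_toD:
  shows "k \<le> n" "grown n E" "J \<subseteq> {k<..n}" "Field t \<subseteq> Field E" "t \<subseteq> E\<^sup>*"
    and "remove_degree_2 (spanned k E) = t"
    and "\<And>e. e \<in> t \<Longrightarrow> snd ` tree_path E e \<subseteq> Field t \<union> labelled J"
    and "\<And>e f. e \<in> t \<Longrightarrow> f \<in> t \<Longrightarrow> e \<noteq> f \<Longrightarrow> tree_path E e \<inter> tree_path E f = {}"
    and "\<And>e \<alpha> \<gamma>. e \<in> t \<Longrightarrow> (\<Sum>f\<in>tree_path E e. edge_weight \<alpha> \<gamma> f) =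
        \<gamma> * (real (card (tree_path E e)) - 1) + edge_weight \<alpha> \<gamma> e"
    and "\<And>\<alpha> \<gamma>. (\<Sum>s\<in>edge_region t J E. site_weight \<alpha> \<gamma> E s) = (\<Sum>e\<in>t. edge_weight \<alpha> \<gamma> e) + real (card J)"
    and "\<And>e. e \<in> t \<Longrightarrow> 1 \<le> card (tree_path E e)"
  using red unfolding reduces_to_def by (elim conjE; simp)+

lemma red_proper: "proper n E"
  using reduces_toD(2) proper_grown by blast

lemma red_finite_J: "finite J"
  using reduces_toD(3) by (meson finite_greaterThanAtMost finite_subset)

lemma red_fresh: "Leaf (Suc n) \<notin> Field t \<union> labelled J" "Branch (Suc n) \<notin> Field t \<union> labelled J" "Suc n \<notin> J"
proof -
  show J: "Suc n \<notin> J" using reduces_toD(3) by auto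
  then show "Leaf (Suc n) \<notin> Field t \<union> labelled J" "Branch (Suc n) \<notin> Field t \<union> labelled J"
    using reduces_toD(4) fresh[OF red_proper] unfolding labelled_def by auto
qed

lemma path_insert_leaf:
  assumes s: "s \<in> sites E" and e: "e \<in> t"
  shows "tree_path (insert_leaf (Suc n) E s) e = subdivide (Suc n) s (tree_path E e)"
proof -
  have "Field t \<subseteq> Field E" by (rule reduces_toD(4))
  then have "fst e \<in> Field E" "snd e \<in> Field E"
    using edge_in_Field[OF e] by auto
  then have ne: "fst e \<noteq> Leaf (Suc n)" "fst e \<noteq> Branch (Suc n)" "snd e \<noteq> Leaf (Suc n)" "snd e \<noteq> Branch (Suc n)"
    using fresh[OF red_proper] by auto
  have "(fst e, snd e) \<in> E\<^sup>*" using e reduces_toD(5) by auto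
  then have sub: "anc E (fst e) \<subseteq> anc E (snd e)" by (rule anc_mono[OF red_proper])
  have "anc E (snd e) \<subseteq> E" by (auto simp: anc_def)
  then have "Branch (Suc n) \<notin> Field (anc E (snd e))"
    using fresh(2)[OF red_proper] mono_Field by blast
  then show ?thesis
    unfolding tree_path_def using anc_insert_leaf[OF red_proper s] ne sub by (simp add: subdivide_Diff)
qed

lemma fresh_path: "Branch (Suc n) \<notin> Field (tree_path E e)"
  using fresh(2)[OF red_proper] mono_Field[OF tree_path_subset] by blast

lemma card_path_insert_leaf:
  assumes s: "s \<in> sites E" and e: "e \<in> t"
  shows "card (tree_path (insert_leaf (Suc n) E s) e) = card (tree_path E e) + (if s \<in> Edge_Site ` tree_path E e then 1 else 0)"
  using path_insert_leaf[OF assms] subdivide_weight(2)[OF finite_tree_path[OF red_proper] fresh_path, of s e] by simp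

lemma graph_dist_path: "e \<in> t \<Longrightarrow> graph_dist E (fst e) (snd e) = card (tree_path E e)"
  unfolding tree_path_def by (rule graph_dist_anc[OF red_proper]) (use reduces_toD(5) in auto)

lemma path_region: "e \<in> t \<Longrightarrow> Edge_Site ` tree_path E e \<subseteq> edge_region t J E"
  using reduces_toD(7)[of e] tree_path_subset[of E e] unfolding edge_region_def region_def by auto

lemma edge_region_sites: "edge_region t J E \<subseteq> sites E"
  unfolding edge_region_def region_def sites_def by auto

text \<open>The label of the new leaf joins \<open>J\<close> exactly when the site lies in the
  region. A site on one of the paths always does, so the fresh branch point on a path is covered by
  the enlarged set of labels.\<close>

lemma reduces_to_insert_leaf:
  assumes s: "s \<in> sites E" and J': "J' = (if s \<in> edge_region t J E then insert (Suc n) J else J)"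
  shows "reduces_to k t (Suc n) (insert_leaf (Suc n) E s) J'"
proof -
  let ?E = "insert_leaf (Suc n) E s" and ?b = "Branch (Suc n)" and ?l = "Leaf (Suc n)"
  note pr = red_proper
  note R = reduces_toD
  have g: "grown n E" "k \<le> n" by (rule R)+
  have 1: "k \<le> Suc n" "grown (Suc n) ?E" "J' \<subseteq> {k<..Suc n}"
  proof -
    have "J \<subseteq> {k<..n}" by (rule R)
    then show "J' \<subseteq> {k<..Suc n}" using g(2) unfolding J' by (auto dest!: subsetD)
  qed (use g grown.step[OF g(1) s] in simp_all)
  have 2: "Field t \<subseteq> Field ?E" using R(4) Field_insert_leaf(1)[OF pr s] by (rule order_trans)
  have 3: "t \<subseteq> ?E\<^sup>*"
  proof
    fix e assume e: "e \<in> t"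
    then have "fst e \<in> Field E" "snd e \<in> Field E"
      using R(4) edge_in_Field[OF e] by blast+
    then have ne: "fst e \<noteq> ?l" "fst e \<noteq> ?b" "snd e \<noteq> ?l" "snd e \<noteq> ?b"
      using fresh[OF pr] by auto
    have "(fst e, snd e) \<in> E\<^sup>*" using e R(5) by auto
    then have "(fst e, snd e) \<in> ?E\<^sup>*" using rtrancl_insert_leaf[OF pr s] ne by blast
    then show "e \<in> ?E\<^sup>*" by simp
  qed
  \<comment> \<open>The spanned tree is a union of ancestor sets, and a split edge is split
    simultaneously in all of them that contain it.\<close>
  have sp: "spanned k ?E = subdivide (Suc n) s (spanned k E)"
  proof -
    have "spanned k ?E = (\<Union>i\<in>{1..k}. subdivide (Suc n) s (anc E (Leaf i)))"
      unfolding spanned_anc using anc_insert_leaf[OF pr s] g(2) by (intro SUP_cong refl) auto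
    also have "\<dots> = subdivide (Suc n) s (\<Union>i\<in>{1..k}. anc E (Leaf i))"
    proof (cases s)
      case (Edge_Site e)
      have "e \<in> E" using s Edge_Site by (auto simp: sites_def)
      then show ?thesis using Edge_Site by (auto split: if_splits)
    qed auto
    finally show ?thesis unfolding spanned_anc .
  qed
  have spE: "spanned k E \<subseteq> E" by (auto simp: spanned_def)
  have 4: "remove_degree_2 (spanned k ?E) = t"
  proof (cases "s \<in> Edge_Site ` spanned k E")
    case True
    then obtain a c where ac: "s = Edge_Site (a, c)" "(a, c) \<in> spanned k E" by auto
    have "?b \<notin> Field (spanned k E)" using fresh(2)[OF pr] mono_Field[OF spE] by auto
    moreover have "a \<noteq> c" using proper_edge_neq[OF pr, of a c] ac spE by auto
    moreover have "finite (spanned k E)" using spE proper_finite(1)[OF pr] finite_subset by blast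
    ultimately show ?thesis
      using remove_degree_2_subdivide[of "spanned k E" a c ?b] ac R(6) sp by simp
  next
    case False
    then have "subdivide (Suc n) s (spanned k E) = spanned k E" by (cases s) auto
    then show ?thesis using R(6) sp by simp
  qed
  have 5: "snd ` tree_path ?E e \<subseteq> Field t \<union> labelled J'" if e: "e \<in> t" for e
  proof (cases "s \<in> Edge_Site ` tree_path E e")
    case True
    then have J2: "J' = insert (Suc n) J" using path_region[OF e] J' by auto
    from True obtain f where f: "s = Edge_Site f" "f \<in> tree_path E e" by auto
    then have "snd ` tree_path ?E e \<subseteq> insert ?b (snd ` tree_path E e)"
      unfolding path_insert_leaf[OF s e] by auto
    moreover have "snd ` tree_path E e \<subseteq> Field t \<union> labelled J" by (rule R(7)[OF e])
    ultimately show ?thesis unfolding J2 labelled_def by auto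
  next
    case False
    then have "subdivide (Suc n) s (tree_path E e) = tree_path E e" by (cases s) auto
    moreover have "snd ` tree_path E e \<subseteq> Field t \<union> labelled J" by (rule R(7)[OF e])
    moreover have "labelled J \<subseteq> labelled J'" unfolding J' labelled_def by auto
    ultimately show ?thesis using path_insert_leaf[OF s e] by auto
  qed
  have 6: "tree_path ?E e \<inter> tree_path ?E f = {}" if "e \<in> t" "f \<in> t" "e \<noteq> f" for e f
    unfolding path_insert_leaf[OF s that(1)] path_insert_leaf[OF s that(2)]
    by (rule subdivide_disjoint[OF fresh_path fresh_path R(8)[OF that]])
  have 7: "(\<Sum>f\<in>tree_path ?E e. edge_weight \<alpha> \<gamma> f) =
        \<gamma> * (real (card (tree_path ?E e)) - 1) + edge_weight \<alpha> \<gamma> e" if e: "e \<in> t" for e \<alpha> \<gamma>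
  proof -
    have "(\<Sum>f\<in>tree_path E e. edge_weight \<alpha> \<gamma> f) =
        \<gamma> * (real (card (tree_path E e)) - 1) + edge_weight \<alpha> \<gamma> e" by (rule R(9)[OF e])
    then show ?thesis
      unfolding path_insert_leaf[OF s e] subdivide_weight[OF finite_tree_path[OF pr] fresh_path]
      by (auto simp: algebra_simps)
  qed
  have 8: "(\<Sum>s\<in>edge_region t J' ?E. site_weight \<alpha> \<gamma> ?E s) = (\<Sum>e\<in>t. edge_weight \<alpha> \<gamma> e) + real (card J')" for \<alpha> \<gamma>
  proof -
    have F: "v \<noteq> ?l" "v \<noteq> ?b" if "v \<in> Field E" for v using that fresh[OF pr] by auto
    have "region_weight \<alpha> \<gamma> (labelled J') (Field t \<union> labelled J') ?E =
        region_weight \<alpha> \<gamma> (labelled J) (Field t \<union> labelled J) E + (if s \<in> edge_region t J E then 1 else 0)"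
      unfolding edge_region_def
    proof (rule region_weight_insert_leaf[OF pr s])
      fix v assume "v \<in> Field E"
      note F[OF this]
      then show v: "v \<in> labelled J' \<longleftrightarrow> v \<in> labelled J" unfolding J' labelled_def by auto
      then show "v \<in> Field t \<union> labelled J' \<longleftrightarrow> v \<in> Field t \<union> labelled J" by auto
    next
      assume "s \<in> region (labelled J) (Field t \<union> labelled J) E"
      then show "{?l, ?b} \<subseteq> labelled J' \<inter> (Field t \<union> labelled J')"
        unfolding J' edge_region_def labelled_def by auto
    next
      assume "s \<notin> region (labelled J) (Field t \<union> labelled J) E"
      then have "J' = J" unfolding J' edge_region_def by simp
      then show "{?l, ?b} \<inter> (labelled J' \<union> (Field t \<union> labelled J')) = {}"
        using red_fresh by auto
    qed
    moreover have "(\<Sum>s\<in>edge_region t J E. site_weight \<alpha> \<gamma> E s) = (\<Sum>e\<in>t. edge_weight \<alpha> \<gamma> e) + real (card J)"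
      by (rule R(10))
    ultimately show ?thesis
      unfolding edge_region_def sum_region[OF proper_finite(1)[OF pr]]
        sum_region[OF proper_finite(1)[OF proper_insert_leaf[OF pr s grown_pos[OF g(1)]]]]
      using red_finite_J red_fresh(3) by (simp add: J' edge_region_def)
  qed
  have 9: "1 \<le> card (tree_path ?E e)" if "e \<in> t" for e
    using R(11)[OF that] card_path_insert_leaf[OF s that] by simp
  show ?thesis
    unfolding reduces_to_def by (intro conjI ballI allI impI; (rule 1 2 3 4 5 6 7 8 9; assumption)?)
qed

end

section \<open>Almost sure convergence\<close>

text \<open>The quotient of two Gamma series at \<open>x\<close> and \<open>x + r\<close> is the
  ratio of rising factorials with \<open>n + 1\<close> factors times \<open>n powr (-r)\<close>
  inverted appropriately; the last pair of factors tends to ratio one. The delay by \<open>k\<close>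
  is harmless because \<open>(n - k) / n\<close> tends to one.\<close>

lemma pochhammer_ratio_asymp:
  fixes x r :: real
  assumes x: "x > 0" and r: "r \<ge> 0"
  shows "(\<lambda>n. pochhammer (x + r) (n - k) / pochhammer x (n - k) / real n powr r) \<longlonglongrightarrow> Gamma x / Gamma (x + r)"
proof -
  have p: "pochhammer x n > 0" "pochhammer (x + r) n > 0" for n
    using x r by (auto intro!: pochhammer_pos)
  have "(\<lambda>n. Gamma_series x n / Gamma_series (x + r) n) \<longlonglongrightarrow> Gamma x / Gamma (x + r)"
    using x r by (intro tendsto_divide Gamma_series_LIMSEQ) (auto simp: Gamma_eq_zero_iff dest: nonpos_Ints_nonpos)
  moreover have "(\<lambda>n. (x + real n) / (x + r + real n)) \<longlonglongrightarrow> 1" by real_asymp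
  ultimately have "(\<lambda>n. Gamma_series x n / Gamma_series (x + r) n * ((x + real n) / (x + r + real n))) \<longlonglongrightarrow> Gamma x / Gamma (x + r) * 1"
    by (rule tendsto_mult)
  moreover have "eventually (\<lambda>n. Gamma_series x n / Gamma_series (x + r) n * ((x + real n) / (x + r + real n)) =
      pochhammer (x + r) n / pochhammer x n / real n powr r) sequentially"
    using eventually_gt_at_top[of 0]
  proof eventually_elim
    case (elim n)
    have "exp ((x + r) * ln (real n)) = exp (x * ln (real n)) * real n powr r"
      using elim by (simp add: powr_def algebra_simps exp_add)
    then have 1: "Gamma_series (x + r) n = fact n * (exp (x * ln (real n)) * real n powr r) / (pochhammer (x + r) n * (x + r + real n))"
      "Gamma_series x n = fact n * exp (x * ln (real n)) / (pochhammer x n * (x + real n))"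
      by (simp_all add: Gamma_series_def pochhammer_Suc)
    have "F * X / (P1 * u) / (F * (X * N) / (P2 * v)) * (u / v) = P2 / P1 / N"
      if "F > 0" "X > 0" "N > 0" "P1 > 0" "P2 > 0" "u > 0" "v > 0" for F X N P1 P2 u v :: real
      using that by (simp add: field_simps)
    from this[of "fact n" "exp (x * ln (real n))" "real n powr r"] show ?case
      unfolding 1 using p[of n] x r elim by simp
  qed
  ultimately have "(\<lambda>n. pochhammer (x + r) n / pochhammer x n / real n powr r) \<longlonglongrightarrow> Gamma x / Gamma (x + r)"
    by (simp add: tendsto_cong)
  then have "(\<lambda>n. pochhammer (x + r) (n - k) / pochhammer x (n - k) / real (n - k) powr r) \<longlonglongrightarrow> Gamma x / Gamma (x + r)"
    by (rule filterlim_compose) (rule filterlim_minus_const_nat_at_top)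
  moreover have "(\<lambda>n. (real (n - k) / real n) powr r) \<longlonglongrightarrow> 1"
  proof -
    have "(\<lambda>n. (real n - real k) / real n) \<longlonglongrightarrow> 1" by real_asymp
    moreover have "eventually (\<lambda>n. (real n - real k) / real n = real (n - k) / real n) sequentially"
      using eventually_ge_at_top[of k] by eventually_elim (simp add: of_nat_diff)
    ultimately have "(\<lambda>n. real (n - k) / real n) \<longlonglongrightarrow> 1" by (rule Lim_transform_eventually)
    then have "(\<lambda>n. (real (n - k) / real n) powr r) \<longlonglongrightarrow> 1 powr r"
      by (intro tendsto_powr tendsto_const) auto
    then show ?thesis by simp
  qed
  ultimately have "(\<lambda>n. pochhammer (x + r) (n - k) / pochhammer x (n - k) / real (n - k) powr r * (real (n - k) / real n) powr r)
      \<longlonglongrightarrow> Gamma x / Gamma (x + r) * 1" by (rule tendsto_mult)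
  moreover have "eventually (\<lambda>n. pochhammer (x + r) (n - k) / pochhammer x (n - k) / real (n - k) powr r * (real (n - k) / real n) powr r =
      pochhammer (x + r) (n - k) / pochhammer x (n - k) / real n powr r) sequentially"
    using eventually_gt_at_top[of k] by eventually_elim (simp add: powr_divide)
  ultimately show ?thesis by (simp add: tendsto_cong)
qed

text \<open>Each of the \<open>p\<close> factors is \<open>x n\<close> plus a constant, and
  constants vanish against \<open>n powr \<kappa>\<close>.\<close>

lemma pochhammer_powr_asymp:
  fixes x :: "nat \<Rightarrow> real"
  assumes lim: "(\<lambda>n. x n / real n powr \<kappa>) \<longlonglongrightarrow> L" and \<kappa>: "\<kappa> > 0"
  shows "(\<lambda>n. pochhammer (x n) p / real n powr (\<kappa> * real p)) \<longlonglongrightarrow> L ^ p"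
proof (induction p)
  case 0
  have "eventually (\<lambda>n. 1 = real n powr (\<kappa> * real 0)) sequentially"
    using eventually_gt_at_top[of 0] by eventually_elim simp
  then show ?case
    by (intro tendsto_eventually) (auto elim: eventually_mono)
next
  case (Suc p)
  have "(\<lambda>n. real p / real n powr \<kappa>) \<longlonglongrightarrow> 0" using \<kappa> by real_asymp
  then have "(\<lambda>n. x n / real n powr \<kappa> + real p / real n powr \<kappa>) \<longlonglongrightarrow> L + 0"
    by (intro tendsto_add lim)
  from tendsto_mult[OF Suc this]
  have "(\<lambda>n. pochhammer (x n) p / real n powr (\<kappa> * real p) * (x n / real n powr \<kappa> + real p / real n powr \<kappa>)) \<longlonglongrightarrow> L ^ Suc p"
    by (simp add: mult.commute)
  then show ?case
    by (simp add: pochhammer_Suc add_divide_distrib[symmetric] distrib_left powr_add algebra_simps)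
qed

text \<open>Consecutive points of the sequence of \<open>c\<close>-th powers have ratio tending to
  one. Between two of them the monotone \<open>x\<close> lies between its values at the ends, and
  replacing the normalisation by that of the other end costs a factor tending to one.\<close>

lemma powr_subseq_interpolation:
  fixes x :: "nat \<Rightarrow> real" and c k :: nat
  assumes c: "c \<ge> 1" and \<kappa>: "\<kappa> > 0"
    and mono: "\<And>m n. k \<le> m \<Longrightarrow> m \<le> n \<Longrightarrow> x m \<le> x n" and nonneg: "\<And>n. k \<le> n \<Longrightarrow> 0 \<le> x n"
    and lim: "(\<lambda>j. x (Suc j ^ c) / real (Suc j ^ c) powr \<kappa>) \<longlonglongrightarrow> L"
  shows "(\<lambda>n. x n / real n powr \<kappa>) \<longlonglongrightarrow> L"
proof -
  define r where "r n = (GREATEST j. Suc j ^ c \<le> n)" for n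
  have self: "j \<le> Suc j ^ c" for j
    using c self_le_power[of "Suc j" c] by linarith
  have r: "Suc (r n) ^ c \<le> n" "n < Suc (Suc (r n)) ^ c" if "n \<ge> 1" for n
  proof -
    have b: "\<And>y. Suc y ^ c \<le> n \<Longrightarrow> y \<le> n" using self order_trans by blast
    show "Suc (r n) ^ c \<le> n" unfolding r_def
      by (rule GreatestI_nat[of _ 0 n]) (use that b in auto)
    show "n < Suc (Suc (r n)) ^ c"
    proof (rule ccontr)
      assume "\<not> ?thesis"
      then have "Suc (r n) \<le> r n" unfolding r_def
        by (intro Greatest_le_nat[of _ _ n]) (use b in \<open>auto simp: r_def\<close>)
      then show False by simp
    qed
  qed
  have rlim: "filterlim r at_top sequentially"
    unfolding filterlim_at_top
  proof
    fix Z :: nat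
    show "eventually (\<lambda>n. Z \<le> r n) sequentially"
      using eventually_ge_at_top[of "Suc Z ^ c"]
    proof eventually_elim
      case (elim n)
      show ?case unfolding r_def
      proof (rule Greatest_le_nat[of _ _ n])
        show "y \<le> n" if "Suc y ^ c \<le> n" for y using self[of y] that by simp
      qed (rule elim)
    qed
  qed
  define N where "N j = real (Suc j ^ c)" for j
  have Npos: "N j > 0" for j by (simp add: N_def)
  have ratio: "(\<lambda>j. (N j / N (Suc j)) powr \<kappa>) \<longlonglongrightarrow> 1"
  proof -
    have "(\<lambda>j. (real (Suc j) / real (Suc (Suc j))) ^ c) \<longlonglongrightarrow> 1 ^ c"
      by (intro tendsto_power) real_asymp
    then have "(\<lambda>j. (N j / N (Suc j)) powr \<kappa>) \<longlonglongrightarrow> 1 powr \<kappa>"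
      by (intro tendsto_powr tendsto_const) (auto simp: N_def power_divide)
    then show ?thesis by simp
  qed
  have lim': "(\<lambda>j. x (Suc j ^ c) / N j powr \<kappa>) \<longlonglongrightarrow> L" using lim by (simp add: N_def)
  have g1: "(\<lambda>j. x (Suc j ^ c) / N (Suc j) powr \<kappa>) \<longlonglongrightarrow> L"
  proof -
    have "(\<lambda>j. x (Suc j ^ c) / N j powr \<kappa> * (N j / N (Suc j)) powr \<kappa>) \<longlonglongrightarrow> L * 1"
      by (intro tendsto_mult lim' ratio)
    moreover have "x (Suc j ^ c) / N j powr \<kappa> * (N j / N (Suc j)) powr \<kappa> = x (Suc j ^ c) / N (Suc j) powr \<kappa>" for j
      using Npos[of j] Npos[of "Suc j"] by (simp add: powr_divide)
    ultimately show ?thesis by simp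
  qed
  have g2: "(\<lambda>j. x (Suc (Suc j) ^ c) / N j powr \<kappa>) \<longlonglongrightarrow> L"
  proof -
    have "(\<lambda>j. x (Suc (Suc j) ^ c) / N (Suc j) powr \<kappa> / (N j / N (Suc j)) powr \<kappa>) \<longlonglongrightarrow> L / 1"
      by (intro tendsto_divide LIMSEQ_Suc[OF lim'] ratio) auto
    moreover have "x (Suc (Suc j) ^ c) / N (Suc j) powr \<kappa> / (N j / N (Suc j)) powr \<kappa> = x (Suc (Suc j) ^ c) / N j powr \<kappa>" for j
      using Npos[of j] Npos[of "Suc j"] by (simp add: powr_divide)
    ultimately show ?thesis by (simp only: div_by_1)
  qed
  have ev: "eventually (\<lambda>n. n \<ge> 1 \<and> r n \<ge> k) sequentially"
    using rlim eventually_ge_at_top[of "1::nat"] unfolding filterlim_at_top by (auto intro: eventually_conj)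
  show ?thesis
  proof (rule tendsto_sandwich)
    show "(\<lambda>n. x (Suc (r n) ^ c) / N (Suc (r n)) powr \<kappa>) \<longlonglongrightarrow> L"
      by (rule filterlim_compose[OF g1 rlim])
    show "(\<lambda>n. x (Suc (Suc (r n)) ^ c) / N (r n) powr \<kappa>) \<longlonglongrightarrow> L"
      by (rule filterlim_compose[OF g2 rlim])
    show "eventually (\<lambda>n. x (Suc (r n) ^ c) / N (Suc (r n)) powr \<kappa> \<le> x n / real n powr \<kappa>) sequentially"
      using ev
    proof eventually_elim
      case (elim n)
      have rn: "Suc (r n) ^ c \<le> n" "n < Suc (Suc (r n)) ^ c" using r elim by auto
      have k: "k \<le> Suc (r n) ^ c" using self[of "r n"] elim by simp
      have "real n powr \<kappa> \<le> N (Suc (r n)) powr \<kappa>"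
        unfolding N_def using rn \<kappa> by (intro powr_mono2) (auto simp flip: of_nat_power)
      then show ?case
        using mono[OF k rn(1)] nonneg[OF k] elim by (intro frac_le) auto
    qed
    show "eventually (\<lambda>n. x n / real n powr \<kappa> \<le> x (Suc (Suc (r n)) ^ c) / N (r n) powr \<kappa>) sequentially"
      using ev
    proof eventually_elim
      case (elim n)
      have rn: "Suc (r n) ^ c \<le> n" "n < Suc (Suc (r n)) ^ c" using r elim by auto
      have k: "k \<le> n" using self[of "r n"] elim rn by linarith
      have "N (r n) powr \<kappa> \<le> real n powr \<kappa>"
        unfolding N_def using rn \<kappa> by (intro powr_mono2) (auto simp flip: of_nat_power)
      moreover have "x n \<le> x (Suc (Suc (r n)) ^ c)" using mono k rn(2) by simp
      ultimately show ?case
        using nonneg[of "Suc (Suc (r n)) ^ c"] k rn(2) Npos[of "r n"] by (intro frac_le) auto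
    qed
  qed
qed

text \<open>Summable \<open>L\<^sup>1\<close> increments force almost sure convergence.\<close>

lemma (in finite_measure) AE_convergent_summable_increments:
  fixes f :: "nat \<Rightarrow> 'a \<Rightarrow> real"
  assumes int: "\<And>j. integrable M (f j)"
    and b: "\<And>j. (\<integral>x. \<bar>f (Suc j) x - f j x\<bar> \<partial>M) \<le> b j" and sm: "summable b"
  shows "AE x in M. convergent (\<lambda>j. f j x)"
proof -
  have m[measurable]: "f j \<in> borel_measurable M" for j using int by (rule borel_measurable_integrable)
  have b0: "0 \<le> b j" for j using b[of j] by (rule order_trans[rotated]) simp
  have "(\<integral>\<^sup>+ x. (\<Sum>j. ennreal \<bar>f (Suc j) x - f j x\<bar>) \<partial>M) = (\<Sum>j. \<integral>\<^sup>+ x. ennreal \<bar>f (Suc j) x - f j x\<bar> \<partial>M)"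
    by (rule nn_integral_suminf) simp
  also have "\<dots> = (\<Sum>j. ennreal (\<integral>x. \<bar>f (Suc j) x - f j x\<bar> \<partial>M))"
    using int by (intro suminf_cong nn_integral_eq_integral) auto
  also have "\<dots> \<le> (\<Sum>j. ennreal (b j))"
    by (intro suminf_le summableI ennreal_leI b)
  also have "\<dots> = ennreal (suminf b)" by (rule suminf_ennreal2[OF b0 sm])
  also have "\<dots> < \<infinity>" by simp
  finally have "(\<integral>\<^sup>+ x. (\<Sum>j. ennreal \<bar>f (Suc j) x - f j x\<bar>) \<partial>M) \<noteq> \<infinity>" by simp
  then have "AE x in M. (\<Sum>j. ennreal \<bar>f (Suc j) x - f j x\<bar>) \<noteq> \<infinity>"
    by (intro nn_integral_PInf_AE) auto
  then show ?thesis
  proof eventually_elim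
    case (elim x)
    then have "summable (\<lambda>j. \<bar>f (Suc j) x - f j x\<bar>)"
      by (intro summable_suminf_not_top) auto
    then have "summable (\<lambda>j. f (Suc j) x - f j x)" by (rule summable_rabs_cancel)
    then have "convergent (\<lambda>n. \<Sum>j<n. f (Suc j) x - f j x)" by (simp add: summable_iff_convergent)
    then have "convergent (\<lambda>n. f n x - f 0 x)" by (simp only: sum_lessThan_telescope[of "\<lambda>j. f j x"])
    from convergent_add[OF this convergent_const[of "f 0 x"]] show ?case by simp
  qed
qed

text \<open>Pass to the limit in expectations of an \<open>L\<^sup>2\<close>-bounded sequence by truncation.\<close>

lemma (in prob_space) expectation_tendsto_L2:
  fixes f :: "nat \<Rightarrow> 'a \<Rightarrow> real"
  assumes int: "\<And>n. integrable M (f n)" and int2: "\<And>n. integrable M (\<lambda>x. (f n x)\<^sup>2)"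
    and nn: "\<And>n. AE x in M. 0 \<le> f n x" and m[measurable]: "h \<in> borel_measurable M"
    and lim: "AE x in M. (\<lambda>n. f n x) \<longlonglongrightarrow> h x"
    and B: "\<And>n. expectation (\<lambda>x. (f n x)\<^sup>2) \<le> B"
    and E: "(\<lambda>n. expectation (f n)) \<longlonglongrightarrow> e"
  shows "(\<integral>\<^sup>+ x. ennreal (h x) \<partial>M) = ennreal e"
proof -
  have mf[measurable]: "f n \<in> borel_measurable M" for n using int by (rule borel_measurable_integrable)
  have hn: "AE x in M. 0 \<le> h x"
  proof -
    have "AE x in M. \<forall>n. 0 \<le> f n x" using nn by (simp add: AE_all_countable)
    with lim show ?thesis by eventually_elim (auto intro: LIMSEQ_le_const)
  qed
  have e0: "0 \<le> e" using E by (rule LIMSEQ_le_const) (auto intro: integral_nonneg_AE nn)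
  have B0: "0 \<le> B" using B[of 0] by (rule order_trans[rotated]) simp
  have trunc: "(\<lambda>n. expectation (\<lambda>x. min (f n x) c)) \<longlonglongrightarrow> expectation (\<lambda>x. min (h x) c)" if c: "c > 0" for c
  proof (rule integral_dominated_convergence[where w = "\<lambda>_. c"])
    show "AE x in M. (\<lambda>n. min (f n x) c) \<longlonglongrightarrow> min (h x) c"
      using lim by eventually_elim (intro tendsto_min tendsto_const)
    show "AE x in M. norm (min (f n x) c) \<le> c" for n
      using nn[of n] by eventually_elim (use c in auto)
  qed auto
  \<comment> \<open>Where \<open>f\<close> exceeds \<open>c\<close> it is at most its square divided
    by \<open>c\<close>. The truncation error is thus uniform in \<open>n\<close>, so the limits in
    \<open>n\<close> and in \<open>c\<close> can be taken one after the other.\<close>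
  have close: "\<bar>expectation (f n) - expectation (\<lambda>x. min (f n x) c)\<bar> \<le> B / c" if c: "c > 0" for n c
  proof -
    have im: "integrable M (\<lambda>x. min (f n x) c)" using int by auto
    have "expectation (f n) - expectation (\<lambda>x. min (f n x) c) = expectation (\<lambda>x. f n x - min (f n x) c)"
      using int im by simp
    moreover have "\<dots> \<le> expectation (\<lambda>x. (f n x)\<^sup>2 / c)"
    proof (rule integral_mono)
      fix x
      show "f n x - min (f n x) c \<le> (f n x)\<^sup>2 / c"
      proof (cases "f n x \<le> c")
        case False
        then have "c * f n x \<le> f n x * f n x" using c by (intro mult_right_mono) auto
        then have "f n x \<le> (f n x)\<^sup>2 / c" using c by (simp add: field_simps power2_eq_square)
        then show ?thesis using False c by auto
      qed (use c in auto)
    qed (use int im int2 in auto)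
    moreover have "expectation (\<lambda>x. (f n x)\<^sup>2 / c) \<le> B / c" using B c by (simp add: divide_right_mono)
    moreover have "0 \<le> expectation (\<lambda>x. f n x - min (f n x) c)" by (rule integral_nonneg_AE) auto
    ultimately show ?thesis by simp
  qed
  have close': "\<bar>e - expectation (\<lambda>x. min (h x) c)\<bar> \<le> B / c" if c: "c > 0" for c
  proof (rule LIMSEQ_le_const2)
    show "(\<lambda>n. \<bar>expectation (f n) - expectation (\<lambda>x. min (f n x) c)\<bar>) \<longlonglongrightarrow> \<bar>e - expectation (\<lambda>x. min (h x) c)\<bar>"
      by (intro tendsto_rabs tendsto_diff E trunc c)
  qed (use close[OF c] in auto)
  have "(\<lambda>j. B / real (Suc j)) \<longlonglongrightarrow> 0" by real_asymp
  then have "(\<lambda>j. e - expectation (\<lambda>x. min (h x) (real (Suc j)))) \<longlonglongrightarrow> 0"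
    by (rule Lim_null_comparison[rotated]) (use close' in auto)
  then have "(\<lambda>j. e - (e - expectation (\<lambda>x. min (h x) (real (Suc j))))) \<longlonglongrightarrow> e - 0"
    by (intro tendsto_diff tendsto_const)
  then have l1: "(\<lambda>j. ennreal (expectation (\<lambda>x. min (h x) (real (Suc j))))) \<longlonglongrightarrow> ennreal e"
    by (intro tendsto_ennrealI) simp
  have eq: "ennreal (expectation (\<lambda>x. min (h x) (real (Suc j)))) = (\<integral>\<^sup>+ x. ennreal (min (h x) (real (Suc j))) \<partial>M)" for j
  proof (rule nn_integral_eq_integral[symmetric])
    show "integrable M (\<lambda>x. min (h x) (real (Suc j)))"
      by (rule integrable_const_bound[where B = "real (Suc j)"]) (use hn in \<open>auto elim!: eventually_mono\<close>)
    show "AE x in M. 0 \<le> min (h x) (real (Suc j))" using hn by eventually_elim simp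
  qed
  have "(\<lambda>j. \<integral>\<^sup>+ x. ennreal (min (h x) (real (Suc j))) \<partial>M) \<longlonglongrightarrow> (\<integral>\<^sup>+ x. ennreal (h x) \<partial>M)"
  proof (rule nn_integral_LIMSEQ)
    show "incseq (\<lambda>j x. ennreal (min (h x) (real (Suc j))))"
      by (intro incseq_SucI le_funI ennreal_leI min.mono) auto
    show "(\<lambda>j. ennreal (min (h x) (real (Suc j)))) \<longlonglongrightarrow> ennreal (h x)" for x
    proof (rule tendsto_eventually)
      obtain N where "h x \<le> real N" using real_arch_simple by blast
      then have hN: "min (h x) (real (Suc j)) = h x" if "j \<ge> N" for j using that by auto
      show "eventually (\<lambda>j. ennreal (min (h x) (real (Suc j))) = ennreal (h x)) sequentially"
        using eventually_ge_at_top[of N] by eventually_elim (simp only: hN)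
    qed
  qed simp
  then show ?thesis using l1 unfolding eq by (rule LIMSEQ_unique)
qed

section \<open>Distributions determined by their moments\<close>

lemma exp_eq_suminf_ennreal:
  fixes y :: real
  assumes "0 \<le> y"
  shows "ennreal (exp y) = (\<Sum>n. ennreal (y ^ n / fact n))"
proof -
  have "(\<lambda>n. y ^ n / fact n) sums exp y"
    using exp_converges[of y] by (simp add: field_simps)
  then have e: "(\<Sum>n. y ^ n / fact n) = exp y" and sm: "summable (\<lambda>n. y ^ n / fact n)"
    by (auto simp: sums_iff)
  have "(\<Sum>n. ennreal (y ^ n / fact n)) = ennreal (\<Sum>n. y ^ n / fact n)"
    by (rule suminf_ennreal2[OF _ sm]) (use assms in simp)
  then show ?thesis unfolding e by (rule sym)
qed

lemma power_le_fact_exp: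
  fixes y :: real
  assumes "0 \<le> y"
  shows "y ^ n \<le> fact n * exp y"
proof -
  have "(\<lambda>n. y ^ n / fact n) sums exp y"
    using exp_converges[of y] by (simp add: field_simps)
  then have e: "(\<Sum>n. y ^ n / fact n) = exp y" and sm: "summable (\<lambda>n. y ^ n / fact n)"
    by (auto simp: sums_iff)
  have "sum (\<lambda>n. y ^ n / fact n) {n} \<le> (\<Sum>n. y ^ n / fact n)"
    by (rule sum_le_suminf[OF sm]) (use assms in auto)
  then have "y ^ n / fact n \<le> exp y" unfolding e by simp
  then show ?thesis by (simp add: field_simps)
qed

text \<open>In extended nonnegative numbers sum and integral commute unconditionally. Exponential
  moments become functions of the ordinary moments, and their finiteness passes from one measure to
  any other nonnegative one with the same moments.\<close>

lemma nn_integral_exp_suminf: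
  fixes f :: "'a \<Rightarrow> real"
  assumes m[measurable]: "f \<in> borel_measurable M" and nn: "AE x in M. 0 \<le> f x" and t: "0 \<le> t"
  shows "(\<integral>\<^sup>+ x. ennreal (exp (t * f x)) \<partial>M) = (\<Sum>n. ennreal (t ^ n / fact n) * (\<integral>\<^sup>+ x. ennreal (f x ^ n) \<partial>M))"
proof -
  have "(\<integral>\<^sup>+ x. ennreal (exp (t * f x)) \<partial>M) = (\<integral>\<^sup>+ x. (\<Sum>n. ennreal (t ^ n / fact n) * ennreal (f x ^ n)) \<partial>M)"
  proof (rule nn_integral_cong_AE)
    show "AE x in M. ennreal (exp (t * f x)) = (\<Sum>n. ennreal (t ^ n / fact n) * ennreal (f x ^ n))"
      using nn
    proof eventually_elim
      case (elim x)
      have "ennreal (exp (t * f x)) = (\<Sum>n. ennreal ((t * f x) ^ n / fact n))"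
        by (rule exp_eq_suminf_ennreal) (use elim t in auto)
      also have "\<dots> = (\<Sum>n. ennreal (t ^ n / fact n) * ennreal (f x ^ n))"
        using elim t by (intro suminf_cong) (simp add: ennreal_mult[symmetric] power_mult_distrib)
      finally show ?case .
    qed
  qed
  also have "\<dots> = (\<Sum>n. \<integral>\<^sup>+ x. ennreal (t ^ n / fact n) * ennreal (f x ^ n) \<partial>M)"
    by (rule nn_integral_suminf) simp
  also have "\<dots> = (\<Sum>n. ennreal (t ^ n / fact n) * (\<integral>\<^sup>+ x. ennreal (f x ^ n) \<partial>M))"
    by (intro suminf_cong nn_integral_cmult) simp
  finally show ?thesis .
qed

text \<open>The Taylor remainder of order \<open>n\<close> is at most twice the \<open>n\<close>-th
  term of the moment series at \<open>\<bar>t\<bar>\<close>, and that series converges because the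
  exponential moment at \<open>\<bar>t\<bar>\<close> is finite.\<close>

lemma (in real_distribution) char_moment_expansion:
  assumes nn: "AE x in M. 0 \<le> x"
    and ex: "\<And>t. 0 \<le> t \<Longrightarrow> (\<integral>\<^sup>+ x. ennreal (exp (t * x)) \<partial>M) < \<infinity>"
  shows "(\<lambda>n. \<Sum>k\<le>n. ((\<i> * t) ^ k / fact k) * complex_of_real (enn2real (\<integral>\<^sup>+ x. ennreal (x ^ k) \<partial>M))) \<longlonglongrightarrow> char M t"
proof -
  have fin: "(\<integral>\<^sup>+ x. ennreal (x ^ n) \<partial>M) < \<infinity>" for n
  proof -
    have "(\<integral>\<^sup>+ x. ennreal (x ^ n) \<partial>M) \<le> (\<integral>\<^sup>+ x. ennreal (fact n) * ennreal (exp (1 * x)) \<partial>M)"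
    proof (rule nn_integral_mono_AE)
      show "AE x in M. ennreal (x ^ n) \<le> ennreal (fact n) * ennreal (exp (1 * x))"
        using nn by eventually_elim (simp add: ennreal_mult[symmetric] ennreal_leI power_le_fact_exp)
    qed
    also have "\<dots> = ennreal (fact n) * (\<integral>\<^sup>+ x. ennreal (exp (1 * x)) \<partial>M)"
      by (rule nn_integral_cmult) simp
    also have "\<dots> < \<infinity>" using ex[of 1] by (simp add: ennreal_mult_less_top)
    finally show ?thesis .
  qed
  have pn: "AE x in M. 0 \<le> x ^ n" for n using nn by eventually_elim simp
  have int: "integrable M (\<lambda>x. x ^ n)" for n
    by (rule integrableI_nonneg[OF _ pn fin]) simp
  have E: "expectation (\<lambda>x. x ^ n) = enn2real (\<integral>\<^sup>+ x. ennreal (x ^ n) \<partial>M)" for n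
    by (rule integral_eq_nn_integral[OF _ pn]) simp
  have Eabs: "expectation (\<lambda>x. \<bar>x\<bar> ^ n) = expectation (\<lambda>x. x ^ n)" for n
    by (rule integral_cong_AE) (use nn in \<open>auto elim!: eventually_mono\<close>)
  have E0: "0 \<le> expectation (\<lambda>x. x ^ n)" for n by (rule integral_nonneg_AE[OF pn])
  have sm: "summable (\<lambda>n. \<bar>t\<bar> ^ n / fact n * expectation (\<lambda>x. x ^ n))"
  proof (rule summable_suminf_not_top)
    show "0 \<le> \<bar>t\<bar> ^ n / fact n * expectation (\<lambda>x. x ^ n)" for n using E0 by simp
    have "ennreal (\<bar>t\<bar> ^ n / fact n * expectation (\<lambda>x. x ^ n)) = ennreal (\<bar>t\<bar> ^ n / fact n) * (\<integral>\<^sup>+ x. ennreal (x ^ n) \<partial>M)" for n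
      using fin[of n] E0[of n] unfolding E by (subst ennreal_mult) auto
    then have "(\<Sum>n. ennreal (\<bar>t\<bar> ^ n / fact n * expectation (\<lambda>x. x ^ n))) = (\<integral>\<^sup>+ x. ennreal (exp (\<bar>t\<bar> * x)) \<partial>M)"
      using nn_integral_exp_suminf[OF _ nn, of "\<bar>t\<bar>"] by simp
    also have "\<dots> \<noteq> top" using ex[of "\<bar>t\<bar>"] by simp
    finally show "(\<Sum>n. ennreal (\<bar>t\<bar> ^ n / fact n * expectation (\<lambda>x. x ^ n))) \<noteq> top" .
  qed
  have "(\<lambda>n. 2 * (\<bar>t\<bar> ^ n / fact n * expectation (\<lambda>x. x ^ n))) \<longlonglongrightarrow> 0"
    using tendsto_mult[OF tendsto_const[of 2] summable_LIMSEQ_zero[OF sm]] by simp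
  then have "(\<lambda>n. char M t - (\<Sum>k\<le>n. ((\<i> * t) ^ k / fact k) * expectation (\<lambda>x. x ^ k))) \<longlonglongrightarrow> 0"
  proof (rule Lim_null_comparison[rotated], intro always_eventually allI)
    fix n
    show "cmod (char M t - (\<Sum>k\<le>n. ((\<i> * t) ^ k / fact k) * expectation (\<lambda>x. x ^ k))) \<le>
        2 * (\<bar>t\<bar> ^ n / fact n * expectation (\<lambda>x. x ^ n))"
      using char_approx1[of n t, OF int] by (simp add: Eabs)
  qed
  then have "(\<lambda>n. char M t - (char M t - (\<Sum>k\<le>n. ((\<i> * t) ^ k / fact k) * expectation (\<lambda>x. x ^ k)))) \<longlonglongrightarrow> char M t - 0"
    by (intro tendsto_diff tendsto_const)
  then show ?thesis by (simp add: E)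
qed

text \<open>Exponential moments are assumed of one measure only; the other inherits them through its
  moments. Both characteristic functions are then limits of the same partial sums.\<close>

lemma real_distribution_eq_moments:
  assumes "real_distribution \<mu>" "real_distribution \<nu>"
    and nn: "AE x in \<mu>. 0 \<le> x" "AE x in \<nu>. 0 \<le> x"
    and mom: "\<And>n. (\<integral>\<^sup>+ x. ennreal (x ^ n) \<partial>\<mu>) = (\<integral>\<^sup>+ x. ennreal (x ^ n) \<partial>\<nu>)"
    and ex: "\<And>t. 0 \<le> t \<Longrightarrow> (\<integral>\<^sup>+ x. ennreal (exp (t * x)) \<partial>\<nu>) < \<infinity>"
  shows "\<mu> = \<nu>"
proof (rule Levy_uniqueness[OF assms(1,2)])
  interpret \<mu>: real_distribution \<mu> by fact
  interpret \<nu>: real_distribution \<nu> by fact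
  have ex': "(\<integral>\<^sup>+ x. ennreal (exp (t * x)) \<partial>\<mu>) < \<infinity>" if "0 \<le> t" for t
    using ex[OF that] nn_integral_exp_suminf[OF _ nn(1) that] nn_integral_exp_suminf[OF _ nn(2) that]
    by (simp add: mom)
  show "char \<mu> = char \<nu>"
  proof
    fix t
    show "char \<mu> t = char \<nu> t"
    proof (rule LIMSEQ_unique)
      show "(\<lambda>n. \<Sum>k\<le>n. ((\<i> * t) ^ k / fact k) * complex_of_real (enn2real (\<integral>\<^sup>+ x. ennreal (x ^ k) \<partial>\<nu>))) \<longlonglongrightarrow> char \<mu> t"
        using \<mu>.char_moment_expansion[OF nn(1) ex', where t = t] by (simp only: mom)
      show "(\<lambda>n. \<Sum>k\<le>n. ((\<i> * t) ^ k / fact k) * complex_of_real (enn2real (\<integral>\<^sup>+ x. ennreal (x ^ k) \<partial>\<nu>))) \<longlonglongrightarrow> char \<nu> t"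
        using \<nu>.char_moment_expansion[OF nn(2) ex, where t = t] .
    qed
  qed
qed

text \<open>The measures have the same total mass, their moment of order zero, and are normalised by
  it; mass zero is a separate case. This generality is what the passage to several coordinates calls
  for, where the measures carry weights.\<close>

lemma real_measure_eq_moments:
  fixes \<mu> \<nu> :: "real measure"
  assumes sets: "sets \<mu> = sets borel" "sets \<nu> = sets borel"
    and nn: "AE x in \<mu>. 0 \<le> x" "AE x in \<nu>. 0 \<le> x"
    and mom: "\<And>n. (\<integral>\<^sup>+ x. ennreal (x ^ n) \<partial>\<mu>) = (\<integral>\<^sup>+ x. ennreal (x ^ n) \<partial>\<nu>)"
    and ex: "\<And>t. 0 \<le> t \<Longrightarrow> (\<integral>\<^sup>+ x. ennreal (exp (t * x)) \<partial>\<nu>) < \<infinity>"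
  shows "\<mu> = \<nu>"
proof -
  define c where "c = emeasure \<nu> UNIV"
  have sp: "space \<mu> = UNIV" "space \<nu> = UNIV" using sets by (auto dest: sets_eq_imp_space_eq)
  have c: "emeasure \<mu> UNIV = c" using mom[of 0] sp unfolding c_def by simp
  have cfin: "c < \<infinity>" using ex[of 0] sp unfolding c_def by simp
  show ?thesis
  proof (cases "c = 0")
    case True
    show ?thesis
    proof (rule measure_eqI)
      fix A assume "A \<in> sets \<mu>"
      have "emeasure \<mu> A \<le> emeasure \<mu> UNIV" "emeasure \<nu> A \<le> emeasure \<nu> UNIV"
        using emeasure_space[of \<mu> A] emeasure_space[of \<nu> A] sp by auto
      then show "emeasure \<mu> A = emeasure \<nu> A" using c True unfolding c_def by simp
    qed (use sets in simp)
  next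
    case False
    define r where "r = 1 / c"
    have rc: "r * c = 1" using False cfin unfolding r_def by (simp add: ennreal_divide_times ennreal_divide_self less_top)
    have nnS: "(\<integral>\<^sup>+ x. f x \<partial>scale_measure r N) = r * (\<integral>\<^sup>+ x. f x \<partial>N)"
      if "f \<in> borel_measurable N" for f :: "real \<Rightarrow> ennreal" and N
      by (rule nn_integral_scale_measure[OF that])
    have rd: "real_distribution (scale_measure r N)" if "sets N = sets borel" "emeasure N UNIV = c" for N :: "real measure"
    proof -
      have "space N = UNIV" using that(1) by (auto dest: sets_eq_imp_space_eq)
      then show ?thesis
        using that rc by (intro real_distribution.intro prob_spaceI real_distribution_axioms.intro)
          (simp_all add: space_scale_measure)
    qed
    have "scale_measure r \<mu> = scale_measure r \<nu>"
    proof (rule real_distribution_eq_moments)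
      show "real_distribution (scale_measure r \<mu>)" by (rule rd[OF sets(1) c])
      show "real_distribution (scale_measure r \<nu>)" by (rule rd[OF sets(2)]) (simp add: c_def)
      have rf: "r < \<infinity>" using False unfolding r_def by (simp add: less_top[symmetric] ennreal_divide_eq_top_iff)
      have AE: "AE x in scale_measure r N. 0 \<le> x" if N0: "AE x in N. 0 \<le> x" for N :: "real measure"
      proof -
        show ?thesis using N0 unfolding eventually_ae_filter
          by (auto simp: null_sets_def space_scale_measure)
      qed
      show "AE x in scale_measure r \<mu>. 0 \<le> x" "AE x in scale_measure r \<nu>. 0 \<le> x" using AE nn by auto
      have m: "f \<in> borel_measurable \<mu>" "f \<in> borel_measurable \<nu>" if "f \<in> borel_measurable borel" for f :: "real \<Rightarrow> ennreal"
        using that sets by (simp_all cong: measurable_cong_sets)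
      show "(\<integral>\<^sup>+ x. ennreal (x ^ n) \<partial>scale_measure r \<mu>) = (\<integral>\<^sup>+ x. ennreal (x ^ n) \<partial>scale_measure r \<nu>)" for n
        by (subst (1 2) nnS) (auto intro!: m simp: mom)
      show "(\<integral>\<^sup>+ x. ennreal (exp (t * x)) \<partial>scale_measure r \<nu>) < \<infinity>" if "0 \<le> t" for t
      proof -
        have "(\<integral>\<^sup>+ x. ennreal (exp (t * x)) \<partial>scale_measure r \<nu>) = r * (\<integral>\<^sup>+ x. ennreal (exp (t * x)) \<partial>\<nu>)"
          by (rule nnS, rule m) simp
        then show ?thesis using ex[OF that] rf by (simp add: ennreal_mult_less_top)
      qed
    qed
    then have eq: "r * emeasure \<mu> A = r * emeasure \<nu> A" for A
      by (metis emeasure_scale_measure)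
    show ?thesis
    proof (rule measure_eqI)
      fix A assume "A \<in> sets \<mu>"
      have "c * (r * emeasure \<mu> A) = c * (r * emeasure \<nu> A)" using eq by simp
      then show "emeasure \<mu> A = emeasure \<nu> A" using rc by (simp add: mult.assoc[symmetric] mult.commute)
    qed (use sets in simp)
  qed
qed

lemma prod_power_le_exp:
  fixes x :: "'i \<Rightarrow> real"
  assumes "finite I" "J \<subseteq> I" "\<And>i. i \<in> I \<Longrightarrow> 0 \<le> x i"
  shows "(\<Prod>i\<in>J. x i ^ p i) \<le> (\<Prod>i\<in>J. fact (p i)) * exp (\<Sum>i\<in>I. x i)"
proof -
  have J: "finite J" using assms finite_subset by blast
  have "(\<Prod>i\<in>J. x i ^ p i) \<le> (\<Prod>i\<in>J. fact (p i) * exp (x i))"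
    using assms by (intro prod_mono) (auto intro: power_le_fact_exp)
  also have "\<dots> = (\<Prod>i\<in>J. fact (p i)) * exp (\<Sum>i\<in>J. x i)"
    using J by (simp add: prod.distrib exp_sum)
  also have "\<dots> \<le> (\<Prod>i\<in>J. fact (p i)) * exp (\<Sum>i\<in>I. x i)"
    using assms by (intro mult_left_mono) (auto intro!: sum_mono2 prod_nonneg)
  finally show ?thesis .
qed

text \<open>The coordinates are converted one at a time from moments to indicator functions, each time by
  the one-dimensional uniqueness result for the measure weighted by the remaining factors.\<close>

lemma PiM_eq_moments:
  fixes \<mu> \<nu> :: "('i \<Rightarrow> real) measure"
  assumes I: "finite I"
    and sets: "sets \<mu> = sets (PiM I (\<lambda>_. borel))" "sets \<nu> = sets (PiM I (\<lambda>_. borel))"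
    and nn: "\<And>i. i \<in> I \<Longrightarrow> AE x in \<mu>. 0 \<le> x i" "\<And>i. i \<in> I \<Longrightarrow> AE x in \<nu>. 0 \<le> x i"
    and mom: "\<And>p. (\<integral>\<^sup>+ x. ennreal (\<Prod>i\<in>I. x i ^ p i) \<partial>\<mu>) = (\<integral>\<^sup>+ x. ennreal (\<Prod>i\<in>I. x i ^ p i) \<partial>\<nu>)"
    and ex: "\<And>t. 0 \<le> t \<Longrightarrow> (\<integral>\<^sup>+ x. ennreal (exp (t * (\<Sum>i\<in>I. x i))) \<partial>\<nu>) < \<infinity>"
  shows "\<mu> = \<nu>"
proof -
  have m: "f \<in> borel_measurable \<mu>" "f \<in> borel_measurable \<nu>" if "f \<in> borel_measurable (PiM I (\<lambda>_. borel))"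
    for f :: "('i \<Rightarrow> real) \<Rightarrow> 'b :: topological_space"
    using that sets by (simp_all cong: measurable_cong_sets)
  have nnI: "AE x in \<mu>. \<forall>i\<in>I. 0 \<le> x i" "AE x in \<nu>. \<forall>i\<in>I. 0 \<le> x i"
    using nn I by (auto intro: AE_finite_allI)
  \<comment> \<open>\<open>J\<close> collects the coordinates that have been converted to
    indicators; the others still carry powers.\<close>
  define F where "F J A p x = (\<Prod>i\<in>J. indicator (A i) (x i)) * ennreal (\<Prod>i\<in>I - J. x i ^ p i)"
    for J :: "'i set" and A :: "'i \<Rightarrow> real set" and p :: "'i \<Rightarrow> nat" and x :: "'i \<Rightarrow> real"
  have claim: "(\<integral>\<^sup>+ x. F J A p x \<partial>\<mu>) = (\<integral>\<^sup>+ x. F J A p x \<partial>\<nu>)"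
    if "J \<subseteq> I" "\<And>i. A i \<in> sets borel" for J A p
  proof -
    have "finite J" using that I finite_subset by blast
    then show ?thesis using that(1)
    proof (induction J arbitrary: p rule: finite_induct)
      case empty
      then show ?case using mom by (simp add: F_def)
    next
      case (insert j J)
      have A[measurable]: "A i \<in> sets borel" for i by (rule that)
      have j: "j \<in> I" "j \<notin> J" and J: "J \<subseteq> I" "finite J" using insert by auto
      define h where "h x = (\<Prod>i\<in>J. indicator (A i) (x i)) * ennreal (\<Prod>i\<in>I - insert j J. x i ^ p i)" for x :: "'i \<Rightarrow> real"
      have h0[measurable]: "h \<in> borel_measurable (PiM I (\<lambda>_. borel))"
      proof -
        have c: "(\<lambda>x. x i :: real) \<in> borel_measurable (PiM I (\<lambda>_. borel))" if "i \<in> I" for i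
          using that by simp
        have ind: "(\<lambda>x. indicator (A i) (x i :: real) :: ennreal) \<in> borel_measurable (PiM I (\<lambda>_. borel))" if "i \<in> J" for i
          using J that by (intro measurable_compose[OF c borel_measurable_indicator]) auto
        have pr: "(\<lambda>x. \<Prod>i\<in>I - insert j J. x i ^ p i :: real) \<in> borel_measurable (PiM I (\<lambda>_. borel))"
          by (rule borel_measurable_prod) (auto intro!: borel_measurable_power c)
        show ?thesis
          unfolding h_def
        proof (rule borel_measurable_times_ennreal)
          show "(\<lambda>x. \<Prod>i\<in>J. indicator (A i) (x i) :: ennreal) \<in> borel_measurable (PiM I (\<lambda>_. borel))"
            by (rule borel_measurable_prod_ennreal) (rule ind)
          show "(\<lambda>x. ennreal (\<Prod>i\<in>I - insert j J. x i ^ p i)) \<in> borel_measurable (PiM I (\<lambda>_. borel))"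
            by (rule measurable_compose[OF pr measurable_ennreal])
        qed
      qed
      have xj[measurable]: "(\<lambda>x. x j) \<in> borel_measurable (PiM I (\<lambda>_. borel))" using j by simp
      have hF: "h x * ennreal (x j ^ n) = F J A (p(j := n)) x" if "\<forall>i\<in>I. 0 \<le> x i" for x n
      proof -
        have "I - J = insert j (I - insert j J)" using j by auto
        then have "(\<Prod>i\<in>I - J. x i ^ (p(j := n)) i) = (\<Prod>i\<in>insert j (I - insert j J). x i ^ (p(j := n)) i)"
          by (simp only:)
        also have "\<dots> = x j ^ n * (\<Prod>i\<in>I - insert j J. x i ^ (p(j := n)) i)"
          using I by (subst prod.insert) auto
        also have "(\<Prod>i\<in>I - insert j J. x i ^ (p(j := n)) i) = (\<Prod>i\<in>I - insert j J. x i ^ p i)"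
          by (intro prod.cong) auto
        finally have "(\<Prod>i\<in>I - J. x i ^ (p(j := n)) i) = x j ^ n * (\<Prod>i\<in>I - insert j J. x i ^ p i)" .
        moreover have "0 \<le> (\<Prod>i\<in>I - insert j J. x i ^ p i)" "0 \<le> x j ^ n"
          using that j by (auto intro!: prod_nonneg)
        ultimately show ?thesis unfolding F_def h_def by (simp add: ennreal_mult mult_ac)
      qed
      have hle: "h x \<le> ennreal ((\<Prod>i\<in>I - insert j J. fact (p i)) * exp (\<Sum>i\<in>I. x i))" if "\<forall>i\<in>I. 0 \<le> x i" for x
      proof -
        have "(\<Prod>i\<in>J. indicator (A i) (x i)) \<le> (1 :: ennreal)"
          by (intro prod_le_1) (auto simp: indicator_def)
        then have "h x \<le> 1 * ennreal (\<Prod>i\<in>I - insert j J. x i ^ p i)"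
          unfolding h_def by (intro mult_right_mono) auto
        also have "\<dots> \<le> ennreal ((\<Prod>i\<in>I - insert j J. fact (p i)) * exp (\<Sum>i\<in>I. x i))"
          using that I by (simp add: ennreal_leI prod_power_le_exp)
        finally show ?thesis .
      qed
      \<comment> \<open>The law of coordinate \<open>j\<close> under the measure weighted by all
        other factors. It is a finite measure, in general not of mass one.\<close>
      define D where "D N = distr (density N h) borel (\<lambda>x. x j)" for N
      have DI: "(\<integral>\<^sup>+ y. g y \<partial>D N) = (\<integral>\<^sup>+ x. h x * g (x j) \<partial>N)"
        if "N = \<mu> \<or> N = \<nu>" and [measurable]: "g \<in> borel_measurable borel" for g N
      proof -
        have [measurable]: "h \<in> borel_measurable N" "(\<lambda>x. x j) \<in> borel_measurable N"
          using that by (elim disjE; simp add: m[OF h0] m[OF xj])+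
        have "(\<integral>\<^sup>+ y. g y \<partial>D N) = (\<integral>\<^sup>+ x. g (x j) \<partial>density N h)"
          unfolding D_def by (intro nn_integral_distr) auto
        also have "\<dots> = (\<integral>\<^sup>+ x. h x * g (x j) \<partial>N)"
          by (intro nn_integral_density) auto
        finally show ?thesis .
      qed
      have "D \<mu> = D \<nu>"
      proof (rule real_measure_eq_moments)
        show "sets (D \<mu>) = sets borel" "sets (D \<nu>) = sets borel" by (simp_all add: D_def)
        have "AE y in D N. 0 \<le> y" if "N = \<mu> \<or> N = \<nu>" for N
        proof -
          have [measurable]: "h \<in> borel_measurable N" "(\<lambda>x. x j) \<in> borel_measurable N"
            using that by (elim disjE; simp add: m[OF h0] m[OF xj])+
          have "AE x in N. 0 \<le> x j" using that nn j by auto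
          then show ?thesis unfolding D_def
            by (subst AE_distr_iff) (auto simp: AE_density elim: eventually_mono)
        qed
        then show "AE y in D \<mu>. 0 \<le> y" "AE y in D \<nu>. 0 \<le> y" by auto
        show "(\<integral>\<^sup>+ y. ennreal (y ^ n) \<partial>D \<mu>) = (\<integral>\<^sup>+ y. ennreal (y ^ n) \<partial>D \<nu>)" for n
        proof -
          have "(\<integral>\<^sup>+ x. h x * ennreal (x j ^ n) \<partial>N) = (\<integral>\<^sup>+ x. F J A (p(j := n)) x \<partial>N)" if "N = \<mu> \<or> N = \<nu>" for N
          proof (rule nn_integral_cong_AE)
            have "AE x in N. \<forall>i\<in>I. 0 \<le> x i" using that nnI by auto
            then show "AE x in N. h x * ennreal (x j ^ n) = F J A (p(j := n)) x"
              by (rule eventually_mono) (use hF in blast)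
          qed
          note 1 = this
          have 2: "(\<integral>\<^sup>+ y. ennreal (y ^ n) \<partial>D N) = (\<integral>\<^sup>+ x. h x * ennreal (x j ^ n) \<partial>N)"
            if "N = \<mu> \<or> N = \<nu>" for N
            by (rule DI[OF that]) simp
          have 3: "(\<integral>\<^sup>+ x. F J A (p(j := n)) x \<partial>\<mu>) = (\<integral>\<^sup>+ x. F J A (p(j := n)) x \<partial>\<nu>)"
            by (rule insert.IH[OF J(1)])
          show ?thesis by (simp only: 1[of \<mu>] 1[of \<nu>] 2[of \<mu>] 2[of \<nu>] 3 simp_thms)
        qed
        show "(\<integral>\<^sup>+ y. ennreal (exp (t * y)) \<partial>D \<nu>) < \<infinity>" if t: "0 \<le> t" for t
        proof -
          let ?C = "\<Prod>i\<in>I - insert j J. fact (p i) :: real"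
          have "(\<integral>\<^sup>+ y. ennreal (exp (t * y)) \<partial>D \<nu>) = (\<integral>\<^sup>+ x. h x * ennreal (exp (t * x j)) \<partial>\<nu>)"
            by (rule DI) auto
          \<comment> \<open>The weight \<open>h\<close> is at most a constant times the exponential
            of the sum of the coordinates, so the exponential moment at \<open>t\<close> is
            controlled by the given one at \<open>1 + t\<close>.\<close>
          also have "\<dots> \<le> (\<integral>\<^sup>+ x. ennreal ?C * ennreal (exp ((1 + t) * (\<Sum>i\<in>I. x i))) \<partial>\<nu>)"
          proof (rule nn_integral_mono_AE)
            show "AE x in \<nu>. h x * ennreal (exp (t * x j)) \<le> ennreal ?C * ennreal (exp ((1 + t) * (\<Sum>i\<in>I. x i)))"
              using nnI(2)
            proof eventually_elim
              case (elim x)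
              have "x j \<le> (\<Sum>i\<in>I. x i)" using j I elim by (intro member_le_sum) auto
              then have "exp (t * x j) \<le> exp (t * (\<Sum>i\<in>I. x i))" using t by (simp add: mult_left_mono)
              then have "h x * ennreal (exp (t * x j)) \<le> ennreal (?C * exp (\<Sum>i\<in>I. x i)) * ennreal (exp (t * (\<Sum>i\<in>I. x i)))"
                using hle[OF elim] by (intro mult_mono ennreal_leI) auto
              also have "\<dots> = ennreal ?C * ennreal (exp ((1 + t) * (\<Sum>i\<in>I. x i)))"
                by (simp add: ennreal_mult[symmetric] prod_nonneg exp_add[symmetric] algebra_simps)
              finally show ?case .
            qed
          qed
          also have "\<dots> = ennreal ?C * (\<integral>\<^sup>+ x. ennreal (exp ((1 + t) * (\<Sum>i\<in>I. x i))) \<partial>\<nu>)"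
            by (intro nn_integral_cmult m) simp
          also have "\<dots> < \<infinity>" using ex[of "1 + t"] t by (simp add: ennreal_mult_less_top)
          finally show ?thesis .
        qed
      qed
      then have "(\<integral>\<^sup>+ y. indicator (A j) y \<partial>D \<mu>) = (\<integral>\<^sup>+ y. indicator (A j) y \<partial>D \<nu>)" by simp
      then have "(\<integral>\<^sup>+ x. h x * indicator (A j) (x j) \<partial>\<mu>) = (\<integral>\<^sup>+ x. h x * indicator (A j) (x j) \<partial>\<nu>)"
        using DI[of _ "indicator (A j)"] by auto
      moreover have "h x * indicator (A j) (x j) = F (insert j J) A p x" for x
        unfolding h_def F_def using j J by (simp add: mult_ac)
      ultimately show ?case by simp
    qed
  qed
  show ?thesis
  proof (rule measure_eqI_generator_eq)
    let ?E = "prod_algebra I (\<lambda>_. borel :: real measure)" and ?\<Omega> = "PiE I (\<lambda>_. UNIV :: real set)"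
    show "Int_stable ?E" by (rule Int_stable_prod_algebra)
    show "?E \<subseteq> Pow ?\<Omega>" using prod_algebra_sets_into_space[of I "\<lambda>_. borel :: real measure"] by simp
    show "sets \<mu> = sigma_sets ?\<Omega> ?E" "sets \<nu> = sigma_sets ?\<Omega> ?E"
      using sets by (simp_all add: sets_PiM)
    have val: "emeasure N (PiE I A) = (\<integral>\<^sup>+ x. F I A (\<lambda>_. 0) x \<partial>N)"
      if N: "N = \<mu> \<or> N = \<nu>" and A: "\<And>i. i \<in> I \<Longrightarrow> A i \<in> sets borel" for N A
    proof -
      have sN: "sets N = sets (PiM I (\<lambda>_. borel))" using N sets by auto
      have spN: "space N = ?\<Omega>" using sets_eq_imp_space_eq[OF sN] by (simp add: space_PiM)
      have "PiE I A \<in> sets N" unfolding sN using A I by (intro sets_PiM_I_finite) auto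
      then have "emeasure N (PiE I A) = (\<integral>\<^sup>+ x. indicator (PiE I A) x \<partial>N)" by simp
      also have "\<dots> = (\<integral>\<^sup>+ x. F I A (\<lambda>_. 0) x \<partial>N)"
      proof (rule nn_integral_cong)
        fix x assume "x \<in> space N"
        then have "x \<in> PiE I A \<longleftrightarrow> (\<forall>i\<in>I. x i \<in> A i)" unfolding spN by (auto simp: PiE_iff)
        then show "indicator (PiE I A) x = F I A (\<lambda>_. 0) x"
          unfolding F_def using I by (auto simp: indicator_def prod_zero_iff)
      qed
      finally show ?thesis .
    qed
    show "emeasure \<mu> X = emeasure \<nu> X" if XE: "X \<in> ?E" for X
    proof -
      obtain A0 where X0: "X = PiE I A0" "\<And>i. i \<in> I \<Longrightarrow> A0 i \<in> sets borel"
        using XE unfolding prod_algebra_eq_finite[OF I] by (auto simp: Pi_iff)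
      \<comment> \<open>Off \<open>I\<close> the sets are chosen empty merely to have Borel sets at
        every index; the product set does not change.\<close>
      define A where "A i = (if i \<in> I then A0 i else {})" for i
      have A: "X = PiE I A" "\<And>i. A i \<in> sets borel"
        using X0 unfolding A_def by (auto intro!: PiE_cong)
      show ?thesis unfolding A(1)
        by (subst (1 2) val) (use A(2) claim[OF order_refl, of A "\<lambda>_. 0"] in auto)
    qed
    show "range (\<lambda>_::nat. ?\<Omega>) \<subseteq> ?E" "(\<Union>i::nat. ?\<Omega>) = ?\<Omega>"
      using prod_algebraI_finite[OF I, of "\<lambda>_. UNIV" "\<lambda>_. borel"] by auto
    have "emeasure \<nu> ?\<Omega> < \<infinity>"
    proof -
      have "space \<nu> = ?\<Omega>" using sets_eq_imp_space_eq[OF sets(2)] by (simp add: space_PiM)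
      then show ?thesis using ex[of 0] by simp
    qed
    moreover have "emeasure \<mu> ?\<Omega> = emeasure \<nu> ?\<Omega>"
      by (subst (1 2) val) (use claim[OF order_refl, of "\<lambda>_. UNIV" "\<lambda>_. 0"] in auto)
    ultimately show "emeasure \<mu> ?\<Omega> \<noteq> \<infinity>" for i :: nat by simp
  qed
qed

section \<open>Moments of the Mittag-Leffler, beta and Dirichlet distributions\<close>

lemma Gamma_plus1_pos: "0 < x \<Longrightarrow> Gamma (x + 1) = x * Gamma x" for x :: real
  by (rule Gamma_plus1) (auto dest: nonpos_Ints_nonpos)

text \<open>The Gamma integral under the substitution \<open>t = x * u\<close>.\<close>

lemma nn_integral_powr_exp:
  fixes a x :: real
  assumes a: "a > 0" and x: "x > 0"
  shows "(\<integral>\<^sup>+ u. ennreal (indicator {0..} u * u powr (a - 1)) * ennreal (exp (- (u * x))) \<partial>lborel) = ennreal (Gamma a * x powr (- a))"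
proof -
  have "ennreal (Gamma a) = (\<integral>\<^sup>+ t. ennreal (indicator {0..} t * t powr (a - 1) / exp t) \<partial>lborel)"
    by (rule Gamma_conv_nn_integral_real[OF a])
  also have "\<dots> = \<bar>x\<bar> * (\<integral>\<^sup>+ u. ennreal (indicator {0..} (0 + x * u) * (0 + x * u) powr (a - 1) / exp (0 + x * u)) \<partial>lborel)"
    by (rule nn_integral_real_affine) (use x in auto)
  also have "(\<integral>\<^sup>+ u. ennreal (indicator {0..} (0 + x * u) * (0 + x * u) powr (a - 1) / exp (0 + x * u)) \<partial>lborel) =
      (\<integral>\<^sup>+ u. ennreal (x powr (a - 1)) * (ennreal (indicator {0..} u * u powr (a - 1)) * ennreal (exp (- (u * x)))) \<partial>lborel)"
    using x by (intro nn_integral_cong)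
      (auto simp: ennreal_mult[symmetric] indicator_def powr_mult exp_minus field_simps zero_le_mult_iff)
  also have "\<dots> = ennreal (x powr (a - 1)) * (\<integral>\<^sup>+ u. ennreal (indicator {0..} u * u powr (a - 1)) * ennreal (exp (- (u * x))) \<partial>lborel)"
    by (rule nn_integral_cmult) simp
  finally have "ennreal (Gamma a) = ennreal (x powr a) * (\<integral>\<^sup>+ u. ennreal (indicator {0..} u * u powr (a - 1)) * ennreal (exp (- (u * x))) \<partial>lborel)"
    using x by (simp add: mult.assoc[symmetric] ennreal_mult[symmetric] powr_mult_base)
  then have "ennreal (x powr (- a)) * ennreal (Gamma a) = (ennreal (x powr (- a)) * ennreal (x powr a)) *
      (\<integral>\<^sup>+ u. ennreal (indicator {0..} u * u powr (a - 1)) * ennreal (exp (- (u * x))) \<partial>lborel)"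
    by (simp only: mult.assoc)
  also have "ennreal (x powr (- a)) * ennreal (x powr a) = 1"
    using x by (simp add: ennreal_mult[symmetric] powr_add[symmetric])
  finally show ?thesis using a by (simp add: ennreal_mult[symmetric] Gamma_real_pos less_imp_le mult.commute)
qed

lemma nn_integral_exp_tail:
  fixes y :: real
  shows "(\<integral>\<^sup>+ v. ennreal (exp (- v)) * indicator {y..} v \<partial>lborel) = ennreal (exp (- y))"
proof -
  have "(\<integral>\<^sup>+ v. ennreal (exp (- v)) * indicator {y..} v \<partial>lborel) = 0 - (- exp (- y))"
  proof (rule nn_integral_FTC_atLeast)
    show "((\<lambda>v::real. - exp (- v)) \<longlongrightarrow> 0) at_top"
      using tendsto_minus[OF filterlim_compose[OF exp_at_bot filterlim_uminus_at_bot_at_top]] by simp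
  qed (auto intro!: derivative_eq_intros)
  then show ?thesis by simp
qed

text \<open>Layer-cake representation of \<open>exp (- (u powr \<gamma>))\<close>, in place of the substitution \<open>v = u powr \<gamma>\<close>.\<close>

lemma nn_integral_powr_exp_powr:
  fixes a \<gamma> :: real
  assumes a: "a > 0" and \<gamma>: "\<gamma> > 0"
  shows "(\<integral>\<^sup>+ u. ennreal (indicator {0..} u * u powr (a - 1)) * ennreal (exp (- (u powr \<gamma>))) \<partial>lborel) = ennreal (Gamma (a / \<gamma>) / \<gamma>)"
proof -
  let ?i = "\<lambda>u v :: real. ennreal (indicator {0..} u * u powr (a - 1)) * (ennreal (exp (- v)) * indicator {u powr \<gamma>..} v)"
  have [measurable]: "Measurable.pred (borel \<Otimes>\<^sub>M borel) (\<lambda>x. snd x \<in> {(fst x :: real) powr \<gamma>..})"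
    by (simp add: atLeast_def)
  have m: "case_prod ?i \<in> borel_measurable (lborel \<Otimes>\<^sub>M lborel)"
    unfolding indicator_def by (simp add: split_beta') 
  have "(\<integral>\<^sup>+ u. ennreal (indicator {0..} u * u powr (a - 1)) * ennreal (exp (- (u powr \<gamma>))) \<partial>lborel) = (\<integral>\<^sup>+ u. \<integral>\<^sup>+ v. ?i u v \<partial>lborel \<partial>lborel)"
    by (intro nn_integral_cong) (simp add: nn_integral_cmult nn_integral_exp_tail)
  also have "\<dots> = (\<integral>\<^sup>+ v. \<integral>\<^sup>+ u. ?i u v \<partial>lborel \<partial>lborel)"
    by (rule lborel_pair.Fubini'[OF m, symmetric])
  also have "\<dots> = (\<integral>\<^sup>+ v. ennreal (1 / a) * ennreal (indicator {0..} v * v powr ((a / \<gamma> + 1) - 1) / exp v) \<partial>lborel)"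
  proof (rule nn_integral_cong)
    fix v :: real
    show "(\<integral>\<^sup>+ u. ?i u v \<partial>lborel) = ennreal (1 / a) * ennreal (indicator {0..} v * v powr ((a / \<gamma> + 1) - 1) / exp v)"
    proof (cases "v \<ge> 0")
      case True
      let ?c = "v powr (1 / \<gamma>)"
      have iff: "u powr \<gamma> \<le> v \<longleftrightarrow> u \<le> ?c" if "u \<ge> 0" for u
      proof
        assume "u powr \<gamma> \<le> v"
        then have "(u powr \<gamma>) powr (1 / \<gamma>) \<le> ?c" using \<gamma> by (intro powr_mono2) auto
        then show "u \<le> ?c" using that \<gamma> by (simp add: powr_powr)
      next
        assume "u \<le> ?c"
        then have "u powr \<gamma> \<le> ?c powr \<gamma>" using that \<gamma> by (intro powr_mono2) auto
        then show "u powr \<gamma> \<le> v" using True \<gamma> by (simp add: powr_powr)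
      qed
      have "(\<integral>\<^sup>+ u. ?i u v \<partial>lborel) = (\<integral>\<^sup>+ u. ennreal (exp (- v)) * ennreal (indicator {0..?c} u * u powr (a - 1)) \<partial>lborel)"
      proof (rule nn_integral_cong)
        fix u :: real
        show "?i u v = ennreal (exp (- v)) * ennreal (indicator {0..?c} u * u powr (a - 1))"
          using iff[of u] by (cases "u \<ge> 0") (auto simp: indicator_def mult.commute)
      qed
      also have "\<dots> = ennreal (exp (- v)) * (\<integral>\<^sup>+ u. ennreal (indicator {0..?c} u * u powr (a - 1)) \<partial>lborel)"
        by (rule nn_integral_cmult) simp
      also have "(\<integral>\<^sup>+ u. ennreal (indicator {0..?c} u * u powr (a - 1)) \<partial>lborel) = ennreal (?c powr (a - 1 + 1) / (a - 1 + 1))"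
        by (intro nn_integral_has_integral_lebesgue has_integral_powr_from_0) (use a in auto)
      also have "ennreal (exp (- v)) * \<dots> = ennreal (1 / a) * ennreal (indicator {0..} v * v powr ((a / \<gamma> + 1) - 1) / exp v)"
        using True a by (simp add: powr_powr ennreal_mult[symmetric] exp_minus field_simps)
      finally show ?thesis .
    next
      case False
      have "?i u v = 0" for u
      proof -
        have "\<not> u powr \<gamma> \<le> v" using False powr_ge_zero[of u \<gamma>] by linarith
        then show ?thesis by simp
      qed
      then have "(\<integral>\<^sup>+ u. ?i u v \<partial>lborel) = (\<integral>\<^sup>+ u. 0 \<partial>(lborel :: real measure))" by (rule nn_integral_cong)
      then show ?thesis using False by simp
    qed
  qed
  also have "\<dots> = ennreal (1 / a) * (\<integral>\<^sup>+ v. ennreal (indicator {0..} v * v powr ((a / \<gamma> + 1) - 1) / exp v) \<partial>lborel)"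
    by (rule nn_integral_cmult) simp
  also have "(\<integral>\<^sup>+ v. ennreal (indicator {0..} v * v powr ((a / \<gamma> + 1) - 1) / exp v) \<partial>lborel) = ennreal (Gamma (a / \<gamma> + 1))"
    by (rule Gamma_conv_nn_integral_real[symmetric]) (use a \<gamma> in \<open>auto intro: add_pos_pos\<close>)
  also have "Gamma (a / \<gamma> + 1) = a / \<gamma> * Gamma (a / \<gamma>)"
    using a \<gamma> by (intro Gamma_plus1) (auto dest: nonpos_Ints_nonpos simp: field_simps not_le)
  also have "ennreal (1 / a) * ennreal (a / \<gamma> * Gamma (a / \<gamma>)) = ennreal (Gamma (a / \<gamma>) / \<gamma>)"
    using a \<gamma> by (simp add: ennreal_mult[symmetric] Gamma_real_pos less_imp_le)
  finally show ?thesis .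
qed

text \<open>With \<open>s = x powr (-\<gamma>)\<close> the moment of order \<open>r\<close> is the
  negative moment of order \<open>\<gamma> * r\<close> of the subordinator. The Gamma integral
  writes \<open>x powr (-a)\<close> as a mixture of the exponentials \<open>exp (-(u * x))\<close>,
  so that after exchanging the integrals only the Laplace transform enters.\<close>

lemma mittag_leffler_moment:
  assumes g: "mittag_leffler_density \<gamma> g" and \<gamma>: "\<gamma> > 0" and r: "r > 0"
  shows "(\<integral>\<^sup>+ s. ennreal (g s) * ennreal (s powr r) \<partial>lborel) = ennreal (Gamma (r + 1) / Gamma (\<gamma> * r + 1))"
proof -
  obtain S where S: "real_distribution S" "AE x in S. 0 < x"
    "\<forall>u\<ge>0. (\<integral>x. exp (- (u * x)) \<partial>S) = exp (- (u powr \<gamma>))"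
    "distributed S lborel (\<lambda>x. x powr (- \<gamma>)) (\<lambda>s. ennreal (g s))"
    using g unfolding mittag_leffler_density_def by blast
  interpret S: real_distribution S by fact
  define a where "a = \<gamma> * r"
  have a: "a > 0" using \<gamma> r by (simp add: a_def)
  have [measurable_cong]: "sets S = sets borel" by simp
  have "(\<integral>\<^sup>+ s. ennreal (g s) * ennreal (s powr r) \<partial>lborel) = (\<integral>\<^sup>+ x. ennreal ((x powr (- \<gamma>)) powr r) \<partial>S)"
    by (rule distributed_nn_integral[OF S(4)]) simp
  also have "\<dots> = (\<integral>\<^sup>+ x. ennreal (x powr (- a)) \<partial>S)" by (simp add: powr_powr a_def)
  finally have 1: "(\<integral>\<^sup>+ s. ennreal (g s) * ennreal (s powr r) \<partial>lborel) = (\<integral>\<^sup>+ x. ennreal (x powr (- a)) \<partial>S)" .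
  let ?i = "\<lambda>u x :: real. ennreal (indicator {0..} u * u powr (a - 1)) * ennreal (exp (- (u * x)))"
  interpret P: pair_sigma_finite lborel S by standard
  have "ennreal (Gamma a) * (\<integral>\<^sup>+ x. ennreal (x powr (- a)) \<partial>S) = (\<integral>\<^sup>+ x. ennreal (Gamma a) * ennreal (x powr (- a)) \<partial>S)"
    by (rule nn_integral_cmult[symmetric]) simp
  also have "\<dots> = (\<integral>\<^sup>+ x. (\<integral>\<^sup>+ u. ?i u x \<partial>lborel) \<partial>S)"
  proof (rule nn_integral_cong_AE)
    show "AE x in S. ennreal (Gamma a) * ennreal (x powr (- a)) = (\<integral>\<^sup>+ u. ?i u x \<partial>lborel)"
      using S(2)
    proof eventually_elim
      case (elim x)
      show ?case using nn_integral_powr_exp[OF a elim] a by (simp add: ennreal_mult[symmetric] Gamma_real_pos less_imp_le)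
    qed
  qed
  also have "\<dots> = (\<integral>\<^sup>+ u. (\<integral>\<^sup>+ x. ?i u x \<partial>S) \<partial>lborel)"
    by (rule P.Fubini') simp
  also have "\<dots> = (\<integral>\<^sup>+ u. ennreal (indicator {0..} u * u powr (a - 1)) * ennreal (exp (- (u powr \<gamma>))) \<partial>lborel)"
  proof (rule nn_integral_cong)
    fix u :: real
    show "(\<integral>\<^sup>+ x. ?i u x \<partial>S) = ennreal (indicator {0..} u * u powr (a - 1)) * ennreal (exp (- (u powr \<gamma>)))"
    proof (cases "u \<ge> 0")
      case True
      have "(\<integral>\<^sup>+ x. ?i u x \<partial>S) = ennreal (indicator {0..} u * u powr (a - 1)) * (\<integral>\<^sup>+ x. ennreal (exp (- (u * x))) \<partial>S)"
        by (rule nn_integral_cmult) simp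
      also have "(\<integral>\<^sup>+ x. ennreal (exp (- (u * x))) \<partial>S) = ennreal (\<integral>x. exp (- (u * x)) \<partial>S)"
      proof (rule nn_integral_eq_integral)
        have "AE x in S. norm (exp (- (u * x))) \<le> 1" using S(2) by eventually_elim (use True in simp)
        then show "integrable S (\<lambda>x. exp (- (u * x)))" by (rule S.integrable_const_bound) simp
      qed simp
      also have "\<dots> = ennreal (exp (- (u powr \<gamma>)))" using S(3) True by simp
      finally show ?thesis .
    qed simp
  qed
  also have "\<dots> = ennreal (Gamma (a / \<gamma>) / \<gamma>)" by (rule nn_integral_powr_exp_powr[OF a \<gamma>])
  finally have 2: "ennreal (Gamma a) * (\<integral>\<^sup>+ x. ennreal (x powr (- a)) \<partial>S) = ennreal (Gamma r / \<gamma>)"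
    using \<gamma> by (simp add: a_def)
  have Ga: "Gamma a > 0" using a by (rule Gamma_real_pos)
  have "(\<integral>\<^sup>+ x. ennreal (x powr (- a)) \<partial>S) = ennreal (1 / Gamma a) * (ennreal (Gamma a) * (\<integral>\<^sup>+ x. ennreal (x powr (- a)) \<partial>S))"
    using Ga by (simp add: mult.assoc[symmetric] ennreal_mult[symmetric])
  also have "\<dots> = ennreal (1 / Gamma a * (Gamma r / \<gamma>))"
    unfolding 2 using Ga r \<gamma> by (subst ennreal_mult) (auto simp: Gamma_real_pos less_imp_le)
  also have "1 / Gamma a * (Gamma r / \<gamma>) = Gamma (r + 1) / Gamma (a + 1)"
  proof -
    have "Gamma (r + 1) = r * Gamma r" "Gamma (a + 1) = a * Gamma a"
      using a r by (auto intro!: Gamma_plus1 dest: nonpos_Ints_nonpos)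
    then show ?thesis using Ga a r \<gamma> by (simp add: a_def)
  qed
  finally show ?thesis using 1 by (simp add: a_def)
qed

section \<open>Support, tilting and exponential moments of the Mittag-Leffler law\<close>

lemma mittag_leffler_measurable: "mittag_leffler_density \<gamma> g \<Longrightarrow> (\<lambda>s. ennreal (g s)) \<in> borel_measurable borel"
  unfolding mittag_leffler_density_def by (auto dest: distributed_borel_measurable)

text \<open>As a density, \<open>g\<close> vanishes on the nonpositive reals only almost everywhere.
  This is needed to combine \<open>s powr a\<close> with \<open>s ^ p\<close>, which is legitimate
  for positive \<open>s\<close>.\<close>

lemma mittag_leffler_support:
  assumes g: "mittag_leffler_density \<gamma> g"
  shows "AE s in lborel. s \<le> 0 \<longrightarrow> g s = 0"
proof -
  obtain S where S: "real_distribution S" "AE x in S. 0 < x"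
    "distributed S lborel (\<lambda>x. x powr (- \<gamma>)) (\<lambda>s. ennreal (g s))"
    using g unfolding mittag_leffler_density_def by blast
  interpret S: real_distribution S by fact
  have m: "(\<lambda>x. x powr (- \<gamma>)) \<in> S \<rightarrow>\<^sub>M lborel" using S(3) by (simp add: distributed_measurable)
  have "AE x in S. 0 < x powr (- \<gamma>)" using S(2) by eventually_elim simp
  then have "AE s in distr S lborel (\<lambda>x. x powr (- \<gamma>)). 0 < s"
    by (subst AE_distr_iff[OF m]) auto
  then have "AE s in density lborel (\<lambda>s. ennreal (g s)). 0 < s"
    unfolding distributed_distr_eq_density[OF S(3)] .
  then have "AE s in lborel. 0 < ennreal (g s) \<longrightarrow> 0 < s"
    using mittag_leffler_measurable[OF g] by (subst (asm) AE_density) auto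
  moreover have "0 \<le> g s" for s using g by (simp add: mittag_leffler_density_def)
  ultimately show ?thesis by (auto elim!: eventually_mono simp: less_le)
qed

text \<open>The law of \<open>L\<close> for \<open>a = l + k (1 - \<alpha>) / \<gamma>\<close> and
  \<open>C\<close> the corresponding Gamma quotient.\<close>

definition tilted :: "real \<Rightarrow> real \<Rightarrow> (real \<Rightarrow> real) \<Rightarrow> real measure" where
  "tilted C a g = density lborel (\<lambda>s. ennreal (C * s powr a * g s))"

text \<open>Log-convexity of Gamma, with \<open>x\<close> written as the convex combination of
  \<open>x - 1\<close> and \<open>x + \<gamma>\<close> with weights
  \<open>\<gamma> / (1 + \<gamma>)\<close> and \<open>1 / (1 + \<gamma>)\<close>; the value at
  \<open>x - 1\<close> is then eliminated by the functional equation.\<close>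

lemma Gamma_ratio_lower:
  fixes x \<gamma> :: real
  assumes x: "x > 1" and \<gamma>: "\<gamma> > 0"
  shows "Gamma x * (x - 1) powr \<gamma> \<le> Gamma (x + \<gamma>)"
proof -
  have pos: "Gamma x > 0" "Gamma (x - 1) > 0" "Gamma (x + \<gamma>) > 0" using x \<gamma> by (auto intro: Gamma_real_pos)
  let ?t = "1 / (1 + \<gamma>)"
  have t: "0 \<le> ?t" "?t \<le> 1" using \<gamma> by auto
  have eq: "(1 - ?t) * (x - 1) + ?t * (x + \<gamma>) = x"
  proof -
    have "1 - ?t = \<gamma> / (1 + \<gamma>)" using \<gamma> by (simp add: field_simps)
    then show ?thesis using \<gamma> by (simp add: add_divide_distrib[symmetric]) (simp add: field_simps)
  qed
  have "(ln \<circ> Gamma) ((1 - ?t) *\<^sub>R (x - 1) + ?t *\<^sub>R (x + \<gamma>)) \<le> (1 - ?t) * (ln \<circ> Gamma) (x - 1) + ?t * (ln \<circ> Gamma) (x + \<gamma>)"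
    by (rule convex_onD[OF log_convex_Gamma_real]) (use x \<gamma> t in auto)
  then have "ln (Gamma x) \<le> (1 - ?t) * ln (Gamma (x - 1)) + ?t * ln (Gamma (x + \<gamma>))"
    using eq by simp
  then have "(1 + \<gamma>) * ln (Gamma x) \<le> (1 + \<gamma>) * ((1 - ?t) * ln (Gamma (x - 1)) + ?t * ln (Gamma (x + \<gamma>)))"
    using \<gamma> by (intro mult_left_mono) auto
  also have "\<dots> = \<gamma> * ln (Gamma (x - 1)) + ln (Gamma (x + \<gamma>))"
    using \<gamma> by (simp add: distrib_left mult.assoc[symmetric] right_diff_distrib)
  finally have "(1 + \<gamma>) * ln (Gamma x) \<le> \<gamma> * ln (Gamma (x - 1)) + ln (Gamma (x + \<gamma>))" .
  moreover have "Gamma x = (x - 1) * Gamma (x - 1)"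
    using Gamma_plus1_pos[of "x - 1"] x by simp
  then have "ln (Gamma x) = ln (x - 1) + ln (Gamma (x - 1))"
    using ln_mult_pos[of "x - 1" "Gamma (x - 1)"] x pos by (simp only: diff_gt_0_iff_gt)
  then have "\<gamma> * ln (Gamma x) = \<gamma> * ln (x - 1) + \<gamma> * ln (Gamma (x - 1))" by (simp add: distrib_left)
  ultimately have "ln (Gamma x) + \<gamma> * ln (x - 1) \<le> ln (Gamma (x + \<gamma>))" by (simp add: algebra_simps)
  moreover have "ln (Gamma x) + \<gamma> * ln (x - 1) = ln (Gamma x * (x - 1) powr \<gamma>)"
  proof -
    have "ln (Gamma x * (x - 1) powr \<gamma>) = ln (Gamma x) + ln ((x - 1) powr \<gamma>)"
      by (rule ln_mult_pos) (use x pos in auto)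
    also have "ln ((x - 1) powr \<gamma>) = \<gamma> * ln (x - 1)" using x by (simp add: ln_powr)
    finally show ?thesis by simp
  qed
  ultimately show ?thesis using pos x by simp
qed

context
  fixes \<gamma> a C :: real and g
  assumes g: "mittag_leffler_density \<gamma> g" and \<gamma>: "0 < \<gamma>" and a: "0 < a" and C: "0 < C"
begin

lemma tilted_moment:
  "(\<integral>\<^sup>+ s. ennreal (s ^ p) \<partial>tilted C a g) = ennreal (C * (Gamma (a + real p + 1) / Gamma (\<gamma> * (a + real p) + 1)))"
proof -
  have g0: "0 \<le> g s" for s using g by (simp add: mittag_leffler_density_def)
  have [measurable]: "(\<lambda>s. ennreal (g s)) \<in> borel_measurable borel" by (rule mittag_leffler_measurable[OF g])
  have eq: "ennreal (C * s powr a * g s) = ennreal (C * s powr a) * ennreal (g s)" for s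
    using g0 C by (simp add: ennreal_mult)
  have "(\<integral>\<^sup>+ s. ennreal (s ^ p) \<partial>tilted C a g) = (\<integral>\<^sup>+ s. ennreal (C * s powr a) * ennreal (g s) * ennreal (s ^ p) \<partial>lborel)"
    unfolding tilted_def eq by (rule nn_integral_density) auto
  also have "\<dots> = (\<integral>\<^sup>+ s. ennreal C * (ennreal (g s) * ennreal (s powr (a + real p))) \<partial>lborel)"
  proof (rule nn_integral_cong_AE)
    show "AE s in lborel. ennreal (C * s powr a) * ennreal (g s) * ennreal (s ^ p) = ennreal C * (ennreal (g s) * ennreal (s powr (a + real p)))"
      using mittag_leffler_support[OF g]
    proof eventually_elim
      case (elim s)
      show ?case
      proof (cases "s \<le> 0")
        case False
        then have "s powr (a + real p) = s powr a * s ^ p" by (simp add: powr_add powr_realpow)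
        then show ?thesis using False C g0[of s] by (simp add: ennreal_mult[symmetric] mult_ac)
      qed (use elim in simp)
    qed
  qed
  also have "\<dots> = ennreal C * (\<integral>\<^sup>+ s. ennreal (g s) * ennreal (s powr (a + real p)) \<partial>lborel)"
    by (rule nn_integral_cmult) simp
  also have "\<dots> = ennreal C * ennreal (Gamma (a + real p + 1) / Gamma (\<gamma> * (a + real p) + 1))"
    by (subst mittag_leffler_moment[OF g \<gamma>]) (use a in auto)
  finally show ?thesis by (simp only: ennreal_mult'[OF less_imp_le[OF C]])
qed

lemma tilted_pos: "AE s in tilted C a g. 0 < s"
proof -
  have g0: "0 \<le> g s" for s using g by (simp add: mittag_leffler_density_def)
  have [measurable]: "(\<lambda>s. ennreal (g s)) \<in> borel_measurable borel" by (rule mittag_leffler_measurable[OF g])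
  have eq: "ennreal (C * s powr a * g s) = ennreal (C * s powr a) * ennreal (g s)" for s
    using g0 C by (simp add: ennreal_mult)
  show ?thesis unfolding tilted_def eq
    by (subst AE_density) (use mittag_leffler_support[OF g] in \<open>auto elim!: eventually_mono simp: not_less\<close>)
qed

text \<open>The quotient of consecutive terms is at most
  \<open>t * (1 + a) * (\<gamma> * (a + p)) powr (-\<gamma>)\<close>, by the lower bound for
  quotients of Gamma values. It tends to zero, so the ratio test applies for every
  \<open>t\<close>.\<close>

lemma tilted_exp_finite:
  assumes t: "0 \<le> t"
  shows "summable (\<lambda>p. t ^ p / fact p * (C * (Gamma (a + real p + 1) / Gamma (\<gamma> * (a + real p) + 1))))"
proof -
  define f where "f p = t ^ p / fact p * (C * (Gamma (a + real p + 1) / Gamma (\<gamma> * (a + real p) + 1)))" for p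
  have "(\<lambda>p. t * (1 + a) * (\<gamma> * (a + real p)) powr (- \<gamma>)) \<longlonglongrightarrow> t * (1 + a) * 0"
  proof (intro tendsto_mult tendsto_const tendsto_neg_powr)
    show "filterlim (\<lambda>p. \<gamma> * (a + real p)) at_top sequentially"
      using \<gamma> by (intro filterlim_tendsto_pos_mult_at_top[OF tendsto_const] filterlim_tendsto_add_at_top[OF tendsto_const] filterlim_real_sequentially) auto
  qed (use \<gamma> in auto)
  then have "eventually (\<lambda>p. t * (1 + a) * (\<gamma> * (a + real p)) powr (- \<gamma>) < 1 / 2) sequentially"
    by (rule order_tendstoD) simp
  then obtain N where N: "\<And>p. p \<ge> N \<Longrightarrow> t * (1 + a) * (\<gamma> * (a + real p)) powr (- \<gamma>) < 1 / 2"
    by (auto simp: eventually_sequentially)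
  have "summable f"
  proof (rule summable_ratio_test[of "1 / 2" N])
    fix p assume p: "p \<ge> N"
    define x where "x = \<gamma> * (a + real p) + 1"
    have x: "x > 1" using a \<gamma> by (simp add: x_def)
    have G: "Gamma x > 0" "Gamma (x + \<gamma>) > 0" "Gamma (a + real p + 1) > 0" using x \<gamma> a by (auto intro: Gamma_real_pos)
    have f0: "f p \<ge> 0" unfolding f_def x_def[symmetric] using t C G by simp
    have xS: "\<gamma> * (a + real (Suc p)) + 1 = x + \<gamma>" by (simp add: x_def algebra_simps)
    have GS: "Gamma (a + real (Suc p) + 1) = (a + real p + 1) * Gamma (a + real p + 1)"
      using Gamma_plus1_pos[of "a + real p + 1"] a by (simp add: add_ac)
    have "f (Suc p) = (t * ((a + real p + 1) / real (Suc p)) * (Gamma x / Gamma (x + \<gamma>))) * f p"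
    proof -
      have "t * T / (S * F) * (C * (A * G0 / G2)) = t * (A / S) * (G1 / G2) * (T / F * (C * (G0 / G1)))"
        if "S \<noteq> 0" "F \<noteq> 0" "G1 \<noteq> 0" "G2 \<noteq> 0" for T S F A G0 G1 G2 :: real
        using that by (simp add: field_simps)
      from this[of "real (Suc p)" "fact p" "Gamma x" "Gamma (x + \<gamma>)" "t ^ p" "a + real p + 1" "Gamma (a + real p + 1)"]
      show ?thesis unfolding f_def xS GS x_def[symmetric] using G
        by (simp only: fact_Suc power_Suc of_nat_mult) (simp add: less_imp_neq[symmetric])
    qed
    also have "\<dots> \<le> (t * (1 + a) * (x - 1) powr (- \<gamma>)) * f p"
    proof (intro mult_right_mono mult_mono f0)
      have "a + real p + 1 \<le> (1 + a) * real (Suc p)" using a by (simp add: algebra_simps)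
      then show "(a + real p + 1) / real (Suc p) \<le> 1 + a" by (simp add: field_simps)
      show "Gamma x / Gamma (x + \<gamma>) \<le> (x - 1) powr (- \<gamma>)"
        using Gamma_ratio_lower[OF x \<gamma>] G x by (simp add: powr_minus field_simps)
    qed (use t a G in auto)
    also have "\<dots> \<le> 1 / 2 * f p"
      using N[OF p] f0 unfolding x_def by (intro mult_right_mono) auto
    finally have "f (Suc p) \<le> 1 / 2 * f p" .
    moreover have "f (Suc p) \<ge> 0" unfolding f_def xS GS using t C G a by simp
    ultimately show "norm (f (Suc p)) \<le> 1 / 2 * norm (f p)" using f0 by simp
  qed simp
  then show ?thesis by (simp add: f_def[abs_def])
qed

end

section \<open>Beta and Dirichlet integrals\<close>

lemma nn_integral_Beta_scaled:
  fixes a b s :: real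
  assumes a: "a > 0" and b: "b > 0"
  shows "(\<integral>\<^sup>+ y. ennreal (if 0 < y \<and> y < s then y powr (a - 1) * (s - y) powr (b - 1) else 0) \<partial>lborel) =
    ennreal (if 0 < s then Beta a b * s powr (a + b - 1) else 0)"
proof (cases "0 < s")
  case True
  have "(\<integral>\<^sup>+ y. ennreal (if 0 < y \<and> y < s then y powr (a - 1) * (s - y) powr (b - 1) else 0) \<partial>lborel) =
    \<bar>s\<bar> * (\<integral>\<^sup>+ y. ennreal (if 0 < 0 + s * y \<and> 0 + s * y < s then (0 + s * y) powr (a - 1) * (s - (0 + s * y)) powr (b - 1) else 0) \<partial>lborel)"
    by (rule nn_integral_real_affine) (use True in auto)
  also have "(\<integral>\<^sup>+ y. ennreal (if 0 < 0 + s * y \<and> 0 + s * y < s then (0 + s * y) powr (a - 1) * (s - (0 + s * y)) powr (b - 1) else 0) \<partial>lborel)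
     = (\<integral>\<^sup>+ y. ennreal (s powr (a + b - 2)) * ennreal (indicator {0..1} y * (y powr (a - 1) * (1 - y) powr (b - 1))) \<partial>lborel)"
  proof (rule nn_integral_cong)
    fix y :: real
    show "ennreal (if 0 < 0 + s * y \<and> 0 + s * y < s then (0 + s * y) powr (a - 1) * (s - (0 + s * y)) powr (b - 1) else 0) =
        ennreal (s powr (a + b - 2)) * ennreal (indicator {0..1} y * (y powr (a - 1) * (1 - y) powr (b - 1)))"
    proof (cases "0 < y \<and> y < 1")
      case y: True
      have "(s * y) powr (a - 1) = s powr (a - 1) * y powr (a - 1)" using True y by (simp add: powr_mult)
      moreover have "(s - s * y) powr (b - 1) = s powr (b - 1) * (1 - y) powr (b - 1)"
        using True y powr_mult[of s "1 - y" "b - 1"] by (simp add: algebra_simps)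
      moreover have "s powr (a + b - 2) = s powr (a - 1) * s powr (b - 1)" by (simp add: powr_add[symmetric])
      ultimately show ?thesis using True y by (simp add: ennreal_mult[symmetric] mult_ac)
    next
      case False
      then have 1: "\<not> (0 < s * y \<and> s * y < s)" using True by (auto simp: zero_less_mult_iff)
      have 2: "indicator {0..1} y * (y powr (a - 1) * (1 - y) powr (b - 1)) = 0"
        using False by (cases "y = 0 \<or> y = 1") (auto simp: indicator_def)
      show ?thesis unfolding add_0_left if_not_P[OF 1] 2 by simp
    qed
  qed
  also have "\<dots> = ennreal (s powr (a + b - 2)) * (\<integral>\<^sup>+ y. ennreal (indicator {0..1} y * (y powr (a - 1) * (1 - y) powr (b - 1))) \<partial>lborel)"
    by (rule nn_integral_cmult) simp
  also have "(\<integral>\<^sup>+ y. ennreal (indicator {0..1} y * (y powr (a - 1) * (1 - y) powr (b - 1))) \<partial>lborel) = ennreal (Beta a b)"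
    by (rule nn_integral_has_integral_lebesgue[OF _ has_integral_Beta_real[OF a b]]) simp
  also have "ennreal \<bar>s\<bar> * (ennreal (s powr (a + b - 2)) * ennreal (Beta a b)) = ennreal (Beta a b * s powr (a + b - 1))"
  proof -
    have "s * s powr (a + b - 2) = s powr (a + b - 1)"
      using True powr_mult_base[of s "a + b - 2"] by simp
    moreover have "0 \<le> Beta a b" using a b by (simp add: Beta_def Gamma_real_pos less_imp_le)
    ultimately show ?thesis using True by (simp add: ennreal_mult[symmetric] mult.assoc[symmetric] mult.commute)
  qed
  finally show ?thesis using True by simp
next
  case False
  then have "(if 0 < y \<and> y < s then y powr (a - 1) * (s - y) powr (b - 1) else 0) = 0" for y by auto
  then show ?thesis using False by simp
qed

text \<open>For \<open>b = 0\<close> the Gamma values cancel to one, the moment of the point mass at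
  one, so the degenerate case obeys the same formula. It does occur: for \<open>k = 1\<close>, and
  for binary trees when \<gamma> = \<alpha>.\<close>

lemma beta_distribution_moment:
  assumes a: "a > 0" and b: "b \<ge> 0" and q: "q \<ge> 0"
  shows "(\<integral>\<^sup>+ w. ennreal (w powr q) \<partial>beta_distribution a b) = ennreal (Gamma (a + q) * Gamma (a + b) / (Gamma a * Gamma (a + b + q)))"
proof (cases "b = 0")
  case True
  have "Gamma a > 0" "Gamma (a + q) > 0" using a q by (auto intro: Gamma_real_pos)
  then show ?thesis using True by (simp add: beta_distribution_def nn_integral_return)
next
  case False
  then have b: "b > 0" using b by simp
  have B: "Beta a b > 0" using a b by (simp add: Beta_def Gamma_real_pos)
  have "(\<integral>\<^sup>+ w. ennreal (w powr q) \<partial>beta_distribution a b) =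
     (\<integral>\<^sup>+ w. ennreal (if 0 < w \<and> w < 1 then w powr (a - 1) * (1 - w) powr (b - 1) / Beta a b else 0) * ennreal (w powr q) \<partial>lborel)"
    unfolding beta_distribution_def using False by (simp add: nn_integral_density)
  also have "\<dots> = (\<integral>\<^sup>+ w. ennreal (1 / Beta a b) * ennreal (if 0 < w \<and> w < 1 then w powr ((a + q) - 1) * (1 - w) powr (b - 1) else 0) \<partial>lborel)"
  proof (rule nn_integral_cong)
    fix w :: real
    have "w powr (a + q - 1) = w powr (a - 1) * w powr q" by (simp add: powr_add[symmetric] algebra_simps)
    then show "ennreal (if 0 < w \<and> w < 1 then w powr (a - 1) * (1 - w) powr (b - 1) / Beta a b else 0) * ennreal (w powr q) =
        ennreal (1 / Beta a b) * ennreal (if 0 < w \<and> w < 1 then w powr ((a + q) - 1) * (1 - w) powr (b - 1) else 0)"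
      using B by (simp add: ennreal_mult[symmetric] mult_ac)
  qed
  also have "\<dots> = ennreal (1 / Beta a b) * (\<integral>\<^sup>+ w. ennreal (if 0 < w \<and> w < 1 then w powr ((a + q) - 1) * (1 - w) powr (b - 1) else 0) \<partial>lborel)"
    by (rule nn_integral_cmult) simp
  also have "\<dots> = ennreal (1 / Beta a b * Beta (a + q) b)"
    using nn_integral_Beta_scaled[of "a + q" b 1] a b q B by (subst ennreal_mult) (auto simp: Beta_def Gamma_real_pos less_imp_le)
  also have "1 / Beta a b * Beta (a + q) b = Gamma (a + q) * Gamma (a + b) / (Gamma a * Gamma (a + b + q))"
  proof -
    have "Gamma a > 0" "Gamma b > 0" "Gamma (a + b) > 0" using a b by (auto intro: Gamma_real_pos)
    then show ?thesis by (simp add: Beta_def add_ac)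
  qed
  finally show ?thesis .
qed

lemma beta_distribution_support: "AE w in beta_distribution a b. 0 < w \<and> w \<le> 1"
proof (cases "b = 0")
  case True
  then show ?thesis unfolding beta_distribution_def if_P[OF True] by (subst AE_return) auto
next
  case False
  then show ?thesis unfolding beta_distribution_def if_not_P[OF False] by (subst AE_density) auto
qed

text \<open>The total \<open>s\<close> is kept general for the induction: once the coordinate
  \<open>j\<close> has the value \<open>y\<close>, the remaining integral is of the same form with
  total \<open>s - y\<close>, and the outer integral is a scaled Beta integral.\<close>

lemma dirichlet_integral:
  fixes a :: "nat \<Rightarrow> real"
  assumes I: "finite I" and a: "\<And>i. i \<in> I \<Longrightarrow> a i > 0" and b: "b > 0"
  shows "(\<integral>\<^sup>+ x. ennreal (if (\<forall>i\<in>I. 0 < x i) \<and> (\<Sum>i\<in>I. x i) < s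
       then (\<Prod>i\<in>I. x i powr (a i - 1)) * (s - (\<Sum>i\<in>I. x i)) powr (b - 1) else 0) \<partial>PiM I (\<lambda>_. lborel)) =
     ennreal (if 0 < s then (\<Prod>i\<in>I. Gamma (a i)) * Gamma b / Gamma ((\<Sum>i\<in>I. a i) + b) * s powr ((\<Sum>i\<in>I. a i) + b - 1) else 0)"
  using I a
proof (induction I arbitrary: s rule: finite_induct)
  case empty
  interpret product_sigma_finite "\<lambda>_::nat. lborel :: real measure" by standard
  have "Gamma b > 0" using b by (rule Gamma_real_pos)
  then show ?case by (subst nn_integral_empty) auto
next
  case (insert j I)
  interpret product_sigma_finite "\<lambda>_::nat. lborel :: real measure" by standard
  define A where "A = (\<Sum>i\<in>I. a i)"
  define K where "K = (\<Prod>i\<in>I. Gamma (a i)) * Gamma b / Gamma (A + b)"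
  have A: "A \<ge> 0" unfolding A_def using insert.prems by (intro sum_nonneg) (auto simp: less_imp_le)
  have aj: "a j > 0" using insert.prems by simp
  have K: "K \<ge> 0" unfolding K_def using A b insert.prems by (intro divide_nonneg_nonneg mult_nonneg_nonneg prod_nonneg) (auto simp: Gamma_real_pos less_imp_le)
  let ?F = "\<lambda>I s x. if (\<forall>i\<in>I. 0 < x i) \<and> (\<Sum>i\<in>I. x i) < s
       then (\<Prod>i\<in>I. x i powr (a i - 1)) * (s - (\<Sum>i\<in>I. x i)) powr (b - 1) else 0"
  have m: "(\<lambda>x. ennreal (?F J s x)) \<in> borel_measurable (PiM J (\<lambda>_. lborel))" if "finite J" for J :: "nat set" and s
  proof -
    have c[measurable]: "(\<lambda>x. x i :: real) \<in> borel_measurable (PiM J (\<lambda>_. lborel))" if "i \<in> J" for i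
      using measurable_component_singleton[OF that, of "\<lambda>_. lborel :: real measure"] by simp
    have s1: "(\<lambda>x. \<Sum>i\<in>J. x i :: real) \<in> borel_measurable (PiM J (\<lambda>_. lborel))"
      by (rule borel_measurable_sum) (rule c)
    have p1: "(\<lambda>x. \<Prod>i\<in>J. x i powr (a i - 1)) \<in> borel_measurable (PiM J (\<lambda>_. lborel))"
    proof (rule borel_measurable_prod)
      fix i assume i: "i \<in> J"
      note [measurable] = c[OF i]
      show "(\<lambda>x. x i powr (a i - 1)) \<in> borel_measurable (PiM J (\<lambda>_. lborel))" by measurable
    qed
    have q1: "Measurable.pred (PiM J (\<lambda>_. lborel)) (\<lambda>x. \<forall>i\<in>J. (0::real) < x i)"
    proof (rule pred_intros_finite(3)[OF that])
      fix i assume i: "i \<in> J"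
      note [measurable] = c[OF i]
      show "Measurable.pred (PiM J (\<lambda>_. lborel)) (\<lambda>x. (0::real) < x i)" by measurable
    qed
    show ?thesis using s1 p1 q1 by measurable
  qed
  have "(\<integral>\<^sup>+ x. ennreal (?F (insert j I) s x) \<partial>PiM (insert j I) (\<lambda>_. lborel)) =
      (\<integral>\<^sup>+ y. (\<integral>\<^sup>+ x. ennreal (?F (insert j I) s (x(j := y))) \<partial>PiM I (\<lambda>_. lborel)) \<partial>lborel)"
    by (rule product_nn_integral_insert_rev[OF insert.hyps(1,2) m]) (use insert.hyps in auto)
  also have "\<dots> = (\<integral>\<^sup>+ y. ennreal K * ennreal (if 0 < y \<and> y < s then y powr (a j - 1) * (s - y) powr ((A + b) - 1) else 0) \<partial>lborel)"
  proof (rule nn_integral_cong)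
    fix y :: real
    have upd: "?F (insert j I) s (x(j := y)) = (if 0 < y then y powr (a j - 1) * ?F I (s - y) x else 0)" for x
    proof -
      have "(\<Sum>i\<in>insert j I. (x(j := y)) i) = y + (\<Sum>i\<in>I. x i)"
        using insert.hyps by (simp, intro sum.cong) auto
      moreover have "(\<Prod>i\<in>insert j I. (x(j := y)) i powr (a i - 1)) = y powr (a j - 1) * (\<Prod>i\<in>I. x i powr (a i - 1))"
        using insert.hyps by (simp, intro disjI2 prod.cong) auto
      moreover have "(\<forall>i\<in>insert j I. 0 < (x(j := y)) i) \<longleftrightarrow> 0 < y \<and> (\<forall>i\<in>I. 0 < x i)"
        using insert.hyps by auto
      ultimately show ?thesis by (auto simp: algebra_simps)
    qed
    show "(\<integral>\<^sup>+ x. ennreal (?F (insert j I) s (x(j := y))) \<partial>PiM I (\<lambda>_. lborel)) =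
        ennreal K * ennreal (if 0 < y \<and> y < s then y powr (a j - 1) * (s - y) powr ((A + b) - 1) else 0)"
    proof (cases "0 < y")
      case True
      have "(\<integral>\<^sup>+ x. ennreal (?F (insert j I) s (x(j := y))) \<partial>PiM I (\<lambda>_. lborel)) =
          (\<integral>\<^sup>+ x. ennreal (y powr (a j - 1)) * ennreal (?F I (s - y) x) \<partial>PiM I (\<lambda>_. lborel))"
        unfolding upd using True by (intro nn_integral_cong) (auto simp: ennreal_mult')
      also have "\<dots> = ennreal (y powr (a j - 1)) * (\<integral>\<^sup>+ x. ennreal (?F I (s - y) x) \<partial>PiM I (\<lambda>_. lborel))"
        by (rule nn_integral_cmult[OF m[OF insert.hyps(1)]])
      also have "(\<integral>\<^sup>+ x. ennreal (?F I (s - y) x) \<partial>PiM I (\<lambda>_. lborel)) =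
          ennreal (if 0 < s - y then K * (s - y) powr (A + b - 1) else 0)"
        unfolding K_def A_def by (rule insert.IH) (use insert.prems in auto)
      finally show ?thesis using True K by (auto simp: ennreal_mult[symmetric] mult_ac)
    next
      case False
      then show ?thesis unfolding upd by simp
    qed
  qed
  also have "\<dots> = ennreal K * (\<integral>\<^sup>+ y. ennreal (if 0 < y \<and> y < s then y powr (a j - 1) * (s - y) powr ((A + b) - 1) else 0) \<partial>lborel)"
    by (rule nn_integral_cmult) simp
  also have "\<dots> = ennreal K * ennreal (if 0 < s then Beta (a j) (A + b) * s powr (a j + (A + b) - 1) else 0)"
    by (subst nn_integral_Beta_scaled) (use aj A b in auto)
  also have "\<dots> = ennreal (if 0 < s then (K * Beta (a j) (A + b)) * s powr (a j + (A + b) - 1) else 0)"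
    using K by (simp add: ennreal_mult'[symmetric] mult.assoc)
  also have "K * Beta (a j) (A + b) = (\<Prod>i\<in>insert j I. Gamma (a i)) * Gamma b / Gamma ((\<Sum>i\<in>insert j I. a i) + b)"
  proof -
    have "Gamma (A + b) > 0" using A b by (intro Gamma_real_pos) auto
    then show ?thesis unfolding K_def Beta_def using insert.hyps by (simp add: A_def add_ac)
  qed
  also have "a j + (A + b) - 1 = (\<Sum>i\<in>insert j I. a i) + b - 1" using insert.hyps by (simp add: A_def)
  finally show ?case .
qed

lemma tilted_exp:
  assumes "mittag_leffler_density \<gamma> g" "0 < \<gamma>" "0 < a" "0 < C" "0 \<le> t"
  shows "(\<integral>\<^sup>+ s. ennreal (exp (t * s)) \<partial>tilted C a g) < \<infinity>"
proof -
  let ?m = "\<lambda>p::nat. C * (Gamma (a + real p + 1) / Gamma (\<gamma> * (a + real p) + 1))"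
  have m0: "0 \<le> ?m p" for p
    using assms by (intro mult_nonneg_nonneg divide_nonneg_nonneg less_imp_le[OF Gamma_real_pos]) (auto intro: add_pos_nonneg add_nonneg_pos)
  have "AE s in tilted C a g. 0 \<le> s"
    using tilted_pos[OF assms(1-4)] by eventually_elim simp
  then have "(\<integral>\<^sup>+ s. ennreal (exp (t * s)) \<partial>tilted C a g) = (\<Sum>p. ennreal (t ^ p / fact p) * (\<integral>\<^sup>+ s. ennreal (s ^ p) \<partial>tilted C a g))"
    by (intro nn_integral_exp_suminf) (use assms in \<open>auto simp: tilted_def\<close>)
  also have "\<dots> = (\<Sum>p. ennreal (t ^ p / fact p * ?m p))"
    unfolding tilted_moment[OF assms(1-4)] using assms(5) by (intro suminf_cong ennreal_mult'[symmetric]) simp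
  also have "\<dots> = ennreal (\<Sum>p. t ^ p / fact p * ?m p)"
    by (rule suminf_ennreal2[OF mult_nonneg_nonneg[OF _ m0] tilted_exp_finite[OF assms]]) (use assms(5) in simp)
  finally show ?thesis by simp
qed

lemma prob_space_tilted:
  assumes "mittag_leffler_density \<gamma> g" "0 < \<gamma>" "0 < a" "C = Gamma (1 + \<gamma> * a) / Gamma (1 + a)"
  shows "prob_space (tilted C a g)"
proof
  have C: "0 < C" unfolding assms(4) using assms(2,3) by (intro divide_pos_pos Gamma_real_pos) (auto intro: add_pos_pos)
  have "emeasure (tilted C a g) (space (tilted C a g)) = (\<integral>\<^sup>+ s. ennreal (s ^ 0) \<partial>tilted C a g)" by simp
  also have "\<dots> = 1"
  proof -
    have "Gamma (1 + \<gamma> * a) > 0" "Gamma (1 + a) > 0" using assms(2,3) by (auto intro!: Gamma_real_pos add_pos_pos)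
    then show ?thesis
      unfolding tilted_moment[OF assms(1-3) C] by (simp add: assms(4) add.commute)
  qed
  finally show "emeasure (tilted C a g) (space (tilted C a g)) = 1" .
qed

lemma prob_space_beta: "0 < a \<Longrightarrow> 0 \<le> b \<Longrightarrow> prob_space (beta_distribution a b)"
proof
  assume ab: "0 < a" "0 \<le> b"
  have "emeasure (beta_distribution a b) (space (beta_distribution a b)) = (\<integral>\<^sup>+ w. 1 \<partial>beta_distribution a b)" by simp
  also have "\<dots> = (\<integral>\<^sup>+ w. ennreal (w powr 0) \<partial>beta_distribution a b)"
    by (rule nn_integral_cong_AE) (use beta_distribution_support[of a b] in \<open>auto elim!: eventually_mono\<close>)
  also have "\<dots> = 1"
  proof -
    have "Gamma a > 0" "Gamma (a + b) > 0" using ab by (auto intro!: Gamma_real_pos)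
    then show ?thesis unfolding beta_distribution_moment[OF ab order_refl] by simp
  qed
  finally show "emeasure (beta_distribution a b) (space (beta_distribution a b)) = 1" .
qed

context
  fixes a :: "real list" and m :: nat
  assumes len: "length a = Suc m" and pos: "\<And>i. i < Suc m \<Longrightarrow> 0 < a ! i"
begin

definition "dir_rest (x :: nat \<Rightarrow> real) = 1 - (\<Sum>i<m. x i)"
text \<open>The exponents are free because multiplication by a monomial only shifts them; moments of
  the Dirichlet law are then integrals of the same kernel.\<close>

definition "dir_kernel (c :: nat \<Rightarrow> real) (x :: nat \<Rightarrow> real) = (if (\<forall>i<m. 0 < x i) \<and> 0 < dir_rest x
   then (\<Prod>i<m. x i powr (c i - 1)) * dir_rest x powr (c m - 1) else 0)"

lemma dir_kernel_integral:
  assumes "\<And>i. i < Suc m \<Longrightarrow> 0 < c i"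
  shows "(\<integral>\<^sup>+ x. ennreal (dir_kernel c x) \<partial>PiM {..<m} (\<lambda>_. lborel)) =
    ennreal ((\<Prod>i<Suc m. Gamma (c i)) / Gamma (\<Sum>i<Suc m. c i))"
proof -
  have "dir_kernel c x = (if (\<forall>i\<in>{..<m}. 0 < x i) \<and> (\<Sum>i<m. x i) < 1
      then (\<Prod>i<m. x i powr (c i - 1)) * (1 - (\<Sum>i<m. x i)) powr (c m - 1) else 0)" for x
    by (simp add: dir_kernel_def dir_rest_def)
  then show ?thesis
    using dirichlet_integral[of "{..<m}" c "c m" 1] assms by simp
qed

lemma measurable_dir:
  shows "dir_rest \<in> borel_measurable (PiM {..<m} (\<lambda>_. lborel))"
    and "(\<lambda>x. x(m := dir_rest x)) \<in> PiM {..<m} (\<lambda>_. lborel) \<rightarrow>\<^sub>M PiM {..<Suc m} (\<lambda>_. borel)"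
    and "dir_kernel c \<in> borel_measurable (PiM {..<m} (\<lambda>_. lborel))"
proof -
  have c: "(\<lambda>x. x i :: real) \<in> borel_measurable (PiM {..<m} (\<lambda>_. lborel))" if "i < m" for i
    using measurable_component_singleton[of i "{..<m}" "\<lambda>_. lborel :: real measure"] that by simp
  show r[measurable]: "dir_rest \<in> borel_measurable (PiM {..<m} (\<lambda>_. lborel))"
    unfolding dir_rest_def[abs_def] by (intro borel_measurable_diff borel_measurable_const borel_measurable_sum) (use c in auto)
  show "(\<lambda>x. x(m := dir_rest x)) \<in> PiM {..<m} (\<lambda>_. lborel) \<rightarrow>\<^sub>M PiM {..<Suc m} (\<lambda>_. borel)"
  proof (rule measurable_PiM_single')
    show "(\<lambda>x. (x(m := dir_rest x)) i) \<in> PiM {..<m} (\<lambda>_. lborel) \<rightarrow>\<^sub>M borel" if "i \<in> {..<Suc m}" for i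
      using that c[of i] r by (cases "i = m") auto
    show "(\<lambda>x. x(m := dir_rest x)) \<in> space (PiM {..<m} (\<lambda>_. lborel)) \<rightarrow> (\<Pi>\<^sub>E i\<in>{..<Suc m}. space borel)"
      by (auto simp: space_PiM PiE_def extensional_def)
  qed
  have q1[measurable]: "Measurable.pred (PiM {..<m} (\<lambda>_. lborel)) (\<lambda>x. \<forall>i\<in>{..<m}. (0::real) < x i)"
  proof (rule pred_intros_finite(3)[OF finite_lessThan])
    fix i assume i: "i \<in> {..<m}"
    then have [measurable]: "(\<lambda>x. x i :: real) \<in> borel_measurable (PiM {..<m} (\<lambda>_. lborel))" using c by simp
    show "Measurable.pred (PiM {..<m} (\<lambda>_. lborel)) (\<lambda>x. (0::real) < x i)" by measurable
  qed
  have p1[measurable]: "(\<lambda>x. \<Prod>i\<in>{..<m}. x i powr (c i - 1)) \<in> borel_measurable (PiM {..<m} (\<lambda>_. lborel))" for c :: "nat \<Rightarrow> real"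
  proof (rule borel_measurable_prod)
    fix i assume i: "i \<in> {..<m}"
    then have [measurable]: "(\<lambda>x. x i :: real) \<in> borel_measurable (PiM {..<m} (\<lambda>_. lborel))" using c by simp
    show "(\<lambda>x. x i powr (c i - 1)) \<in> borel_measurable (PiM {..<m} (\<lambda>_. lborel))" by measurable
  qed
  have "(\<lambda>x. if (\<forall>i\<in>{..<m}. 0 < x i) \<and> 0 < dir_rest x then (\<Prod>i\<in>{..<m}. x i powr (c i - 1)) * dir_rest x powr (c m - 1) else 0)
     \<in> borel_measurable (PiM {..<m} (\<lambda>_. lborel))"
    by measurable
  then show "dir_kernel c \<in> borel_measurable (PiM {..<m} (\<lambda>_. lborel))"
    by (simp add: dir_kernel_def[abs_def] Ball_def)
qed

text \<open>The multivariate Beta function of the parameters.\<close>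

definition "dir_const = (\<Prod>i<Suc m. Gamma (a ! i)) / Gamma (\<Sum>i<Suc m. a ! i)"

lemma dir_const_pos: "0 < dir_const"
  unfolding dir_const_def using pos
  by (intro divide_pos_pos prod_pos Gamma_real_pos sum_pos) auto

lemma dirichlet_eq:
  "dirichlet a = distr (density (PiM {..<m} (\<lambda>_. lborel)) (\<lambda>x. ennreal (dir_kernel ((!) a) x) / ennreal dir_const))
      (PiM {..<Suc m} (\<lambda>_. borel)) (\<lambda>x. x(m := dir_rest x))"
proof -
  have Z: "(\<integral>\<^sup>+ x. ennreal (dir_kernel ((!) a) x) \<partial>PiM {..<m} (\<lambda>_. lborel)) = ennreal dir_const"
    unfolding dir_const_def by (rule dir_kernel_integral) (rule pos)
  show ?thesis
    unfolding dirichlet_def Let_def len diff_Suc_1 Z[symmetric] dir_kernel_def dir_rest_def by (rule refl)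
qed

lemma sets_dirichlet: "sets (dirichlet a) = sets (PiM {..<Suc m} (\<lambda>_. borel))"
  unfolding dirichlet_eq by simp

lemma nn_integral_dirichlet:
  assumes h: "h \<in> borel_measurable (PiM {..<Suc m} (\<lambda>_. borel))"
  shows "(\<integral>\<^sup>+ y. h y \<partial>dirichlet a) =
    (\<integral>\<^sup>+ x. ennreal (dir_kernel ((!) a) x) / ennreal dir_const * h (x(m := dir_rest x)) \<partial>PiM {..<m} (\<lambda>_. lborel))"
proof -
  have d: "(\<lambda>x. ennreal (dir_kernel ((!) a) x) / ennreal dir_const) \<in> borel_measurable (PiM {..<m} (\<lambda>_. lborel))"
    using measurable_dir(3)[of "(!) a"] by measurable
  have "(\<integral>\<^sup>+ y. h y \<partial>dirichlet a) = (\<integral>\<^sup>+ x. h (x(m := dir_rest x)) \<partial>density (PiM {..<m} (\<lambda>_. lborel)) (\<lambda>x. ennreal (dir_kernel ((!) a) x) / ennreal dir_const))"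
    unfolding dirichlet_eq by (rule nn_integral_distr) (use measurable_dir(2) h in auto)
  also have "\<dots> = (\<integral>\<^sup>+ x. ennreal (dir_kernel ((!) a) x) / ennreal dir_const * h (x(m := dir_rest x)) \<partial>PiM {..<m} (\<lambda>_. lborel))"
    by (rule nn_integral_density[OF d measurable_compose[OF measurable_dir(2) h]])
  finally show ?thesis .
qed

lemma dirichlet_moment:
  fixes p :: "nat \<Rightarrow> nat"
  shows "(\<integral>\<^sup>+ y. ennreal (\<Prod>i<Suc m. y i ^ p i) \<partial>dirichlet a) =
    ennreal ((\<Prod>i<Suc m. Gamma (a ! i + real (p i)) / Gamma (a ! i)) *
      (Gamma (\<Sum>i<Suc m. a ! i) / Gamma ((\<Sum>i<Suc m. a ! i) + real (\<Sum>i<Suc m. p i))))"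
proof -
  have "(\<integral>\<^sup>+ y. ennreal (\<Prod>i<Suc m. y i ^ p i) \<partial>dirichlet a) =
     (\<integral>\<^sup>+ x. ennreal (dir_kernel ((!) a) x) / ennreal dir_const * ennreal (\<Prod>i<Suc m. (x(m := dir_rest x)) i ^ p i) \<partial>PiM {..<m} (\<lambda>_. lborel))"
    by (rule nn_integral_dirichlet, rule measurable_compose[OF _ measurable_ennreal], rule borel_measurable_prod, rule borel_measurable_power, rule measurable_component_singleton)
  also have "\<dots> = (\<integral>\<^sup>+ x. ennreal (1 / dir_const) * ennreal (dir_kernel (\<lambda>i. a ! i + real (p i)) x) \<partial>PiM {..<m} (\<lambda>_. lborel))"
  proof (rule nn_integral_cong)
    fix x :: "nat \<Rightarrow> real"
    have "dir_kernel ((!) a) x * (\<Prod>i<Suc m. (x(m := dir_rest x)) i ^ p i) = dir_kernel (\<lambda>i. a ! i + real (p i)) x"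
    proof (cases "(\<forall>i<m. 0 < x i) \<and> 0 < dir_rest x")
      case True
      have P: "(\<Prod>i<Suc m. (x(m := dir_rest x)) i ^ p i) = (\<Prod>i<m. x i ^ p i) * dir_rest x ^ p m"
        unfolding prod.lessThan_Suc by (auto intro!: arg_cong2[of _ _ _ _ "(*)"] prod.cong)
      have 1: "y powr (b - 1) * y ^ q = y powr (b + real q - 1)" if "0 < y" for y b :: real and q
      proof -
        have "y powr (b + real q - 1) = y powr ((b - 1) + real q)" by (simp add: algebra_simps)
        also have "\<dots> = y powr (b - 1) * y ^ q" unfolding powr_add using that by (simp add: powr_realpow)
        finally show ?thesis by simp
      qed
      have 2: "(\<Prod>i<m. x i powr (a ! i - 1)) * (\<Prod>i<m. x i ^ p i) = (\<Prod>i<m. x i powr (a ! i + real (p i) - 1))"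
        unfolding prod.distrib[symmetric] using True by (intro prod.cong) (auto simp: 1)
      show ?thesis unfolding P dir_kernel_def if_P[OF True] 2[symmetric] 1[OF conjunct2[OF True], symmetric] by (simp add: mult_ac)
    next
      case False
      then show ?thesis unfolding dir_kernel_def if_not_P[OF False] by simp
    qed
    moreover have "0 \<le> dir_kernel ((!) a) x" unfolding dir_kernel_def by (auto intro!: mult_nonneg_nonneg prod_nonneg)
    ultimately show "ennreal (dir_kernel ((!) a) x) / ennreal dir_const * ennreal (\<Prod>i<Suc m. (x(m := dir_rest x)) i ^ p i) =
        ennreal (1 / dir_const) * ennreal (dir_kernel (\<lambda>i. a ! i + real (p i)) x)"
      using dir_const_pos by (simp add: divide_ennreal ennreal_mult'[symmetric] flip: \<open>_ = dir_kernel (\<lambda>i. a ! i + real (p i)) x\<close>)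
  qed
  also have "\<dots> = ennreal (1 / dir_const) * (\<integral>\<^sup>+ x. ennreal (dir_kernel (\<lambda>i. a ! i + real (p i)) x) \<partial>PiM {..<m} (\<lambda>_. lborel))"
    by (rule nn_integral_cmult) (use measurable_dir(3) in measurable)
  also have "\<dots> = ennreal (1 / dir_const) * ennreal ((\<Prod>i<Suc m. Gamma (a ! i + real (p i))) / Gamma (\<Sum>i<Suc m. a ! i + real (p i)))"
    by (subst dir_kernel_integral) (use pos in \<open>auto intro: add_pos_nonneg\<close>)
  also have "\<dots> = ennreal (1 / dir_const * ((\<Prod>i<Suc m. Gamma (a ! i + real (p i))) / Gamma (\<Sum>i<Suc m. a ! i + real (p i))))"
    using dir_const_pos by (subst ennreal_mult') auto
  also have "1 / dir_const * ((\<Prod>i<Suc m. Gamma (a ! i + real (p i))) / Gamma (\<Sum>i<Suc m. a ! i + real (p i))) =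
      (\<Prod>i<Suc m. Gamma (a ! i + real (p i)) / Gamma (a ! i)) *
      (Gamma (\<Sum>i<Suc m. a ! i) / Gamma ((\<Sum>i<Suc m. a ! i) + real (\<Sum>i<Suc m. p i)))"
  proof -
    have "(\<Sum>i<Suc m. a ! i + real (p i)) = (\<Sum>i<Suc m. a ! i) + real (\<Sum>i<Suc m. p i)"
      unfolding sum.distrib of_nat_sum ..
    moreover have "1 / (x / y) * (u / v) = u / x * (y / v)" for x y u v :: real by simp
    ultimately show ?thesis unfolding dir_const_def prod_dividef by (simp only:)
  qed
  finally show ?thesis .
qed

lemma dirichlet_support: "AE y in dirichlet a. (\<forall>i<Suc m. 0 < y i) \<and> (\<Sum>i<Suc m. y i) = 1"
proof -
  have c: "(\<lambda>y. y i :: real) \<in> borel_measurable (PiM {..<Suc m} (\<lambda>_. borel))" if "i < Suc m" for i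
    using that by simp
  have q1: "Measurable.pred (PiM {..<Suc m} (\<lambda>_. borel)) (\<lambda>y. \<forall>i\<in>{..<Suc m}. (0::real) < y i)"
  proof (rule pred_intros_finite(3)[OF finite_lessThan])
    fix i assume i: "i \<in> {..<Suc m}"
    then have [measurable]: "(\<lambda>x. x i :: real) \<in> borel_measurable (PiM {..<Suc m} (\<lambda>_. borel))" using c by simp
    show "Measurable.pred (PiM {..<Suc m} (\<lambda>_. borel)) (\<lambda>x. (0::real) < x i)" by measurable
  qed
  have s1: "(\<lambda>y. \<Sum>i<Suc m. y i :: real) \<in> borel_measurable (PiM {..<Suc m} (\<lambda>_. borel))"
    by (rule borel_measurable_sum) (use c in auto)
  have m: "{y \<in> space (PiM {..<Suc m} (\<lambda>_. borel)). (\<forall>i<Suc m. 0 < y i) \<and> (\<Sum>i<Suc m. y i) = (1::real)} \<in> sets (PiM {..<Suc m} (\<lambda>_. borel))"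
    using q1 s1 unfolding Ball_def lessThan_iff by measurable
  have d: "(\<lambda>x. ennreal (dir_kernel ((!) a) x) / ennreal dir_const) \<in> borel_measurable (PiM {..<m} (\<lambda>_. lborel))"
    using measurable_dir(3)[of "(!) a"] by measurable
  have t: "(\<lambda>x. x(m := dir_rest x)) \<in> density (PiM {..<m} (\<lambda>_. lborel)) (\<lambda>x. ennreal (dir_kernel ((!) a) x) / ennreal dir_const)
      \<rightarrow>\<^sub>M PiM {..<Suc m} (\<lambda>_. borel)"
    using measurable_dir(2) by simp
  have key: "(\<forall>i<Suc m. 0 < (x(m := dir_rest x)) i) \<and> (\<Sum>i<Suc m. (x(m := dir_rest x)) i) = 1"
    if "0 < ennreal (dir_kernel ((!) a) x) / ennreal dir_const" for x
  proof -
    have "dir_kernel ((!) a) x \<noteq> 0" using that by auto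
    then have "(\<forall>i<m. 0 < x i) \<and> 0 < dir_rest x" unfolding dir_kernel_def by (auto split: if_splits)
    moreover have "(\<Sum>i<Suc m. (x(m := dir_rest x)) i) = (\<Sum>i<m. x i) + dir_rest x"
      unfolding sum.lessThan_Suc by (auto intro!: arg_cong2[of _ _ _ _ "(+)"] sum.cong)
    ultimately show ?thesis by (auto simp: less_Suc_eq dir_rest_def)
  qed
  show ?thesis
    unfolding dirichlet_eq by (subst AE_distr_iff[OF t m], subst AE_density[OF d]) (use key in \<open>auto intro!: AE_I2\<close>)
qed

lemma prob_space_dirichlet: "prob_space (dirichlet a)"
proof
  have "emeasure (dirichlet a) (space (dirichlet a)) = (\<integral>\<^sup>+ y. ennreal (\<Prod>i<Suc m. y i ^ (0::nat)) \<partial>dirichlet a)" by simp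
  also have "\<dots> = 1"
  proof -
    have "Gamma (a ! i) > 0" if "i < Suc m" for i using pos[OF that] by (rule Gamma_real_pos)
    then have 1: "(\<Prod>i<Suc m. Gamma (a ! i + real 0) / Gamma (a ! i)) = 1"
      by (intro prod.neutral) force
    have "Gamma (\<Sum>i<Suc m. a ! i) > 0" using pos by (intro Gamma_real_pos sum_pos) auto
    then show ?thesis unfolding dirichlet_moment[of "\<lambda>_. 0"] 1 by (simp del: sum.lessThan_Suc)
  qed
  finally show "emeasure (dirichlet a) (space (dirichlet a)) = 1" .
qed

end

section \<open>Almost sure statements and integrals on product spaces\<close>

lemma AE_pair_fst:
  assumes "prob_space N" "AE x in M. P x"
  shows "AE z in M \<Otimes>\<^sub>M N. P (fst z)"
proof -
  interpret N: prob_space N by fact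
  obtain A where A: "A \<in> null_sets M" "{x \<in> space M. \<not> P x} \<subseteq> A"
    using assms(2) unfolding eventually_ae_filter by blast
  have "A \<times> space N \<in> null_sets (M \<Otimes>\<^sub>M N)"
    using A(1) by (auto simp: null_sets_def N.emeasure_pair_measure_Times)
  then show ?thesis
    by (rule AE_I') (use A(2) in \<open>auto simp: space_pair_measure\<close>)
qed

lemma AE_pair_snd:
  assumes "prob_space M" "prob_space N" "AE y in N. P y"
  shows "AE z in M \<Otimes>\<^sub>M N. P (snd z)"
proof -
  interpret N: prob_space N by fact
  obtain A where A: "A \<in> null_sets N" "{x \<in> space N. \<not> P x} \<subseteq> A"
    using assms(3) unfolding eventually_ae_filter by blast
  have "space M \<times> A \<in> null_sets (M \<Otimes>\<^sub>M N)"
    using A(1) by (auto simp: null_sets_def N.emeasure_pair_measure_Times)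
  then show ?thesis
    by (rule AE_I') (use A(2) in \<open>auto simp: space_pair_measure\<close>)
qed

lemma nn_integral_pair_mult:
  assumes "sigma_finite_measure N" and f[measurable]: "f \<in> borel_measurable M" and h[measurable]: "h \<in> borel_measurable N"
  shows "(\<integral>\<^sup>+ z. f (fst z) * h (snd z) \<partial>(M \<Otimes>\<^sub>M N)) = (\<integral>\<^sup>+ x. f x \<partial>M) * (\<integral>\<^sup>+ y. h y \<partial>N)"
proof -
  interpret N: sigma_finite_measure N by fact
  have "(\<integral>\<^sup>+ z. f (fst z) * h (snd z) \<partial>(M \<Otimes>\<^sub>M N)) = (\<integral>\<^sup>+ x. \<integral>\<^sup>+ y. f x * h y \<partial>N \<partial>M)"
    by (subst N.nn_integral_fst[symmetric]) auto
  also have "\<dots> = (\<integral>\<^sup>+ x. f x * (\<integral>\<^sup>+ y. h y \<partial>N) \<partial>M)"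
    by (intro nn_integral_cong nn_integral_cmult) simp
  also have "\<dots> = (\<integral>\<^sup>+ x. f x \<partial>M) * (\<integral>\<^sup>+ y. h y \<partial>N)"
    by (rule nn_integral_multc) simp
  finally show ?thesis .
qed

section \<open>The growth chain\<close>

text \<open>Makes \<open>\<gamma> * (card (tree_path E e) + edge_shift \<alpha> \<gamma> e)\<close> the total weight of the edges of \<open>E\<close> on the
  path that replaces \<open>e\<close>: a leaf edge has weight \<open>1 - \<alpha>\<close> instead of \<open>\<gamma>\<close>.\<close>

definition edge_shift :: "real \<Rightarrow> real \<Rightarrow> edge \<Rightarrow> real" where
  "edge_shift \<alpha> \<gamma> e = (if leaf_edge e then (1 - \<alpha>) / \<gamma> - 1 else 0)"

text \<open>The one-step law of the chain. A quantity that depends on the chosen site only through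
  the path that contains it, the rest of the region, or the complement of the region is averaged
  with the weights \<open>\<gamma> * Y e\<close>, \<open>U\<close> minus their sum, and
  \<open>n - \<alpha> - U\<close>.\<close>

lemma sum_sites_reduces_to:
  fixes H :: "site \<Rightarrow> real"
  assumes red: "reduces_to k t n E J" and \<gamma>: "\<gamma> \<noteq> 0" and fin: "finite t"
    and path: "\<And>e f. e \<in> t \<Longrightarrow> f \<in> tree_path E e \<Longrightarrow> H (Edge_Site f) = G e"
    and off: "\<And>s. s \<in> edge_region t J E \<Longrightarrow> s \<notin> (\<Union>e\<in>t. Edge_Site ` tree_path E e) \<Longrightarrow> H s = G1"
    and rest: "\<And>s. s \<in> sites E \<Longrightarrow> s \<notin> edge_region t J E \<Longrightarrow> H s = G0"
    and Y: "\<And>e. e \<in> t \<Longrightarrow> Y e = real (card (tree_path E e)) + edge_shift \<alpha> \<gamma> e"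
    and U: "U = (\<Sum>e\<in>t. edge_weight \<alpha> \<gamma> e) + real (card J)"
  shows "(\<Sum>s\<in>sites E. site_weight \<alpha> \<gamma> E s * H s) =
     (\<Sum>e\<in>t. \<gamma> * Y e * G e) + (U - (\<Sum>e\<in>t. \<gamma> * Y e)) * G1 + (real n - \<alpha> - U) * G0"
proof -
  let ?w = "site_weight \<alpha> \<gamma> E"
  note pr = red_proper[OF red] and R = reduces_toD[OF red]
  have finS: "finite (sites E)" using proper_finite[OF pr] unfolding sites_def by auto
  define P where "P = (\<Union>e\<in>t. Edge_Site ` tree_path E e)"
  have PR: "P \<subseteq> edge_region t J E" unfolding P_def using path_region[OF red] by blast
  note RS = edge_region_sites[OF red]
  have wP: "(\<Sum>s\<in>Edge_Site ` tree_path E e. ?w s) = \<gamma> * Y e" if e: "e \<in> t" for e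
  proof -
    have "(\<Sum>s\<in>Edge_Site ` tree_path E e. ?w s) = (\<Sum>f\<in>tree_path E e. edge_weight \<alpha> \<gamma> f)"
      by (simp add: sum.reindex inj_on_def)
    also have "\<dots> = \<gamma> * (real (card (tree_path E e)) - 1) + edge_weight \<alpha> \<gamma> e" by (rule R(9)[OF e])
    also have "\<dots> = \<gamma> * Y e" unfolding Y[OF e] using \<gamma> by (auto simp: edge_shift_def field_simps)
    finally show ?thesis .
  qed
  have sumP: "(\<Sum>s\<in>P. ?w s * K s) = (\<Sum>e\<in>t. \<Sum>s\<in>Edge_Site ` tree_path E e. ?w s * K s)" for K
    unfolding P_def
  proof (rule sum.UNION_disjoint[OF fin])
    show "\<forall>e\<in>t. finite (Edge_Site ` tree_path E e)" using finite_tree_path[OF pr] by auto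
    show "\<forall>e\<in>t. \<forall>f\<in>t. e \<noteq> f \<longrightarrow> Edge_Site ` tree_path E e \<inter> Edge_Site ` tree_path E f = {}"
      using R(8) by blast
  qed
  have 1: "(\<Sum>s\<in>P. ?w s * H s) = (\<Sum>e\<in>t. \<gamma> * Y e * G e)"
  proof -
    have "(\<Sum>s\<in>P. ?w s * H s) = (\<Sum>e\<in>t. \<Sum>s\<in>Edge_Site ` tree_path E e. ?w s * G e)"
      unfolding sumP using path by (intro sum.cong) auto
    also have "\<dots> = (\<Sum>e\<in>t. \<gamma> * Y e * G e)"
      using wP by (intro sum.cong) (auto simp: sum_distrib_right[symmetric])
    finally show ?thesis .
  qed
  have 2: "(\<Sum>s\<in>P. ?w s) = (\<Sum>e\<in>t. \<gamma> * Y e)"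
    using sumP[of "\<lambda>_. 1"] wP by simp
  have 3: "(\<Sum>s\<in>edge_region t J E. ?w s) = U" using R(10) U by simp
  have 4: "(\<Sum>s\<in>sites E. ?w s) = real n - \<alpha>" by (rule total_weight[OF R(2)])
  have "(\<Sum>s\<in>sites E. ?w s * H s) = (\<Sum>s\<in>sites E - edge_region t J E. ?w s * H s) + (\<Sum>s\<in>edge_region t J E. ?w s * H s)"
    by (rule sum.subset_diff[OF RS finS])
  also have "(\<Sum>s\<in>sites E - edge_region t J E. ?w s * H s) = (\<Sum>s\<in>sites E - edge_region t J E. ?w s) * G0"
    unfolding sum_distrib_right using rest by (intro sum.cong) auto
  also have "(\<Sum>s\<in>sites E - edge_region t J E. ?w s) = real n - \<alpha> - U"
    using sum.subset_diff[OF RS finS, of ?w] 3 4 by simp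
  also have "(\<Sum>s\<in>edge_region t J E. ?w s * H s) =
      (\<Sum>s\<in>edge_region t J E - P. ?w s * H s) + (\<Sum>s\<in>P. ?w s * H s)"
    by (rule sum.subset_diff[OF PR finite_subset[OF RS finS]])
  also have "(\<Sum>s\<in>edge_region t J E - P. ?w s * H s) = (\<Sum>s\<in>edge_region t J E - P. ?w s) * G1"
    unfolding sum_distrib_right using off by (intro sum.cong) (auto simp: P_def)
  also have "(\<Sum>s\<in>edge_region t J E - P. ?w s) = U - (\<Sum>e\<in>t. \<gamma> * Y e)"
    using sum.subset_diff[OF PR finite_subset[OF RS finS], of ?w] 2 3 by simp
  finally show ?thesis using 1 by simp
qed

section \<open>Finite histories and functionals of finitely many trees\<close>

instance vertex :: countable by countable_datatype

text \<open>Countability makes every function of finitely many trees of the sequence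
  measurable.\<close>

lemma countable_trees: "countable (trees n)"
proof (rule countable_subset)
  show "trees n \<subseteq> {E :: tree. finite E}" by (auto simp: trees_def rooted_tree_def)
  show "countable {E :: tree. finite E}" by (rule countable_Collect_finite)
qed

text \<open>Adaptedness, phrased for deterministic sequences: a functional determined by the first
  \<open>n\<close> trees. It takes the place of measurability with respect to a filtration.\<close>

definition depends :: "nat \<Rightarrow> ((nat \<Rightarrow> tree) \<Rightarrow> 'b) \<Rightarrow> bool" where
  "depends n f \<longleftrightarrow> (\<forall>t t'. (\<forall>i\<in>{1..n}. t i = t' i) \<longrightarrow> f t = f t')"

lemma dependsD: "depends n f \<Longrightarrow> (\<And>i. i \<in> {1..n} \<Longrightarrow> t i = t' i) \<Longrightarrow> f t = f t'"
  by (auto simp: depends_def)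

lemma depends_mono: "depends n f \<Longrightarrow> n \<le> m \<Longrightarrow> depends m f"
  unfolding depends_def by (meson atLeastAtMost_iff order_trans)

definition extend :: "(nat \<Rightarrow> tree) \<Rightarrow> nat \<Rightarrow> site \<Rightarrow> nat \<Rightarrow> tree" where
  "extend t n s = t(Suc n := insert_leaf (Suc n) (t n) s)"

definition first_tree :: tree where "first_tree = {(Root, Leaf 1)}"

text \<open>The possible values of the first \<open>m + 1\<close> trees, the index being shifted
  because trees start at time one. Sequences are \<open>undefined\<close> at all other times, so
  that a history is determined by its relevant values and sums over histories are well
  posed.\<close>

primrec histories :: "nat \<Rightarrow> (nat \<Rightarrow> tree) set" where
  "histories 0 = {(\<lambda>_. undefined)(Suc 0 := first_tree)}"
| "histories (Suc m) = (\<lambda>(t, E). t(Suc (Suc m) := E)) `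
      (SIGMA t:histories m. insert_leaf (Suc (Suc m)) (t (Suc m)) ` sites (t (Suc m)))"

lemma histories_props:
  "t \<in> histories m \<Longrightarrow> (\<forall>i. i \<notin> {1..Suc m} \<longrightarrow> t i = undefined) \<and> (\<forall>i\<in>{1..Suc m}. grown i (t i)) \<and>
     t 1 = first_tree \<and>
     (\<forall>i\<in>{1..m}. \<exists>s\<in>sites (t i). t (Suc i) = insert_leaf (Suc i) (t i) s)"
proof (induction m arbitrary: t)
  case 0
  then show ?case using grown.base by (auto simp: first_tree_def)
next
  case (Suc m)
  then obtain u s where u: "u \<in> histories m" "s \<in> sites (u (Suc m))"
    "t = u(Suc (Suc m) := insert_leaf (Suc (Suc m)) (u (Suc m)) s)" by auto
  note IH = Suc.IH[OF u(1)]
  have "grown (Suc m) (u (Suc m))" using IH by auto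
  then have "grown (Suc (Suc m)) (t (Suc (Suc m)))" using grown.step u by auto
  moreover have "grown i (t i)" if "i \<in> {1..Suc m}" for i using that IH u(3) by auto
  ultimately have "\<forall>i\<in>{1..Suc (Suc m)}. grown i (t i)" by (metis atLeastAtMost_iff le_SucE)
  moreover have "\<exists>s\<in>sites (t i). t (Suc i) = insert_leaf (Suc i) (t i) s" if "i \<in> {1..Suc m}" for i
  proof (cases "i = Suc m")
    case True
    then show ?thesis using u by auto
  next
    case False
    then have "i \<in> {1..m}" using that by auto
    then show ?thesis using IH u(3) by auto
  qed
  ultimately show ?case using IH u(3) by auto
qed

lemma finite_sites: "grown n E \<Longrightarrow> finite (sites E)"
  using proper_finite[OF proper_grown] unfolding sites_def by auto

lemma finite_histories: "finite (histories m)"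
proof (induction m)
  case (Suc m)
  have "finite (insert_leaf (Suc (Suc m)) (t (Suc m)) ` sites (t (Suc m)))" if "t \<in> histories m" for t
    using histories_props[OF that] finite_sites[of "Suc m" "t (Suc m)"] by auto
  then show ?case using Suc by (auto intro!: finite_imageI finite_SigmaI)
qed simp

text \<open>\<open>growth_prob\<close> groups sites by the tree they lead to; summing over the trees
  undoes the grouping.\<close>

lemma sum_growth_prob:
  fixes g :: "tree \<Rightarrow> real"
  assumes "grown n E"
  shows "(\<Sum>E'\<in>insert_leaf (Suc n) E ` sites E. growth_prob \<alpha> \<gamma> n E E' * g E') =
    (\<Sum>s\<in>sites E. site_weight \<alpha> \<gamma> E s / (real n - \<alpha>) * g (insert_leaf (Suc n) E s))"
  unfolding growth_prob_def total_weight[OF assms] Suc_eq_plus1[symmetric]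
  unfolding sum.image_gen[OF finite_sites[OF assms], of _ "insert_leaf (Suc n) E"]
  by (intro sum.cong) (auto simp: sum_divide_distrib sum_distrib_right)

locale alpha_gamma = prob_space M for M :: "'a measure" +
  fixes \<alpha> \<gamma> :: real and T :: "nat \<Rightarrow> 'a \<Rightarrow> tree"
  assumes \<alpha>: "0 < \<alpha>" "\<alpha> < 1" and \<gamma>: "0 < \<gamma>" "\<gamma> \<le> \<alpha>"
    and agt: "alpha_gamma_trees \<alpha> \<gamma> M T"
begin

lemma T_trees: "n \<ge> 1 \<Longrightarrow> \<omega> \<in> space M \<Longrightarrow> T n \<omega> \<in> trees n"
  using agt measurable_space[of "T n" M "count_space (trees n)"] unfolding alpha_gamma_trees_def by auto

abbreviation seq :: "'a \<Rightarrow> nat \<Rightarrow> tree" where "seq \<omega> \<equiv> (\<lambda>i. T i \<omega>)"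

definition hist_prob :: "nat \<Rightarrow> (nat \<Rightarrow> tree) \<Rightarrow> real" where
  "hist_prob n t = prob {\<omega> \<in> space M. \<forall>i\<in>{1..n}. T i \<omega> = t i}"

lemma hist_event: "{\<omega> \<in> space M. \<forall>i\<in>{1..n}. T i \<omega> = t i} \<in> sets M"
proof -
  have "{\<omega> \<in> space M. T i \<omega> = t i} \<in> sets M" if "i \<in> {1..n}" for i
  proof (cases "t i \<in> trees i")
    case True
    have "T i \<in> M \<rightarrow>\<^sub>M count_space (trees i)" using agt that unfolding alpha_gamma_trees_def by auto
    then have "T i -` {t i} \<inter> space M \<in> sets M" using True by (auto intro: measurable_sets)
    moreover have "T i -` {t i} \<inter> space M = {\<omega> \<in> space M. T i \<omega> = t i}" by auto
    ultimately show ?thesis by simp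
  next
    case False
    have "T i \<omega> \<noteq> t i" if "\<omega> \<in> space M" for \<omega>
      using T_trees[of i \<omega>] that \<open>i \<in> {1..n}\<close> False by fastforce
    then have "{\<omega> \<in> space M. T i \<omega> = t i} = {}" by blast
    then show ?thesis by (metis sets.empty_sets)
  qed
  then show ?thesis by (auto intro: sets.sets_Collect_finite_All)
qed

lemma measurable_depends:
  assumes f: "depends n f"
  shows "(\<lambda>\<omega>. f (seq \<omega>)) \<in> M \<rightarrow>\<^sub>M count_space UNIV"
proof -
  let ?H = "PiE {1..n} trees"
  let ?h = "\<lambda>\<omega>. restrict (seq \<omega>) {1..n}"
  have c: "countable ?H" by (intro countable_PiE) (auto simp: countable_trees)
  have "?h \<in> M \<rightarrow>\<^sub>M count_space ?H"
    unfolding measurable_count_space_eq_countable[OF c]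
  proof (intro conjI ballI)
    show "?h \<in> space M \<rightarrow> ?H" using T_trees by auto
    fix t assume "t \<in> ?H"
    then have "?h -` {t} \<inter> space M = {\<omega> \<in> space M. \<forall>i\<in>{1..n}. T i \<omega> = t i}"
      by (auto simp: fun_eq_iff PiE_def extensional_def restrict_def)
    then show "?h -` {t} \<inter> space M \<in> sets M" using hist_event by simp
  qed
  then have "(\<lambda>\<omega>. f (?h \<omega>)) \<in> M \<rightarrow>\<^sub>M count_space UNIV"
    by (rule measurable_compose) simp
  moreover have "f (?h \<omega>) = f (seq \<omega>)" for \<omega>
    using f by (rule dependsD) auto
  ultimately show ?thesis by simp
qed

lemma measurable_depends_borel:
  assumes f: "depends n f"
  shows "(\<lambda>\<omega>. f (seq \<omega>)) \<in> borel_measurable M"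
  using measurable_compose[OF measurable_depends[OF f], of id borel] by simp

text \<open>The transition rule is prescribed from time two onwards. The step from the first tree to
  the second is deterministic and fits the rule as well, because the single edge is the only site of
  the first tree.\<close>

lemma hist_prob_Suc:
  assumes "t \<in> histories m" and E: "E \<in> insert_leaf (Suc (Suc m)) (t (Suc m)) ` sites (t (Suc m))"
  shows "hist_prob (Suc (Suc m)) (t(Suc (Suc m) := E)) = hist_prob (Suc m) t * growth_prob \<alpha> \<gamma> (Suc m) (t (Suc m)) E"
proof (cases "m = 0")
  case False
  let ?t = "t(Suc (Suc m) := E)"
  have "hist_prob (Suc m + 1) ?t = hist_prob (Suc m) ?t * growth_prob \<alpha> \<gamma> (Suc m) (?t (Suc m)) (?t (Suc m + 1))"
    using agt False unfolding alpha_gamma_trees_def hist_prob_def by simp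
  moreover have "hist_prob (Suc m) ?t = hist_prob (Suc m) t"
    unfolding hist_prob_def by (intro arg_cong[of _ _ prob]) auto
  ultimately show ?thesis by simp
next
  case True
  let ?e = "(Root, Leaf 1)" and ?E2 = "{(Root, Branch 2), (Branch 2, Leaf 1), (Branch 2, Leaf 2)}"
  have t1: "t (Suc 0) = first_tree" using histories_props[OF assms(1)] by simp
  have T1: "T (Suc 0) \<omega> = first_tree" "T 2 \<omega> = ?E2" if "\<omega> \<in> space M" for \<omega>
    using agt that unfolding alpha_gamma_trees_def first_tree_def by auto
  have "degree first_tree v \<le> card first_tree" for v
    unfolding degree_def by (intro card_mono) (auto simp: first_tree_def)
  then have "degree first_tree v \<le> 1" for v by (simp add: first_tree_def)
  then have "\<not> 3 \<le> degree first_tree v" for v by (meson le_trans numeral_le_one_iff semiring_norm(70))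
  then have "sites first_tree = Edge_Site ` first_tree" by (auto simp: sites_def)
  then have s: "sites first_tree = {Edge_Site ?e}" by (simp add: first_tree_def)
  have ins: "insert_leaf (Suc (Suc 0)) first_tree (Edge_Site ?e) = ?E2"
    by (auto simp: first_tree_def numeral_2_eq_2)
  have "E \<in> insert_leaf (Suc (Suc 0)) first_tree ` {Edge_Site ?e}" using E True t1 s by simp
  then have E2: "E = ?E2" using ins by blast
  have "growth_prob \<alpha> \<gamma> (Suc 0) first_tree ?E2 = 1"
  proof -
    have "{s' \<in> {Edge_Site ?e}. insert_leaf (Suc (Suc 0)) first_tree s' = ?E2} = {Edge_Site ?e}"
      using ins by blast
    then show ?thesis unfolding growth_prob_def s Suc_eq_plus1[symmetric]
      using \<alpha> by (simp only:) (simp add: leaf_edge_def)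
  qed
  moreover have "{\<omega> \<in> space M. \<forall>i\<in>{1..Suc 0}. T i \<omega> = t i} = space M"
    using T1 t1 by auto
  moreover have "{\<omega> \<in> space M. \<forall>i\<in>{1..Suc (Suc 0)}. T i \<omega> = (t(Suc (Suc 0) := E)) i} = space M"
  proof -
    have "{1..Suc (Suc 0)} = {Suc 0, Suc (Suc 0)}" by auto
    moreover have "T (Suc (Suc 0)) \<omega> = E" if "\<omega> \<in> space M" for \<omega>
      using T1(2)[OF that] E2 by (simp only: numeral_2_eq_2)
    ultimately show ?thesis using T1(1) t1 by auto
  qed
  ultimately show ?thesis
    using True E2 t1 unfolding hist_prob_def by (simp add: prob_space)
qed

lemma inj_on_histories:
  "inj_on (\<lambda>(t, E). t(Suc (Suc m) := E)) (SIGMA t:histories m. X t)"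
proof (rule inj_onI, clarify)
  fix t E t' E' assume t: "t \<in> histories m" "t' \<in> histories m"
    and eq: "t(Suc (Suc m) := E) = t'(Suc (Suc m) := E')"
  have "t i = t' i" for i
  proof (cases "i = Suc (Suc m)")
    case True
    then show ?thesis using histories_props[OF t(1)] histories_props[OF t(2)] by simp
  next
    case False
    then show ?thesis using fun_cong[OF eq, of i] by simp
  qed
  then show "t = t' \<and> E = E'" using fun_cong[OF eq, of "Suc (Suc m)"] by auto
qed

lemma sum_histories_Suc:
  "(\<Sum>t\<in>histories (Suc m). hist_prob (Suc (Suc m)) t * f t) =
   (\<Sum>t\<in>histories m. hist_prob (Suc m) t *
      (\<Sum>s\<in>sites (t (Suc m)). site_weight \<alpha> \<gamma> (t (Suc m)) s / (real (Suc m) - \<alpha>) * f (extend t (Suc m) s)))"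
proof -
  let ?X = "\<lambda>t. insert_leaf (Suc (Suc m)) (t (Suc m)) ` sites (t (Suc m))"
  have gr: "grown (Suc m) (t (Suc m))" if "t \<in> histories m" for t
    using histories_props[OF that] by simp
  have "(\<Sum>t\<in>histories (Suc m). hist_prob (Suc (Suc m)) t * f t) =
      (\<Sum>(t, E)\<in>Sigma (histories m) ?X. hist_prob (Suc (Suc m)) (t(Suc (Suc m) := E)) * f (t(Suc (Suc m) := E)))"
    unfolding histories.simps by (subst sum.reindex[OF inj_on_histories]) (simp add: case_prod_unfold)
  also have "\<dots> = (\<Sum>t\<in>histories m. \<Sum>E\<in>?X t. hist_prob (Suc (Suc m)) (t(Suc (Suc m) := E)) * f (t(Suc (Suc m) := E)))"
    using finite_histories finite_sites[OF gr] by (subst sum.Sigma) auto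
  also have "\<dots> = (\<Sum>t\<in>histories m. \<Sum>E\<in>?X t. hist_prob (Suc m) t * (growth_prob \<alpha> \<gamma> (Suc m) (t (Suc m)) E * f (t(Suc (Suc m) := E))))"
    by (intro sum.cong refl) (simp add: hist_prob_Suc)
  also have "\<dots> = (\<Sum>t\<in>histories m. hist_prob (Suc m) t *
      (\<Sum>s\<in>sites (t (Suc m)). site_weight \<alpha> \<gamma> (t (Suc m)) s / (real (Suc m) - \<alpha>) * f (extend t (Suc m) s)))"
    unfolding sum_distrib_left[symmetric]
  proof (intro sum.cong refl arg_cong2[of _ _ _ _ "(*)"])
    fix t assume t: "t \<in> histories m"
    show "(\<Sum>E\<in>?X t. growth_prob \<alpha> \<gamma> (Suc m) (t (Suc m)) E * f (t(Suc (Suc m) := E))) =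
      (\<Sum>s\<in>sites (t (Suc m)). site_weight \<alpha> \<gamma> (t (Suc m)) s / (real (Suc m) - \<alpha>) * f (extend t (Suc m) s))"
      unfolding extend_def by (rule sum_growth_prob[OF gr[OF t]])
  qed
  finally show ?thesis .
qed

lemma sum_hist_prob: "(\<Sum>t\<in>histories m. hist_prob (Suc m) t) = 1"
proof (induction m)
  case 0
  have "{\<omega> \<in> space M. \<forall>i\<in>{1..Suc 0}. T i \<omega> = ((\<lambda>_. undefined)(Suc 0 := first_tree)) i} = space M"
    using agt unfolding alpha_gamma_trees_def first_tree_def by auto
  then show ?case by (simp add: hist_prob_def prob_space)
next
  case (Suc m)
  have "(\<Sum>s\<in>sites (t (Suc m)). site_weight \<alpha> \<gamma> (t (Suc m)) s / (real (Suc m) - \<alpha>) * 1) = 1"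
    if "t \<in> histories m" for t
  proof -
    have "grown (Suc m) (t (Suc m))" using histories_props[OF that] by simp
    from total_weight[OF this, of \<alpha> \<gamma>] show ?thesis
      using \<alpha> by (simp add: sum_divide_distrib[symmetric])
  qed
  then show ?case using sum_histories_Suc[of m "\<lambda>_. 1"] Suc by simp
qed

lemma hist_disjoint:
  assumes "t \<in> histories m" "t' \<in> histories m" "\<forall>i\<in>{1..Suc m}. T i \<omega> = t i" "\<forall>i\<in>{1..Suc m}. T i \<omega> = t' i"
  shows "t = t'"
proof
  fix i
  show "t i = t' i"
    using histories_props[OF assms(1)] histories_props[OF assms(2)] assms(3,4)
    by (cases "i \<in> {1..Suc m}") metis+
qed

text \<open>The events of distinct histories are disjoint and their probabilities add up to one.
  Membership in \<open>trees n\<close> alone would not say that consecutive trees differ by an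
  insertion; this does, almost surely.\<close>

lemma AE_histories: "AE \<omega> in M. \<exists>t\<in>histories m. \<forall>i\<in>{1..Suc m}. T i \<omega> = t i"
proof -
  let ?A = "\<lambda>t. {\<omega> \<in> space M. \<forall>i\<in>{1..Suc m}. T i \<omega> = t i}"
  have "prob (\<Union>t\<in>histories m. ?A t) = (\<Sum>t\<in>histories m. prob (?A t))"
  proof (rule finite_measure_finite_Union[OF finite_histories])
    show "?A ` histories m \<subseteq> sets M" using hist_event by blast
    show "disjoint_family_on ?A (histories m)"
      unfolding disjoint_family_on_def using hist_disjoint by blast
  qed
  also have "\<dots> = 1" using sum_hist_prob[of m] by (simp add: hist_prob_def)
  finally have "prob (\<Union>t\<in>histories m. ?A t) = 1" .
  moreover have "(\<Union>t\<in>histories m. ?A t) \<in> events" using finite_histories hist_event by blast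
  ultimately have "AE \<omega> in M. \<omega> \<in> (\<Union>t\<in>histories m. ?A t)" using prob_eq_1 by blast
  then show ?thesis by (rule AE_mp) (auto intro!: AE_I2)
qed

text \<open>Up to a null set the functional is a finite sum of constants times indicators of
  histories, so integrability is automatic.\<close>

lemma expectation_histories:
  fixes f :: "(nat \<Rightarrow> tree) \<Rightarrow> real"
  assumes f: "depends (Suc m) f"
  shows "integrable M (\<lambda>\<omega>. f (seq \<omega>))"
    and "expectation (\<lambda>\<omega>. f (seq \<omega>)) = (\<Sum>t\<in>histories m. hist_prob (Suc m) t * f t)"
proof -
  let ?A = "\<lambda>t. {\<omega> \<in> space M. \<forall>i\<in>{1..Suc m}. T i \<omega> = t i}"
  let ?g = "\<lambda>\<omega>. \<Sum>t\<in>histories m. f t * indicator (?A t) \<omega>"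
  have eq: "AE \<omega> in M. f (seq \<omega>) = ?g \<omega>"
    using AE_histories[of m] AE_space
  proof eventually_elim
    case (elim \<omega>)
    then obtain t where t: "t \<in> histories m" "\<forall>i\<in>{1..Suc m}. T i \<omega> = t i" by auto
    have "?g \<omega> = (\<Sum>t'\<in>histories m. if t' = t then f t' else 0)"
    proof (intro sum.cong refl)
      fix t' assume t': "t' \<in> histories m"
      have "\<omega> \<in> ?A t' \<longleftrightarrow> t' = t"
        using t(2) elim(2) hist_disjoint[OF t' t(1) _ t(2)] by blast
      then show "f t' * indicator (?A t') \<omega> = (if t' = t then f t' else 0)"
        by (simp add: indicator_def)
    qed
    also have "\<dots> = f t" using t finite_histories by simp
    also have "\<dots> = f (seq \<omega>)" using f by (rule dependsD) (use t in auto)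
    finally show ?case by simp
  qed
  have ind: "integrable M (indicator (?A t) :: 'a \<Rightarrow> real)" for t
    by (intro integrable_real_indicator hist_event) (simp add: less_top[symmetric])
  have ig: "integrable M ?g" by (intro Bochner_Integration.integrable_sum integrable_mult_right ind)
  have meas: "(\<lambda>\<omega>. f (seq \<omega>)) \<in> borel_measurable M" by (rule measurable_depends_borel[OF f])
  show "integrable M (\<lambda>\<omega>. f (seq \<omega>))"
    using integrable_cong_AE[OF meas borel_measurable_integrable[OF ig] eq] ig by simp
  have "expectation (\<lambda>\<omega>. f (seq \<omega>)) = expectation ?g"
    using integral_cong_AE[OF meas borel_measurable_integrable[OF ig] eq] .
  also have "\<dots> = (\<Sum>t\<in>histories m. f t * prob (?A t))"
  proof (subst Bochner_Integration.integral_sum)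
    have "?A t \<inter> space M = ?A t" for t by auto
    then have "expectation (\<lambda>\<omega>. f t * indicator (?A t) \<omega>) = f t * prob (?A t)" for t
      by simp
    then show "(\<Sum>t\<in>histories m. expectation (\<lambda>\<omega>. f t * indicator (?A t) \<omega>)) =
        (\<Sum>t\<in>histories m. f t * prob (?A t))"
      by (simp only:)
  qed (intro integrable_mult_right ind)
  finally show "expectation (\<lambda>\<omega>. f (seq \<omega>)) = (\<Sum>t\<in>histories m. hist_prob (Suc m) t * f t)"
    by (simp add: hist_prob_def mult.commute)
qed

text \<open>The conditional expectation of \<open>f\<close> given the first \<open>n\<close> trees,
  written out over the sites of the current tree.\<close>

definition step_mean :: "nat \<Rightarrow> ((nat \<Rightarrow> tree) \<Rightarrow> real) \<Rightarrow> (nat \<Rightarrow> tree) \<Rightarrow> real" where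
  "step_mean n f t = (\<Sum>s\<in>sites (t n). site_weight \<alpha> \<gamma> (t n) s / (real n - \<alpha>) * f (extend t n s))"

lemma depends_step_mean:
  assumes "depends (Suc n) f" "n \<ge> 1"
  shows "depends n (step_mean n f)"
  unfolding depends_def
proof (intro allI impI)
  fix t t' :: "nat \<Rightarrow> tree" assume eq: "\<forall>i\<in>{1..n}. t i = t' i"
  then have n: "t n = t' n" using assms by auto
  have "f (extend t n s) = f (extend t' n s)" for s
    using assms(1) by (rule dependsD) (use eq n in \<open>auto simp: extend_def\<close>)
  then show "step_mean n f t = step_mean n f t'" unfolding step_mean_def n by simp
qed

lemma expectation_step:
  assumes f: "depends (Suc n) f" and n: "n \<ge> 1"
  shows "expectation (\<lambda>\<omega>. f (seq \<omega>)) = expectation (\<lambda>\<omega>. step_mean n f (seq \<omega>))"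
proof -
  obtain m where m: "n = Suc m" using n by (cases n) auto
  show ?thesis
    using expectation_histories(2)[OF f[unfolded m]] sum_histories_Suc[of m f]
      expectation_histories(2)[OF depends_step_mean[OF f n, unfolded m]]
    unfolding m by (simp add: step_mean_def)
qed

lemma AE_growth:
  "AE \<omega> in M. \<forall>n\<ge>1. grown n (T n \<omega>) \<and> (\<exists>s\<in>sites (T n \<omega>). T (Suc n) \<omega> = insert_leaf (Suc n) (T n \<omega>) s)"
proof -
  have "AE \<omega> in M. n \<ge> 1 \<longrightarrow> grown n (T n \<omega>) \<and> (\<exists>s\<in>sites (T n \<omega>). T (Suc n) \<omega> = insert_leaf (Suc n) (T n \<omega>) s)" for n
    using AE_histories[of n]
  proof eventually_elim
    case (elim \<omega>)
    then obtain t where t: "t \<in> histories n" "\<forall>i\<in>{1..Suc n}. T i \<omega> = t i" by auto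
    then have "T n \<omega> = t n" "T (Suc n) \<omega> = t (Suc n)" if "n \<ge> 1" using that by auto
    then show ?case using histories_props[OF t(1)] by auto
  qed
  then show ?thesis by (simp add: AE_all_countable)
qed

end

section \<open>One-step means of lengths, weights and rising factorials\<close>

lemma sum_sites_enumerated:
  fixes H :: "site \<Rightarrow> real" and en :: "nat \<Rightarrow> edge"
  assumes red: "reduces_to k t n E J" and \<gamma>: "\<gamma> \<noteq> 0" and bij: "bij_betw en {..<m} t"
    and path: "\<And>i f. i < m \<Longrightarrow> f \<in> tree_path E (en i) \<Longrightarrow> H (Edge_Site f) = G i"
    and off: "\<And>s. s \<in> edge_region t J E \<Longrightarrow> (\<And>i. i < m \<Longrightarrow> s \<notin> Edge_Site ` tree_path E (en i)) \<Longrightarrow> H s = G1"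
    and rest: "\<And>s. s \<in> sites E \<Longrightarrow> s \<notin> edge_region t J E \<Longrightarrow> H s = G0"
    and Y: "\<And>i. i < m \<Longrightarrow> Y i = real (card (tree_path E (en i))) + edge_shift \<alpha> \<gamma> (en i)"
    and U: "U = (\<Sum>e\<in>t. edge_weight \<alpha> \<gamma> e) + real (card J)"
  shows "(\<Sum>s\<in>sites E. site_weight \<alpha> \<gamma> E s * H s) =
     (\<Sum>i<m. \<gamma> * Y i * G i) + (U - (\<Sum>i<m. \<gamma> * Y i)) * G1 + (real n - \<alpha> - U) * G0"
proof -
  define ix where "ix = inv_into {..<m} en"
  have ix: "ix (en i) = i" if "i < m" for i
    unfolding ix_def using bij that by (simp add: bij_betw_def)
  have ixt: "ix e < m" "en (ix e) = e" if "e \<in> t" for e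
    using bij that ix unfolding bij_betw_def by (metis imageE lessThan_iff)+
  have "finite t" using bij by (metis bij_betw_finite finite_lessThan)
  have "(\<Sum>s\<in>sites E. site_weight \<alpha> \<gamma> E s * H s) =
     (\<Sum>e\<in>t. \<gamma> * Y (ix e) * G (ix e)) + (U - (\<Sum>e\<in>t. \<gamma> * Y (ix e))) * G1 + (real n - \<alpha> - U) * G0"
  proof (rule sum_sites_reduces_to[OF red \<gamma> \<open>finite t\<close> _ _ rest _ U])
    show "H (Edge_Site f) = G (ix e)" if "e \<in> t" "f \<in> tree_path E e" for e f
      using path[of "ix e" f] ixt[OF that(1)] that(2) by simp
    show "Y (ix e) = real (card (tree_path E e)) + edge_shift \<alpha> \<gamma> e" if "e \<in> t" for e
      using Y[of "ix e"] ixt[OF that] by simp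
    show "H s = G1" if "s \<in> edge_region t J E" "s \<notin> (\<Union>e\<in>t. Edge_Site ` tree_path E e)" for s
    proof (rule off[OF that(1)])
      fix i assume "i < m"
      then have "en i \<in> t" using bij by (auto simp: bij_betw_def)
      then show "s \<notin> Edge_Site ` tree_path E (en i)" using that(2) by blast
    qed
  qed
  also have "(\<Sum>e\<in>t. \<gamma> * Y (ix e) * G (ix e)) = (\<Sum>i<m. \<gamma> * Y i * G i)"
    unfolding sum.reindex_bij_betw[OF bij, symmetric] using ix by (intro sum.cong) auto
  also have "(\<Sum>e\<in>t. \<gamma> * Y (ix e)) = (\<Sum>i<m. \<gamma> * Y i)"
    unfolding sum.reindex_bij_betw[OF bij, symmetric] using ix by (intro sum.cong) auto
  finally show ?thesis .
qed

text \<open>The leaves inserted after time \<open>k\<close> on, or in a subtree attached to, an edge of the reduced tree,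
  as opposed to those attached to one of its vertices.\<close>

primrec labels :: "nat \<Rightarrow> (nat \<Rightarrow> tree) \<Rightarrow> nat \<Rightarrow> nat set" where
  "labels k t 0 = {}"
| "labels k t (Suc n) = (if k \<le> n \<and> (\<exists>s\<in>edge_region (t k) (labels k t n) (t n). t (Suc n) = insert_leaf (Suc n) (t n) s)
     then insert (Suc n) (labels k t n) else labels k t n)"

lemma labels_start: "n \<le> k \<Longrightarrow> labels k t n = {}"
  by (induction n) auto

lemma depends_labels:
  assumes "k \<ge> 1"
  shows "depends n (\<lambda>t. labels k t n)"
proof (induction n)
  case 0
  then show ?case by (simp add: depends_def)
next
  case (Suc n)
  show ?case unfolding depends_def
  proof (intro allI impI)
    fix t t' :: "nat \<Rightarrow> tree" assume eq: "\<forall>i\<in>{1..Suc n}. t i = t' i"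
    have IH: "labels k t n = labels k t' n" using Suc by (rule dependsD) (use eq in auto)
    show "labels k t (Suc n) = labels k t' (Suc n)"
    proof (cases "k \<le> n")
      case True
      then have "t k = t' k" "t n = t' n" "t (Suc n) = t' (Suc n)" using eq assms by auto
      then show ?thesis using IH by auto
    qed (simp add: IH)
  qed
qed

text \<open>Membership of the site in the region is tested in \<open>labels\<close> by the existence
  of a site producing the next tree; injectivity of the insertion makes this the site actually
  chosen.\<close>

lemma labels_extend:
  assumes k: "k \<ge> 1" and kn: "k \<le> n" and red: "reduces_to k (t k) n (t n) (labels k t n)" and s: "s \<in> sites (t n)"
    and u: "\<And>i. i \<le> n \<Longrightarrow> u i = t i" "u (Suc n) = insert_leaf (Suc n) (t n) s"
  shows "labels k u (Suc n) =
    (if s \<in> edge_region (t k) (labels k t n) (t n) then insert (Suc n) (labels k t n) else labels k t n)"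
proof -
  have 1: "labels k u n = labels k t n"
    using depends_labels[OF k] by (rule dependsD) (use u in auto)
  have "(\<exists>s'\<in>edge_region (t k) (labels k t n) (t n). insert_leaf (Suc n) (t n) s = insert_leaf (Suc n) (t n) s')
      \<longleftrightarrow> s \<in> edge_region (t k) (labels k t n) (t n)"
    using insert_leaf_inj[OF red_proper[OF red] s] edge_region_sites[OF red] by blast
  then show ?thesis using kn u 1 by simp
qed

definition Y_proc :: "real \<Rightarrow> real \<Rightarrow> (tree \<Rightarrow> nat \<Rightarrow> edge) \<Rightarrow> nat \<Rightarrow> nat \<Rightarrow> (nat \<Rightarrow> tree) \<Rightarrow> nat \<Rightarrow> real" where
  "Y_proc \<alpha> \<gamma> en k i t n = real (card (tree_path (t n) (en (t k) i))) + edge_shift \<alpha> \<gamma> (en (t k) i)"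

definition U_proc :: "real \<Rightarrow> real \<Rightarrow> nat \<Rightarrow> (nat \<Rightarrow> tree) \<Rightarrow> nat \<Rightarrow> real" where
  "U_proc \<alpha> \<gamma> k t n = (\<Sum>e\<in>t k. edge_weight \<alpha> \<gamma> e) + real (card (labels k t n))"

lemma depends_Y: "1 \<le> k \<Longrightarrow> k \<le> n \<Longrightarrow> depends n (\<lambda>t. Y_proc \<alpha> \<gamma> en k i t n)"
  unfolding depends_def Y_proc_def by auto

lemma depends_U:
  assumes "1 \<le> k" "k \<le> n"
  shows "depends n (\<lambda>t. U_proc \<alpha> \<gamma> k t n)"
  unfolding depends_def
proof (intro allI impI)
  fix t t' :: "nat \<Rightarrow> tree" assume eq: "\<forall>i\<in>{1..n}. t i = t' i"
  have "labels k t n = labels k t' n"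
    using depends_labels[OF assms(1), of n] eq unfolding depends_def by blast
  then show "U_proc \<alpha> \<gamma> k t n = U_proc \<alpha> \<gamma> k t' n" using eq assms by (simp add: U_proc_def)
qed

definition mixed :: "real \<Rightarrow> real \<Rightarrow> (tree \<Rightarrow> nat \<Rightarrow> edge) \<Rightarrow> nat \<Rightarrow> nat \<Rightarrow> (nat \<Rightarrow> nat) \<Rightarrow> nat \<Rightarrow>
    (nat \<Rightarrow> tree) \<Rightarrow> nat \<Rightarrow> real" where
  "mixed \<alpha> \<gamma> en k m p q t n = (\<Prod>i<m. pochhammer (Y_proc \<alpha> \<gamma> en k i t n) (p i)) *
     pochhammer (U_proc \<alpha> \<gamma> k t n + \<gamma> * real (\<Sum>i<m. p i)) q"

lemma depends_mixed:
  assumes "1 \<le> k" "k \<le> n"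
  shows "depends n (\<lambda>t. mixed \<alpha> \<gamma> en k m p q t n)"
  unfolding depends_def
proof (intro allI impI)
  fix t t' :: "nat \<Rightarrow> tree" assume eq: "\<forall>i\<in>{1..n}. t i = t' i"
  have "U_proc \<alpha> \<gamma> k t n = U_proc \<alpha> \<gamma> k t' n"
    by (rule dependsD[OF depends_U[OF assms]]) (use eq in auto)
  moreover have "Y_proc \<alpha> \<gamma> en k i t n = Y_proc \<alpha> \<gamma> en k i t' n" for i
    by (rule dependsD[OF depends_Y[OF assms]]) (use eq in auto)
  ultimately show "mixed \<alpha> \<gamma> en k m p q t n = mixed \<alpha> \<gamma> en k m p q t' n"
    by (simp add: mixed_def)
qed

context
  fixes k n :: nat and t :: "nat \<Rightarrow> tree" and en :: "tree \<Rightarrow> nat \<Rightarrow> edge" and \<alpha> \<gamma> :: real and m :: nat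
  assumes k: "k \<ge> 1" and kn: "k \<le> n" and red: "reduces_to k (t k) n (t n) (labels k t n)"
    and bij: "bij_betw (en (t k)) {..<m} (t k)" and \<alpha>\<gamma>: "0 < \<alpha>" "\<alpha> < 1" "0 < \<gamma>" "\<gamma> \<le> \<alpha>"
begin

abbreviation "YY \<equiv> Y_proc \<alpha> \<gamma> en k"
abbreviation "UU \<equiv> U_proc \<alpha> \<gamma> k"
abbreviation "MM \<equiv> mixed \<alpha> \<gamma> en k m"

lemma en_mem: "i < m \<Longrightarrow> en (t k) i \<in> t k"
  using bij by (auto simp: bij_betw_def)

lemma extend_simps: "extend t n s k = t k" "extend t n s n = t n" "extend t n s (Suc n) = insert_leaf (Suc n) (t n) s"
  using kn by (auto simp: extend_def)

lemma Y_extend: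
  assumes s: "s \<in> sites (t n)" and i: "i < m"
  shows "YY i (extend t n s) (Suc n) = YY i t n + (if s \<in> Edge_Site ` tree_path (t n) (en (t k) i) then 1 else 0)"
  unfolding Y_proc_def extend_simps using card_path_insert_leaf[OF red s en_mem[OF i]] by simp

lemma U_extend:
  assumes s: "s \<in> sites (t n)"
  shows "UU (extend t n s) (Suc n) = UU t n + (if s \<in> edge_region (t k) (labels k t n) (t n) then 1 else 0)"
proof -
  have "labels k (extend t n s) (Suc n) =
    (if s \<in> edge_region (t k) (labels k t n) (t n) then insert (Suc n) (labels k t n) else labels k t n)"
    by (rule labels_extend[OF k kn red s]) (auto simp: extend_def)
  then show ?thesis unfolding U_proc_def extend_simps
    using red_finite_J[OF red] red_fresh(3)[OF red] by simp
qed

text \<open>A path has at least one edge, and the shift exceeds minus one because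
  \<open>1 - \<alpha>\<close> is positive.\<close>

lemma Y_pos: "i < m \<Longrightarrow> 0 < YY i t n"
proof -
  assume "i < m"
  then have "1 \<le> card (tree_path (t n) (en (t k) i))" using reduces_toD(11)[OF red en_mem] by simp
  then have "1 \<le> real (card (tree_path (t n) (en (t k) i)))" by simp
  moreover have "0 < (1 - \<alpha>) / \<gamma>" using \<alpha>\<gamma> by simp
  ultimately show "0 < YY i t n" unfolding Y_proc_def edge_shift_def by simp
qed

lemma path_inj:
  assumes "i < m" "j < m" "f \<in> tree_path (t n) (en (t k) i)" "f \<in> tree_path (t n) (en (t k) j)"
  shows "i = j"
proof (rule ccontr)
  assume "i \<noteq> j"
  then have "en (t k) i \<noteq> en (t k) j" using bij assms(1,2) by (auto simp: bij_betw_def inj_on_def)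
  then show False using reduces_toD(8)[OF red en_mem[OF assms(1)] en_mem[OF assms(2)]] assms(3,4) by blast
qed

lemma sum_sites_proc:
  assumes "\<And>i f. i < m \<Longrightarrow> f \<in> tree_path (t n) (en (t k) i) \<Longrightarrow> H (Edge_Site f) = G i"
    and "\<And>s. s \<in> edge_region (t k) (labels k t n) (t n) \<Longrightarrow>
       (\<And>i. i < m \<Longrightarrow> s \<notin> Edge_Site ` tree_path (t n) (en (t k) i)) \<Longrightarrow> H s = G1"
    and "\<And>s. s \<in> sites (t n) \<Longrightarrow> s \<notin> edge_region (t k) (labels k t n) (t n) \<Longrightarrow> H s = G0"
  shows "(\<Sum>s\<in>sites (t n). site_weight \<alpha> \<gamma> (t n) s * H s) =
     (\<Sum>i<m. \<gamma> * YY i t n * G i) + (UU t n - (\<Sum>i<m. \<gamma> * YY i t n)) * G1 + (real n - \<alpha> - UU t n) * G0"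
proof (rule sum_sites_enumerated[OF red _ bij])
  show "\<gamma> \<noteq> 0" using \<alpha>\<gamma> by simp
qed (fact assms | simp add: Y_proc_def U_proc_def)+

lemma path_sites: "i < m \<Longrightarrow> f \<in> tree_path (t n) (en (t k) i) \<Longrightarrow> Edge_Site f \<in> edge_region (t k) (labels k t n) (t n)"
  using path_region[OF red en_mem[of i]] by blast

lemma sum_U_step:
  "(\<Sum>s\<in>sites (t n). site_weight \<alpha> \<gamma> (t n) s * (UU (extend t n s) (Suc n) - UU t n)) = UU t n"
  by (subst sum_sites_proc[where G = "\<lambda>_. 1" and ?G1.0 = 1 and ?G0.0 = 0])
    (use edge_region_sites[OF red] path_sites U_extend in \<open>auto simp: subset_iff\<close>)

lemma sum_Y_step:
  assumes j: "j < m"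
  shows "(\<Sum>s\<in>sites (t n). site_weight \<alpha> \<gamma> (t n) s * (YY j (extend t n s) (Suc n) - YY j t n)) = \<gamma> * YY j t n"
proof -
  have "(\<Sum>s\<in>sites (t n). site_weight \<alpha> \<gamma> (t n) s * (YY j (extend t n s) (Suc n) - YY j t n)) =
     (\<Sum>i<m. \<gamma> * YY i t n * (if i = j then 1 else 0)) + (UU t n - (\<Sum>i<m. \<gamma> * YY i t n)) * 0 + (real n - \<alpha> - UU t n) * 0"
  proof (rule sum_sites_proc)
    fix i f assume if': "i < m" "f \<in> tree_path (t n) (en (t k) i)"
    then have "Edge_Site f \<in> sites (t n)" using path_sites edge_region_sites[OF red] by blast
    moreover have "Edge_Site f \<in> Edge_Site ` tree_path (t n) (en (t k) j) \<longleftrightarrow> i = j"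
      using if' path_inj[OF if'(1) j if'(2)] by auto
    ultimately show "YY j (extend t n (Edge_Site f)) (Suc n) - YY j t n = (if i = j then 1 else 0)"
      using Y_extend[of _ j] j by simp
  next
    fix s assume s: "s \<in> edge_region (t k) (labels k t n) (t n)"
      "\<And>i. i < m \<Longrightarrow> s \<notin> Edge_Site ` tree_path (t n) (en (t k) i)"
    then have "s \<in> sites (t n)" using edge_region_sites[OF red] by blast
    then show "YY j (extend t n s) (Suc n) - YY j t n = 0"
      using Y_extend[of s j] j s(2)[OF j] by simp
  next
    fix s assume s: "s \<in> sites (t n)" "s \<notin> edge_region (t k) (labels k t n) (t n)"
    then have "s \<notin> Edge_Site ` tree_path (t n) (en (t k) j)" using path_sites[OF j] by blast
    then show "YY j (extend t n s) (Suc n) - YY j t n = 0"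
      using Y_extend[of s j] j s(1) by simp
  qed
  also have "\<dots> = \<gamma> * YY j t n" using j by (simp add: if_distrib cong: if_cong)
  finally show ?thesis .
qed

text \<open>A hit on path \<open>j\<close> multiplies the corresponding rising factorial by
  \<open>(Y j + p j) / Y j\<close>, so all paths together contribute \<gamma> times the sum of
  \<open>Y j + p j\<close>, and the rest of the region contributes \<open>U\<close> minus \<gamma>
  times the sum of \<open>Y j\<close>. The total \<open>U + \<gamma> * P\<close> is exactly the
  argument of the last rising factorial; this dictates the shift there, since one more application
  of the same identity then produces the constant eigenvalue.\<close>

lemma sum_mixed_step:
  fixes p :: "nat \<Rightarrow> nat" and q :: nat
  defines "P \<equiv> real (\<Sum>i<m. p i)"
  shows "(\<Sum>s\<in>sites (t n). site_weight \<alpha> \<gamma> (t n) s * MM p q (extend t n s) (Suc n)) =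
     (real n - \<alpha> + \<gamma> * P + real q) * MM p q t n"
proof -
  define V where "V = pochhammer (UU t n + \<gamma> * P) q"
  define V1 where "V1 = pochhammer (UU t n + 1 + \<gamma> * P) q"
  define PP where "PP = (\<Prod>i<m. pochhammer (YY i t n) (p i))"
  define G where "G j = (\<Prod>i<m. pochhammer (YY i t n + (if i = j then 1 else 0)) (p i)) * V1" for j
  \<comment> \<open>Both sides equal the rising factorial of \<open>y\<close> with
    \<open>r + 1\<close> factors.\<close>
  have shift: "pochhammer (y + 1) r * y = pochhammer y r * (y + real r)" for y :: real and r
    using pochhammer_rec[of y r] pochhammer_rec'[of y r] by (simp add: mult.commute)
  have G: "YY j t n * G j = (YY j t n + real (p j)) * PP * V1" if j: "j < m" for j
  proof -
    have "(\<Prod>i<m. pochhammer (YY i t n + (if i = j then 1 else 0)) (p i)) =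
        pochhammer (YY j t n + 1) (p j) * (\<Prod>i\<in>{..<m} - {j}. pochhammer (YY i t n + (if i = j then 1 else 0)) (p i))"
      using j by (subst prod.remove[of _ j]) auto
    also have "(\<Prod>i\<in>{..<m} - {j}. pochhammer (YY i t n + (if i = j then 1 else 0)) (p i)) =
        (\<Prod>i\<in>{..<m} - {j}. pochhammer (YY i t n) (p i))" by (intro prod.cong) auto
    finally have "YY j t n * G j = (pochhammer (YY j t n + 1) (p j) * YY j t n) *
        (\<Prod>i\<in>{..<m} - {j}. pochhammer (YY i t n) (p i)) * V1" by (simp add: G_def)
    also have "\<dots> = (YY j t n + real (p j)) * (pochhammer (YY j t n) (p j) *
        (\<Prod>i\<in>{..<m} - {j}. pochhammer (YY i t n) (p i))) * V1" unfolding shift by simp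
    also have "pochhammer (YY j t n) (p j) * (\<Prod>i\<in>{..<m} - {j}. pochhammer (YY i t n) (p i)) = PP"
      unfolding PP_def using j by (subst (2) prod.remove[of _ j]) auto
    finally show ?thesis .
  qed
  have V1: "V1 * (UU t n + \<gamma> * P) = V * (UU t n + \<gamma> * P + real q)"
    unfolding V1_def V_def using shift[of "UU t n + \<gamma> * P" q] by (simp add: algebra_simps)
  have ext: "MM p q (extend t n s) (Suc n) =
      (\<Prod>i<m. pochhammer (YY i t n + (if s \<in> Edge_Site ` tree_path (t n) (en (t k) i) then 1 else 0)) (p i)) *
      pochhammer (UU t n + (if s \<in> edge_region (t k) (labels k t n) (t n) then 1 else 0) + \<gamma> * P) q"
    if "s \<in> sites (t n)" for s
    unfolding mixed_def U_extend[OF that] P_def using Y_extend[OF that] by simp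
  have "(\<Sum>s\<in>sites (t n). site_weight \<alpha> \<gamma> (t n) s * MM p q (extend t n s) (Suc n)) =
     (\<Sum>i<m. \<gamma> * YY i t n * G i) + (UU t n - (\<Sum>i<m. \<gamma> * YY i t n)) * (PP * V1) + (real n - \<alpha> - UU t n) * (PP * V)"
  proof (rule sum_sites_proc)
    fix j f assume jf: "j < m" "f \<in> tree_path (t n) (en (t k) j)"
    have r: "Edge_Site f \<in> edge_region (t k) (labels k t n) (t n)" using path_sites jf by blast
    then have s: "Edge_Site f \<in> sites (t n)" using edge_region_sites[OF red] by blast
    have "Edge_Site f \<in> Edge_Site ` tree_path (t n) (en (t k) i) \<longleftrightarrow> i = j" if "i < m" for i
      using jf path_inj[OF that jf(1) _ jf(2)] by auto
    then show "MM p q (extend t n (Edge_Site f)) (Suc n) = G j"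
      unfolding ext[OF s] G_def V1_def using r by (intro arg_cong2[of _ _ _ _ "(*)"] prod.cong) auto
  next
    fix s assume s: "s \<in> edge_region (t k) (labels k t n) (t n)"
      "\<And>i. i < m \<Longrightarrow> s \<notin> Edge_Site ` tree_path (t n) (en (t k) i)"
    then have "s \<in> sites (t n)" using edge_region_sites[OF red] by blast
    then show "MM p q (extend t n s) (Suc n) = PP * V1"
      using ext s unfolding PP_def V1_def by simp
  next
    fix s assume s: "s \<in> sites (t n)" "s \<notin> edge_region (t k) (labels k t n) (t n)"
    then have "s \<notin> Edge_Site ` tree_path (t n) (en (t k) i)" if "i < m" for i using path_sites[OF that] by blast
    then show "MM p q (extend t n s) (Suc n) = PP * V"
      using ext[OF s(1)] s(2) unfolding PP_def V_def by simp
  qed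
  also have "(\<Sum>i<m. \<gamma> * YY i t n * G i) = (\<Sum>i<m. \<gamma> * (YY i t n + real (p i)) * (PP * V1))"
    using G by (intro sum.cong) (auto simp: mult.assoc)
  also have "\<dots> = (\<gamma> * (\<Sum>i<m. YY i t n) + \<gamma> * P) * (PP * V1)"
    unfolding sum_distrib_right[symmetric] sum_distrib_left[symmetric] sum.distrib P_def by (simp add: algebra_simps)
  also have "(\<Sum>i<m. \<gamma> * YY i t n) = \<gamma> * (\<Sum>i<m. YY i t n)" by (simp add: sum_distrib_left)
  finally have "(\<Sum>s\<in>sites (t n). site_weight \<alpha> \<gamma> (t n) s * MM p q (extend t n s) (Suc n)) =
     PP * (V1 * (UU t n + \<gamma> * P)) + (real n - \<alpha> - UU t n) * (PP * V)" by (simp add: algebra_simps)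
  also have "\<dots> = (real n - \<alpha> + \<gamma> * P + real q) * (PP * V)" unfolding V1 by (simp add: algebra_simps)
  finally show ?thesis unfolding mixed_def PP_def V_def P_def .
qed

end

context alpha_gamma
begin

lemma AE_reduces_to:
  assumes k: "k \<ge> 1"
  shows "AE \<omega> in M. \<forall>n\<ge>k. reduces_to k (T k \<omega>) n (T n \<omega>) (labels k (seq \<omega>) n)"
  using AE_growth AE_space
proof eventually_elim
  case (elim \<omega>)
  show ?case
  proof (intro allI impI)
    fix n assume "k \<le> n"
    then show "reduces_to k (T k \<omega>) n (T n \<omega>) (labels k (seq \<omega>) n)"
    proof (induction n rule: dec_induct)
      case base
      have "grown k (T k \<omega>)" using elim(1) k by blast
      from reduces_to_self[OF this T_trees[OF k elim(2)]] show ?case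
        using labels_start[of k k "seq \<omega>"] by simp
    next
      case (step n)
      obtain s where s: "s \<in> sites (T n \<omega>)" "T (Suc n) \<omega> = insert_leaf (Suc n) (T n \<omega>) s"
        using elim(1) k step by (meson order_trans)
      show ?case unfolding s(2)
        by (rule reduces_to_insert_leaf[OF step.IH s(1)])
          (use labels_extend[OF k step(1), of "seq \<omega>" s "seq \<omega>"] step.IH s in simp)
    qed
  qed
qed

end

section \<open>Second moment method for linearly growing functionals\<close>

context alpha_gamma
begin

lemma k_minus_\<alpha>: "1 \<le> k \<Longrightarrow> 0 < real k - \<alpha>"
  using \<alpha> by (metis add_0_left diff_gt_0_iff_gt less_le_trans of_nat_1 of_nat_mono)

lemma extend_agrees:
  assumes f: "depends (Suc n) f" and s: "u (Suc n) = insert_leaf (Suc n) (u n) s"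
  shows "f (extend u n s) = f u"
  using f by (rule dependsD) (auto simp: extend_def s)

text \<open>The product of \<open>1 + r / (j - \<alpha>)\<close> over the times \<open>j\<close>
  from \<open>k\<close> to \<open>n - 1\<close>: the mean growth of a functional whose expected
  increment at time \<open>j\<close> is \<open>r / (j - \<alpha>)\<close> times its value. It is of
  order \<open>n powr r\<close>.\<close>

definition norming :: "nat \<Rightarrow> real \<Rightarrow> nat \<Rightarrow> real" where
  "norming k r n = pochhammer (real k - \<alpha> + r) (n - k) / pochhammer (real k - \<alpha>) (n - k)"

lemma norming_pos: "1 \<le> k \<Longrightarrow> 0 \<le> r \<Longrightarrow> 0 < norming k r n"
  unfolding norming_def using k_minus_\<alpha>[of k] by (intro divide_pos_pos pochhammer_pos) auto

lemma norming_self: "norming k r k = 1"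
  by (simp add: norming_def)

lemma norming_Suc:
  assumes "1 \<le> k" "k \<le> n"
  shows "norming k r (Suc n) = norming k r n * (1 + r / (real n - \<alpha>))"
proof -
  have "real n - \<alpha> > 0" using k_minus_\<alpha>[of n] assms by simp
  then show ?thesis
    using assms by (simp add: norming_def Suc_diff_le pochhammer_Suc of_nat_diff field_simps)
qed

lemma norming_asymp:
  assumes "1 \<le> k" "0 \<le> r"
  shows "(\<lambda>n. norming k r n / real n powr r) \<longlonglongrightarrow> Gamma (real k - \<alpha>) / Gamma (real k - \<alpha> + r)"
  unfolding norming_def using pochhammer_ratio_asymp[OF k_minus_\<alpha>[OF assms(1)] assms(2)] .

lemma step_mean_affine:
  assumes g: "grown n (t n)" and n: "1 \<le> n"
    and \<delta>: "(\<Sum>s\<in>sites (t n). site_weight \<alpha> \<gamma> (t n) s * \<delta> s) = \<pi>"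
    and f: "\<And>s. s \<in> sites (t n) \<Longrightarrow> f (extend t n s) = c + d * \<delta> s"
  shows "step_mean n f t = c + d * (\<pi> / (real n - \<alpha>))"
proof -
  have n\<alpha>: "real n - \<alpha> > 0" using k_minus_\<alpha>[OF n] .
  have "step_mean n f t = (\<Sum>s\<in>sites (t n). c / (real n - \<alpha>) * site_weight \<alpha> \<gamma> (t n) s + d / (real n - \<alpha>) * (site_weight \<alpha> \<gamma> (t n) s * \<delta> s))"
    unfolding step_mean_def using f by (intro sum.cong) (auto simp: algebra_simps add_divide_distrib)
  also have "\<dots> = c / (real n - \<alpha>) * (real n - \<alpha>) + d / (real n - \<alpha>) * \<pi>"
    unfolding sum.distrib sum_distrib_left[symmetric] \<delta> total_weight[OF g] ..
  finally show ?thesis using n\<alpha> by simp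
qed

text \<open>\<open>X n / norming k \<kappa> n\<close> is an \<open>L\<^sup>2\<close>-bounded martingale. Its increments are summable along a
  polynomial subsequence, between whose points \<open>X\<close> is monotone.\<close>

lemma AE_convergent_linear_growth:
  fixes X :: "(nat \<Rightarrow> tree) \<Rightarrow> nat \<Rightarrow> real" and \<kappa> :: real
  assumes k: "1 \<le> k" and \<kappa>: "0 < \<kappa>"
    and dep: "\<And>n. k \<le> n \<Longrightarrow> depends n (\<lambda>t. X t n)"
    and nonneg: "AE \<omega> in M. \<forall>n\<ge>k. 0 \<le> X (seq \<omega>) n"
    and step: "AE \<omega> in M. \<forall>n\<ge>k. \<forall>s\<in>sites (T n \<omega>). X (extend (seq \<omega>) n s) (Suc n) - X (seq \<omega>) n \<in> {0, 1}"
    and mean: "AE \<omega> in M. \<forall>n\<ge>k. (\<Sum>s\<in>sites (T n \<omega>). site_weight \<alpha> \<gamma> (T n \<omega>) s *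
        (X (extend (seq \<omega>) n s) (Suc n) - X (seq \<omega>) n)) = \<kappa> * X (seq \<omega>) n"
  shows "AE \<omega> in M. convergent (\<lambda>n. X (seq \<omega>) n / real n powr \<kappa>)"
proof -
  define a where "a = norming k \<kappa>"
  have a: "a n > 0" for n unfolding a_def using norming_pos k \<kappa> by simp
  have aS: "a (Suc n) = a n * (1 + \<kappa> / (real n - \<alpha>))" if "k \<le> n" for n
    unfolding a_def by (rule norming_Suc[OF k that])
  have n\<alpha>: "real n - \<alpha> > 0" if "k \<le> n" for n using k_minus_\<alpha>[of n] k that by simp
  have dX: "depends m (\<lambda>t. X t n)" if "k \<le> n" "n \<le> m" for m n
    by (rule depends_mono[OF dep[OF that(1)] that(2)])
  have int: "integrable M (\<lambda>\<omega>. f (seq \<omega>))" if "depends n f" "1 \<le> n" for f :: "(nat \<Rightarrow> tree) \<Rightarrow> real" and n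
    using expectation_histories(1)[of "n - 1" f] that by simp
  define e where "e = expectation (\<lambda>\<omega>. X (seq \<omega>) k)"
  have e0: "e \<ge> 0" unfolding e_def using nonneg by (intro integral_nonneg_AE) (auto elim: eventually_mono)
  have EX: "expectation (\<lambda>\<omega>. X (seq \<omega>) n) = e * a n" if "k \<le> n" for n
    using that
  proof (induction n rule: dec_induct)
    case base
    show ?case by (simp add: e_def a_def norming_self)
  next
    case (step n)
    have n1: "1 \<le> n" using step k by simp
    have "expectation (\<lambda>\<omega>. X (seq \<omega>) (Suc n)) = expectation (\<lambda>\<omega>. step_mean n (\<lambda>t. X t (Suc n)) (seq \<omega>))"
      by (rule expectation_step[OF _ n1]) (use dX step in auto)
    also have "\<dots> = expectation (\<lambda>\<omega>. X (seq \<omega>) n * (1 + \<kappa> / (real n - \<alpha>)))"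
    proof (rule integral_cong_AE)
      show "(\<lambda>\<omega>. step_mean n (\<lambda>t. X t (Suc n)) (seq \<omega>)) \<in> borel_measurable M"
        by (rule measurable_depends_borel[OF depends_step_mean[OF _ n1]]) (use dX step in auto)
      show "(\<lambda>\<omega>. X (seq \<omega>) n * (1 + \<kappa> / (real n - \<alpha>))) \<in> borel_measurable M"
        using measurable_depends_borel[OF dX[of n n]] step by auto
      show "AE \<omega> in M. step_mean n (\<lambda>t. X t (Suc n)) (seq \<omega>) = X (seq \<omega>) n * (1 + \<kappa> / (real n - \<alpha>))"
        using AE_growth mean
      proof eventually_elim
        case (elim \<omega>)
        have "step_mean n (\<lambda>t. X t (Suc n)) (seq \<omega>) = X (seq \<omega>) n + 1 * (\<kappa> * X (seq \<omega>) n / (real n - \<alpha>))"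
          by (rule step_mean_affine[where \<delta> = "\<lambda>s. X (extend (seq \<omega>) n s) (Suc n) - X (seq \<omega>) n"])
            (use elim n1 step in auto)
        then show ?case by (simp add: algebra_simps)
      qed
    qed
    also have "\<dots> = e * a (Suc n)" using step by (simp add: aS)
    finally show ?case .
  qed
  define D where "D n m = expectation (\<lambda>\<omega>. (X (seq \<omega>) m / a m - X (seq \<omega>) n / a n)\<^sup>2)" for n m
  have dD: "depends m (\<lambda>t. (X t m / a m - X t n / a n)\<^sup>2)" if "k \<le> n" "n \<le> m" for n m
    using dX[of n m] dX[of m m] that unfolding depends_def by (metis order_trans order_refl)
  \<comment> \<open>By orthogonality of the increments, one step adds to the second moment at most a
    mean conditional variance. The telescoping form of the bound vanishes at \<open>m = n\<close>
    and stays below \<open>e / a n\<close>.\<close>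
  have D: "D n m \<le> e * (1 / a n - 1 / a m)" if nk: "k \<le> n" and nm: "n \<le> m" for n m
    using nm
  proof (induction m rule: dec_induct)
    case base
    show ?case by (simp add: D_def)
  next
    case (step m)
    have m: "k \<le> m" "1 \<le> m" using step nk k by auto
    have "D n (Suc m) = expectation (\<lambda>\<omega>. step_mean m (\<lambda>t. (X t (Suc m) / a (Suc m) - X t n / a n)\<^sup>2) (seq \<omega>))"
      unfolding D_def by (rule expectation_step[OF dD m(2)]) (use nk step in auto)
    also have "\<dots> \<le> expectation (\<lambda>\<omega>. (X (seq \<omega>) m / a m - X (seq \<omega>) n / a n)\<^sup>2 + \<kappa> / ((real m - \<alpha>) * (a (Suc m))\<^sup>2) * X (seq \<omega>) m)"
    proof (rule integral_mono_AE)
      show "integrable M (\<lambda>\<omega>. step_mean m (\<lambda>t. (X t (Suc m) / a (Suc m) - X t n / a n)\<^sup>2) (seq \<omega>))"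
        by (rule int[OF depends_step_mean[OF dD m(2)] m(2)]) (use nk step in auto)
      show "integrable M (\<lambda>\<omega>. (X (seq \<omega>) m / a m - X (seq \<omega>) n / a n)\<^sup>2 + \<kappa> / ((real m - \<alpha>) * (a (Suc m))\<^sup>2) * X (seq \<omega>) m)"
        using int[OF dD[OF nk step(1)] m(2)] int[OF dX[of m m] m(2)] m by auto
      show "AE \<omega> in M. step_mean m (\<lambda>t. (X t (Suc m) / a (Suc m) - X t n / a n)\<^sup>2) (seq \<omega>) \<le>
          (X (seq \<omega>) m / a m - X (seq \<omega>) n / a n)\<^sup>2 + \<kappa> / ((real m - \<alpha>) * (a (Suc m))\<^sup>2) * X (seq \<omega>) m"
        using AE_growth mean assms(5)
      proof eventually_elim
        case (elim \<omega>)
        define x where "x = X (seq \<omega>) m"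
        define y where "y = X (seq \<omega>) n / a n"
        define a' where "a' = a (Suc m)"
        define u where "u = x / a' - y"
        define \<pi> where "\<pi> = \<kappa> * x / (real m - \<alpha>)"
        define \<delta> where "\<delta> s = X (extend (seq \<omega>) m s) (Suc m) - x" for s
        have \<delta>: "\<delta> s \<in> {0, 1}" if "s \<in> sites (T m \<omega>)" for s
          using elim(3) m that unfolding \<delta>_def x_def by blast
        have a': "a' > 0" by (simp add: a'_def a)
        have ext: "X (extend (seq \<omega>) m s) n = X (seq \<omega>) n" for s
          using dep[OF nk] by (rule dependsD) (use step in \<open>auto simp: extend_def\<close>)
        \<comment> \<open>The increment is zero or one and equals its own square, so the squared
          distance is affine in it.\<close>
        have "step_mean m (\<lambda>t. (X t (Suc m) / a (Suc m) - X t n / a n)\<^sup>2) (seq \<omega>) =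
            u\<^sup>2 + (2 * u / a' + 1 / a'\<^sup>2) * (\<kappa> * x / (real m - \<alpha>))"
        proof (rule step_mean_affine[where \<delta> = \<delta>])
          show "grown m (T m \<omega>)" using elim(1) m by blast
          show "(\<Sum>s\<in>sites (T m \<omega>). site_weight \<alpha> \<gamma> (T m \<omega>) s * \<delta> s) = \<kappa> * x"
            using elim(2) m unfolding \<delta>_def x_def by blast
          fix s assume "s \<in> sites (T m \<omega>)"
          then have "\<delta> s = 0 \<or> \<delta> s = 1" using \<delta> by blast
          have "X (extend (seq \<omega>) m s) (Suc m) = x + \<delta> s" by (simp add: \<delta>_def)
          show "(X (extend (seq \<omega>) m s) (Suc m) / a (Suc m) - X (extend (seq \<omega>) m s) n / a n)\<^sup>2 =
              u\<^sup>2 + (2 * u / a' + 1 / a'\<^sup>2) * \<delta> s"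
          proof -
            have "X (extend (seq \<omega>) m s) (Suc m) / a (Suc m) - X (extend (seq \<omega>) m s) n / a n = u + \<delta> s / a'"
              using \<open>X (extend (seq \<omega>) m s) (Suc m) = x + \<delta> s\<close>
              unfolding ext u_def y_def a'_def[symmetric] by (simp add: add_divide_distrib)
            then show ?thesis using \<open>\<delta> s = 0 \<or> \<delta> s = 1\<close> by (auto simp: power2_sum power_divide)
          qed
        qed (rule m)
        also have "\<dots> = u\<^sup>2 + (2 * u / a' + 1 / a'\<^sup>2) * \<pi>" by (simp add: \<pi>_def)
        \<comment> \<open>Completing the square separates the conditional mean from the variance of
          a Bernoulli increment, of which only the first term \<open>\<pi> / a'\<^sup>2\<close> is
          kept as an upper bound.\<close>
        also have "\<dots> = (u + \<pi> / a')\<^sup>2 + \<pi> / a'\<^sup>2 - (\<pi> / a')\<^sup>2"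
          using a' by (simp add: power2_eq_square field_simps)
        also have "u + \<pi> / a' = x / a m - y"
        proof -
          have "a' = a m * (1 + \<kappa> / (real m - \<alpha>))" unfolding a'_def by (rule aS[OF m(1)])
          moreover have "1 + \<kappa> / (real m - \<alpha>) > 0" using \<kappa> n\<alpha>[OF m(1)] by (intro add_pos_pos) auto
          moreover have "x + \<pi> = x * (1 + \<kappa> / (real m - \<alpha>))" by (simp add: \<pi>_def algebra_simps)
          ultimately have "(x + \<pi>) / a' = x / a m" using a[of m] by simp
          then show ?thesis unfolding u_def by (simp add: add_divide_distrib)
        qed
        finally have "step_mean m (\<lambda>t. (X t (Suc m) / a (Suc m) - X t n / a n)\<^sup>2) (seq \<omega>) \<le> (x / a m - y)\<^sup>2 + \<pi> / a'\<^sup>2"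
          by simp
        then show ?case unfolding x_def y_def a'_def \<pi>_def by simp
      qed
    qed
    also have "\<dots> = D n m + \<kappa> / ((real m - \<alpha>) * (a (Suc m))\<^sup>2) * (e * a m)"
      using int[OF dD[OF nk step(1)] m(2)] int[OF dX[of m m] m(2)] m by (simp add: D_def EX)
    \<comment> \<open>With \<open>r = \<kappa> / (m - \<alpha>)\<close> the new term is
      \<open>e * r / (a m * (1 + r)\<^sup>2)\<close>. Dropping one factor \<open>1 + r\<close>
      leaves precisely \<open>e\<close> times the difference of \<open>1 / a m\<close> and
      \<open>1 / a (Suc m)\<close>.\<close>
    also have "\<dots> \<le> D n m + e * (1 / a m - 1 / a (Suc m))"
    proof -
      define r where "r = \<kappa> / (real m - \<alpha>)"
      have r: "r > 0" unfolding r_def using \<kappa> n\<alpha>[OF m(1)] by simp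
      have "\<kappa> / ((real m - \<alpha>) * (a (Suc m))\<^sup>2) * (e * a m) = e * (r / (a m * (1 + r)\<^sup>2))"
        unfolding aS[OF m(1)] r_def[symmetric] using a[of m] by (simp add: r_def power2_eq_square mult_ac)
      also have "\<dots> \<le> e * (r / (a m * (1 + r)))"
        using e0 r a[of m] by (intro mult_left_mono divide_left_mono mult_left_mono) (auto simp: power2_eq_square mult_le_cancel_left1)
      also have "r / (a m * (1 + r)) = 1 / a m - 1 / a (Suc m)"
      proof -
        have "r / (x * (1 + r)) = 1 / x - 1 / (x * (1 + r))" if "x > 0" for x
        proof -
          have "1 + r \<noteq> 0" "x \<noteq> 0" using r that by auto
          then show ?thesis by (simp add: divide_simps)
        qed
        from this[OF a[of m]] show ?thesis unfolding aS[OF m(1)] r_def[symmetric] .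
      qed
      finally show ?thesis by simp
    qed
    also have "\<dots> \<le> e * (1 / a n - 1 / a (Suc m))" using step.IH by (simp add: algebra_simps)
    finally show ?case .
  qed
  have D1: "expectation (\<lambda>\<omega>. \<bar>X (seq \<omega>) m / a m - X (seq \<omega>) n / a n\<bar>) \<le> sqrt (e / a n)"
    if nk: "k \<le> n" and nm: "n \<le> m" for n m
  proof -
    let ?Z = "\<lambda>\<omega>. \<bar>X (seq \<omega>) m / a m - X (seq \<omega>) n / a n\<bar>"
    have m: "1 \<le> m" using k nk nm by simp
    have i1: "integrable M ?Z" using int[OF dX[of n m] m] int[OF dX[of m m] m] nk nm by auto
    have i2: "integrable M (\<lambda>\<omega>. (?Z \<omega>)\<^sup>2)" using int[OF dD[OF that] m] by simp
    have "(expectation ?Z)\<^sup>2 \<le> expectation (\<lambda>\<omega>. (?Z \<omega>)\<^sup>2)"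
      using variance_positive[of ?Z] variance_eq[OF i1 i2] by simp
    also have "\<dots> = D n m" by (simp add: D_def)
    also have "\<dots> \<le> e / a n" using D[OF that] a[of m] e0 by (simp add: right_diff_distrib) (smt (verit) divide_nonneg_pos)
    finally show ?thesis by (rule real_le_rsqrt)
  qed
  \<comment> \<open>With this exponent \<open>a\<close> grows at least like the fourth power of
    \<open>j\<close> along the subsequence, so the square roots of \<open>e / a\<close> are bounded
    by a multiple of \<open>1 / j\<^sup>2\<close>.\<close>
  obtain c :: nat where c: "c \<ge> 1" "real c * \<kappa> \<ge> 4"
  proof -
    obtain c where "real c > 4 / \<kappa>" using reals_Archimedean2 by blast
    then have "real (Suc c) * \<kappa> \<ge> 4" using \<kappa> by (simp add: field_simps)
    then show ?thesis using that[of "Suc c"] by simp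
  qed
  define G where "G = Gamma (real k - \<alpha>) / Gamma (real k - \<alpha> + \<kappa>)"
  have G: "G > 0" unfolding G_def using k_minus_\<alpha>[OF k] \<kappa> by (intro divide_pos_pos Gamma_real_pos) auto
  have aG: "(\<lambda>n. a n / real n powr \<kappa>) \<longlonglongrightarrow> G"
    unfolding a_def G_def by (rule norming_asymp) (use k \<kappa> in auto)
  have lower: "eventually (\<lambda>n. a n \<ge> G / 2 * real n powr \<kappa>) sequentially"
  proof -
    have "eventually (\<lambda>n. a n / real n powr \<kappa> > G / 2) sequentially"
      using order_tendstoD(1)[OF aG, of "G / 2"] G by simp
    with eventually_gt_at_top[of 0] show ?thesis
    proof eventually_elim
      case (elim n)
      have "real n powr \<kappa> > 0" using elim by simp
      then show ?case using elim by (simp add: field_simps)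
    qed
  qed
  let ?N = "\<lambda>j. Suc j ^ c"
  have self: "j \<le> ?N j" for j using c self_le_power[of "Suc j" c] by linarith
  \<comment> \<open>The shift of the index by \<open>k\<close> keeps all points of the subsequence
    at times where the hypotheses on \<open>X\<close> apply.\<close>
  have Nk: "k \<le> ?N (j + k)" for j using self[of "j + k"] by simp
  have Nmono: "?N j \<le> ?N (Suc j)" for j by (intro power_mono) auto
  have sm: "summable (\<lambda>j. sqrt (e / a (?N (j + k))))"
  proof (rule summable_comparison_test_ev)
    have flt: "filterlim (\<lambda>j. ?N (j + k)) at_top sequentially"
      unfolding filterlim_at_top
    proof
      fix Z show "eventually (\<lambda>j. Z \<le> ?N (j + k)) sequentially"
        using eventually_ge_at_top[of Z] by eventually_elim (use self le_trans add_leD1 in metis)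
    qed
    have "eventually (\<lambda>j. a (?N (j + k)) \<ge> G / 2 * real (?N (j + k)) powr \<kappa>) sequentially"
      by (rule eventually_compose_filterlim[OF lower flt])
    then show "eventually (\<lambda>j. norm (sqrt (e / a (?N (j + k)))) \<le> sqrt (2 * e / G) * inverse (real (Suc j) ^ 2)) sequentially"
    proof eventually_elim
      case (elim j)
      have "real (Suc j) ^ 4 = real (Suc j) powr 4" by (simp add: powr_numeral)
      also have "\<dots> \<le> real (Suc j) powr (real c * \<kappa>)" using c by (intro powr_mono) auto
      also have "\<dots> \<le> real (Suc (j + k)) powr (real c * \<kappa>)" using c by (intro powr_mono2) auto
      also have "\<dots> = real (?N (j + k)) powr \<kappa>" by (simp add: powr_powr[symmetric] powr_realpow del: of_nat_Suc)
      finally have "G / 2 * real (Suc j) ^ 4 \<le> a (?N (j + k))" using elim G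
        by (meson half_gt_zero less_eq_real_def mult_left_mono order_trans)
      then have "e / a (?N (j + k)) \<le> e / (G / 2 * real (Suc j) ^ 4)"
        using e0 G a by (intro divide_left_mono mult_pos_pos) auto
      also have "\<dots> = (2 * e / G) * (inverse (real (Suc j) ^ 2))\<^sup>2"
        by (simp add: field_simps power_mult[symmetric])
      finally have "sqrt (e / a (?N (j + k))) \<le> sqrt ((2 * e / G) * (inverse (real (Suc j) ^ 2))\<^sup>2)"
        by simp
      also have "\<dots> = sqrt (2 * e / G) * inverse (real (Suc j) ^ 2)"
        unfolding real_sqrt_mult by (subst real_sqrt_abs) simp
      finally show ?case using e0 a[of "?N (j + k)"] by simp
    qed
    have "summable (\<lambda>j. inverse (real (Suc j) ^ 2))"
      using inverse_power_summable[of 2, where 'a = real] by (subst summable_Suc_iff) simp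
    then show "summable (\<lambda>j. sqrt (2 * e / G) * inverse (real (Suc j) ^ 2))" by (rule summable_mult)
  qed
  have "AE \<omega> in M. convergent (\<lambda>j. X (seq \<omega>) (?N (j + k)) / a (?N (j + k)))"
  proof (rule AE_convergent_summable_increments[OF _ _ sm])
    fix j
    have "1 \<le> ?N (j + k)" using Nk[of j] k by simp
    from int[OF dX[OF Nk order_refl] this] show "integrable M (\<lambda>\<omega>. X (seq \<omega>) (?N (j + k)) / a (?N (j + k)))" by simp
    show "expectation (\<lambda>\<omega>. \<bar>X (seq \<omega>) (?N (Suc j + k)) / a (?N (Suc j + k)) - X (seq \<omega>) (?N (j + k)) / a (?N (j + k))\<bar>)
        \<le> sqrt (e / a (?N (j + k)))"
      using D1[OF Nk[of j], of "?N (Suc j + k)"] Nmono[of "j + k"] by simp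
  qed
  then show ?thesis using AE_growth nonneg step
  proof eventually_elim
    case (elim \<omega>)
    from elim(1) obtain L where L: "(\<lambda>j. X (seq \<omega>) (?N (j + k)) / a (?N (j + k))) \<longlonglongrightarrow> L" by (auto simp: convergent_def)
    have L': "(\<lambda>j. X (seq \<omega>) (?N j) / a (?N j)) \<longlonglongrightarrow> L" by (rule LIMSEQ_offset[OF L])
    have "filterlim (\<lambda>j. ?N j) at_top sequentially"
      unfolding filterlim_at_top
    proof
      fix Z show "eventually (\<lambda>j. Z \<le> ?N j) sequentially"
        using eventually_ge_at_top[of Z] by eventually_elim (use self le_trans in metis)
    qed
    then have "(\<lambda>j. a (?N j) / real (?N j) powr \<kappa>) \<longlonglongrightarrow> G" by (rule filterlim_compose[OF aG])
    from tendsto_mult[OF L' this] have "(\<lambda>j. X (seq \<omega>) (?N j) / real (?N j) powr \<kappa>) \<longlonglongrightarrow> L * G"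
      using a by (simp add: less_imp_neq[symmetric])
    then have "(\<lambda>n. X (seq \<omega>) n / real n powr \<kappa>) \<longlonglongrightarrow> L * G"
    proof (rule powr_subseq_interpolation[OF c(1) \<kappa>, rotated 2])
      show "0 \<le> X (seq \<omega>) n" if "k \<le> n" for n using elim(3) that by blast
      have st: "X (seq \<omega>) n \<le> X (seq \<omega>) (Suc n)" if n: "k \<le> n" for n
      proof -
        obtain s where s: "s \<in> sites (T n \<omega>)" "T (Suc n) \<omega> = insert_leaf (Suc n) (T n \<omega>) s"
          using elim(2) n k by (meson order_trans)
        have "X (extend (seq \<omega>) n s) (Suc n) = X (seq \<omega>) (Suc n)"
          by (rule extend_agrees) (use dX n s in auto)
        moreover have "X (extend (seq \<omega>) n s) (Suc n) - X (seq \<omega>) n \<in> {0, 1}" using elim(4) n s(1) by blast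
        ultimately show ?thesis by auto
      qed
      show "X (seq \<omega>) m \<le> X (seq \<omega>) n" if "k \<le> m" "m \<le> n" for m n
        using that(2)
      proof (induction n rule: dec_induct)
        case (step n)
        then show ?case using st[of n] that(1) by simp
      qed simp
    qed
    then show ?case by (auto simp: convergent_def)
  qed
qed

end

section \<open>Bounds for rising factorials\<close>

lemma pochhammer_mono_real:
  fixes x y :: real
  assumes "0 \<le> x" "x \<le> y"
  shows "0 \<le> pochhammer x n \<and> pochhammer x n \<le> pochhammer y n"
  using assms
proof (induction n)
  case (Suc n)
  then show ?case by (auto simp: pochhammer_Suc intro!: mult_mono mult_nonneg_nonneg)
qed simp

text \<open>The rising factorial of length \<open>2 * n\<close> is the product of two of length
  \<open>n\<close>, the second one started at \<open>y + n\<close>; each dominates the one at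
  \<open>x\<close>. Second moments are thereby bounded by first moments with doubled
  exponents.\<close>

lemma pochhammer_square_le:
  fixes x y :: real
  assumes "0 \<le> x" "x \<le> y"
  shows "(pochhammer x n)\<^sup>2 \<le> pochhammer y (2 * n)"
proof -
  have "pochhammer y (2 * n) = pochhammer y n * pochhammer (y + real n) n"
    using pochhammer_product'[of y n n] by (simp add: mult_2)
  moreover have "pochhammer x n * pochhammer x n \<le> pochhammer y n * pochhammer (y + real n) n"
    using pochhammer_mono_real[OF assms, of n] pochhammer_mono_real[of x "y + real n" n] assms
      pochhammer_mono_real[of y y n]
    by (intro mult_mono) auto
  ultimately show ?thesis by (simp add: power2_eq_square)
qed

section \<open>Joint moments of the limits\<close>

locale alpha_gamma_enum = alpha_gamma M \<alpha> \<gamma> T for M :: "'a measure" and \<alpha> \<gamma> T +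
  fixes k :: nat and enum :: "tree \<Rightarrow> nat \<Rightarrow> edge"
  assumes k: "1 \<le> k" and enum: "edge_enumeration k enum"
begin

abbreviation "Y \<equiv> Y_proc \<alpha> \<gamma> enum k"
abbreviation "U \<equiv> U_proc \<alpha> \<gamma> k"

text \<open>The number of edges of the reduced tree is random. Setting the length to zero beyond it
  gives a process for every index, and its convergence needs no conditioning on the shape.\<close>

definition "X i t n = (if i < card (t k) then Y i t n else 0)" for t :: "nat \<Rightarrow> tree"

lemma enum_bij: "\<omega> \<in> space M \<Longrightarrow> bij_betw (enum (T k \<omega>)) {..<card (T k \<omega>)} (T k \<omega>)"
  using enum T_trees[OF k] unfolding edge_enumeration_def by blast

lemma enum_leaf: "\<omega> \<in> space M \<Longrightarrow> i < card (T k \<omega>) \<Longrightarrow> leaf_edge (enum (T k \<omega>) i) \<longleftrightarrow> i < k"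
  using enum T_trees[OF k] unfolding edge_enumeration_def by blast

lemmas params = \<alpha>(1) \<alpha>(2) \<gamma>(1) \<gamma>(2)

lemma depends_X: "k \<le> n \<Longrightarrow> depends n (\<lambda>t. X i t n)"
  unfolding depends_def
proof (intro allI impI)
  fix t t' :: "nat \<Rightarrow> tree" assume n: "k \<le> n" and eq: "\<forall>i\<in>{1..n}. t i = t' i"
  have "Y i t n = Y i t' n" by (rule dependsD[OF depends_Y[OF k n]]) (use eq in auto)
  then show "X i t n = X i t' n" using eq k n by (simp add: X_def)
qed

lemma AE_X_convergent: "AE \<omega> in M. convergent (\<lambda>n. X i (seq \<omega>) n / real n powr \<gamma>)"
proof (rule AE_convergent_linear_growth[OF k \<gamma>(1)])
  show "depends n (\<lambda>t. X i t n)" if "k \<le> n" for n by (rule depends_X[OF that])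
  show "AE \<omega> in M. \<forall>n\<ge>k. 0 \<le> X i (seq \<omega>) n"
    using AE_reduces_to[OF k] AE_space
  proof eventually_elim
    case (elim \<omega>)
    show ?case
    proof (intro allI impI)
      fix n assume n: "k \<le> n"
      have red: "reduces_to k (T k \<omega>) n (T n \<omega>) (labels k (seq \<omega>) n)" using elim n by blast
      show "0 \<le> X i (seq \<omega>) n"
        using Y_pos[of k n "seq \<omega>" enum "card (T k \<omega>)" \<alpha> \<gamma> i] k n red enum_bij[OF elim(2)] params
        by (auto simp: X_def less_imp_le)
    qed
  qed
  show "AE \<omega> in M. \<forall>n\<ge>k. \<forall>s\<in>sites (T n \<omega>). X i (extend (seq \<omega>) n s) (Suc n) - X i (seq \<omega>) n \<in> {0, 1}"
    using AE_reduces_to[OF k] AE_space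
  proof eventually_elim
    case (elim \<omega>)
    show ?case
    proof (intro allI impI ballI)
      fix n s assume n: "k \<le> n" and s: "s \<in> sites (T n \<omega>)"
      have red: "reduces_to k (T k \<omega>) n (T n \<omega>) (labels k (seq \<omega>) n)" using elim n by blast
      have e: "extend (seq \<omega>) n s k = T k \<omega>" using n by (simp add: extend_def)
      show "X i (extend (seq \<omega>) n s) (Suc n) - X i (seq \<omega>) n \<in> {0, 1}"
        using Y_extend[of k n "seq \<omega>" enum "card (T k \<omega>)" \<alpha> \<gamma> s i] k n red enum_bij[OF elim(2)] params s
        by (auto simp: X_def e)
    qed
  qed
  show "AE \<omega> in M. \<forall>n\<ge>k. (\<Sum>s\<in>sites (T n \<omega>). site_weight \<alpha> \<gamma> (T n \<omega>) s *
        (X i (extend (seq \<omega>) n s) (Suc n) - X i (seq \<omega>) n)) = \<gamma> * X i (seq \<omega>) n"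
    using AE_reduces_to[OF k] AE_space
  proof eventually_elim
    case (elim \<omega>)
    show ?case
    proof (intro allI impI ballI)
      fix n assume n: "k \<le> n"
      have red: "reduces_to k (T k \<omega>) n (T n \<omega>) (labels k (seq \<omega>) n)" using elim n by blast
      have e: "extend (seq \<omega>) n s k = T k \<omega>" for s using n by (simp add: extend_def)
      show "(\<Sum>s\<in>sites (T n \<omega>). site_weight \<alpha> \<gamma> (T n \<omega>) s *
        (X i (extend (seq \<omega>) n s) (Suc n) - X i (seq \<omega>) n)) = \<gamma> * X i (seq \<omega>) n"
        using sum_Y_step[of k n "seq \<omega>" enum "card (T k \<omega>)" \<alpha> \<gamma> i] k n red enum_bij[OF elim(2)] params
        by (auto simp: X_def e)
    qed
  qed
qed

lemma AE_U_convergent: "AE \<omega> in M. convergent (\<lambda>n. U (seq \<omega>) n / real n powr 1)"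
proof (rule AE_convergent_linear_growth[OF k])
  show "depends n (\<lambda>t. U t n)" if "k \<le> n" for n by (rule depends_U[OF k that])
  show "AE \<omega> in M. \<forall>n\<ge>k. 0 \<le> U (seq \<omega>) n"
    unfolding U_proc_def using params by (intro AE_I2 allI impI add_nonneg_nonneg sum_nonneg) auto
  show "AE \<omega> in M. \<forall>n\<ge>k. \<forall>s\<in>sites (T n \<omega>). U (extend (seq \<omega>) n s) (Suc n) - U (seq \<omega>) n \<in> {0, 1}"
    using AE_reduces_to[OF k] AE_space
  proof eventually_elim
    case (elim \<omega>)
    show ?case
    proof (intro allI impI ballI)
      fix n s assume n: "k \<le> n" and s: "s \<in> sites (T n \<omega>)"
      have red: "reduces_to k (T k \<omega>) n (T n \<omega>) (labels k (seq \<omega>) n)" using elim n by blast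
      show "U (extend (seq \<omega>) n s) (Suc n) - U (seq \<omega>) n \<in> {0, 1}"
        using U_extend[of k n "seq \<omega>" enum "card (T k \<omega>)" \<alpha> \<gamma> s] k n red enum_bij[OF elim(2)] params s
        by auto
    qed
  qed
  show "AE \<omega> in M. \<forall>n\<ge>k. (\<Sum>s\<in>sites (T n \<omega>). site_weight \<alpha> \<gamma> (T n \<omega>) s *
        (U (extend (seq \<omega>) n s) (Suc n) - U (seq \<omega>) n)) = 1 * U (seq \<omega>) n"
    using AE_reduces_to[OF k] AE_space
  proof eventually_elim
    case (elim \<omega>)
    show ?case
    proof (intro allI impI ballI)
      fix n assume n: "k \<le> n"
      have red: "reduces_to k (T k \<omega>) n (T n \<omega>) (labels k (seq \<omega>) n)" using elim n by blast
      show "(\<Sum>s\<in>sites (T n \<omega>). site_weight \<alpha> \<gamma> (T n \<omega>) s *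
        (U (extend (seq \<omega>) n s) (Suc n) - U (seq \<omega>) n)) = 1 * U (seq \<omega>) n"
        using sum_U_step[of k n "seq \<omega>" enum "card (T k \<omega>)" \<alpha> \<gamma>] k n red enum_bij[OF elim(2)] params
        by auto
    qed
  qed
qed simp

text \<open>The limit is taken along \<open>n + k\<close>, since the processes are functions of the
  first \<open>n\<close> trees only from time \<open>k\<close> on; this makes measurability
  immediate.\<close>

definition "\<xi> i \<omega> = lim (\<lambda>n. X i (seq \<omega>) (n + k) / real (n + k) powr \<gamma>)"
definition "W \<omega> = lim (\<lambda>n. U (seq \<omega>) (n + k) / real (n + k))"

lemma \<xi>_measurable[measurable]: "\<xi> i \<in> borel_measurable M"
  unfolding \<xi>_def by (intro borel_measurable_lim_metric borel_measurable_divide measurable_depends_borel[OF depends_X] borel_measurable_const) simp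

lemma W_measurable[measurable]: "W \<in> borel_measurable M"
  unfolding W_def by (intro borel_measurable_lim_metric borel_measurable_divide measurable_depends_borel[OF depends_U[OF k]] borel_measurable_const) simp

lemma AE_limits:
  "AE \<omega> in M. (\<forall>i. (\<lambda>n. X i (seq \<omega>) n / real n powr \<gamma>) \<longlonglongrightarrow> \<xi> i \<omega>) \<and> (\<lambda>n. U (seq \<omega>) n / real n powr 1) \<longlonglongrightarrow> W \<omega>"
proof -
  have lim: "f \<longlonglongrightarrow> lim (\<lambda>n. f (n + k))" if cf: "convergent f" for f :: "nat \<Rightarrow> real"
  proof -
    obtain L where L: "f \<longlonglongrightarrow> L" using cf by (auto simp: convergent_def)
    have "lim (\<lambda>n. f (n + k)) = L" by (rule limI[OF LIMSEQ_ignore_initial_segment[OF L]])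
    with L show ?thesis by simp
  qed
  have "AE \<omega> in M. \<forall>i. convergent (\<lambda>n. X i (seq \<omega>) n / real n powr \<gamma>)"
    using AE_X_convergent by (simp add: AE_all_countable)
  then show ?thesis using AE_U_convergent
  proof eventually_elim
    case (elim \<omega>)
    then show ?case using lim[of "\<lambda>n. X _ (seq \<omega>) n / real n powr \<gamma>"] lim[OF elim(2)]
      by (auto simp: \<xi>_def W_def)
  qed
qed

text \<open>The initial values of the shifted lengths, that is, edge weights at time
  \<open>k\<close> divided by \<gamma>; they reappear as the Dirichlet parameters.\<close>

definition "av i = (if i < k then (1 - \<alpha>) / \<gamma> else 1)" for i :: nat
text \<open>The total edge weight at time \<open>k\<close>, which is the initial value of
  \<open>U\<close> and becomes the first beta parameter.\<close>

definition "\<theta> l = real k * (1 - \<alpha>) + real l * \<gamma>" for l :: nat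
definition "A l = {\<omega> \<in> space M. card (T k \<omega>) = k + l}" for l :: nat

lemma A_sets[measurable]: "A l \<in> sets M"
proof -
  have "depends k (\<lambda>t. card (t k) = k + l)" using k by (auto simp: depends_def)
  from measurable_depends[OF this] show ?thesis unfolding A_def by (simp add: pred_def)
qed

lemma sum_av: "(\<Sum>i<k + l. av i) = \<theta> l / \<gamma>"
proof -
  have "(\<Sum>i<k + l. av i) = (\<Sum>i<k. av i) + (\<Sum>i=k..<k + l. av i)"
    by (simp add: sum.atLeastLessThan_concat[symmetric] lessThan_atLeast0 del: sum.op_ivl_Suc)
  also have "(\<Sum>i<k. av i) = real k * ((1 - \<alpha>) / \<gamma>)" by (simp add: av_def)
  also have "(\<Sum>i=k..<k + l. av i) = real l" by (simp add: av_def)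
  finally show ?thesis using \<gamma> by (simp add: \<theta>_def field_simps)
qed

lemma initial_values:
  assumes \<omega>: "\<omega> \<in> A l" and g: "grown k (T k \<omega>)"
  shows "i < k + l \<Longrightarrow> Y i (seq \<omega>) k = av i" and "U (seq \<omega>) k = \<theta> l"
proof -
  have sp: "\<omega> \<in> space M" and c: "card (T k \<omega>) = k + l" using \<omega> by (auto simp: A_def)
  have bij: "bij_betw (enum (T k \<omega>)) {..<k + l} (T k \<omega>)" using enum_bij[OF sp] c by simp
  note pr = proper_grown[OF g]
  show "Y i (seq \<omega>) k = av i" if i: "i < k + l"
  proof -
    let ?e = "enum (T k \<omega>) i"
    have "?e \<in> T k \<omega>" using bij i by (auto simp: bij_betw_def)
    then have "tree_path (T k \<omega>) ?e = {?e}"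
      using anc_edge[OF pr, of "fst ?e" "snd ?e"] unfolding tree_path_def by auto
    then show ?thesis using enum_leaf[OF sp, of i] i c by (simp add: Y_proc_def edge_shift_def av_def)
  qed
  have "U (seq \<omega>) k = (\<Sum>e\<in>T k \<omega>. edge_weight \<alpha> \<gamma> e)"
    by (simp add: U_proc_def labels_start)
  also have "\<dots> = (\<Sum>i<k + l. edge_weight \<alpha> \<gamma> (enum (T k \<omega>) i))"
    by (rule sum.reindex_bij_betw[OF bij, symmetric])
  also have "\<dots> = (\<Sum>i<k + l. \<gamma> * av i)"
    using enum_leaf[OF sp] c \<gamma> by (intro sum.cong) (auto simp: av_def)
  also have "\<dots> = \<theta> l" using sum_av[of l] \<gamma> by (simp add: sum_distrib_left[symmetric])
  finally show "U (seq \<omega>) k = \<theta> l" .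
qed

definition "F l p q t n = (if card (t k) = k + l then mixed \<alpha> \<gamma> enum k (k + l) p q t n else 0)" for t :: "nat \<Rightarrow> tree"

lemma depends_F: "k \<le> n \<Longrightarrow> depends n (\<lambda>t. F l p q t n)"
  unfolding depends_def
proof (intro allI impI)
  fix t t' :: "nat \<Rightarrow> tree" assume n: "k \<le> n" and eq: "\<forall>i\<in>{1..n}. t i = t' i"
  have "mixed \<alpha> \<gamma> enum k (k + l) p q t n = mixed \<alpha> \<gamma> enum k (k + l) p q t' n"
    by (rule dependsD[OF depends_mixed[OF k n]]) (use eq in auto)
  then show "F l p q t n = F l p q t' n" using eq k n by (simp add: F_def)
qed

text \<open>The power of \<open>n\<close> at which the mean of \<open>F\<close> grows: \<gamma> for
  each factor from a length and one for each factor from \<open>U\<close>.\<close>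

definition "rate l p q = \<gamma> * real (\<Sum>i<k + l. p i) + real q" for p :: "nat \<Rightarrow> nat" and q :: nat

lemma expectation_F:
  assumes n: "k \<le> n"
  shows "expectation (\<lambda>\<omega>. F l p q (seq \<omega>) n) =
    prob (A l) * ((\<Prod>i<k + l. pochhammer (av i) (p i)) * pochhammer (\<theta> l + \<gamma> * real (\<Sum>i<k + l. p i)) q) *
    norming k (rate l p q) n"
  using n
proof (induction n rule: dec_induct)
  case base
  let ?c = "(\<Prod>i<k + l. pochhammer (av i) (p i)) * pochhammer (\<theta> l + \<gamma> * real (\<Sum>i<k + l. p i)) q"
  have "expectation (\<lambda>\<omega>. F l p q (seq \<omega>) k) = expectation (\<lambda>\<omega>. indicator (A l) \<omega> * ?c)"
  proof (rule integral_cong_AE)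
    show "(\<lambda>\<omega>. F l p q (seq \<omega>) k) \<in> borel_measurable M"
      by (rule measurable_depends_borel[OF depends_F[OF order_refl]])
    show "AE \<omega> in M. F l p q (seq \<omega>) k = indicator (A l) \<omega> * ?c"
      using AE_growth AE_space
    proof eventually_elim
      case (elim \<omega>)
      have g: "grown k (T k \<omega>)" using elim(1) k by blast
      show ?case
      proof (cases "\<omega> \<in> A l")
        case True
        have "mixed \<alpha> \<gamma> enum k (k + l) p q (seq \<omega>) k = ?c"
          unfolding mixed_def initial_values(2)[OF True g]
          using initial_values(1)[OF True g] by (intro arg_cong2[of _ _ _ _ "(*)"] prod.cong) auto
        then show ?thesis using True by (simp add: F_def A_def)
      next
        case False
        then show ?thesis using elim by (simp add: F_def A_def)
      qed
    qed
  qed simp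
  also have "\<dots> = prob (A l) * ?c"
    using sets.sets_into_space[OF A_sets[of l]] by (simp add: Int_absorb2)
  finally show ?case by (simp add: norming_self)
next
  case (step n)
  have n1: "1 \<le> n" using step k by simp
  have na: "real n - \<alpha> > 0" using k_minus_\<alpha>[OF n1] .
  have "expectation (\<lambda>\<omega>. F l p q (seq \<omega>) (Suc n)) = expectation (\<lambda>\<omega>. step_mean n (\<lambda>t. F l p q t (Suc n)) (seq \<omega>))"
    by (rule expectation_step[OF depends_F n1]) (use step in simp)
  also have "\<dots> = expectation (\<lambda>\<omega>. (1 + rate l p q / (real n - \<alpha>)) * F l p q (seq \<omega>) n)"
  proof (rule integral_cong_AE)
    show "(\<lambda>\<omega>. step_mean n (\<lambda>t. F l p q t (Suc n)) (seq \<omega>)) \<in> borel_measurable M"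
      by (rule measurable_depends_borel[OF depends_step_mean[OF depends_F n1]]) (use step in simp)
    show "(\<lambda>\<omega>. (1 + rate l p q / (real n - \<alpha>)) * F l p q (seq \<omega>) n) \<in> borel_measurable M"
      using measurable_depends_borel[OF depends_F[OF step(1)]] by simp
    show "AE \<omega> in M. step_mean n (\<lambda>t. F l p q t (Suc n)) (seq \<omega>) = (1 + rate l p q / (real n - \<alpha>)) * F l p q (seq \<omega>) n"
      using AE_reduces_to[OF k] AE_space
    proof eventually_elim
      case (elim \<omega>)
      have red: "reduces_to k (T k \<omega>) n (T n \<omega>) (labels k (seq \<omega>) n)" using elim(1) step(1) by blast
      have e: "extend (seq \<omega>) n s k = T k \<omega>" for s using step(1) by (simp add: extend_def)
      show ?case
      proof (cases "card (T k \<omega>) = k + l")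
        case True
        have bij: "bij_betw (enum (T k \<omega>)) {..<k + l} (T k \<omega>)" using enum_bij[OF elim(2)] True by simp
        have "step_mean n (\<lambda>t. F l p q t (Suc n)) (seq \<omega>) =
          (\<Sum>s\<in>sites (T n \<omega>). site_weight \<alpha> \<gamma> (T n \<omega>) s * mixed \<alpha> \<gamma> enum k (k + l) p q (extend (seq \<omega>) n s) (Suc n)) / (real n - \<alpha>)"
          unfolding step_mean_def F_def e using True by (simp add: sum_divide_distrib)
        also have "(\<Sum>s\<in>sites (T n \<omega>). site_weight \<alpha> \<gamma> (T n \<omega>) s * mixed \<alpha> \<gamma> enum k (k + l) p q (extend (seq \<omega>) n s) (Suc n)) =
            (real n - \<alpha> + \<gamma> * real (\<Sum>i<k + l. p i) + real q) * mixed \<alpha> \<gamma> enum k (k + l) p q (seq \<omega>) n"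
          using sum_mixed_step[of k n "seq \<omega>" enum "k + l" \<alpha> \<gamma> p q] k step(1) red bij params by blast
        also have "\<dots> / (real n - \<alpha>) = (1 + rate l p q / (real n - \<alpha>)) * F l p q (seq \<omega>) n"
          using na True by (simp add: F_def rate_def field_simps)
        finally show ?thesis .
      next
        case False
        then show ?thesis unfolding step_mean_def F_def e by simp
      qed
    qed
  qed
  also have "\<dots> = (1 + rate l p q / (real n - \<alpha>)) * expectation (\<lambda>\<omega>. F l p q (seq \<omega>) n)" by simp
  finally show ?case unfolding step.IH norming_Suc[OF k step(1)] by simp
qed

text \<open>The square is dominated by the functional with doubled exponents, whose mean is known
  exactly. This supplies the second moments required for passing to the limit in the first
  ones.\<close>

lemma F_bounds:
  assumes "\<omega> \<in> space M" "reduces_to k (T k \<omega>) n (T n \<omega>) (labels k (seq \<omega>) n)" "k \<le> n"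
  shows "0 \<le> F l p q (seq \<omega>) n"
    and "(F l p q (seq \<omega>) n)\<^sup>2 \<le> F l (\<lambda>i. 2 * p i) (2 * q) (seq \<omega>) n"
proof -
  let ?P = "real (\<Sum>i<k + l. p i)"
  have Un: "0 \<le> U (seq \<omega>) n" unfolding U_proc_def using params by (intro add_nonneg_nonneg sum_nonneg) auto
  have UP: "0 \<le> U (seq \<omega>) n + \<gamma> * ?P"
    by (intro add_nonneg_nonneg mult_nonneg_nonneg Un of_nat_0_le_iff less_imp_le[OF \<gamma>(1)])
  have Yn: "0 \<le> Y i (seq \<omega>) n" if "card (T k \<omega>) = k + l" "i < k + l" for i
    using Y_pos[of k n "seq \<omega>" enum "k + l" \<alpha> \<gamma> i] k assms enum_bij[OF assms(1)] params that by simp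
  show "0 \<le> F l p q (seq \<omega>) n"
    unfolding F_def mixed_def using Yn UP pochhammer_mono_real[OF _ order_refl]
    by (auto intro!: mult_nonneg_nonneg prod_nonneg)
  show "(F l p q (seq \<omega>) n)\<^sup>2 \<le> F l (\<lambda>i. 2 * p i) (2 * q) (seq \<omega>) n"
  proof (cases "card (T k \<omega>) = k + l")
    case True
    have "((\<Prod>i<k + l. pochhammer (Y i (seq \<omega>) n) (p i)) * pochhammer (U (seq \<omega>) n + \<gamma> * ?P) q)\<^sup>2 =
        (\<Prod>i<k + l. (pochhammer (Y i (seq \<omega>) n) (p i))\<^sup>2) * (pochhammer (U (seq \<omega>) n + \<gamma> * ?P) q)\<^sup>2"
      by (simp add: power_mult_distrib prod_power_distrib)
    also have "\<dots> \<le> (\<Prod>i<k + l. pochhammer (Y i (seq \<omega>) n) (2 * p i)) * pochhammer (U (seq \<omega>) n + \<gamma> * real (\<Sum>i<k + l. 2 * p i)) (2 * q)"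
    proof (intro mult_mono prod_mono conjI pochhammer_square_le UP)
      show "U (seq \<omega>) n + \<gamma> * ?P \<le> U (seq \<omega>) n + \<gamma> * real (\<Sum>i<k + l. 2 * p i)"
      proof -
        have "?P \<le> real (\<Sum>i<k + l. 2 * p i)" unfolding of_nat_le_iff by (intro sum_mono) simp
        then show ?thesis using \<gamma> by (intro add_left_mono mult_left_mono) auto
      qed
      show "0 \<le> (\<Prod>i<k + l. pochhammer (Y i (seq \<omega>) n) (2 * p i))"
        using Yn[OF True] pochhammer_mono_real[OF _ order_refl] by (intro prod_nonneg) auto
    qed (use Yn[OF True] in auto)
    finally show ?thesis using True by (simp add: F_def mixed_def)
  next
    case False
    then show ?thesis by (simp add: F_def)
  qed
qed

text \<open>The normalised \<open>F\<close> converges to the monomial in the limits on the event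
  \<open>A l\<close> and vanishes elsewhere, while its mean converges by the exact formula; bounded
  second moments identify the two limits. Conditioning divides by the probability of the
  event.\<close>

lemma limit_moment:
  assumes l: "prob (A l) > 0"
  shows "(\<integral>\<^sup>+ \<omega>. ennreal ((\<Prod>i<k + l. \<xi> i \<omega> ^ p i) * W \<omega> ^ q) \<partial>uniform_measure M (A l)) =
    ennreal ((\<Prod>i<k + l. pochhammer (av i) (p i)) * pochhammer (\<theta> l + \<gamma> * real (\<Sum>i<k + l. p i)) q *
      (Gamma (real k - \<alpha>) / Gamma (real k - \<alpha> + rate l p q)))"
proof -
  let ?c = "(\<Prod>i<k + l. pochhammer (av i) (p i)) * pochhammer (\<theta> l + \<gamma> * real (\<Sum>i<k + l. p i)) q"
  let ?G = "Gamma (real k - \<alpha>) / Gamma (real k - \<alpha> + rate l p q)"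
  let ?r = "rate l p q"
  have r0: "0 \<le> rate l p q" for p q
    unfolding rate_def by (intro add_nonneg_nonneg mult_nonneg_nonneg of_nat_0_le_iff less_imp_le[OF \<gamma>(1)])
  define f where "f n \<omega> = F l p q (seq \<omega>) (n + k) / real (n + k) powr ?r" for n \<omega>
  define h where "h \<omega> = indicator (A l) \<omega> * ((\<Prod>i<k + l. \<xi> i \<omega> ^ p i) * W \<omega> ^ q)" for \<omega>
  have int: "integrable M (\<lambda>\<omega>. g (seq \<omega>))" if "depends n g" "1 \<le> n" for g :: "(nat \<Rightarrow> tree) \<Rightarrow> real" and n
    using expectation_histories(1)[of "n - 1" g] that by simp
  have nk: "1 \<le> n + k" "k \<le> n + k" for n using k by auto
  have lim2: "(\<lambda>n. norming k (rate l p q) (n + k) / real (n + k) powr rate l p q) \<longlonglongrightarrow> Gamma (real k - \<alpha>) / Gamma (real k - \<alpha> + rate l p q)" for p q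
    by (rule LIMSEQ_ignore_initial_segment[OF norming_asymp[OF k r0]])
  have Ef: "expectation (\<lambda>\<omega>. F l p q (seq \<omega>) (n + k) / real (n + k) powr rate l p q) =
      prob (A l) * ((\<Prod>i<k + l. pochhammer (av i) (p i)) * pochhammer (\<theta> l + \<gamma> * real (\<Sum>i<k + l. p i)) q) *
      (norming k (rate l p q) (n + k) / real (n + k) powr rate l p q)" for n p q
    using expectation_F[OF nk(2)[of n], of l p q] by simp
  \<comment> \<open>The normalised means with doubled exponents converge and are therefore
    bounded.\<close>
  obtain B where B: "\<And>n. norm (prob (A l) * ((\<Prod>i<k + l. pochhammer (av i) (2 * p i)) * pochhammer (\<theta> l + \<gamma> * real (\<Sum>i<k + l. 2 * p i)) (2 * q)) *
      (norming k (rate l (\<lambda>i. 2 * p i) (2 * q)) (n + k) / real (n + k) powr rate l (\<lambda>i. 2 * p i) (2 * q))) \<le> B"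
    using convergent_imp_Bseq[OF convergentI[OF tendsto_mult[OF tendsto_const lim2[of "\<lambda>i. 2 * p i" "2 * q"]]]]
    unfolding Bseq_def by blast
  have "(\<integral>\<^sup>+ \<omega>. ennreal (h \<omega>) \<partial>M) = ennreal (prob (A l) * ?c * ?G)"
  proof (rule expectation_tendsto_L2)
    show "integrable M (f n)" for n unfolding f_def using int[OF depends_F[OF nk(2)] nk(1)] by simp
    have dF2: "depends (n + k) (\<lambda>t. (F l p q t (n + k))\<^sup>2)" for n
      using depends_F[OF nk(2)[of n], of l p q] unfolding depends_def by metis
    show int2: "integrable M (\<lambda>\<omega>. (f n \<omega>)\<^sup>2)" for n
      unfolding f_def power_divide using int[OF dF2 nk(1)] by simp
    have red: "AE \<omega> in M. \<omega> \<in> space M \<and> reduces_to k (T k \<omega>) (n + k) (T (n + k) \<omega>) (labels k (seq \<omega>) (n + k))" for n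
      using AE_reduces_to[OF k] AE_space by eventually_elim (use nk in blast)
    show "AE \<omega> in M. 0 \<le> f n \<omega>" for n
      using red[of n] by eventually_elim (simp add: f_def F_bounds)
    show "h \<in> borel_measurable M" unfolding h_def by measurable
    show "AE \<omega> in M. (\<lambda>n. f n \<omega>) \<longlonglongrightarrow> h \<omega>"
      using AE_limits AE_space
    proof eventually_elim
      case (elim \<omega>)
      show ?case
      proof (cases "\<omega> \<in> A l")
        case False
        then show ?thesis using elim by (simp add: f_def F_def h_def A_def)
      next
        case True
        have c: "card (T k \<omega>) = k + l" using True by (simp add: A_def)
        let ?P = "real (\<Sum>i<k + l. p i)"
        have L1: "(\<lambda>n. pochhammer (Y i (seq \<omega>) n) (p i) / real n powr (\<gamma> * real (p i))) \<longlonglongrightarrow> \<xi> i \<omega> ^ p i" if "i < k + l" for i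
        proof -
          have "(\<lambda>n. X i (seq \<omega>) n / real n powr \<gamma>) \<longlonglongrightarrow> \<xi> i \<omega>" using elim by blast
          then have "(\<lambda>n. Y i (seq \<omega>) n / real n powr \<gamma>) \<longlonglongrightarrow> \<xi> i \<omega>" using that c by (simp add: X_def)
          then show ?thesis by (rule pochhammer_powr_asymp[OF _ \<gamma>(1)])
        qed
        have L2: "(\<lambda>n. pochhammer (U (seq \<omega>) n + \<gamma> * ?P) q / real n powr (1 * real q)) \<longlonglongrightarrow> W \<omega> ^ q"
        proof (rule pochhammer_powr_asymp)
          have 1: "(\<lambda>n. c / real n powr 1) \<longlonglongrightarrow> 0" for c :: real by real_asymp
          have 2: "(\<lambda>n. U (seq \<omega>) n / real n powr 1) \<longlonglongrightarrow> W \<omega>" using elim by blast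
          show "(\<lambda>n. (U (seq \<omega>) n + \<gamma> * ?P) / real n powr 1) \<longlonglongrightarrow> W \<omega>"
            unfolding add_divide_distrib using tendsto_add[OF 2 1[of "\<gamma> * ?P"]] by simp
        qed simp
        have "(\<lambda>n. (\<Prod>i<k + l. pochhammer (Y i (seq \<omega>) n) (p i) / real n powr (\<gamma> * real (p i))) *
            (pochhammer (U (seq \<omega>) n + \<gamma> * ?P) q / real n powr (1 * real q))) \<longlonglongrightarrow> (\<Prod>i<k + l. \<xi> i \<omega> ^ p i) * W \<omega> ^ q"
          by (intro tendsto_mult tendsto_prod L1 L2) auto
        from LIMSEQ_ignore_initial_segment[OF this, of k]
        have "(\<lambda>n. (\<Prod>i<k + l. pochhammer (Y i (seq \<omega>) (n + k)) (p i) / real (n + k) powr (\<gamma> * real (p i))) *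
            (pochhammer (U (seq \<omega>) (n + k) + \<gamma> * ?P) q / real (n + k) powr (1 * real q))) \<longlonglongrightarrow> (\<Prod>i<k + l. \<xi> i \<omega> ^ p i) * W \<omega> ^ q" .
        moreover have "(\<Prod>i<k + l. pochhammer (Y i (seq \<omega>) (n + k)) (p i) / real (n + k) powr (\<gamma> * real (p i))) *
            (pochhammer (U (seq \<omega>) (n + k) + \<gamma> * ?P) q / real (n + k) powr (1 * real q)) = f n \<omega>" for n
        proof -
          have "real (n + k) powr ?r = (\<Prod>i<k + l. real (n + k) powr (\<gamma> * real (p i))) * real (n + k) powr (1 * real q)"
            using k by (simp add: rate_def powr_add sum_distrib_left powr_sum)
          then show ?thesis unfolding f_def F_def mixed_def using c by (simp add: prod_dividef)
        qed
        ultimately show ?thesis using True by (simp add: h_def)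
      qed
    qed
    show "expectation (\<lambda>\<omega>. (f n \<omega>)\<^sup>2) \<le> B" for n
    proof -
      \<comment> \<open>Doubling all exponents doubles the rate, so the normalisation of the
        dominating functional is exactly the square of the original one.\<close>
      have d2: "rate l (\<lambda>i. 2 * p i) (2 * q) = ?r + ?r" unfolding rate_def sum_distrib_left[symmetric] by (simp add: algebra_simps)
      have "expectation (\<lambda>\<omega>. (f n \<omega>)\<^sup>2) \<le> expectation (\<lambda>\<omega>. F l (\<lambda>i. 2 * p i) (2 * q) (seq \<omega>) (n + k) / real (n + k) powr rate l (\<lambda>i. 2 * p i) (2 * q))"
      proof (rule integral_mono_AE[OF int2])
        show "integrable M (\<lambda>\<omega>. F l (\<lambda>i. 2 * p i) (2 * q) (seq \<omega>) (n + k) / real (n + k) powr rate l (\<lambda>i. 2 * p i) (2 * q))"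
          using int[OF depends_F[OF nk(2)] nk(1)] by simp
        show "AE \<omega> in M. (f n \<omega>)\<^sup>2 \<le> F l (\<lambda>i. 2 * p i) (2 * q) (seq \<omega>) (n + k) / real (n + k) powr rate l (\<lambda>i. 2 * p i) (2 * q)"
          using red[of n]
        proof eventually_elim
          case (elim \<omega>)
          show ?case unfolding f_def power_divide d2 powr_add power2_eq_square[of "real (n + k) powr ?r"]
            by (rule divide_right_mono) (use F_bounds(2)[of \<omega> "n + k" l p q] elim nk(2) in auto)
        qed
      qed
      also have "\<dots> \<le> B" unfolding Ef using B[of n] by (simp only: real_norm_def abs_le_iff)
      finally show ?thesis .
    qed
    show "(\<lambda>n. expectation (f n)) \<longlonglongrightarrow> prob (A l) * ?c * ?G"
      unfolding f_def[abs_def] Ef by (intro tendsto_mult tendsto_const lim2)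
  qed
  moreover have "(\<integral>\<^sup>+ \<omega>. ennreal ((\<Prod>i<k + l. \<xi> i \<omega> ^ p i) * W \<omega> ^ q) \<partial>uniform_measure M (A l)) =
      (\<integral>\<^sup>+ \<omega>. ennreal (h \<omega>) \<partial>M) / emeasure M (A l)"
  proof (subst nn_integral_uniform_measure)
    show "(\<integral>\<^sup>+ \<omega>. ennreal ((\<Prod>i<k + l. \<xi> i \<omega> ^ p i) * W \<omega> ^ q) * indicator (A l) \<omega> \<partial>M) / emeasure M (A l) =
      (\<integral>\<^sup>+ \<omega>. ennreal (h \<omega>) \<partial>M) / emeasure M (A l)"
      by (intro arg_cong2[of _ _ _ _ "(/)"] nn_integral_cong refl) (simp add: h_def indicator_def)
  qed measurable
  moreover have "ennreal (prob (A l) * ?c * ?G) / emeasure M (A l) = ennreal (?c * ?G)"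
  proof -
    have "0 \<le> ?c * ?G"
    proof (intro mult_nonneg_nonneg prod_nonneg divide_nonneg_nonneg)
      show "\<And>i. i \<in> {..<k + l} \<Longrightarrow> 0 \<le> pochhammer (av i) (p i)"
        using pochhammer_mono_real[OF _ order_refl] params by (simp add: av_def)
      show "0 \<le> pochhammer (\<theta> l + \<gamma> * real (\<Sum>i<k + l. p i)) q"
      proof (rule pochhammer_mono_real[OF _ order_refl, THEN conjunct1])
        have "0 \<le> \<theta> l" unfolding \<theta>_def using params by (intro add_nonneg_nonneg mult_nonneg_nonneg) auto
        then show "0 \<le> \<theta> l + \<gamma> * real (\<Sum>i<k + l. p i)"
          by (intro add_nonneg_nonneg mult_nonneg_nonneg of_nat_0_le_iff less_imp_le[OF \<gamma>(1)])
      qed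
      show "0 \<le> Gamma (real k - \<alpha>)" "0 \<le> Gamma (real k - \<alpha> + ?r)"
        using k_minus_\<alpha>[OF k] r0[of p q] by (auto intro!: less_imp_le[OF Gamma_real_pos])
    qed
    moreover have "ennreal (b * x) / ennreal b = ennreal x" if "0 \<le> x" "0 < b" for b x :: real
      using that by (subst divide_ennreal) auto
    ultimately show ?thesis using l by (simp only: emeasure_eq_measure mult.assoc)
  qed
  ultimately show ?thesis by simp
qed

end

lemma sets_beta_distribution: "sets (beta_distribution a b) = sets borel"
  by (simp add: beta_distribution_def)

lemma sets_tilted: "sets (tilted C a g) = sets borel"
  by (simp add: tilted_def)

section \<open>The law of the limits\<close>

text \<open>The target law \<open>Q\<close> of \<open>(W, L, D)\<close>, and its image under \<open>(w, l, d) \<mapsto> (l w\<^sup>\<gamma> d, w)\<close>.\<close>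

locale ideal_law =
  fixes \<gamma> \<theta> b C c :: real and g :: "real \<Rightarrow> real" and a :: "real list" and m :: nat
  assumes \<gamma>: "0 < \<gamma>" and \<theta>: "0 < \<theta>" and b: "0 \<le> b"
    and g: "mittag_leffler_density \<gamma> g" and C: "C = Gamma (1 + \<gamma> * c) / Gamma (1 + c)" and c: "c = \<theta> / \<gamma>"
    and len: "length a = m" and m: "0 < m" and pos: "\<And>i. i < m \<Longrightarrow> 0 < a ! i" and sum_a: "(\<Sum>i<m. a ! i) = c"
begin

abbreviation "WL \<equiv> beta_distribution \<theta> b"
abbreviation "LL \<equiv> tilted C c g"
abbreviation "DL \<equiv> dirichlet a"
abbreviation "V \<equiv> PiM {..<m} (\<lambda>_. borel :: real measure)"
abbreviation "I \<equiv> PiM {..m} (\<lambda>_. borel :: real measure)"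
definition "Q = WL \<Otimes>\<^sub>M (LL \<Otimes>\<^sub>M DL)"

lemma c_pos: "0 < c" using c \<theta> \<gamma> by simp

lemma C_pos: "0 < C"
  unfolding C using \<gamma> c_pos by (intro divide_pos_pos Gamma_real_pos) (auto intro: add_pos_pos)

lemma len': "length a = Suc (m - 1)" "\<And>i. i < Suc (m - 1) \<Longrightarrow> 0 < a ! i" "Suc (m - 1) = m"
  using len m pos by auto

lemma prob_space_WL: "prob_space WL" by (rule prob_space_beta[OF \<theta> b])
lemma prob_space_LL: "prob_space LL" by (rule prob_space_tilted[OF g \<gamma> c_pos C])
lemma prob_space_DL: "prob_space DL" by (rule prob_space_dirichlet[OF len'(1,2)])

lemma sets_DL: "sets DL = sets V"
  using sets_dirichlet[OF len'(1,2)] unfolding len'(3) .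

lemma sets_Q: "sets Q = sets (borel \<Otimes>\<^sub>M (borel \<Otimes>\<^sub>M V))"
  unfolding Q_def by (intro sets_pair_measure_cong sets_beta_distribution sets_tilted sets_DL)

sublocale LD: pair_prob_space LL DL
  using prob_space_LL prob_space_DL by (simp add: pair_prob_space_def pair_sigma_finite_def prob_space_imp_sigma_finite)

lemma prob_space_LD: "prob_space (LL \<Otimes>\<^sub>M DL)" by (rule LD.prob_space_axioms)

lemma AE_Q: "AE z in Q. 0 < fst z \<and> fst z \<le> 1 \<and> 0 < fst (snd z) \<and> (\<forall>i<m. 0 < snd (snd z) i) \<and> (\<Sum>i<m. snd (snd z) i) = 1"
proof -
  have 1: "AE z in Q. 0 < fst z \<and> fst z \<le> 1"
    unfolding Q_def by (rule AE_pair_fst[OF prob_space_LD beta_distribution_support])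
  have 2: "AE z in Q. 0 < fst (snd z)"
    unfolding Q_def by (rule AE_pair_snd[OF prob_space_WL prob_space_LD AE_pair_fst[OF prob_space_DL tilted_pos[OF g \<gamma> c_pos C_pos]]])
  have "AE y in DL. (\<forall>i<m. 0 < y i) \<and> (\<Sum>i<m. y i) = 1"
    using dirichlet_support[OF len'(1,2)] unfolding len'(3) .
  then have 3: "AE z in Q. (\<forall>i<m. 0 < snd (snd z) i) \<and> (\<Sum>i<m. snd (snd z) i) = 1"
    unfolding Q_def by (intro AE_pair_snd[OF prob_space_WL prob_space_LD] AE_pair_snd[OF prob_space_LL prob_space_DL])
  from 1 2 3 show ?thesis by eventually_elim blast
qed

text \<open>The value of \<open>W\<close> is appended as coordinate \<open>m\<close>, which places
  the joint law on a product of real lines, where moments determine it.\<close>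

definition lengths :: "real \<times> real \<times> (nat \<Rightarrow> real) \<Rightarrow> nat \<Rightarrow> real" where
  "lengths z = (\<lambda>i\<in>{..m}. if i < m then fst (snd z) * fst z powr \<gamma> * snd (snd z) i else fst z)"

definition triple :: "(nat \<Rightarrow> real) \<Rightarrow> real \<times> real \<times> (nat \<Rightarrow> real)" where
  "triple x = (x m, (\<Sum>i<m. x i) / x m powr \<gamma>, \<lambda>i\<in>{..<m}. x i / (\<Sum>i<m. x i))"

lemma lengths_measurable: "lengths \<in> Q \<rightarrow>\<^sub>M I"
proof -
  have [measurable]: "(\<lambda>z. snd (snd z) i) \<in> borel_measurable (borel \<Otimes>\<^sub>M (borel \<Otimes>\<^sub>M V))" if "i < m" for i
    by (rule measurable_compose[OF _ measurable_component_singleton[of i "{..<m}"]]) (use that in auto)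
  have "lengths \<in> (borel \<Otimes>\<^sub>M (borel \<Otimes>\<^sub>M V)) \<rightarrow>\<^sub>M I"
    unfolding lengths_def[abs_def]
  proof (rule measurable_restrict)
    fix i assume "i \<in> {..m}"
    show "(\<lambda>z. if i < m then fst (snd z) * fst z powr \<gamma> * snd (snd z) i else fst z) \<in> borel_measurable (borel \<Otimes>\<^sub>M (borel \<Otimes>\<^sub>M V))"
      by (cases "i < m") auto
  qed
  then show ?thesis using sets_Q by (simp cong: measurable_cong_sets)
qed

lemma triple_measurable: "triple \<in> I \<rightarrow>\<^sub>M (borel \<Otimes>\<^sub>M (borel \<Otimes>\<^sub>M V))"
proof -
  have c[measurable]: "(\<lambda>x. x i) \<in> borel_measurable I" if "i \<le> m" for i
    using that by simp
  have s[measurable]: "(\<lambda>x. \<Sum>i<m. x i) \<in> borel_measurable I"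
    by (rule borel_measurable_sum) (use c in auto)
  show ?thesis unfolding triple_def[abs_def]
  proof (intro measurable_Pair measurable_restrict)
    show "(\<lambda>x. x m) \<in> borel_measurable I" using c by simp
    show "(\<lambda>x. (\<Sum>i<m. x i) / x m powr \<gamma>) \<in> borel_measurable I" using c[OF order_refl] by measurable
    show "(\<lambda>x. x i / (\<Sum>i<m. x i)) \<in> borel_measurable I" if "i \<in> {..<m}" for i
    proof -
      have [measurable]: "(\<lambda>x. x i) \<in> borel_measurable I" using c that by simp
      show ?thesis by measurable
    qed
  qed
qed

text \<open>The entries of \<open>d\<close> sum to one, so the lengths sum to
  \<open>s * w powr \<gamma>\<close>; as \<open>w\<close> and \<open>s\<close> are positive, both
  divisions are legitimate. Equality of the last component also uses that \<open>d\<close> is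
  extensional.\<close>

lemma triple_lengths: "AE z in Q. triple (lengths z) = z"
  using AE_Q AE_space
proof eventually_elim
  case (elim z)
  let ?w = "fst z" and ?s = "fst (snd z)" and ?d = "snd (snd z)"
  have "z \<in> space (borel \<Otimes>\<^sub>M (borel \<Otimes>\<^sub>M V))" using elim(2) sets_eq_imp_space_eq[OF sets_Q] by simp
  then have d: "?d \<in> extensional {..<m}" by (auto simp: space_pair_measure space_PiM PiE_def)
  have S: "(\<Sum>i<m. lengths z i) = ?s * ?w powr \<gamma>"
  proof -
    have "(\<Sum>i<m. lengths z i) = (\<Sum>i<m. ?s * ?w powr \<gamma> * ?d i)" by (intro sum.cong) (auto simp: lengths_def)
    also have "\<dots> = ?s * ?w powr \<gamma> * (\<Sum>i<m. ?d i)" by (simp add: sum_distrib_left)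
    finally show ?thesis using elim(1) by simp
  qed
  have wp: "?w powr \<gamma> > 0" using elim(1) by simp
  have "(\<lambda>i\<in>{..<m}. lengths z i / (?s * ?w powr \<gamma>)) = ?d"
  proof
    fix i
    show "(\<lambda>i\<in>{..<m}. lengths z i / (?s * ?w powr \<gamma>)) i = ?d i"
    proof (cases "i < m")
      case True
      then show ?thesis using elim(1) wp by (simp add: lengths_def)
    next
      case False
      then show ?thesis using d by (simp add: extensional_def)
    qed
  qed
  moreover have "lengths z m = ?w" by (simp add: lengths_def)
  ultimately show ?case unfolding triple_def S using wp by (simp add: prod_eq_iff)
qed

lemma distr_triple: "distr (distr Q I lengths) (borel \<Otimes>\<^sub>M (borel \<Otimes>\<^sub>M V)) triple = Q"
proof -
  have "distr (distr Q I lengths) (borel \<Otimes>\<^sub>M (borel \<Otimes>\<^sub>M V)) triple = distr Q (borel \<Otimes>\<^sub>M (borel \<Otimes>\<^sub>M V)) (triple \<circ> lengths)"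
    by (rule distr_distr[OF triple_measurable lengths_measurable])
  also have "\<dots> = distr Q (borel \<Otimes>\<^sub>M (borel \<Otimes>\<^sub>M V)) (\<lambda>z. z)"
  proof (rule distr_cong_AE)
    show "AE z in Q. (triple \<circ> lengths) z = z" using triple_lengths by simp
    show "triple \<circ> lengths \<in> Q \<rightarrow>\<^sub>M borel \<Otimes>\<^sub>M (borel \<Otimes>\<^sub>M V)"
      by (rule measurable_comp[OF lengths_measurable triple_measurable])
    show "(\<lambda>z. z) \<in> Q \<rightarrow>\<^sub>M borel \<Otimes>\<^sub>M (borel \<Otimes>\<^sub>M V)" using sets_Q by (rule measurable_ident_sets)
  qed auto
  also have "\<dots> = Q" by (rule distr_id2) (simp add: sets_Q)
  finally show ?thesis .
qed

text \<open>By independence the moment is a product of a beta, a tilted Mittag-Leffler and a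
  Dirichlet moment. The Mittag-Leffler factor equals \<open>Gamma \<theta> * Gamma (c + P) / (Gamma
  c * Gamma (\<theta> + \<gamma> * P))\<close>. Its part in \<open>c\<close> cancels against the
  Dirichlet normalisation and its part in \<theta> turns the beta moment into a rising factorial
  started at \<open>\<theta> + \<gamma> * P\<close>.\<close>

lemma lengths_moment:
  fixes p :: "nat \<Rightarrow> nat"
  defines "P \<equiv> \<Sum>i<m. p i"
  shows "(\<integral>\<^sup>+ x. ennreal (\<Prod>i\<in>{..m}. x i ^ p i) \<partial>distr Q I lengths) =
    ennreal ((\<Prod>i<m. pochhammer (a ! i) (p i)) * pochhammer (\<theta> + \<gamma> * real P) (p m) *
      (Gamma (\<theta> + b) / Gamma (\<theta> + b + (\<gamma> * real P + real (p m)))))"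
proof -
  have m1: "(\<lambda>x. ennreal (\<Prod>i\<in>{..m}. x i ^ p i)) \<in> borel_measurable I"
    by (rule measurable_compose[OF borel_measurable_prod measurable_ennreal]) (auto intro!: borel_measurable_power)
  have "(\<integral>\<^sup>+ x. ennreal (\<Prod>i\<in>{..m}. x i ^ p i) \<partial>distr Q I lengths) = (\<integral>\<^sup>+ z. ennreal (\<Prod>i\<in>{..m}. lengths z i ^ p i) \<partial>Q)"
    using m1 by (subst nn_integral_distr[OF lengths_measurable]) auto
  also have "\<dots> = (\<integral>\<^sup>+ z. ennreal (fst z powr (\<gamma> * real P + real (p m))) * (ennreal (fst (snd z) ^ P) * ennreal (\<Prod>i<m. snd (snd z) i ^ p i)) \<partial>Q)"
  proof (rule nn_integral_cong_AE)
    show "AE z in Q. ennreal (\<Prod>i\<in>{..m}. lengths z i ^ p i) =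
       ennreal (fst z powr (\<gamma> * real P + real (p m))) * (ennreal (fst (snd z) ^ P) * ennreal (\<Prod>i<m. snd (snd z) i ^ p i))"
      using AE_Q
    proof eventually_elim
      case (elim z)
      let ?w = "fst z" and ?s = "fst (snd z)" and ?d = "snd (snd z)"
      have "{..m} = insert m {..<m}" by auto
      then have "(\<Prod>i\<in>{..m}. lengths z i ^ p i) = lengths z m ^ p m * (\<Prod>i<m. lengths z i ^ p i)" by simp
      also have "(\<Prod>i<m. lengths z i ^ p i) = (\<Prod>i<m. (?s * ?w powr \<gamma>) ^ p i * ?d i ^ p i)"
        by (intro prod.cong) (auto simp: lengths_def power_mult_distrib)
      also have "\<dots> = (?s * ?w powr \<gamma>) ^ P * (\<Prod>i<m. ?d i ^ p i)"
        unfolding prod.distrib P_def by (simp add: power_sum)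
      also have "(?s * ?w powr \<gamma>) ^ P = ?s ^ P * ?w powr (\<gamma> * real P)"
        using elim by (simp add: power_mult_distrib powr_powr powr_realpow[symmetric])
      also have "lengths z m ^ p m = ?w powr real (p m)" using elim by (simp add: lengths_def powr_realpow)
      finally have "(\<Prod>i\<in>{..m}. lengths z i ^ p i) = ?w powr (\<gamma> * real P + real (p m)) * (?s ^ P * (\<Prod>i<m. ?d i ^ p i))"
        by (simp add: powr_add mult_ac)
      moreover have "0 \<le> (\<Prod>i<m. ?d i ^ p i)" using elim by (intro prod_nonneg) (auto simp: less_imp_le)
      ultimately show ?case using elim by (simp add: ennreal_mult less_imp_le)
    qed
  qed
  also have "\<dots> = (\<integral>\<^sup>+ w. ennreal (w powr (\<gamma> * real P + real (p m))) \<partial>WL) *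
      (\<integral>\<^sup>+ y. ennreal (fst y ^ P) * ennreal (\<Prod>i<m. snd y i ^ p i) \<partial>(LL \<Otimes>\<^sub>M DL))"
  proof -
    have mD: "(\<lambda>y. ennreal (\<Prod>i<m. y i ^ p i)) \<in> borel_measurable DL"
      unfolding measurable_cong_sets[OF sets_DL refl]
      by (rule measurable_compose[OF borel_measurable_prod measurable_ennreal]) (auto intro!: borel_measurable_power)
    have [measurable]: "(\<lambda>x. ennreal (x ^ P)) \<in> borel_measurable LL"
      unfolding measurable_cong_sets[OF sets_tilted refl] by simp
    show ?thesis unfolding Q_def
      by (rule nn_integral_pair_mult[OF prob_space_imp_sigma_finite[OF prob_space_LD]])
        (use mD in \<open>auto simp: measurable_cong_sets[OF sets_beta_distribution refl] intro!: borel_measurable_times_ennreal measurable_compose[OF measurable_snd mD] measurable_compose[OF measurable_fst, of _ LL]\<close>)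
  qed
  also have "(\<integral>\<^sup>+ y. ennreal (fst y ^ P) * ennreal (\<Prod>i<m. snd y i ^ p i) \<partial>(LL \<Otimes>\<^sub>M DL)) =
      (\<integral>\<^sup>+ s. ennreal (s ^ P) \<partial>LL) * (\<integral>\<^sup>+ d. ennreal (\<Prod>i<m. d i ^ p i) \<partial>DL)"
  proof (rule nn_integral_pair_mult[OF prob_space_imp_sigma_finite[OF prob_space_DL]])
    show "(\<lambda>x. ennreal (x ^ P)) \<in> borel_measurable LL"
      unfolding measurable_cong_sets[OF sets_tilted refl] by simp
    show "(\<lambda>y. ennreal (\<Prod>i<m. y i ^ p i)) \<in> borel_measurable DL"
      unfolding measurable_cong_sets[OF sets_DL refl]
      by (rule measurable_compose[OF borel_measurable_prod measurable_ennreal]) (auto intro!: borel_measurable_power)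
  qed
  also have "(\<integral>\<^sup>+ w. ennreal (w powr (\<gamma> * real P + real (p m))) \<partial>WL) =
      ennreal (Gamma (\<theta> + (\<gamma> * real P + real (p m))) * Gamma (\<theta> + b) / (Gamma \<theta> * Gamma (\<theta> + b + (\<gamma> * real P + real (p m)))))"
    by (rule beta_distribution_moment[OF \<theta> b]) (use \<gamma> in auto)
  also have "(\<integral>\<^sup>+ s. ennreal (s ^ P) \<partial>LL) = ennreal (C * (Gamma (c + real P + 1) / Gamma (\<gamma> * (c + real P) + 1)))"
    by (rule tilted_moment[OF g \<gamma> c_pos C_pos])
  also have "(\<integral>\<^sup>+ d. ennreal (\<Prod>i<m. d i ^ p i) \<partial>DL) =
      ennreal ((\<Prod>i<m. Gamma (a ! i + real (p i)) / Gamma (a ! i)) * (Gamma c / Gamma (c + real P)))"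
    using dirichlet_moment[OF len'(1,2), of p] unfolding len'(3) sum_a P_def by simp
  also have "(\<Prod>i<m. Gamma (a ! i + real (p i)) / Gamma (a ! i)) = (\<Prod>i<m. pochhammer (a ! i) (p i))"
    using pos by (intro prod.cong refl pochhammer_Gamma[symmetric]) (auto dest: nonpos_Ints_nonpos simp: not_less[symmetric])
  also have "ennreal (Gamma (\<theta> + (\<gamma> * real P + real (p m))) * Gamma (\<theta> + b) / (Gamma \<theta> * Gamma (\<theta> + b + (\<gamma> * real P + real (p m))))) *
      (ennreal (C * (Gamma (c + real P + 1) / Gamma (\<gamma> * (c + real P) + 1))) *
       ennreal ((\<Prod>i<m. pochhammer (a ! i) (p i)) * (Gamma c / Gamma (c + real P)))) =
      ennreal ((\<Prod>i<m. pochhammer (a ! i) (p i)) * pochhammer (\<theta> + \<gamma> * real P) (p m) *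
      (Gamma (\<theta> + b) / Gamma (\<theta> + b + (\<gamma> * real P + real (p m)))))"
  proof -
    let ?r = "\<gamma> * real P + real (p m)" and ?D = "\<Prod>i<m. pochhammer (a ! i) (p i)"
    have gP: "0 \<le> \<gamma> * real P" using \<gamma> by simp
    have p1: "0 < Gamma (\<theta> + ?r)" "0 < Gamma (\<theta> + b)" "0 < Gamma \<theta>" "0 < Gamma (\<theta> + b + ?r)"
      "0 < Gamma (c + real P)" "0 < Gamma c" "0 < Gamma (\<theta> + \<gamma> * real P)"
      using \<theta> b gP c_pos by (auto intro!: Gamma_real_pos)
    \<comment> \<open>The relation between the tilt and the first beta parameter on which the
      cancellation rests.\<close>
    have gc: "\<gamma> * c = \<theta>" using c \<gamma> by simp
    have e1: "Gamma (c + real P + 1) = (c + real P) * Gamma (c + real P)" using c_pos by (intro Gamma_plus1_pos) auto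
    have e2: "Gamma (\<gamma> * (c + real P) + 1) = (\<gamma> * (c + real P)) * Gamma (\<theta> + \<gamma> * real P)"
    proof -
      have "0 < \<gamma> * (c + real P)" using \<gamma> c_pos by (intro mult_pos_pos add_pos_nonneg) auto
      moreover have "\<gamma> * (c + real P) = \<theta> + \<gamma> * real P" by (simp add: distrib_left gc)
      ultimately show ?thesis using Gamma_plus1_pos by metis
    qed
    have e3: "C = \<gamma> * Gamma \<theta> / Gamma c"
    proof -
      have "Gamma (1 + \<gamma> * c) = \<theta> * Gamma \<theta>" using Gamma_plus1_pos[OF \<theta>] gc by (simp add: add.commute)
      moreover have "Gamma (1 + c) = c * Gamma c" using Gamma_plus1_pos[OF c_pos] by (simp add: add.commute)
      ultimately show ?thesis unfolding C using c_pos p1 gc[symmetric] by simp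
    qed
    have e4: "pochhammer (\<theta> + \<gamma> * real P) (p m) = Gamma (\<theta> + ?r) / Gamma (\<theta> + \<gamma> * real P)"
    proof -
      have "0 < \<theta> + \<gamma> * real P" using \<theta> gP by simp
      then have "\<theta> + \<gamma> * real P \<notin> \<int>\<^sub>\<le>\<^sub>0" by (auto dest: nonpos_Ints_nonpos)
      then show ?thesis by (simp add: pochhammer_Gamma add.assoc)
    qed
    have D0: "0 \<le> ?D"
    proof (rule prod_nonneg)
      fix i assume "i \<in> {..<m}"
      then show "0 \<le> pochhammer (a ! i) (p i)" using pochhammer_mono_real[OF _ order_refl, of "a ! i"] pos[of i] by (simp add: less_imp_le)
    qed
    have L: "C * (Gamma (c + real P + 1) / Gamma (\<gamma> * (c + real P) + 1)) = Gamma \<theta> * Gamma (c + real P) / (Gamma c * Gamma (\<theta> + \<gamma> * real P))"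
    proof -
      have "c + real P > 0" using c_pos by simp
      moreover have "\<gamma> * G / H * (x * K / (\<gamma> * x * N)) = G * K / (H * N)" if "0 < x" for G H x K N :: real
        using that \<gamma> by simp
      ultimately show ?thesis unfolding e1 e2 e3 by blast
    qed
    have "Gamma (\<theta> + ?r) * Gamma (\<theta> + b) / (Gamma \<theta> * Gamma (\<theta> + b + ?r)) *
      (C * (Gamma (c + real P + 1) / Gamma (\<gamma> * (c + real P) + 1)) * (?D * (Gamma c / Gamma (c + real P)))) =
      ?D * pochhammer (\<theta> + \<gamma> * real P) (p m) * (Gamma (\<theta> + b) / Gamma (\<theta> + b + ?r))"
    proof -
      have "A * B / (G * E) * (G * K / (H * N) * (D * (H / K))) = D * (A / N) * (B / E)"
        if "0 < G" "0 < H" "0 < K" for A B G E K H N D :: real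
          using that by (simp add: mult_ac)
      then show ?thesis unfolding L e4 using p1 by blast
    qed
    moreover have "0 \<le> C * (Gamma (c + real P + 1) / Gamma (\<gamma> * (c + real P) + 1))" unfolding L using p1 by simp
    moreover have "0 \<le> Gamma (\<theta> + ?r) * Gamma (\<theta> + b) / (Gamma \<theta> * Gamma (\<theta> + b + ?r))" using p1 by simp
    moreover have "0 \<le> ?D * (Gamma c / Gamma (c + real P))" using D0 p1 by simp
    moreover have "ennreal x * (ennreal y * ennreal z) = ennreal (x * (y * z))" if "0 \<le> x" "0 \<le> y" "0 \<le> z" for x y z :: real
      using that by (simp add: ennreal_mult)
    ultimately show ?thesis by presburger
  qed
  finally show ?thesis .
qed

lemma lengths_nonneg: "i \<in> {..m} \<Longrightarrow> AE x in distr Q I lengths. 0 \<le> x i"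
proof -
  assume i: "i \<in> {..m}"
  have "(\<lambda>x. x i) \<in> borel_measurable I" using i by simp
  then have m1: "{x \<in> space I. 0 \<le> x i} \<in> sets I" by measurable
  have "AE z in Q. 0 \<le> lengths z i"
    using AE_Q
  proof eventually_elim
    case (elim z)
    then show ?case using i by (simp add: lengths_def less_imp_le)
  qed
  then show "AE x in distr Q I lengths. 0 \<le> x i"
    by (subst AE_distr_iff[OF lengths_measurable m1])
qed

text \<open>Since \<open>w\<close> is at most one and the entries of \<open>d\<close> sum to one,
  the sum of all coordinates is at most \<open>1 + s\<close>, and only the exponential moment of the
  tilted law matters.\<close>

lemma lengths_exp:
  assumes t: "0 \<le> t"
  shows "(\<integral>\<^sup>+ x. ennreal (exp (t * (\<Sum>i\<in>{..m}. x i))) \<partial>distr Q I lengths) < \<infinity>"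
proof -
  have m1: "(\<lambda>x. ennreal (exp (t * (\<Sum>i\<in>{..m}. x i)))) \<in> borel_measurable I"
  proof -
    have "(\<lambda>x. \<Sum>i\<in>{..m}. x i :: real) \<in> borel_measurable I" by (rule borel_measurable_sum) auto
    then show ?thesis by measurable
  qed
  have mL: "(\<lambda>s. ennreal (exp (t * s))) \<in> borel_measurable LL"
    unfolding measurable_cong_sets[OF sets_tilted refl] by simp
  have "(\<integral>\<^sup>+ x. ennreal (exp (t * (\<Sum>i\<in>{..m}. x i))) \<partial>distr Q I lengths) = (\<integral>\<^sup>+ z. ennreal (exp (t * (\<Sum>i\<in>{..m}. lengths z i))) \<partial>Q)"
    using m1 by (subst nn_integral_distr[OF lengths_measurable]) auto
  also have "\<dots> \<le> (\<integral>\<^sup>+ z. ennreal (exp t) * (ennreal (exp (t * fst (snd z))) * 1) \<partial>Q)"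
  proof (rule nn_integral_mono_AE)
    show "AE z in Q. ennreal (exp (t * (\<Sum>i\<in>{..m}. lengths z i))) \<le> ennreal (exp t) * (ennreal (exp (t * fst (snd z))) * 1)"
      using AE_Q
    proof eventually_elim
      case (elim z)
      let ?w = "fst z" and ?s = "fst (snd z)" and ?d = "snd (snd z)"
      have "{..m} = insert m {..<m}" by auto
      then have "(\<Sum>i\<in>{..m}. lengths z i) = ?w + (\<Sum>i<m. ?s * ?w powr \<gamma> * ?d i)"
        by (simp add: lengths_def)
      also have "(\<Sum>i<m. ?s * ?w powr \<gamma> * ?d i) = ?s * ?w powr \<gamma>"
        using elim by (simp add: sum_distrib_left[symmetric])
      also have "?w + ?s * ?w powr \<gamma> \<le> 1 + ?s * 1"
        using elim \<gamma> powr_le1[of \<gamma> ?w] by (intro add_mono mult_left_mono) auto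
      finally have "t * (\<Sum>i\<in>{..m}. lengths z i) \<le> t + t * ?s" using t by (metis distrib_left mult.right_neutral mult_left_mono)
      then have "exp (t * (\<Sum>i\<in>{..m}. lengths z i)) \<le> exp t * exp (t * ?s)" by (simp add: exp_add[symmetric])
      then show ?case by (simp add: ennreal_mult[symmetric] ennreal_leI)
    qed
  qed
  also have "\<dots> = (\<integral>\<^sup>+ w. ennreal (exp t) \<partial>WL) * (\<integral>\<^sup>+ y. ennreal (exp (t * fst y)) * 1 \<partial>(LL \<Otimes>\<^sub>M DL))"
    unfolding Q_def
    by (rule nn_integral_pair_mult[OF prob_space_imp_sigma_finite[OF prob_space_LD], where f = "\<lambda>_. ennreal (exp t)"])
      (use measurable_compose[OF measurable_fst mL] in auto)
  also have "(\<integral>\<^sup>+ y. ennreal (exp (t * fst y)) * 1 \<partial>(LL \<Otimes>\<^sub>M DL)) = (\<integral>\<^sup>+ s. ennreal (exp (t * s)) \<partial>LL) * (\<integral>\<^sup>+ d. 1 \<partial>DL)"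
    by (rule nn_integral_pair_mult[OF prob_space_imp_sigma_finite[OF prob_space_DL] mL]) simp
  also have "\<dots> = (\<integral>\<^sup>+ s. ennreal (exp (t * s)) \<partial>LL)"
    using prob_space.emeasure_space_1[OF prob_space_DL] by simp
  also have "(\<integral>\<^sup>+ w. ennreal (exp t) \<partial>WL) = ennreal (exp t)"
    using prob_space.emeasure_space_1[OF prob_space_WL] by simp
  also have "ennreal (exp t) * (\<integral>\<^sup>+ s. ennreal (exp (t * s)) \<partial>LL) < \<infinity>"
    using tilted_exp[OF g \<gamma> c_pos C_pos t] by (simp add: ennreal_mult_less_top)
  finally show ?thesis .
qed

text \<open>The moments give equality of the laws of the length vectors; the almost sure inverse
  \<open>triple\<close> carries it back to the law of the triple.\<close>

lemma joint_law_unique: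
  assumes "sets \<mu> = sets I" and "\<And>i. i \<in> {..m} \<Longrightarrow> AE x in \<mu>. 0 \<le> x i"
    and "\<And>p. (\<integral>\<^sup>+ x. ennreal (\<Prod>i\<in>{..m}. x i ^ p i) \<partial>\<mu>) =
      ennreal ((\<Prod>i<m. pochhammer (a ! i) (p i)) * pochhammer (\<theta> + \<gamma> * real (\<Sum>i<m. p i)) (p m) *
      (Gamma (\<theta> + b) / Gamma (\<theta> + b + (\<gamma> * real (\<Sum>i<m. p i) + real (p m)))))"
  shows "distr \<mu> (borel \<Otimes>\<^sub>M (borel \<Otimes>\<^sub>M V)) triple = Q"
proof -
  have "\<mu> = distr Q I lengths"
    by (rule PiM_eq_moments[of "{..m}"]) (use assms lengths_moment lengths_nonneg lengths_exp in auto)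
  then show ?thesis using distr_triple by simp
qed

lemma emeasure_Q_Times:
  assumes "B1 \<in> sets borel" "B2 \<in> sets borel" "B3 \<in> sets V"
  shows "emeasure Q (B1 \<times> (B2 \<times> B3)) = emeasure WL B1 * (emeasure LL B2 * emeasure DL B3)"
proof -
  have "B1 \<in> sets WL" "B2 \<in> sets LL" "B3 \<in> sets DL"
    using assms sets_beta_distribution sets_tilted sets_DL by auto
  then show ?thesis unfolding Q_def
    by (simp add: sigma_finite_measure.emeasure_pair_measure_Times[OF prob_space_imp_sigma_finite[OF prob_space_LD]]
        sigma_finite_measure.emeasure_pair_measure_Times[OF prob_space_imp_sigma_finite[OF prob_space_DL]])
qed

end

section \<open>Conditional laws of the limits given the number of edges\<close>

context alpha_gamma_enum
begin

lemma AE_limits_nonneg: "AE \<omega> in M. (\<forall>i. 0 \<le> \<xi> i \<omega>) \<and> 0 \<le> W \<omega>"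
  using AE_limits AE_reduces_to[OF k] AE_space
proof eventually_elim
  case (elim \<omega>)
  have X0: "0 \<le> X i (seq \<omega>) n / real n powr \<gamma>" if n: "k \<le> n" for i n
  proof -
    have red: "reduces_to k (T k \<omega>) n (T n \<omega>) (labels k (seq \<omega>) n)" using elim(2) n by blast
    show ?thesis
      using Y_pos[of k n "seq \<omega>" enum "card (T k \<omega>)" \<alpha> \<gamma> i] k n red enum_bij[OF elim(3)] params
      by (auto simp: X_def less_imp_le)
  qed
  have U0: "0 \<le> U (seq \<omega>) n / real n powr 1" for n
    unfolding U_proc_def using params by (intro divide_nonneg_nonneg add_nonneg_nonneg sum_nonneg) auto
  have "0 \<le> \<xi> i \<omega>" for i
    by (rule LIMSEQ_le_const[where X = "\<lambda>n. X i (seq \<omega>) n / real n powr \<gamma>"]) (use elim(1) X0 in auto)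
  moreover have "0 \<le> W \<omega>"
    by (rule LIMSEQ_le_const[where X = "\<lambda>n. U (seq \<omega>) n / real n powr 1"]) (use elim(1) U0 in blast)+
  ultimately show ?case by blast
qed

definition "S \<omega> = (\<Sum>i<card (T k \<omega>). \<xi> i \<omega>)"
definition "L \<omega> = S \<omega> / W \<omega> powr \<gamma>"
definition "D \<omega> i = \<xi> i \<omega> / S \<omega>"

lemma S_measurable[measurable]: "S \<in> borel_measurable M"
proof -
  have "depends k (\<lambda>t. card (t k))" using k by (auto simp: depends_def)
  then have "(\<lambda>\<omega>. card (T k \<omega>)) \<in> M \<rightarrow>\<^sub>M count_space UNIV" by (rule measurable_depends)
  then have "(\<lambda>\<omega>. (\<lambda>n \<omega>. \<Sum>i<n. \<xi> i \<omega>) (card (T k \<omega>)) \<omega>) \<in> borel_measurable M"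
    by (rule measurable_compose_countable[rotated]) measurable
  then show ?thesis by (simp add: S_def[abs_def])
qed

lemma L_measurable[measurable]: "L \<in> borel_measurable M"
  unfolding L_def[abs_def] by measurable

lemma D_measurable[measurable]: "(\<lambda>\<omega>. D \<omega> i) \<in> borel_measurable M"
  unfolding D_def[abs_def] by measurable

text \<open>Each of the \<open>k\<close> leaves is the lower end of its own edge. Consequently the
  events \<open>A l\<close> exhaust the space up to a null set.\<close>

lemma card_ge: "AE \<omega> in M. k \<le> card (T k \<omega>)"
  using AE_growth AE_space
proof eventually_elim
  case (elim \<omega>)
  have "grown k (T k \<omega>)" using elim k by blast
  then have pr: "proper k (T k \<omega>)" by (rule proper_grown)
  have "Leaf ` {1..k} \<subseteq> snd ` T k \<omega>"
  proof
    fix v assume "v \<in> Leaf ` {1..k}"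
    then obtain i where i: "v = Leaf i" "i \<in> {1..k}" by auto
    then have "v \<in> Field (T k \<omega>)" "\<forall>x. (v, x) \<notin> T k \<omega>" using pr by (auto simp: proper_def)
    then show "v \<in> snd ` T k \<omega>" by (force simp: Field_def)
  qed
  then have "card (Leaf ` {1..k} :: vertex set) \<le> card (snd ` T k \<omega>)"
    using proper_finite(1)[OF pr] by (intro card_mono) auto
  also have "\<dots> \<le> card (T k \<omega>)" using proper_finite(1)[OF pr] by (rule card_image_le)
  finally show ?case by (simp add: card_image inj_on_def)
qed

text \<open>The part of the total weight \<open>k - \<alpha>\<close> that sits at the branch points;
  it becomes the second beta parameter.\<close>

definition "bb l = (real k - 1) * \<alpha> - real l * \<gamma>" for l :: nat

lemma \<theta>_bb: "\<theta> l + bb l = real k - \<alpha>"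
  by (simp add: \<theta>_def bb_def algebra_simps)

text \<open>An event of positive probability contains a tree obtained by growth. For it
  \<open>bb l\<close> is a sum of branch point weights, each nonnegative because a branch point has
  degree at least three and \<gamma> is at most \<alpha>.\<close>

lemma bb_nonneg:
  assumes "prob (A l) > 0"
  shows "0 \<le> bb l"
proof -
  have "\<not> (AE \<omega> in M. \<omega> \<notin> A l)"
  proof
    assume "AE \<omega> in M. \<omega> \<notin> A l"
    then have "prob (A l) = 0" using prob_eq_0[OF A_sets[of l]] by simp
    then show False using assms by simp
  qed
  moreover have "AE \<omega> in M. \<omega> \<in> A l \<longrightarrow> 0 \<le> bb l"
    using AE_growth
  proof eventually_elim
    case (elim \<omega>)
    show ?case
    proof
      assume \<omega>: "\<omega> \<in> A l"
      let ?E = "T k \<omega>"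
      have g: "grown k ?E" using elim k by blast
      have U: "(\<Sum>e\<in>?E. edge_weight \<alpha> \<gamma> e) = \<theta> l"
        using initial_values(2)[OF \<omega> g] by (simp add: U_proc_def labels_start)
      have "real k - \<alpha> = region_weight \<alpha> \<gamma> UNIV UNIV ?E"
        using total_weight[OF g, of \<alpha> \<gamma>] sum_region[OF proper_finite(1)[OF proper_grown[OF g]], of \<alpha> \<gamma> UNIV UNIV]
        by (simp add: region_UNIV)
      also have "\<dots> = \<theta> l + (\<Sum>v\<in>{v \<in> Field ?E. 3 \<le> degree ?E v}. vertex_weight \<alpha> \<gamma> ?E v)"
        using U by (simp add: region_weight_def)
      finally have "bb l = (\<Sum>v\<in>{v \<in> Field ?E. 3 \<le> degree ?E v}. vertex_weight \<alpha> \<gamma> ?E v)"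
        using \<theta>_bb[of l] by simp
      also have "\<dots> \<ge> 0"
      proof (rule sum_nonneg)
        fix v assume "v \<in> {v \<in> Field ?E. 3 \<le> degree ?E v}"
        then have "1 \<le> real (degree ?E v) - 2" by simp
        then have "1 * \<alpha> \<le> (real (degree ?E v) - 2) * \<alpha>" using params by (intro mult_right_mono) auto
        then show "0 \<le> vertex_weight \<alpha> \<gamma> ?E v" using params by linarith
      qed
      finally show "0 \<le> bb l" .
    qed
  qed
  ultimately show ?thesis by (cases "0 \<le> bb l") auto
qed

text \<open>The tilt exponent of \<open>L\<close>; it equals \<open>\<theta> l / \<gamma>\<close>
  and is also the sum of the Dirichlet parameters.\<close>

definition "cc l = real l + real k * (1 - \<alpha>) / \<gamma>" for l :: nat
definition "CC l = Gamma (1 + real k * (1 - \<alpha>) + real l * \<gamma>) / Gamma (1 + real l + real k * (1 - \<alpha>) / \<gamma>)" for l :: nat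
definition "aa l = replicate k ((1 - \<alpha>) / \<gamma>) @ replicate l 1" for l :: nat

lemma aa_nth: "i < k + l \<Longrightarrow> aa l ! i = av i"
  by (simp add: aa_def av_def nth_append)

lemma ideal_law_limits:
  assumes "prob (A l) > 0" and g: "mittag_leffler_density \<gamma> g"
  shows "ideal_law \<gamma> (\<theta> l) (bb l) (CC l) (cc l) g (aa l) (k + l)"
proof
  show "0 < \<gamma>" by (rule \<gamma>)
  show "0 < \<theta> l" unfolding \<theta>_def using k params by (intro add_pos_nonneg mult_pos_pos mult_nonneg_nonneg) auto
  show "0 \<le> bb l" by (rule bb_nonneg[OF assms(1)])
  show "mittag_leffler_density \<gamma> g" by (rule g)
  show "CC l = Gamma (1 + \<gamma> * cc l) / Gamma (1 + cc l)"
    using \<gamma> by (simp add: CC_def cc_def distrib_left add_ac mult_ac)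
  show c: "cc l = \<theta> l / \<gamma>" using \<gamma> by (simp add: cc_def \<theta>_def field_simps)
  show "length (aa l) = k + l" by (simp add: aa_def)
  show "0 < k + l" using k by simp
  show "0 < aa l ! i" if "i < k + l" for i
    unfolding aa_nth[OF that] using params by (simp add: av_def)
  show "(\<Sum>i<k + l. aa l ! i) = cc l"
    unfolding c sum_av[symmetric] by (intro sum.cong) (auto simp: aa_nth)
qed

text \<open>The Gamma quotient in the limit moments involves \<open>k - \<alpha>\<close>, which is
  \<open>\<theta> l + bb l\<close>. With this identity they coincide with the moments of the ideal
  law.\<close>

lemma joint_law:
  assumes l: "prob (A l) > 0" and g: "mittag_leffler_density \<gamma> g"
  shows "distr (uniform_measure M (A l)) (borel \<Otimes>\<^sub>M (borel \<Otimes>\<^sub>M PiM {..<k + l} (\<lambda>_. borel)))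
      (\<lambda>\<omega>. (W \<omega>, L \<omega>, restrict (D \<omega>) {..<k + l})) = ideal_law.Q (\<theta> l) (bb l) (CC l) (cc l) g (aa l)"
proof -
  interpret J: ideal_law \<gamma> "\<theta> l" "bb l" "CC l" "cc l" g "aa l" "k + l" by (rule ideal_law_limits[OF assms])
  let ?P = "uniform_measure M (A l)" and ?m = "k + l"
  let ?I = "PiM {..?m} (\<lambda>_. borel :: real measure)" and ?V = "PiM {..<?m} (\<lambda>_. borel :: real measure)"
  \<comment> \<open>The same layout as \<open>lengths\<close>, with \<open>W\<close> in the last
    coordinate.\<close>
  define \<Phi> where "\<Phi> \<omega> = (\<lambda>i\<in>{..?m}. if i < ?m then \<xi> i \<omega> else W \<omega>)" for \<omega>
  have \<Phi>M: "\<Phi> \<in> M \<rightarrow>\<^sub>M ?I"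
    unfolding \<Phi>_def[abs_def]
  proof (rule measurable_restrict)
    fix i assume "i \<in> {..?m}"
    show "(\<lambda>\<omega>. if i < ?m then \<xi> i \<omega> else W \<omega>) \<in> borel_measurable M" by (cases "i < ?m") auto
  qed
  have \<Phi>: "\<Phi> \<in> ?P \<rightarrow>\<^sub>M ?I" using \<Phi>M by (simp cong: measurable_cong_sets)
  have AEP: "AE \<omega> in ?P. R \<omega>" if "AE \<omega> in M. \<omega> \<in> A l \<longrightarrow> R \<omega>" for R
    using that by (rule AE_uniform_measureI[OF A_sets])
  have "distr (distr ?P ?I \<Phi>) (borel \<Otimes>\<^sub>M (borel \<Otimes>\<^sub>M ?V)) J.triple = J.Q"
  proof (rule J.joint_law_unique)
    show "AE x in distr ?P ?I \<Phi>. 0 \<le> x i" if i: "i \<in> {..?m}" for i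
    proof -
      have "(\<lambda>x. x i) \<in> borel_measurable ?I" using i by simp
      then have m1: "{x \<in> space ?I. 0 \<le> x i} \<in> sets ?I" by measurable
      have "AE \<omega> in ?P. 0 \<le> \<Phi> \<omega> i"
      proof (rule AEP)
        show "AE \<omega> in M. \<omega> \<in> A l \<longrightarrow> 0 \<le> \<Phi> \<omega> i"
          using AE_limits_nonneg by eventually_elim (use i in \<open>simp add: \<Phi>_def\<close>)
      qed
      then show ?thesis by (subst AE_distr_iff[OF \<Phi> m1])
    qed
    fix p :: "nat \<Rightarrow> nat"
    have m1: "(\<lambda>x. ennreal (\<Prod>i\<in>{..?m}. x i ^ p i)) \<in> borel_measurable ?I"
      by (rule measurable_compose[OF borel_measurable_prod measurable_ennreal]) (auto intro!: borel_measurable_power)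
    have "(\<integral>\<^sup>+ x. ennreal (\<Prod>i\<in>{..?m}. x i ^ p i) \<partial>distr ?P ?I \<Phi>) = (\<integral>\<^sup>+ \<omega>. ennreal (\<Prod>i\<in>{..?m}. \<Phi> \<omega> i ^ p i) \<partial>?P)"
      using m1 by (subst nn_integral_distr[OF \<Phi>]) auto
    also have "\<dots> = (\<integral>\<^sup>+ \<omega>. ennreal ((\<Prod>i<?m. \<xi> i \<omega> ^ p i) * W \<omega> ^ p ?m) \<partial>?P)"
    proof (rule nn_integral_cong)
      fix \<omega>
      have "{..?m} = insert ?m {..<?m}" by auto
      then have "(\<Prod>i\<in>{..?m}. \<Phi> \<omega> i ^ p i) = \<Phi> \<omega> ?m ^ p ?m * (\<Prod>i<?m. \<Phi> \<omega> i ^ p i)" by simp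
      also have "(\<Prod>i<?m. \<Phi> \<omega> i ^ p i) = (\<Prod>i<?m. \<xi> i \<omega> ^ p i)" by (intro prod.cong) (auto simp: \<Phi>_def)
      finally show "ennreal (\<Prod>i\<in>{..?m}. \<Phi> \<omega> i ^ p i) = ennreal ((\<Prod>i<?m. \<xi> i \<omega> ^ p i) * W \<omega> ^ p ?m)"
        by (simp add: \<Phi>_def mult.commute)
    qed
    also have "\<dots> = ennreal ((\<Prod>i<?m. pochhammer (av i) (p i)) * pochhammer (\<theta> l + \<gamma> * real (\<Sum>i<?m. p i)) (p ?m) *
      (Gamma (real k - \<alpha>) / Gamma (real k - \<alpha> + rate l p (p ?m))))"
      by (rule limit_moment[OF l])
    also have "(\<Prod>i<?m. pochhammer (av i) (p i)) = (\<Prod>i<?m. pochhammer (aa l ! i) (p i))"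
      by (intro prod.cong) (auto simp: aa_nth)
    finally show "(\<integral>\<^sup>+ x. ennreal (\<Prod>i\<in>{..?m}. x i ^ p i) \<partial>distr ?P ?I \<Phi>) =
      ennreal ((\<Prod>i<?m. pochhammer (aa l ! i) (p i)) * pochhammer (\<theta> l + \<gamma> * real (\<Sum>i<?m. p i)) (p ?m) *
      (Gamma (\<theta> l + bb l) / Gamma (\<theta> l + bb l + (\<gamma> * real (\<Sum>i<?m. p i) + real (p ?m)))))"
      unfolding \<theta>_bb rate_def .
  qed simp
  moreover have "distr (distr ?P ?I \<Phi>) (borel \<Otimes>\<^sub>M (borel \<Otimes>\<^sub>M ?V)) J.triple =
      distr ?P (borel \<Otimes>\<^sub>M (borel \<Otimes>\<^sub>M ?V)) (J.triple \<circ> \<Phi>)"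
    by (rule distr_distr[OF J.triple_measurable \<Phi>])
  moreover have "\<dots> = distr ?P (borel \<Otimes>\<^sub>M (borel \<Otimes>\<^sub>M ?V)) (\<lambda>\<omega>. (W \<omega>, L \<omega>, restrict (D \<omega>) {..<?m}))"
  proof (rule distr_cong_AE)
    show "AE \<omega> in ?P. (J.triple \<circ> \<Phi>) \<omega> = (W \<omega>, L \<omega>, restrict (D \<omega>) {..<?m})"
    proof (rule AEP, rule AE_I2, rule impI)
      fix \<omega> assume "\<omega> \<in> A l"
      then have c: "card (T k \<omega>) = ?m" by (simp add: A_def)
      have "(\<Sum>i<?m. \<Phi> \<omega> i) = S \<omega>" unfolding S_def c by (intro sum.cong) (auto simp: \<Phi>_def)
      moreover have "\<Phi> \<omega> ?m = W \<omega>" by (simp add: \<Phi>_def)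
      moreover have "\<Phi> \<omega> i = \<xi> i \<omega>" if "i < ?m" for i using that by (simp add: \<Phi>_def)
      ultimately show "(J.triple \<circ> \<Phi>) \<omega> = (W \<omega>, L \<omega>, restrict (D \<omega>) {..<?m})"
        by (auto simp: J.triple_def L_def D_def restrict_def)
    qed
    show "J.triple \<circ> \<Phi> \<in> ?P \<rightarrow>\<^sub>M borel \<Otimes>\<^sub>M (borel \<Otimes>\<^sub>M ?V)" by (rule measurable_comp[OF \<Phi> J.triple_measurable])
    have "(\<lambda>\<omega>. (W \<omega>, L \<omega>, restrict (D \<omega>) {..<?m})) \<in> M \<rightarrow>\<^sub>M borel \<Otimes>\<^sub>M (borel \<Otimes>\<^sub>M ?V)"
      by (intro measurable_Pair measurable_restrict W_measurable L_measurable D_measurable)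
    then show "(\<lambda>\<omega>. (W \<omega>, L \<omega>, restrict (D \<omega>) {..<?m})) \<in> ?P \<rightarrow>\<^sub>M borel \<Otimes>\<^sub>M (borel \<Otimes>\<^sub>M ?V)"
      by (simp cong: measurable_cong_sets)
  qed auto
  ultimately show ?thesis by simp
qed

text \<open>The joint law is a product measure, so the probability of a rectangle factorises. Taking
  two of the sides to be full spaces yields each marginal, and the factorisation itself is the
  independence.\<close>

lemma conditional_laws:
  assumes l: "prob (A l) > 0" and g: "mittag_leffler_density \<gamma> g"
  defines "P \<equiv> uniform_measure M (A l)" and "V \<equiv> PiM {..<k + l} (\<lambda>_. borel :: real measure)"
    and "D' \<equiv> \<lambda>\<omega>. restrict (D \<omega>) {..<k + l}"
  shows "indep_triple P borel W borel L V D'"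
    and "distr P borel W = beta_distribution (\<theta> l) (bb l)"
    and "distr P borel L = tilted (CC l) (cc l) g"
    and "distr P V D' = dirichlet (aa l)"
    and "AE \<omega> in P. 0 < W \<omega> \<and> 0 < L \<omega>"
proof -
  interpret J: ideal_law \<gamma> "\<theta> l" "bb l" "CC l" "cc l" g "aa l" "k + l" by (rule ideal_law_limits[OF l g])
  have "prob_space P" unfolding P_def
    using l by (intro prob_space_uniform_measure) (auto simp: emeasure_eq_measure)
  then interpret P: prob_space P .
  have sP: "sets P = sets M" unfolding P_def by simp
  have mP: "W \<in> borel_measurable P" "L \<in> borel_measurable P" "D' \<in> P \<rightarrow>\<^sub>M V"
  proof -
    have "D' \<in> M \<rightarrow>\<^sub>M V" unfolding D'_def V_def by (intro measurable_restrict D_measurable)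
    then show "W \<in> borel_measurable P" "L \<in> borel_measurable P" "D' \<in> P \<rightarrow>\<^sub>M V"
      by (simp_all cong: measurable_cong_sets[OF sP])
  qed
  have m3: "(\<lambda>\<omega>. (W \<omega>, L \<omega>, D' \<omega>)) \<in> P \<rightarrow>\<^sub>M borel \<Otimes>\<^sub>M (borel \<Otimes>\<^sub>M V)"
    by (intro measurable_Pair mP)
  have JL: "distr P (borel \<Otimes>\<^sub>M (borel \<Otimes>\<^sub>M V)) (\<lambda>\<omega>. (W \<omega>, L \<omega>, D' \<omega>)) = J.Q"
    unfolding P_def V_def D'_def by (rule joint_law[OF l g])
  have rect: "emeasure P {\<omega> \<in> space P. W \<omega> \<in> B1 \<and> L \<omega> \<in> B2 \<and> D' \<omega> \<in> B3} =
      emeasure J.WL B1 * (emeasure J.LL B2 * emeasure J.DL B3)"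
    if B: "B1 \<in> sets borel" "B2 \<in> sets borel" "B3 \<in> sets V" for B1 B2 B3
  proof -
    have "emeasure J.Q (B1 \<times> (B2 \<times> B3)) = emeasure P ((\<lambda>\<omega>. (W \<omega>, L \<omega>, D' \<omega>)) -` (B1 \<times> (B2 \<times> B3)) \<inter> space P)"
      unfolding JL[symmetric] using B by (intro emeasure_distr[OF m3]) auto
    also have "(\<lambda>\<omega>. (W \<omega>, L \<omega>, D' \<omega>)) -` (B1 \<times> (B2 \<times> B3)) \<inter> space P = {\<omega> \<in> space P. W \<omega> \<in> B1 \<and> L \<omega> \<in> B2 \<and> D' \<omega> \<in> B3}"
      by auto
    finally show ?thesis using J.emeasure_Q_Times[of B1 B2 B3] B unfolding V_def by simp
  qed
  have one: "emeasure J.WL UNIV = 1" "emeasure J.LL UNIV = 1" "emeasure J.DL (space V) = 1"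
  proof -
    have "space J.WL = UNIV" "space J.LL = UNIV" "space J.DL = space V"
      using sets_eq_imp_space_eq[OF sets_beta_distribution] sets_eq_imp_space_eq[OF sets_tilted] sets_eq_imp_space_eq[OF J.sets_DL]
      by (auto simp: V_def)
    then show "emeasure J.WL UNIV = 1" "emeasure J.LL UNIV = 1" "emeasure J.DL (space V) = 1"
      using prob_space.emeasure_space_1[OF J.prob_space_WL] prob_space.emeasure_space_1[OF J.prob_space_LL] prob_space.emeasure_space_1[OF J.prob_space_DL] by auto
  qed
  have DV: "D' \<omega> \<in> space V" if "\<omega> \<in> space P" for \<omega> using measurable_space[OF mP(3) that] .
  have W1: "emeasure P {\<omega> \<in> space P. W \<omega> \<in> B} = emeasure J.WL B" if "B \<in> sets borel" for B
    using rect[OF that, of UNIV "space V"] DV one by (simp cong: conj_cong)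
  have L1: "emeasure P {\<omega> \<in> space P. L \<omega> \<in> B} = emeasure J.LL B" if "B \<in> sets borel" for B
    using rect[of UNIV, OF _ that, of "space V"] DV one by (simp cong: conj_cong)
  have D1: "emeasure P {\<omega> \<in> space P. D' \<omega> \<in> B} = emeasure J.DL B" if "B \<in> sets V" for B
    using rect[of UNIV UNIV, OF _ _ that] one by simp
  have vim: "f -` B \<inter> space P = {\<omega> \<in> space P. f \<omega> \<in> B}" for f :: "'a \<Rightarrow> 'c" and B by auto
  show Wd: "distr P borel W = J.WL"
  proof (rule measure_eqI)
    show "sets (distr P borel W) = sets J.WL" by (simp add: sets_beta_distribution)
    show "emeasure (distr P borel W) B = emeasure J.WL B" if "B \<in> sets (distr P borel W)" for B
      using that W1[of B] mP(1) by (simp add: emeasure_distr vim)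
  qed
  show Ld: "distr P borel L = J.LL"
  proof (rule measure_eqI)
    show "sets (distr P borel L) = sets J.LL" by (simp add: sets_tilted)
    show "emeasure (distr P borel L) B = emeasure J.LL B" if "B \<in> sets (distr P borel L)" for B
      using that L1[of B] mP(2) by (simp add: emeasure_distr vim)
  qed
  show "distr P V D' = J.DL"
  proof (rule measure_eqI)
    show "sets (distr P V D') = sets J.DL" using J.sets_DL by (simp add: V_def)
    show "emeasure (distr P V D') B = emeasure J.DL B" if "B \<in> sets (distr P V D')" for B
      using that D1[of B] mP(3) by (simp add: emeasure_distr vim)
  qed
  show "AE \<omega> in P. 0 < W \<omega> \<and> 0 < L \<omega>"
  proof -
    have "AE w in distr P borel W. 0 < w" unfolding Wd using beta_distribution_support by (auto elim: eventually_mono)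
    then have 1: "AE \<omega> in P. 0 < W \<omega>" by (subst (asm) AE_distr_iff[OF mP(1)]) auto
    have "AE s in distr P borel L. 0 < s" unfolding Ld by (rule tilted_pos[OF g \<gamma>(1) J.c_pos J.C_pos])
    then have 2: "AE \<omega> in P. 0 < L \<omega>" by (subst (asm) AE_distr_iff[OF mP(2)]) auto
    from 1 2 show ?thesis by eventually_elim simp
  qed
  have pr: "P.prob {\<omega> \<in> space P. W \<omega> \<in> B1 \<and> L \<omega> \<in> B2 \<and> D' \<omega> \<in> B3} =
      P.prob {\<omega> \<in> space P. W \<omega> \<in> B1} * (P.prob {\<omega> \<in> space P. L \<omega> \<in> B2} * P.prob {\<omega> \<in> space P. D' \<omega> \<in> B3})"
    if B: "B1 \<in> sets borel" "B2 \<in> sets borel" "B3 \<in> sets V" for B1 B2 B3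
    using rect[OF B] W1[OF B(1)] L1[OF B(2)] D1[OF B(3)] by (simp add: measure_def enn2real_mult)
  show "indep_triple P borel W borel L V D'"
    unfolding indep_triple_def
  proof (intro conjI mP)
    let ?G = "\<lambda>i. [{W -` a \<inter> space P |a. a \<in> sets borel}, {L -` b \<inter> space P |b. b \<in> sets borel}, {D' -` c \<inter> space P |c. c \<in> sets V}] ! i"
    show "P.indep_sets ?G {..<3::nat}"
    proof (rule P.indep_setsI)
      fix i :: nat assume "i \<in> {..<3}"
      then have "i = 0 \<or> i = 1 \<or> i = 2" by auto
      then show "?G i \<subseteq> P.events" using mP by (auto intro: measurable_sets)
    next
      fix B and J :: "nat set" assume J: "J \<noteq> {}" "J \<subseteq> {..<3}" "finite J" and B: "\<forall>j\<in>J. B j \<in> ?G j"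
      \<comment> \<open>An index outside \<open>J\<close> receives the full space, which reduces
        every subfamily to a rectangle with three sides.\<close>
      define B1 where "B1 = (if 0 \<in> J then SOME a. a \<in> sets borel \<and> B 0 = W -` a \<inter> space P else UNIV)"
      define B2 where "B2 = (if 1 \<in> J then SOME a. a \<in> sets borel \<and> B 1 = L -` a \<inter> space P else UNIV)"
      define B3 where "B3 = (if 2 \<in> J then SOME a. a \<in> sets V \<and> B 2 = D' -` a \<inter> space P else space V)"
      have 1: "B1 \<in> sets borel \<and> (0 \<in> J \<longrightarrow> B 0 = W -` B1 \<inter> space P)"
      proof (cases "0 \<in> J")
        case True
        then have "\<exists>a. a \<in> sets borel \<and> B 0 = W -` a \<inter> space P" using B by force
        from someI_ex[OF this] show ?thesis using True by (simp add: B1_def)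
      qed (simp add: B1_def)
      have 2: "B2 \<in> sets borel \<and> (1 \<in> J \<longrightarrow> B 1 = L -` B2 \<inter> space P)"
      proof (cases "1 \<in> J")
        case True
        then have "\<exists>a. a \<in> sets borel \<and> B 1 = L -` a \<inter> space P" using B by force
        from someI_ex[OF this] show ?thesis using True by (simp add: B2_def)
      qed (simp add: B2_def)
      have 3: "B3 \<in> sets V \<and> (2 \<in> J \<longrightarrow> B 2 = D' -` B3 \<inter> space P)"
      proof (cases "2 \<in> J")
        case True
        then have "\<exists>a. a \<in> sets V \<and> B 2 = D' -` a \<inter> space P" using B by force
        from someI_ex[OF this] show ?thesis using True by (simp add: B3_def)
      qed (simp add: B3_def)
      define C where "C j = (if j = (0::nat) then {\<omega> \<in> space P. W \<omega> \<in> B1} else if j = 1 then {\<omega> \<in> space P. L \<omega> \<in> B2} else {\<omega> \<in> space P. D' \<omega> \<in> B3})" for j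
      have BC: "B j = C j" if "j \<in> J" for j
      proof -
        have "j = 0 \<or> j = 1 \<or> j = 2" using that J(2) by auto
        then show ?thesis using that 1 2 3 by (auto simp: C_def)
      qed
      have Cfull: "C j = space P" if "j \<notin> J" "j \<in> {0, 1, 2}" for j
        using that DV by (auto simp: C_def B1_def B2_def B3_def)
      have J3: "J \<subseteq> {0, 1, 2}" using J(2) by auto
      have "(\<Inter>j\<in>J. B j) = (\<Inter>j\<in>J. C j)" using BC by auto
      also have "\<dots> = (\<Inter>j\<in>{0, 1, 2}. C j)"
      proof
        show "(\<Inter>j\<in>{0, 1, 2}. C j) \<subseteq> (\<Inter>j\<in>J. C j)" using J3 by auto
        have "x \<in> C j" if "x \<in> (\<Inter>j\<in>J. C j)" "j \<in> {0, 1, 2}" for x j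
        proof (cases "j \<in> J")
          case False
          obtain i where "i \<in> J" using J(1) by auto
          then have "x \<in> C i" using that by auto
          then have "x \<in> space P" by (auto simp: C_def split: if_splits)
          then show ?thesis using Cfull[OF False that(2)] by simp
        qed (use that in auto)
        then show "(\<Inter>j\<in>J. C j) \<subseteq> (\<Inter>j\<in>{0, 1, 2}. C j)" by blast
      qed
      also have "\<dots> = {\<omega> \<in> space P. W \<omega> \<in> B1 \<and> L \<omega> \<in> B2 \<and> D' \<omega> \<in> B3}" by (auto simp: C_def)
      finally have "P.prob (\<Inter>j\<in>J. B j) = P.prob (C 0) * (P.prob (C 1) * P.prob (C 2))"
        using pr 1 2 3 by (simp add: C_def)
      also have "\<dots> = (\<Prod>j\<in>{0, 1, 2}. P.prob (C j))" by simp
      also have "\<dots> = (\<Prod>j\<in>J. P.prob (C j))"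
        using Cfull J3 by (intro prod.mono_neutral_right) (auto simp: P.prob_space)
      also have "\<dots> = (\<Prod>j\<in>J. P.prob (B j))" using BC by (intro prod.cong) auto
      finally show "P.prob (\<Inter>j\<in>J. B j) = (\<Prod>j\<in>J. P.prob (B j))" .
    qed
  qed
qed

text \<open>The lengths are recovered as \<open>L * W powr \<gamma> * D i\<close> only where
  \<open>W\<close> and the sum \<open>S\<close> do not vanish. Positivity follows from the
  conditional laws on each event \<open>A l\<close> of positive probability.\<close>

lemma AE_positive:
  assumes g: "mittag_leffler_density \<gamma> g"
  shows "AE \<omega> in M. 0 < W \<omega> \<and> 0 < L \<omega>"
proof -
  have "AE \<omega> in M. \<omega> \<in> A l \<longrightarrow> 0 < W \<omega> \<and> 0 < L \<omega>" for l
  proof (cases "prob (A l) > 0")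
    case True
    then have "AE \<omega> in uniform_measure M (A l). 0 < W \<omega> \<and> 0 < L \<omega>" by (rule conditional_laws(5)[OF _ g])
    then show ?thesis using True by (subst (asm) AE_uniform_measure) (auto simp: emeasure_eq_measure)
  next
    case False
    then have "prob (A l) = 0" using measure_nonneg[of M "A l"] by linarith
    then have "AE \<omega> in M. \<omega> \<notin> A l" using prob_eq_0[OF A_sets] by blast
    then show ?thesis by eventually_elim simp
  qed
  then have "AE \<omega> in M. \<forall>l. \<omega> \<in> A l \<longrightarrow> 0 < W \<omega> \<and> 0 < L \<omega>" unfolding AE_all_countable by blast
  then show ?thesis using card_ge AE_space
  proof eventually_elim
    case (elim \<omega>)
    then have "\<omega> \<in> A (card (T k \<omega>) - k)" by (simp add: A_def)
    then show ?case using elim by blast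
  qed
qed

section \<open>The limiting tree\<close>

definition "limit_tree \<omega> = (T k \<omega>, \<lambda>e. L \<omega> * W \<omega> powr \<gamma> * D \<omega> (inv_into {..<card (T k \<omega>)} (enum (T k \<omega>)) e))"

lemma limit_tree_lengths:
  assumes "\<omega> \<in> space M" "i < card (T k \<omega>)"
  shows "edge_length (limit_tree \<omega>) (enum (T k \<omega>) i) = L \<omega> * W \<omega> powr \<gamma> * D \<omega> i"
  using enum_bij[OF assms(1)] assms(2) by (simp add: limit_tree_def bij_betw_def)

text \<open>The shape is constant from time \<open>k\<close> on. The graph distance differs from the
  shifted length by a constant, which vanishes after division by
  \<open>n powr \<gamma>\<close>.\<close>

lemma AE_edge_lengths_converge:
  assumes g: "mittag_leffler_density \<gamma> g"
  shows "AE \<omega> in M. edge_lengths_converge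
      (\<lambda>n. divide_lengths (reduced_tree k (T n \<omega>)) (real n powr \<gamma>)) (limit_tree \<omega>)"
  using AE_positive[OF g] AE_limits AE_reduces_to[OF k] AE_space
proof eventually_elim
  case (elim \<omega>)
  have red: "reduces_to k (T k \<omega>) n (T n \<omega>) (labels k (seq \<omega>) n)" if "k \<le> n" for n using elim(3) that by blast
  note bij = enum_bij[OF elim(4)]
  have "S \<omega> \<noteq> 0" using elim(1) by (auto simp: L_def)
  then have LWD: "L \<omega> * W \<omega> powr \<gamma> * D \<omega> i = \<xi> i \<omega>" for i
    using elim(1) by (simp add: L_def D_def)
  show ?case
    unfolding edge_lengths_converge_def
  proof (intro conjI ballI)
    show "\<forall>\<^sub>F n in sequentially. shape (divide_lengths (reduced_tree k (T n \<omega>)) (real n powr \<gamma>)) = shape (limit_tree \<omega>)"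
      using eventually_ge_at_top[of k]
    proof eventually_elim
      case (elim n)
      then show ?case using reduces_toD(6)[OF red] by (simp add: divide_lengths_def reduced_tree_def limit_tree_def)
    qed
    fix e assume "e \<in> shape (limit_tree \<omega>)"
    then have e: "e \<in> T k \<omega>" by (simp add: limit_tree_def)
    then obtain i where i: "i < card (T k \<omega>)" "e = enum (T k \<omega>) i" using bij by (auto simp: bij_betw_def)
    have "(\<lambda>n. X i (seq \<omega>) n / real n powr \<gamma>) \<longlonglongrightarrow> \<xi> i \<omega>" using elim(2) by blast
    moreover have "(\<lambda>n. c / real n powr \<gamma>) \<longlonglongrightarrow> 0" for c :: real using \<gamma>(1) by real_asymp
    ultimately have "(\<lambda>n. X i (seq \<omega>) n / real n powr \<gamma> - edge_shift \<alpha> \<gamma> e / real n powr \<gamma>) \<longlonglongrightarrow> \<xi> i \<omega> - 0"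
      by (rule tendsto_diff)
    moreover have "\<forall>\<^sub>F n in sequentially. X i (seq \<omega>) n / real n powr \<gamma> - edge_shift \<alpha> \<gamma> e / real n powr \<gamma> =
        edge_length (divide_lengths (reduced_tree k (T n \<omega>)) (real n powr \<gamma>)) e"
      using eventually_ge_at_top[of k]
    proof eventually_elim
      case (elim n)
      have "real (graph_dist (T n \<omega>) (fst e) (snd e)) = X i (seq \<omega>) n - edge_shift \<alpha> \<gamma> e"
        using graph_dist_path[OF red[OF elim] e] i by (simp add: X_def Y_proc_def)
      then show ?case by (simp add: divide_lengths_def reduced_tree_def case_prod_beta diff_divide_distrib)
    qed
    ultimately have "(\<lambda>n. edge_length (divide_lengths (reduced_tree k (T n \<omega>)) (real n powr \<gamma>)) e) \<longlonglongrightarrow> \<xi> i \<omega>"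
      by (simp add: tendsto_cong)
    then show "(\<lambda>n. edge_length (divide_lengths (reduced_tree k (T n \<omega>)) (real n powr \<gamma>)) e) \<longlonglongrightarrow> edge_length (limit_tree \<omega>) e"
      using limit_tree_lengths[OF elim(4) i(1)] LWD[of i] i(2) by simp
  qed
qed

end

text \<open>Shape and edge lengths of the limiting tree hold by construction at every sample point;
  only the convergence is almost sure. The remaining claims restate the conditional laws with their
  parameters written out.\<close>

theorem theorem5:
  fixes \<alpha> \<gamma> :: real
    and M :: "'a measure"
    and T :: "nat \<Rightarrow> 'a \<Rightarrow> tree"
    and k :: nat
    and g :: "real \<Rightarrow> real"
    and enum :: "tree \<Rightarrow> nat \<Rightarrow> edge"
  assumes "0 < \<alpha>" "\<alpha> < 1" "0 < \<gamma>" "\<gamma> \<le> \<alpha>"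
    and "alpha_gamma_trees \<alpha> \<gamma> M T"
    and "k \<ge> 1"
    and "mittag_leffler_density \<gamma> g"
    and "edge_enumeration k enum"
  shows "\<exists>(R :: 'a \<Rightarrow> real_tree) (W :: 'a \<Rightarrow> real) (L :: 'a \<Rightarrow> real) (D :: 'a \<Rightarrow> nat \<Rightarrow> real).
      W \<in> borel_measurable M \<and> L \<in> borel_measurable M \<and>
      (\<forall>i. (\<lambda>\<omega>. D \<omega> i) \<in> borel_measurable M) \<and>
      (AE \<omega> in M. edge_lengths_converge
         (\<lambda>n. divide_lengths (reduced_tree k (T n \<omega>)) (real n powr \<gamma>)) (R \<omega>)) \<and>
      (\<forall>\<omega>\<in>space M. shape (R \<omega>) = T k \<omega> \<and>
         (\<forall>i<card (T k \<omega>).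
            edge_length (R \<omega>) (enum (T k \<omega>) i) = L \<omega> * W \<omega> powr \<gamma> * D \<omega> i)) \<and>
      (\<forall>l::nat. let A = {\<omega> \<in> space M. card (T k \<omega>) = k + l};
                    P = uniform_measure M A;
                    V = Pi\<^sub>M {..<k + l} (\<lambda>_. borel);
                    D' = (\<lambda>\<omega>. restrict (D \<omega>) {..<k + l})
         in measure M A > 0 \<longrightarrow>
           indep_triple P borel W borel L V D' \<and>
           distr P borel W =
             beta_distribution (k * (1 - \<alpha>) + l * \<gamma>) ((real k - 1) * \<alpha> - l * \<gamma>) \<and>
           distributed P lborel L (\<lambda>s. ennreal
             (Gamma (1 + k * (1 - \<alpha>) + l * \<gamma>) / Gamma (1 + l + k * (1 - \<alpha>) / \<gamma>) *
              s powr (l + k * (1 - \<alpha>) / \<gamma>) * g s)) \<and>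
           distr P V D' = dirichlet (replicate k ((1 - \<alpha>) / \<gamma>) @ replicate l 1))"
proof -
  have "prob_space M" using assms(5) by (simp add: alpha_gamma_trees_def)
  then interpret prob_space M .
  interpret alpha_gamma_enum M \<alpha> \<gamma> T k enum
    by unfold_locales (use assms in auto)
  note g = assms(7)
  have laws: "indep_triple (uniform_measure M (A l)) borel W borel L (Pi\<^sub>M {..<k + l} (\<lambda>_. borel)) (\<lambda>\<omega>. restrict (D \<omega>) {..<k + l}) \<and>
      distr (uniform_measure M (A l)) borel W = beta_distribution (k * (1 - \<alpha>) + l * \<gamma>) ((real k - 1) * \<alpha> - l * \<gamma>) \<and>
      distributed (uniform_measure M (A l)) lborel L (\<lambda>s. ennreal
             (Gamma (1 + k * (1 - \<alpha>) + l * \<gamma>) / Gamma (1 + l + k * (1 - \<alpha>) / \<gamma>) *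
              s powr (l + k * (1 - \<alpha>) / \<gamma>) * g s)) \<and>
      distr (uniform_measure M (A l)) (Pi\<^sub>M {..<k + l} (\<lambda>_. borel)) (\<lambda>\<omega>. restrict (D \<omega>) {..<k + l}) =
        dirichlet (replicate k ((1 - \<alpha>) / \<gamma>) @ replicate l 1)"
    if l: "measure M (A l) > 0" for l :: nat
  proof (intro conjI)
    note C = conditional_laws[OF l g]
    show "indep_triple (uniform_measure M (A l)) borel W borel L (Pi\<^sub>M {..<k + l} (\<lambda>_. borel)) (\<lambda>\<omega>. restrict (D \<omega>) {..<k + l})"
      by (rule C(1))
    show "distr (uniform_measure M (A l)) borel W = beta_distribution (k * (1 - \<alpha>) + l * \<gamma>) ((real k - 1) * \<alpha> - l * \<gamma>)"
      using C(2) by (simp add: \<theta>_def bb_def)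
    show "distr (uniform_measure M (A l)) (Pi\<^sub>M {..<k + l} (\<lambda>_. borel)) (\<lambda>\<omega>. restrict (D \<omega>) {..<k + l}) =
        dirichlet (replicate k ((1 - \<alpha>) / \<gamma>) @ replicate l 1)"
      using C(4) by (simp add: aa_def)
    let ?f = "\<lambda>s. ennreal (CC l * s powr cc l * g s)"
    have "distributed (uniform_measure M (A l)) lborel L ?f"
      unfolding distributed_def
    proof (intro conjI)
      have "distr (uniform_measure M (A l)) lborel L = distr (uniform_measure M (A l)) borel L"
        by (rule distr_cong) auto
      then show "distr (uniform_measure M (A l)) lborel L = density lborel ?f" using C(3) by (simp add: tilted_def)
      have g0: "0 \<le> g s" for s using g by (simp add: mittag_leffler_density_def)
      \<comment> \<open>Measurability is known for the extended real version of \<open>g\<close>; as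
        \<open>g\<close> is nonnegative, it transfers to \<open>g\<close> itself.\<close>
      have [measurable]: "g \<in> borel_measurable borel"
      proof -
        have "(\<lambda>s. enn2real (ennreal (g s))) \<in> borel_measurable borel"
          using mittag_leffler_measurable[OF g] by measurable
        then show ?thesis by (simp add: g0)
      qed
      show "?f \<in> borel_measurable lborel" by measurable
      show "L \<in> uniform_measure M (A l) \<rightarrow>\<^sub>M lborel" by simp
    qed
    then show "distributed (uniform_measure M (A l)) lborel L (\<lambda>s. ennreal
             (Gamma (1 + k * (1 - \<alpha>) + l * \<gamma>) / Gamma (1 + l + k * (1 - \<alpha>) / \<gamma>) *
              s powr (l + k * (1 - \<alpha>) / \<gamma>) * g s))"
      by (simp add: CC_def cc_def)
  qed
  show ?thesis
  proof (rule exI[of _ limit_tree], rule exI[of _ W], rule exI[of _ L], rule exI[of _ D], intro conjI allI ballI impI)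
    show "AE \<omega> in M. edge_lengths_converge (\<lambda>n. divide_lengths (reduced_tree k (T n \<omega>)) (real n powr \<gamma>)) (limit_tree \<omega>)"
      by (rule AE_edge_lengths_converge[OF g])
    show "shape (limit_tree \<omega>) = T k \<omega>" for \<omega> by (simp add: limit_tree_def)
    show "edge_length (limit_tree \<omega>) (enum (T k \<omega>) i) = L \<omega> * W \<omega> powr \<gamma> * D \<omega> i"
      if "\<omega> \<in> space M" "i < card (T k \<omega>)" for \<omega> i using that by (rule limit_tree_lengths)
    fix l :: nat
    show "let A = {\<omega> \<in> space M. card (T k \<omega>) = k + l};
                    P = uniform_measure M A;
                    V = Pi\<^sub>M {..<k + l} (\<lambda>_. borel);
                    D' = (\<lambda>\<omega>. restrict (D \<omega>) {..<k + l})
         in measure M A > 0 \<longrightarrow>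
           indep_triple P borel W borel L V D' \<and>
           distr P borel W =
             beta_distribution (k * (1 - \<alpha>) + l * \<gamma>) ((real k - 1) * \<alpha> - l * \<gamma>) \<and>
           distributed P lborel L (\<lambda>s. ennreal
             (Gamma (1 + k * (1 - \<alpha>) + l * \<gamma>) / Gamma (1 + l + k * (1 - \<alpha>) / \<gamma>) *
              s powr (l + k * (1 - \<alpha>) / \<gamma>) * g s)) \<and>
           distr P V D' = dirichlet (replicate k ((1 - \<alpha>) / \<gamma>) @ replicate l 1)"
      unfolding Let_def using laws[of l] unfolding A_def by blast
  qed (rule W_measurable L_measurable D_measurable)+
qed

end
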